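(* Let $A$ be a $C^*$-algebra, let $X$ be an $A$-$A$-Hilbert bimodule, and let $\widehat{h}$ be the partial homeomorphism of the spectrum $\widehat{A}$ dual to $X$. If $\widehat{h}$ is topologically free and minimal, then the crossed product $A\rtimes_X\mathbb{Z}$ is simple.
   Context: For bilinear or sesquilinear maps $\gamma$ (inner products, multiplications, representations), $\gamma(S,T)$ denotes the closed linear span of $\{\gamma(s,t): s\in S, t\in T\}$. Ideals in $C^*$-algebras are closed and two-sided; a $C^*$-algebra is simple if it has no ideals other than $\{0\}$ and itself. Hilbert bimodule: An $A$-$A$-Hilbert bimodule $X$ is an $A$-$A$-bimodule which is both a left and a right Hilbert module over $A$, with $A$-valued inner products $\langle\cdot,\cdot\rangle_L$ (linear in the first variable) and $\langle\cdot,\cdot\rangle_R$ (linear in the second variable), such that $x\cdot\langle y,z\rangle_R=\langle x,y\rangle_L\cdot z$ for all $x,y,z\in X$. (The inner products are not assumed full.) Put $I_L=\langle X,X\rangle_L$ and $I_R=\langle X,X\rangle_R$; these are ideals in $A$ and $X$ is an imprimitivity $I_L$-$I_R$-bimodule. Dual partial homeomorphism: $\widehat{A}$ is the spectrum of $A$ (unitary equivalence classes $[\pi]$ of irreducible representations, with the usual topology). For an ideal $I$ of $A$, $\widehat{I}$ is identified with the open subset $\{[\pi]\in\widehat{A}:\pi(I)\neq 0\}$. The partial homeomorphism dual to $X$ is the homeomorphism $\widehat{h}:\widehat{I_R}\to\widehat{I_L}$ between open subsets of $\widehat{A}$ given by Rieffel induction: $\widehat{h}([\pi])=[X\text{-}\mathrm{Ind}(\pi)]$,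 where, for $\pi:A\to\mathcal{B}(H_\pi)$, $X\text{-}\mathrm{Ind}(\pi)$ acts on the Hilbert space $X\otimes_\pi H_\pi$ (with $\langle x_1\otimes_\pi h_1,x_2\otimes_\pi h_2\rangle=\langle h_1,\pi(\langle x_1,x_2\rangle_R)h_2\rangle$) by $X\text{-}\mathrm{Ind}(\pi)(a)(x\otimes_\pi h)=(ax)\otimes_\pi h$. Topological freeness and minimality: Let $\varphi:\Delta\to\varphi(\Delta)$ be a partial homeomorphism of a topological space (a homeomorphism between open subsets). It is topologically free if for every $n>0$ the set $F_n=\{x:\varphi^n(x)=x\}$ (a subset of the natural domain of the $n$-fold composition $\varphi^n$) has empty interior. A set $V$ is invariant under $\varphi$ if $\varphi(V\cap\Delta)=V\cap\varphi(\Delta)$. The map $\varphi$ is minimal if there are no non-trivial closed invariant sets, i.e. the only closed invariant sets are the empty set and the whole space. Crossed product: A covariant representation of $(A,X)$ on a Hilbert space $H$ is a pair $(\pi_A,\pi_X)$, where $\pi_A:A\to\mathcal{B}(H)$ is a representation and $\pi_X:X\to\mathcal{B}(H)$ is linear, such that for all $a\in A$, $x,y\in X$: $\pi_X(ax)=\pi_A(a)\pi_X(x)$, $\pi_X(xa)=\pi_X(x)\pi_A(a)$, $\pi_A(\langle x,y\rangle_R)=\pi_X(x)^*\pi_X(y)$, $\pi_A(\langle x,y\rangle_L)=\pi_X(x)\pi_X(y)^*$. The crossed product $A\rtimes_X\mathbb{Z}$ is the $C^*$-algebra universal for covariant representations of $(A,X)$; it is generated by the images of $A$ and $X$ under the universal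 covariant representation. *)

theory Defs
  imports "HOL-Analysis.Analysis"
begin

section \<open>C*-algebras\<close>

class scaleC =
  fixes scaleC :: "complex \<Rightarrow> 'a \<Rightarrow> 'a" (infixr \<open>*\<^sub>C\<close> 75)

class complex_vector = real_vector + scaleC +
  assumes scaleC_add_right: "c *\<^sub>C (x + y) = c *\<^sub>C x + c *\<^sub>C y"
    and scaleC_add_left: "(c + d) *\<^sub>C x = c *\<^sub>C x + d *\<^sub>C x"
    and scaleC_scaleC: "c *\<^sub>C d *\<^sub>C x = (c * d) *\<^sub>C x"
    and scaleC_one: "1 *\<^sub>C x = x"
    and scaleR_scaleC: "r *\<^sub>R x = complex_of_real r *\<^sub>C x"

global_interpretation complex_vector: vector_space "scaleC :: complex \<Rightarrow> 'a \<Rightarrow> 'a::complex_vector"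
  defines csubspace = "module.subspace (scaleC :: complex \<Rightarrow> 'a \<Rightarrow> 'a)"
    and cspan = "module.span (scaleC :: complex \<Rightarrow> 'a \<Rightarrow> 'a)"
  by unfold_locales (simp_all add: scaleC_add_right scaleC_add_left scaleC_scaleC scaleC_one)

abbreviation clinear :: "('a::complex_vector \<Rightarrow> 'b::complex_vector) \<Rightarrow> bool"
  where "clinear \<equiv> Vector_Spaces.linear scaleC scaleC"

text \<open>No unit is assumed, and the zero algebra is allowed.\<close>

class cstar_algebra = real_normed_algebra + banach + complex_vector +
  fixes star :: "'a \<Rightarrow> 'a"
  assumes scaleC_mult_left: "(c *\<^sub>C x) * y = c *\<^sub>C (x * y)"
    and scaleC_mult_right: "x * (c *\<^sub>C y) = c *\<^sub>C (x * y)"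
    and norm_scaleC: "norm (c *\<^sub>C x) = cmod c * norm x"
    and star_star: "star (star x) = x"
    and star_add: "star (x + y) = star x + star y"
    and star_scaleC: "star (c *\<^sub>C x) = cnj c *\<^sub>C star x"
    and star_mult: "star (x * y) = star y * star x"
    and cstar_identity: "norm (star x * x) = (norm x)\<^sup>2"

instantiation complex :: cstar_algebra
begin
definition scaleC_complex :: "complex \<Rightarrow> complex \<Rightarrow> complex"
  where "scaleC_complex c z = c * z"
definition star_complex :: "complex \<Rightarrow> complex"
  where "star_complex = cnj"
instance
  by standard
    (simp_all add: scaleC_complex_def star_complex_def algebra_simps norm_mult
      scaleR_conv_of_real power2_eq_square)
end

definition positive_elt :: "'a::cstar_algebra \<Rightarrow> bool"
  where "positive_elt a \<longleftrightarrow> (\<exists>b. a = star b * b)"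

definition cstar_ideal :: "'a::cstar_algebra set \<Rightarrow> bool"
  where "cstar_ideal I \<longleftrightarrow> csubspace I \<and> closed I \<and> (\<forall>a. \<forall>b\<in>I. a * b \<in> I \<and> b * a \<in> I)"

definition simple_cstar_algebra :: "'a::cstar_algebra itself \<Rightarrow> bool"
  where "simple_cstar_algebra _ \<longleftrightarrow> (\<forall>I :: 'a set. cstar_ideal I \<longrightarrow> I = {0} \<or> I = UNIV)"

definition cstar_subalgebra :: "'a::cstar_algebra set \<Rightarrow> bool"
  where "cstar_subalgebra S \<longleftrightarrow>
    csubspace S \<and> closed S \<and> (\<forall>a\<in>S. \<forall>b\<in>S. a * b \<in> S) \<and> (\<forall>a\<in>S. star a \<in> S)"

definition cstar_generates :: "'a::cstar_algebra set \<Rightarrow> bool"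
  where "cstar_generates G \<longleftrightarrow> (\<forall>S. cstar_subalgebra S \<longrightarrow> G \<subseteq> S \<longrightarrow> S = UNIV)"

definition star_hom :: "('a::cstar_algebra \<Rightarrow> 'b::cstar_algebra) \<Rightarrow> bool"
  where "star_hom f \<longleftrightarrow>
    clinear f \<and> (\<forall>a b. f (a * b) = f a * f b) \<and> (\<forall>a. f (star a) = star (f a))"


section \<open>Hilbert spaces and representations\<close>

text \<open>
  Hilbert spaces have to be quantified over inside formulas (classes of representations,
  universal property), so they are structures on a carrier set rather than types.
  The inner product is linear in the second variable.
\<close>

record 'h hilbert =
  hcarrier :: "'h set"
  hzero :: 'h
  hadd :: "'h \<Rightarrow> 'h \<Rightarrow> 'h"
  hscale :: "complex \<Rightarrow> 'h \<Rightarrow> 'h"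
  hinner :: "'h \<Rightarrow> 'h \<Rightarrow> complex"

definition hnorm :: "'h hilbert \<Rightarrow> 'h \<Rightarrow> real"
  where "hnorm H h = sqrt (cmod (hinner H h h))"

definition hdist :: "'h hilbert \<Rightarrow> 'h \<Rightarrow> 'h \<Rightarrow> real"
  where "hdist H h k = hnorm H (hadd H h (hscale H (-1) k))"

locale hilbert_space =
  fixes H :: "'h hilbert"
  assumes zero_closed: "hzero H \<in> hcarrier H"
    and add_closed: "\<lbrakk>h \<in> hcarrier H; k \<in> hcarrier H\<rbrakk> \<Longrightarrow> hadd H h k \<in> hcarrier H"
    and scale_closed: "h \<in> hcarrier H \<Longrightarrow> hscale H c h \<in> hcarrier H"
    and add_assoc: "\<lbrakk>h \<in> hcarrier H; k \<in> hcarrier H; l \<in> hcarrier H\<rbrakk>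
      \<Longrightarrow> hadd H (hadd H h k) l = hadd H h (hadd H k l)"
    and add_commute: "\<lbrakk>h \<in> hcarrier H; k \<in> hcarrier H\<rbrakk> \<Longrightarrow> hadd H h k = hadd H k h"
    and add_zero: "h \<in> hcarrier H \<Longrightarrow> hadd H (hzero H) h = h"
    and add_minus: "h \<in> hcarrier H \<Longrightarrow> hadd H h (hscale H (-1) h) = hzero H"
    and scale_add_right: "\<lbrakk>h \<in> hcarrier H; k \<in> hcarrier H\<rbrakk>
      \<Longrightarrow> hscale H c (hadd H h k) = hadd H (hscale H c h) (hscale H c k)"
    and scale_add_left: "h \<in> hcarrier H
      \<Longrightarrow> hscale H (c + d) h = hadd H (hscale H c h) (hscale H d h)"
    and scale_scale: "h \<in> hcarrier H \<Longrightarrow> hscale H c (hscale H d h) = hscale H (c * d) h"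
    and scale_one: "h \<in> hcarrier H \<Longrightarrow> hscale H 1 h = h"
    and inner_add_right: "\<lbrakk>h \<in> hcarrier H; k \<in> hcarrier H; l \<in> hcarrier H\<rbrakk>
      \<Longrightarrow> hinner H h (hadd H k l) = hinner H h k + hinner H h l"
    and inner_scale_right: "\<lbrakk>h \<in> hcarrier H; k \<in> hcarrier H\<rbrakk>
      \<Longrightarrow> hinner H h (hscale H c k) = c * hinner H h k"
    and inner_commute: "\<lbrakk>h \<in> hcarrier H; k \<in> hcarrier H\<rbrakk> \<Longrightarrow> hinner H k h = cnj (hinner H h k)"
    and inner_nonneg: "h \<in> hcarrier H \<Longrightarrow> 0 \<le> Re (hinner H h h)"
    and inner_definite: "\<lbrakk>h \<in> hcarrier H; hinner H h h = 0\<rbrakk> \<Longrightarrow> h = hzero H"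
    and complete: "\<lbrakk>\<And>n. s n \<in> hcarrier H;
        \<And>e. e > 0 \<Longrightarrow> \<exists>N::nat. \<forall>m\<ge>N. \<forall>n\<ge>N. hdist H (s m) (s n) < e\<rbrakk>
      \<Longrightarrow> \<exists>h\<in>hcarrier H. (\<lambda>n. hdist H (s n) h) \<longlonglongrightarrow> 0"

definition hsubspace :: "'h hilbert \<Rightarrow> 'h set \<Rightarrow> bool"
  where "hsubspace H V \<longleftrightarrow> V \<subseteq> hcarrier H \<and> hzero H \<in> V \<and>
    (\<forall>h\<in>V. \<forall>k\<in>V. hadd H h k \<in> V) \<and> (\<forall>c. \<forall>h\<in>V. hscale H c h \<in> V)"

definition hclosed_subspace :: "'h hilbert \<Rightarrow> 'h set \<Rightarrow> bool"
  where "hclosed_subspace H V \<longleftrightarrow> hsubspace H V \<and>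
    (\<forall>s. \<forall>h\<in>hcarrier H. (\<forall>n. s n \<in> V) \<longrightarrow> (\<lambda>n. hdist H (s n) h) \<longlonglongrightarrow> 0 \<longrightarrow> h \<in> V)"

definition htotal :: "'h hilbert \<Rightarrow> 'h set \<Rightarrow> bool"
  where "htotal H S \<longleftrightarrow> S \<subseteq> hcarrier H \<and>
    (\<forall>V. hclosed_subspace H V \<longrightarrow> S \<subseteq> V \<longrightarrow> V = hcarrier H)"

definition hlinear :: "'h hilbert \<Rightarrow> 'k hilbert \<Rightarrow> ('h \<Rightarrow> 'k) \<Rightarrow> bool"
  where "hlinear H K T \<longleftrightarrow> T ` hcarrier H \<subseteq> hcarrier K \<and>
    (\<forall>h\<in>hcarrier H. \<forall>k\<in>hcarrier H. T (hadd H h k) = hadd K (T h) (T k)) \<and>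
    (\<forall>c. \<forall>h\<in>hcarrier H. T (hscale H c h) = hscale K c (T h))"

definition bounded_op :: "'h hilbert \<Rightarrow> ('h \<Rightarrow> 'h) \<Rightarrow> bool"
  where "bounded_op H T \<longleftrightarrow> hlinear H H T \<and>
    (\<exists>M. \<forall>h\<in>hcarrier H. hnorm H (T h) \<le> M * hnorm H h)"

text \<open>Meaningful for bounded operators, where the Riesz theorem yields existence.\<close>

definition hadjoint :: "'h hilbert \<Rightarrow> ('h \<Rightarrow> 'h) \<Rightarrow> 'h \<Rightarrow> 'h"
  where "hadjoint H T k =
    (THE l. l \<in> hcarrier H \<and> (\<forall>h\<in>hcarrier H. hinner H (T h) k = hinner H h l))"

text \<open>Operators are compared on the carrier only; their values elsewhere are irrelevant.\<close>

definition op_linear :: "'h hilbert \<Rightarrow> ('v::complex_vector \<Rightarrow> 'h \<Rightarrow> 'h) \<Rightarrow> bool"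
  where "op_linear H \<rho> \<longleftrightarrow> (\<forall>v. bounded_op H (\<rho> v)) \<and>
    (\<forall>v w. \<forall>h\<in>hcarrier H. \<rho> (v + w) h = hadd H (\<rho> v h) (\<rho> w h)) \<and>
    (\<forall>c v. \<forall>h\<in>hcarrier H. \<rho> (c *\<^sub>C v) h = hscale H c (\<rho> v h))"

definition representation :: "'h hilbert \<Rightarrow> ('a::cstar_algebra \<Rightarrow> 'h \<Rightarrow> 'h) \<Rightarrow> bool"
  where "representation H \<pi> \<longleftrightarrow> hilbert_space H \<and> op_linear H \<pi> \<and>
    (\<forall>a b. \<forall>h\<in>hcarrier H. \<pi> (a * b) h = \<pi> a (\<pi> b h)) \<and>
    (\<forall>a. \<forall>h\<in>hcarrier H. \<pi> (star a) h = hadjoint H (\<pi> a) h)"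

definition irreducible_rep :: "'h hilbert \<Rightarrow> ('a::cstar_algebra \<Rightarrow> 'h \<Rightarrow> 'h) \<Rightarrow> bool"
  where "irreducible_rep H \<pi> \<longleftrightarrow> representation H \<pi> \<and>
    (\<exists>a. \<exists>h\<in>hcarrier H. \<pi> a h \<noteq> hzero H) \<and>
    (\<forall>V. hclosed_subspace H V \<longrightarrow> (\<forall>a. \<pi> a ` V \<subseteq> V) \<longrightarrow> V = {hzero H} \<or> V = hcarrier H)"

type_synonym ('a, 'h) rep = "'h hilbert \<times> ('a \<Rightarrow> 'h \<Rightarrow> 'h)"

definition unitarily_equivalent :: "('a, 'h) rep \<Rightarrow> ('a, 'k) rep \<Rightarrow> bool"
  where "unitarily_equivalent = (\<lambda>(H, \<pi>) (K, \<sigma>). \<exists>U.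
    hlinear H K U \<and> bij_betw U (hcarrier H) (hcarrier K) \<and>
    (\<forall>h\<in>hcarrier H. \<forall>k\<in>hcarrier H. hinner K (U h) (U k) = hinner H h k) \<and>
    (\<forall>a. \<forall>h\<in>hcarrier H. U (\<pi> a h) = \<sigma> a (U h)))"


section \<open>The spectrum\<close>

text \<open>
  Up to unitary equivalence, every irreducible representation \<open>\<pi>\<close> of a C*-algebra on a type \<open>'a\<close>
  lives on a carrier inside \<open>nat \<Rightarrow> 'a\<close>: for a vector \<open>\<xi>\<close> with \<open>\<pi>(A)\<xi> \<noteq> 0\<close>, every vector is the
  limit of some sequence \<open>\<pi>(a\<^sub>n)\<xi>\<close>, so \<open>(a\<^sub>n)\<close> encodes it. Restricting to these
  carriers therefore loses no point of the spectrum.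
\<close>

type_synonym 'a irrep = "('a, nat \<Rightarrow> 'a) rep"

definition irreps :: "'a::cstar_algebra irrep set"
  where "irreps = {(H, \<pi>). irreducible_rep H \<pi>}"

definition spectrum :: "'a::cstar_algebra irrep set set"
  where "spectrum = irreps // {(p, q). p \<in> irreps \<and> q \<in> irreps \<and> unitarily_equivalent p q}"

text \<open>For an ideal \<open>I\<close>, the set of those classes of \<open>\<pi>\<close> with \<open>\<pi>(I) \<noteq> 0\<close>.\<close>

definition ideal_spectrum :: "'a::cstar_algebra set \<Rightarrow> 'a irrep set set"
  where "ideal_spectrum I =
    {C \<in> spectrum. \<exists>(H, \<pi>)\<in>C. \<exists>a\<in>I. \<exists>h\<in>hcarrier H. \<pi> a h \<noteq> hzero H}"

text \<open>
  The hull-kernel topology. The generating sets are themselves closed under arbitrary unions and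
  finite intersections, so they are exactly the open sets.
\<close>

definition spectrum_topology :: "'a::cstar_algebra irrep set topology"
  where "spectrum_topology = topology_generated_by {ideal_spectrum I |I. cstar_ideal I}"


section \<open>Hilbert bimodules\<close>

definition module_norm :: "('x \<Rightarrow> 'x \<Rightarrow> 'a::cstar_algebra) \<Rightarrow> 'x \<Rightarrow> real"
  where "module_norm ip x = sqrt (norm (ip x x))"

definition module_complete :: "('x::complex_vector \<Rightarrow> 'x \<Rightarrow> 'a::cstar_algebra) \<Rightarrow> bool"
  where "module_complete ip \<longleftrightarrow> (\<forall>s.
    (\<forall>e>0. \<exists>N::nat. \<forall>m\<ge>N. \<forall>n\<ge>N. module_norm ip (s m - s n) < e) \<longrightarrow>
    (\<exists>x. (\<lambda>n. module_norm ip (s n - x)) \<longlonglongrightarrow> 0))"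

locale left_hilbert_module =
  fixes lact :: "'a::cstar_algebra \<Rightarrow> 'x::complex_vector \<Rightarrow> 'x"
    and ipL :: "'x \<Rightarrow> 'x \<Rightarrow> 'a"
  assumes lact_linear: "clinear (lact a)"
    and lact_linear_alg: "clinear (\<lambda>a. lact a x)"
    and lact_mult: "lact (a * b) x = lact a (lact b x)"
    and ipL_linear: "clinear (\<lambda>x. ipL x y)"
    and ipL_lact: "ipL (lact a x) y = a * ipL x y"
    and ipL_star: "star (ipL x y) = ipL y x"
    and ipL_positive: "positive_elt (ipL x x)"
    and ipL_definite: "ipL x x = 0 \<Longrightarrow> x = 0"
    and ipL_complete: "module_complete ipL"

locale right_hilbert_module =
  fixes ract :: "'x::complex_vector \<Rightarrow> 'a::cstar_algebra \<Rightarrow> 'x"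
    and ipR :: "'x \<Rightarrow> 'x \<Rightarrow> 'a"
  assumes ract_linear: "clinear (\<lambda>x. ract x a)"
    and ract_linear_alg: "clinear (ract x)"
    and ract_mult: "ract x (a * b) = ract (ract x a) b"
    and ipR_linear: "clinear (ipR x)"
    and ipR_ract: "ipR x (ract y a) = ipR x y * a"
    and ipR_star: "star (ipR x y) = ipR y x"
    and ipR_positive: "positive_elt (ipR x x)"
    and ipR_definite: "ipR x x = 0 \<Longrightarrow> x = 0"
    and ipR_complete: "module_complete ipR"

locale hilbert_bimodule = left_hilbert_module lact ipL + right_hilbert_module ract ipR
  for lact :: "'a::cstar_algebra \<Rightarrow> 'x::complex_vector \<Rightarrow> 'x"
    and ract :: "'x \<Rightarrow> 'a \<Rightarrow> 'x"
    and ipL ipR :: "'x \<Rightarrow> 'x \<Rightarrow> 'a" +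
  assumes act_assoc: "ract (lact a x) b = lact a (ract x b)"
    and ip_compat: "ract x (ipR y z) = lact (ipL x y) z"

definition ip_ideal :: "('x \<Rightarrow> 'x \<Rightarrow> 'a::cstar_algebra) \<Rightarrow> 'a set"
  where "ip_ideal ip = closure (cspan {ip x y |x y. True})"


section \<open>The dual partial homeomorphism\<close>

text \<open>
  \<open>interior_tensor ipR H \<pi> K t\<close> says that \<open>K\<close>, together with the bilinear map \<open>t x h = x \<otimes>\<^sub>\<pi> h\<close>, is the
  Hilbert space \<open>X \<otimes>\<^sub>\<pi> H\<close>: the elementary tensors have the prescribed inner products
  and span a dense subspace. This determines \<open>(K, t)\<close> up to a unique unitary.
\<close>

definition interior_tensor :: "('x::complex_vector \<Rightarrow> 'x \<Rightarrow> 'a::cstar_algebra) \<Rightarrow>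
    'h hilbert \<Rightarrow> ('a \<Rightarrow> 'h \<Rightarrow> 'h) \<Rightarrow> 'k hilbert \<Rightarrow> ('x \<Rightarrow> 'h \<Rightarrow> 'k) \<Rightarrow> bool"
  where "interior_tensor ipR H \<pi> K t \<longleftrightarrow> hilbert_space K \<and>
    (\<forall>x. hlinear H K (t x)) \<and>
    (\<forall>x y. \<forall>h\<in>hcarrier H. t (x + y) h = hadd K (t x h) (t y h)) \<and>
    (\<forall>c x. \<forall>h\<in>hcarrier H. t (c *\<^sub>C x) h = hscale K c (t x h)) \<and>
    (\<forall>x y. \<forall>h\<in>hcarrier H. \<forall>k\<in>hcarrier H.
      hinner K (t x h) (t y k) = hinner H h (\<pi> (ipR x y) k)) \<and>
    htotal K {t x h |x h. h \<in> hcarrier H}"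

text \<open>\<open>(K, \<sigma>)\<close> is (a copy of) the representation \<open>X-Ind(\<pi>)\<close>.\<close>

definition induced_rep :: "('a::cstar_algebra \<Rightarrow> 'x::complex_vector \<Rightarrow> 'x) \<Rightarrow> ('x \<Rightarrow> 'x \<Rightarrow> 'a) \<Rightarrow>
    ('a, 'h) rep \<Rightarrow> ('a, 'k) rep \<Rightarrow> bool"
  where "induced_rep lact ipR = (\<lambda>(H, \<pi>) (K, \<sigma>). representation K \<sigma> \<and>
    (\<exists>t. interior_tensor ipR H \<pi> K t \<and>
      (\<forall>a x. \<forall>h\<in>hcarrier H. \<sigma> a (t x h) = t (lact a x) h)))"

text \<open>The unitary equivalence class of \<open>X-Ind(\<pi>)\<close>, for \<open>C\<close> the class of \<open>\<pi>\<close>; it is meant to be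
  used only for \<open>C \<in> ideal_spectrum (ip_ideal ipR)\<close>.\<close>

definition dual_map :: "('a::cstar_algebra \<Rightarrow> 'x::complex_vector \<Rightarrow> 'x) \<Rightarrow> ('x \<Rightarrow> 'x \<Rightarrow> 'a) \<Rightarrow>
    'a irrep set \<Rightarrow> 'a irrep set"
  where "dual_map lact ipR C = {q \<in> irreps. \<exists>p\<in>C. induced_rep lact ipR p q}"


section \<open>Partial homeomorphisms\<close>

text \<open>A partial homeomorphism is given by its domain \<open>\<Delta>\<close> and a total function \<open>\<phi>\<close> whose values
  outside \<open>\<Delta>\<close> are ignored.\<close>

primrec iterate_domain :: "'p topology \<Rightarrow> 'p set \<Rightarrow> ('p \<Rightarrow> 'p) \<Rightarrow> nat \<Rightarrow> 'p set"
  where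
    "iterate_domain T \<Delta> \<phi> 0 = topspace T"
  | "iterate_domain T \<Delta> \<phi> (Suc n) = {x \<in> iterate_domain T \<Delta> \<phi> n. (\<phi> ^^ n) x \<in> \<Delta>}"

definition topologically_free :: "'p topology \<Rightarrow> 'p set \<Rightarrow> ('p \<Rightarrow> 'p) \<Rightarrow> bool"
  where "topologically_free T \<Delta> \<phi> \<longleftrightarrow>
    (\<forall>n>0. T interior_of {x \<in> iterate_domain T \<Delta> \<phi> n. (\<phi> ^^ n) x = x} = {})"

definition invariant_set :: "'p set \<Rightarrow> ('p \<Rightarrow> 'p) \<Rightarrow> 'p set \<Rightarrow> bool"
  where "invariant_set \<Delta> \<phi> V \<longleftrightarrow> \<phi> ` (V \<inter> \<Delta>) = V \<inter> \<phi> ` \<Delta>"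

definition minimal_map :: "'p topology \<Rightarrow> 'p set \<Rightarrow> ('p \<Rightarrow> 'p) \<Rightarrow> bool"
  where "minimal_map T \<Delta> \<phi> \<longleftrightarrow>
    (\<forall>V. closedin T V \<longrightarrow> invariant_set \<Delta> \<phi> V \<longrightarrow> V = {} \<or> V = topspace T)"


section \<open>The crossed product\<close>

definition covariant_rep :: "('a::cstar_algebra \<Rightarrow> 'x::complex_vector \<Rightarrow> 'x) \<Rightarrow> ('x \<Rightarrow> 'a \<Rightarrow> 'x) \<Rightarrow>
    ('x \<Rightarrow> 'x \<Rightarrow> 'a) \<Rightarrow> ('x \<Rightarrow> 'x \<Rightarrow> 'a) \<Rightarrow>
    'h hilbert \<Rightarrow> ('a \<Rightarrow> 'h \<Rightarrow> 'h) \<Rightarrow> ('x \<Rightarrow> 'h \<Rightarrow> 'h) \<Rightarrow> bool"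
  where "covariant_rep lact ract ipL ipR H \<pi>A \<pi>X \<longleftrightarrow>
    representation H \<pi>A \<and> op_linear H \<pi>X \<and>
    (\<forall>a x. \<forall>h\<in>hcarrier H. \<pi>X (lact a x) h = \<pi>A a (\<pi>X x h)) \<and>
    (\<forall>a x. \<forall>h\<in>hcarrier H. \<pi>X (ract x a) h = \<pi>X x (\<pi>A a h)) \<and>
    (\<forall>x y. \<forall>h\<in>hcarrier H. \<pi>A (ipR x y) h = hadjoint H (\<pi>X x) (\<pi>X y h)) \<and>
    (\<forall>x y. \<forall>h\<in>hcarrier H. \<pi>A (ipL x y) h = \<pi>X x (hadjoint H (\<pi>X y) h))"

text \<open>
  \<open>crossed_product lact ract ipL ipR iA iX\<close> says that the C*-algebra on the common codomain \<open>'b\<close>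
  of \<open>iA\<close> and \<open>iX\<close> is the crossed product, with \<open>(iA, iX)\<close> the universal covariant
  representation. Uniqueness of the representation \<open>\<rho>\<close> follows from generation.

  The universal property is required for Hilbert spaces on carriers inside \<open>nat \<Rightarrow> 'a \<times> 'x\<close>, and
  it then holds for all Hilbert spaces. Every element of the crossed product is a limit
  of a sequence of finite sums of finite products of images (and adjoints of images) of elements
  of \<open>'a\<close> and \<open>'x\<close>, and so is encoded by a sequence in \<open>'a \<times> 'x\<close>. Hence every cyclic
  covariant representation is equivalent to one on such a carrier, and the norm of the
  universal C*-algebra is the supremum over the cyclic ones. (If \<open>'a\<close> is finite, then \<open>A = 0\<close>,
  \<open>X = 0\<close> and there is nothing to encode.)
\<close>

definition crossed_product :: "('a::cstar_algebra \<Rightarrow> 'x::complex_vector \<Rightarrow> 'x) \<Rightarrow> ('x \<Rightarrow> 'a \<Rightarrow> 'x) \<Rightarrow>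
    ('x \<Rightarrow> 'x \<Rightarrow> 'a) \<Rightarrow> ('x \<Rightarrow> 'x \<Rightarrow> 'a) \<Rightarrow>
    ('a \<Rightarrow> 'b::cstar_algebra) \<Rightarrow> ('x \<Rightarrow> 'b) \<Rightarrow> bool"
  where "crossed_product lact ract ipL ipR iA iX \<longleftrightarrow>
    star_hom iA \<and> clinear iX \<and>
    (\<forall>a x. iX (lact a x) = iA a * iX x) \<and>
    (\<forall>a x. iX (ract x a) = iX x * iA a) \<and>
    (\<forall>x y. iA (ipR x y) = star (iX x) * iX y) \<and>
    (\<forall>x y. iA (ipL x y) = iX x * star (iX y)) \<and>
    cstar_generates (range iA \<union> range iX) \<and>
    (\<forall>(H :: (nat \<Rightarrow> 'a \<times> 'x) hilbert) \<pi>A \<pi>X.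
      covariant_rep lact ract ipL ipR H \<pi>A \<pi>X \<longrightarrow>
      (\<exists>\<rho>. representation H \<rho> \<and>
        (\<forall>a. \<forall>h\<in>hcarrier H. \<rho> (iA a) h = \<pi>A a h) \<and>
        (\<forall>x. \<forall>h\<in>hcarrier H. \<rho> (iX x) h = \<pi>X x h)))"

end

theory Submission
  imports Defs
begin

text \<open>
  Let \<open>J\<close> be an ideal of the crossed product \<open>B\<close> and let \<open>I\<close> be its preimage in \<open>A\<close>. An irreducible
  representation of \<open>A\<close> that kills \<open>I\<close> is, by extension of states, the restriction of a
  representation \<open>\<rho>\<close> of \<open>B\<close> killing \<open>J\<close> to an \<open>A\<close>-invariant subspace \<open>M\<close>, and the closed span of
  \<open>\<rho>(X)M\<close> carries the induced representation. So the points of the spectrum killing \<open>I\<close> form a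
  closed invariant set, and minimality leaves \<open>I = A\<close>, which forces \<open>J = B\<close>, or \<open>I = 0\<close>.

  In the latter case let \<open>b\<close> be a finite sum of components \<open>b\<^sub>k\<close>, where \<open>b\<^sub>k\<close> has degree \<open>k\<close> in \<open>X\<close>,
  and let \<open>r < \<parallel>b\<^sub>0\<parallel>\<close>. The points \<open>\<pi>\<close> with \<open>\<parallel>\<pi>(b\<^sub>0)\<parallel> > r\<close> contain a nonempty open set, so by
  topological freeness one of them has no period up to the degree of \<open>b\<close>. Extend it to \<open>(\<rho>, M)\<close> as
  above. The components of nonzero degree move \<open>M\<close> to subspaces with representations not equivalent
  to \<open>\<pi>\<close>, and these are orthogonal to \<open>M\<close>. This yields \<open>\<parallel>b\<^sub>0\<parallel> \<le> \<parallel>b - j\<parallel>\<close>, and then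
  \<open>\<parallel>b\<^sub>k\<parallel> \<le> \<parallel>b - j\<parallel>\<close>, for \<open>j \<in> J\<close>. By the universal property the gauge action is isometric on such
  sums, so their Fejer means are contractive, and approximating \<open>j\<close> twice gives \<open>j = 0\<close>.
\<close>

section \<open>Elementary facts on C*-algebras\<close>

text \<open>An ideal J need not be invariant under the gauge action, so a nonzero element of J
  cannot simply be averaged into A. The estimate on components replaces averaging, but it bounds
  them one at a time and says nothing about their number. Hence the two approximations of j: the
  first fixes the order N of a Fejer mean that hardly changes it; the second is within e / (2N + 1)
  of j, so that the at most 2N + 1 components seen by this mean add up to at most e.

  Quotients are never formed: representations killing J stand for those of B/J, and the states
  vanishing on J are the functionals below one sublinear function, so extension and extreme points
  both become Hahn-Banach arguments. A state extended from A to B need not stay pure; only the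
  A-cyclic subspace of its vector is used, and orthogonality comes from purity of vector states in
  place of Schur's lemma. Injectivity of A \<rightarrow> B is contained in I = 0 and gets no proof
  of its own. Positivity rests on a norm inequality and an iteration for square roots, in place of
  spectra and functional calculus.\<close>

lemma star_zero [simp]: "star (0::'a::cstar_algebra) = 0"
  using star_add[of "0::'a" 0] by simp

lemma star_minus [simp]: "star (- x) = - star (x::'a::cstar_algebra)"
  using star_add[of x "- x"] by (simp add: eq_neg_iff_add_eq_0 add.commute)

lemma star_diff: "star (x - y) = star x - star (y::'a::cstar_algebra)"
  using star_add[of x "- y"] by simp

lemma star_scaleR: "star (r *\<^sub>R x) = r *\<^sub>R star (x::'a::cstar_algebra)"
  by (simp add: scaleR_scaleC star_scaleC)

lemma norm_star [simp]: "norm (star x) = norm (x::'a::cstar_algebra)"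
proof -
  have le: "norm y \<le> norm (star y)" for y :: 'a
  proof (cases "y = 0")
    case False
    have "norm y * norm y \<le> norm (star y) * norm y"
      using norm_mult_ineq[of "star y" y] by (simp add: cstar_identity power2_eq_square)
    then show ?thesis using False by simp
  qed simp
  show ?thesis using le[of x] le[of "star x"] by (simp add: star_star)
qed

lemma cstar_identity': "norm (x * star x) = (norm (x::'a::cstar_algebra))\<^sup>2"
  using cstar_identity[of "star x"] by (simp add: star_star)

lemma norm_square_selfadjoint: "star x = x \<Longrightarrow> norm (x * x) = (norm (x::'a::cstar_algebra))\<^sup>2"
  using cstar_identity[of x] by simp

lemma star_mult_eq_0_iff [simp]: "star x * x = 0 \<longleftrightarrow> (x::'a::cstar_algebra) = 0"
  using cstar_identity[of x] by (metis mult_zero_right norm_eq_zero power2_eq_square mult_eq_0_iff)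

lemma bounded_linear_star: "bounded_linear (star :: 'a::cstar_algebra \<Rightarrow> 'a)"
  by (rule bounded_linear_intro[where K = 1]) (simp_all add: star_add star_scaleR)

lemmas tendsto_star [tendsto_intros] = bounded_linear.tendsto[OF bounded_linear_star]

lemma scaleC_zero_left [simp]: "0 *\<^sub>C x = (0::'a::complex_vector)"
  using complex_vector.scale_zero_left .

lemma scaleC_zero_right [simp]: "c *\<^sub>C (0::'a::complex_vector) = 0"
  using complex_vector.scale_zero_right .

lemma scaleC_minus_left: "(- c) *\<^sub>C x = - (c *\<^sub>C (x::'a::complex_vector))"
  using complex_vector.scale_minus_left .

lemma scaleC_diff_right: "c *\<^sub>C (x - y) = c *\<^sub>C x - c *\<^sub>C (y::'a::complex_vector)"
  using complex_vector.scale_right_diff_distrib .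

lemma scaleC_minus_one: "(- 1) *\<^sub>C x = - (x::'a::complex_vector)"
  by (simp add: scaleC_minus_left scaleC_one)

lemma bounded_linear_scaleC: "bounded_linear (\<lambda>x::'a::cstar_algebra. c *\<^sub>C x)"
  by (rule bounded_linear_intro[where K = "cmod c"])
    (simp_all add: scaleC_add_right scaleR_scaleC scaleC_scaleC norm_scaleC mult.commute)

lemma clinearI:
  assumes "\<And>x y. f (x + y) = f x + f y" "\<And>c x. f (c *\<^sub>C x) = c *\<^sub>C f x"
  shows "clinear f"
proof -
  have "vector_space_pair (scaleC :: complex \<Rightarrow> 'a \<Rightarrow> 'a::complex_vector)
     (scaleC :: complex \<Rightarrow> 'b \<Rightarrow> 'b::complex_vector)" ..
  then show ?thesis using assms
    by (simp add: Vector_Spaces.linear_iff complex_vector.vector_space_axioms)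
qed

lemma clinearD:
  assumes "clinear f"
  shows "f (x + y) = f x + f y" "f (c *\<^sub>C x) = c *\<^sub>C f x" "f 0 = 0" "f (- x) = - f x"
    "f (x - y) = f x - f y" "f (sum g A) = (\<Sum>i\<in>A. f (g i))" "f (r *\<^sub>R x) = r *\<^sub>R f x"
proof -
  interpret Vector_Spaces.linear scaleC scaleC f by fact
  show "f (x + y) = f x + f y" "f (c *\<^sub>C x) = c *\<^sub>C f x" "f 0 = 0" "f (- x) = - f x"
    "f (x - y) = f x - f y" "f (sum g A) = (\<Sum>i\<in>A. f (g i))"
    by (simp_all add: add scale zero neg diff sum)
  show "f (r *\<^sub>R x) = r *\<^sub>R f x" by (simp add: scaleR_scaleC scale)
qed

lemma csubspaceI:
  assumes "0 \<in> S" "\<And>x y. x \<in> S \<Longrightarrow> y \<in> S \<Longrightarrow> x + y \<in> S" "\<And>c x. x \<in> S \<Longrightarrow> c *\<^sub>C x \<in> S"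
  shows "csubspace S"
  using assms by (simp add: complex_vector.subspace_def)

lemma csubspaceD:
  assumes "csubspace S"
  shows "0 \<in> S" "x \<in> S \<Longrightarrow> y \<in> S \<Longrightarrow> x + y \<in> S" "x \<in> S \<Longrightarrow> c *\<^sub>C x \<in> S"
    "x \<in> S \<Longrightarrow> r *\<^sub>R x \<in> S" "x \<in> S \<Longrightarrow> - x \<in> S" "x \<in> S \<Longrightarrow> y \<in> S \<Longrightarrow> x - y \<in> S"
proof -
  show 1: "0 \<in> S" "x \<in> S \<Longrightarrow> y \<in> S \<Longrightarrow> x + y \<in> S" "x \<in> S \<Longrightarrow> c *\<^sub>C x \<in> S" for x y c
    using assms by (auto simp: complex_vector.subspace_def)
  show "x \<in> S \<Longrightarrow> r *\<^sub>R x \<in> S" using 1 by (simp add: scaleR_scaleC)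
  show 2: "x \<in> S \<Longrightarrow> - x \<in> S" for x using 1(3)[of x "-1"] by (simp add: scaleC_minus_one)
  show "x \<in> S \<Longrightarrow> y \<in> S \<Longrightarrow> x - y \<in> S" using 1(2)[of x "- y"] 2 by simp
qed

lemma cstar_idealD:
  assumes "cstar_ideal I"
  shows "csubspace I" "closed I" "b \<in> I \<Longrightarrow> a * b \<in> I" "b \<in> I \<Longrightarrow> b * a \<in> I"
  using assms by (auto simp: cstar_ideal_def)

lemma bounded_linear_mult_plus_scaleC:
  "bounded_linear (\<lambda>b::'a::cstar_algebra. a * b + z *\<^sub>C b)"
  by (intro bounded_linear_add bounded_linear_scaleC bounded_linear_mult_right)

section \<open>Unitization\<close>

class cstar_algebra_1 = cstar_algebra + real_normed_algebra_1

text \<open>The norm below makes the unitization of an algebra that already has a unit its direct sum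
  with the scalars, so no case distinction is needed.\<close>

typedef 'a unitization = "UNIV :: ('a::cstar_algebra \<times> complex) set"
  by simp

definition unitize :: "'a::cstar_algebra \<Rightarrow> complex \<Rightarrow> 'a unitization"
  where "unitize a z = Abs_unitization (a, z)"

definition alg_part :: "'a::cstar_algebra unitization \<Rightarrow> 'a"
  where "alg_part u = fst (Rep_unitization u)"

definition scalar_part :: "'a::cstar_algebra unitization \<Rightarrow> complex"
  where "scalar_part u = snd (Rep_unitization u)"

lemma unitize_parts [simp]: "unitize (alg_part u) (scalar_part u) = u"
  by (simp add: unitize_def alg_part_def scalar_part_def Rep_unitization_inverse)

lemma parts_unitize [simp]: "alg_part (unitize a z) = a" "scalar_part (unitize a z) = z"
  by (simp_all add: unitize_def alg_part_def scalar_part_def Abs_unitization_inverse)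

lemma unitization_eqI: "alg_part u = alg_part v \<Longrightarrow> scalar_part u = scalar_part v \<Longrightarrow> u = v"
  by (metis unitize_parts)

text \<open>The left action of the unitization on the algebra. Its operator norm is the C*-norm if
  the algebra has no unit; if e is a unit, it vanishes at \<open>unitize (- e) 1\<close>, which the
  scalar part has to detect in the norm.\<close>

definition multiplier :: "'a::cstar_algebra unitization \<Rightarrow> 'a \<Rightarrow> 'a"
  where "multiplier u b = alg_part u * b + scalar_part u *\<^sub>C b"

lemma bounded_linear_multiplier: "bounded_linear (multiplier u)"
  unfolding multiplier_def by (rule bounded_linear_mult_plus_scaleC)

instantiation unitization :: (cstar_algebra) "{complex_vector, real_algebra_1}"
begin
definition zero_unitization where "0 = unitize 0 0"
definition one_unitization where "1 = unitize 0 1"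
definition plus_unitization
  where "u + v = unitize (alg_part u + alg_part v) (scalar_part u + scalar_part v)"
definition minus_unitization
  where "u - v = unitize (alg_part u - alg_part v) (scalar_part u - scalar_part v)"
definition uminus_unitization
  where "- u = unitize (- alg_part u) (- scalar_part u)"
definition scaleR_unitization
  where "r *\<^sub>R u = unitize (r *\<^sub>R alg_part u) (of_real r * scalar_part u)"
definition scaleC_unitization
  where "c *\<^sub>C u = unitize (c *\<^sub>C alg_part u) (c * scalar_part u)"
definition times_unitization
  where "u * v = unitize (alg_part u * alg_part v + scalar_part u *\<^sub>C alg_part v
    + scalar_part v *\<^sub>C alg_part u) (scalar_part u * scalar_part v)"

lemma parts_simps [simp]:
  "alg_part 0 = 0" "scalar_part 0 = 0" "alg_part 1 = 0" "scalar_part 1 = 1"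
  "alg_part (u + v) = alg_part u + alg_part v" "scalar_part (u + v) = scalar_part u + scalar_part v"
  "alg_part (u - v) = alg_part u - alg_part v" "scalar_part (u - v) = scalar_part u - scalar_part v"
  "alg_part (- u) = - alg_part u" "scalar_part (- u) = - scalar_part u"
  "alg_part (r *\<^sub>R u) = r *\<^sub>R alg_part u" "scalar_part (r *\<^sub>R u) = of_real r * scalar_part u"
  "alg_part (c *\<^sub>C u) = c *\<^sub>C alg_part u" "scalar_part (c *\<^sub>C u) = c * scalar_part u"
  "alg_part (u * v) = alg_part u * alg_part v + scalar_part u *\<^sub>C alg_part v
    + scalar_part v *\<^sub>C alg_part u"
  "scalar_part (u * v) = scalar_part u * scalar_part v"
  by (simp_all add: zero_unitization_def one_unitization_def plus_unitization_def
      minus_unitization_def uminus_unitization_def scaleR_unitization_def scaleC_unitization_def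
      times_unitization_def)

instance
proof
  show "(0::'a unitization) \<noteq> 1"
    by (metis parts_simps(2) parts_simps(4) zero_neq_one)
qed (rule unitization_eqI; simp add: algebra_simps scaleC_add_right scaleC_add_left scaleC_scaleC
      scaleC_one scaleR_scaleC scaleC_mult_left scaleC_mult_right)+
end

lemma multiplier_simps:
  "multiplier (u + v) b = multiplier u b + multiplier v b"
  "multiplier (c *\<^sub>C u) b = c *\<^sub>C multiplier u b"
  "multiplier (r *\<^sub>R u) b = r *\<^sub>R multiplier u b"
  "multiplier (u * v) b = multiplier u (multiplier v b)"
  by (simp_all add: multiplier_def algebra_simps scaleC_add_right scaleC_add_left scaleC_scaleC
      scaleR_scaleC scaleC_mult_left scaleC_mult_right)

instantiation unitization :: (cstar_algebra) real_normed_algebra_1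
begin

definition norm_unitization
  where "norm u = max (onorm (multiplier u)) (cmod (scalar_part u))"
definition dist_unitization
  where "dist u v = norm (u - v :: 'a unitization)"
definition sgn_unitization
  where "sgn u = u /\<^sub>R norm (u :: 'a unitization)"
definition uniformity_unitization where
  [code del]: "(uniformity :: ('a unitization \<times> 'a unitization) filter)
    = (INF e\<in>{0<..}. principal {(x, y). dist x y < e})"
definition open_unitization where
  [code del]: "open (U :: 'a unitization set) \<longleftrightarrow>
    (\<forall>x\<in>U. eventually (\<lambda>(x', y). x' = x \<longrightarrow> y \<in> U) uniformity)"

lemma onorm_multiplier_le_norm: "norm (multiplier u b) \<le> norm u * norm b"
proof -
  have "norm (multiplier u b) \<le> onorm (multiplier u) * norm b"
    by (rule onorm[OF bounded_linear_multiplier])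
  also have "\<dots> \<le> norm u * norm b"
    by (rule mult_right_mono) (simp_all add: norm_unitization_def)
  finally show ?thesis .
qed

instance
proof
  fix x y :: "'a unitization" and r :: real
  show "(norm x = 0) = (x = 0)"
  proof
    assume "norm x = 0"
    then have *: "scalar_part x = 0" "multiplier x b = 0" for b
      using onorm_multiplier_le_norm[of x b] by (auto simp: norm_unitization_def max_def split: if_splits)
    \<comment> \<open>At \<open>star (alg_part x)\<close> the multiplier takes the value
      \<open>alg_part x * star (alg_part x)\<close>, to which the C*-identity applies.\<close>
    then have "star (star (alg_part x)) * star (alg_part x) = 0"
      using *(2)[of "star (alg_part x)"] by (simp add: multiplier_def star_star)
    then have "alg_part x = 0" by (metis star_mult_eq_0_iff star_star star_zero)
    with * show "x = 0" by (intro unitization_eqI) auto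
  next
    assume "x = 0"
    moreover have "multiplier (0::'a unitization) = (\<lambda>b. 0)" by (simp add: multiplier_def fun_eq_iff)
    ultimately show "norm x = 0"
      by (simp add: norm_unitization_def onorm_zero)
  qed
  show "norm (x + y) \<le> norm x + norm y"
  proof -
    have "onorm (multiplier (x + y)) \<le> onorm (multiplier x) + onorm (multiplier y)"
      using onorm_triangle[OF bounded_linear_multiplier bounded_linear_multiplier, of x y]
      by (simp add: multiplier_simps(1)[abs_def])
    moreover have "cmod (scalar_part (x + y)) \<le> cmod (scalar_part x) + cmod (scalar_part y)"
      by (simp add: norm_triangle_ineq)
    ultimately show ?thesis unfolding norm_unitization_def by linarith
  qed
  show "norm (r *\<^sub>R x) = \<bar>r\<bar> * norm x"
    using onorm_scaleR[OF bounded_linear_multiplier, of r x]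
    by (simp add: norm_unitization_def multiplier_simps(3)[abs_def] norm_mult max_mult_distrib_left)
  show "norm (x * y) \<le> norm x * norm y"
  proof -
    have "onorm (multiplier (x * y)) \<le> onorm (multiplier x) * onorm (multiplier y)"
      using onorm_compose[OF bounded_linear_multiplier bounded_linear_multiplier, of x y]
      by (simp add: multiplier_simps(4)[abs_def] comp_def)
    also have "\<dots> \<le> norm x * norm y"
      by (intro mult_mono) (auto simp: norm_unitization_def intro: onorm_pos_le[OF bounded_linear_multiplier] order_trans[OF onorm_pos_le[OF bounded_linear_multiplier]] max.coboundedI1)
    finally have 1: "onorm (multiplier (x * y)) \<le> norm x * norm y" .
    have 2: "cmod (scalar_part (x * y)) \<le> norm x * norm y"
      unfolding parts_simps norm_mult
      by (intro mult_mono) (auto simp: norm_unitization_def max.coboundedI2)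
    show ?thesis using 1 2 by (simp add: norm_unitization_def[of "x * y"])
  qed
  show "norm (1::'a unitization) = 1"
  proof -
    have "onorm (\<lambda>b::'a. b) \<le> 1" by (rule onorm_bound) auto
    then show ?thesis by (simp add: norm_unitization_def multiplier_def[abs_def] scaleC_one)
  qed
qed (rule dist_unitization_def sgn_unitization_def uniformity_unitization_def open_unitization_def)+
end

lemma norm_scalar_part_le: "cmod (scalar_part u) \<le> norm u"
  by (simp add: norm_unitization_def)

definition emb :: "'a::cstar_algebra \<Rightarrow> 'a unitization"
  where "emb a = unitize a 0"

lemma embed_simps [simp]: "alg_part (emb a) = a" "scalar_part (emb a) = 0"
  by (simp_all add: emb_def)

text \<open>The multiplier of a already attains the norm of a at the single element
  \<open>star a\<close>, by the C*-identity.\<close>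

lemma norm_embed [simp]: "norm (emb a) = norm a"
proof -
  have "onorm (multiplier (emb a)) \<le> norm a"
    by (rule onorm_bound) (auto simp: multiplier_def norm_mult_ineq)
  moreover have "norm a \<le> onorm (multiplier (emb a))"
  proof (cases "a = 0")
    case True then show ?thesis by (simp add: onorm_pos_le[OF bounded_linear_multiplier])
  next
    case False
    have "norm a * norm a \<le> onorm (multiplier (emb a)) * norm a"
      using onorm[OF bounded_linear_multiplier, of "emb a" "star a"]
      by (simp add: multiplier_def cstar_identity' power2_eq_square)
    then show ?thesis using False by simp
  qed
  ultimately show ?thesis by (simp add: norm_unitization_def)
qed

lemma embed_arith:
  "emb (a + b) = emb a + emb b" "emb (a - b) = emb a - emb b"
  "emb (- a) = - emb a" "emb 0 = 0" "emb (c *\<^sub>C a) = c *\<^sub>C emb a"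
  "emb (r *\<^sub>R a) = r *\<^sub>R emb a" "emb (a * b) = emb a * emb b"
  by (rule unitization_eqI; simp)+

lemma unitization_decomp: "u = emb (alg_part u) + scalar_part u *\<^sub>C 1"
  by (rule unitization_eqI) simp_all

instantiation unitization :: (cstar_algebra) cstar_algebra_1
begin

definition star_unitization
  where "star u = unitize (star (alg_part u)) (cnj (scalar_part u))"

lemma parts_star [simp]: "alg_part (star u) = star (alg_part u)"
  "scalar_part (star u) = cnj (scalar_part u)"
  by (simp_all add: star_unitization_def)

instance
proof
  fix c :: complex and x y :: "'a unitization"
  show "star (star x) = x" "star (x + y) = star x + star y" "star (c *\<^sub>C x) = cnj c *\<^sub>C star x"
    "star (x * y) = star y * star x" "(c *\<^sub>C x) * y = c *\<^sub>C (x * y)" "x * (c *\<^sub>C y) = c *\<^sub>C (x * y)"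
    by (rule unitization_eqI; simp add: star_star star_add star_scaleC star_mult algebra_simps
        scaleC_add_right scaleC_scaleC scaleC_mult_left scaleC_mult_right)+
  show scale: "norm (c *\<^sub>C x) = cmod c * norm x" for c and x :: "'a unitization"
  proof -
    have le: "norm (c *\<^sub>C x) \<le> cmod c * norm x" for c and x :: "'a unitization"
    proof -
      have "onorm (multiplier (c *\<^sub>C x)) \<le> cmod c * norm x"
        by (rule onorm_bound) (auto simp: multiplier_simps norm_scaleC mult.assoc
            intro: mult_left_mono onorm_multiplier_le_norm)
      moreover have "cmod (scalar_part (c *\<^sub>C x)) \<le> cmod c * norm x"
        by (simp add: norm_mult mult_left_mono norm_scalar_part_le)
      ultimately show ?thesis by (simp add: norm_unitization_def[of "c *\<^sub>C x"])
    qed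
    show ?thesis
    proof (cases "c = 0")
      case False
      have "norm x = norm (inverse c *\<^sub>C c *\<^sub>C x)" using False by (simp add: scaleC_scaleC scaleC_one)
      also have "\<dots> \<le> cmod (inverse c) * norm (c *\<^sub>C x)" by (rule le)
      finally have "cmod c * norm x \<le> norm (c *\<^sub>C x)"
        using False by (simp add: norm_inverse norm_divide field_simps)
      with le[of c x] show ?thesis by simp
    qed simp
  qed
  show "norm (star x * x) = (norm x)\<^sup>2"
  proof -
    let ?o = "\<lambda>u::'a unitization. onorm (multiplier u)"
    have nn: "0 \<le> ?o u" for u by (rule onorm_pos_le[OF bounded_linear_multiplier])
    have sub: "?o (u * v) \<le> ?o u * ?o v" for u v
      using onorm_compose[OF bounded_linear_multiplier bounded_linear_multiplier, of u v]
      by (simp add: multiplier_simps(4)[abs_def] comp_def)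
    \<comment> \<open>The values \<open>multiplier u b\<close> lie in the algebra itself, so its
      C*-identity yields one for operators: the square of u b is \<open>star b\<close> times the
      action of \<open>star u * u\<close> on b.\<close>
    have A: "(?o u)\<^sup>2 \<le> ?o (star u * u)" for u
    proof -
      have "?o u \<le> sqrt (?o (star u * u))"
      proof (rule onorm_bound)
        fix b
        have "(norm (multiplier u b))\<^sup>2 = norm (star (multiplier u b) * multiplier u b)"
          by (simp add: cstar_identity)
        also have "star (multiplier u b) * multiplier u b = star b * multiplier (star u * u) b"
          by (simp add: multiplier_def star_add star_mult star_scaleC algebra_simps
              scaleC_add_right scaleC_add_left scaleC_scaleC scaleC_mult_left scaleC_mult_right)
        also have "norm \<dots> \<le> norm b * norm (multiplier (star u * u) b)"
          using norm_mult_ineq[of "star b"] by simp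
        also have "\<dots> \<le> norm b * (?o (star u * u) * norm b)"
          by (intro mult_left_mono onorm[OF bounded_linear_multiplier]) simp
        finally have "(norm (multiplier u b))\<^sup>2 \<le> ?o (star u * u) * (norm b)\<^sup>2"
          by (simp add: power2_eq_square mult_ac)
        then have "norm (multiplier u b) \<le> sqrt (?o (star u * u) * (norm b)\<^sup>2)"
          by (rule real_le_rsqrt)
        then show "norm (multiplier u b) \<le> sqrt (?o (star u * u)) * norm b"
          by (simp add: real_sqrt_mult)
      qed (simp add: nn)
      then show ?thesis using nn[of u] by (metis nn power_mono real_sqrt_pow2)
    qed
    have B: "?o u \<le> ?o (star u)" for u
    proof (cases "?o u = 0")
      case True then show ?thesis by (simp add: nn)
    next
      case False
      have "?o u * ?o u \<le> ?o (star u) * ?o u"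
        using A[of u] sub[of "star u" u] by (simp add: power2_eq_square)
      then show ?thesis using False nn[of u] by simp
    qed
    have star_star': "star (star x) = x"
      by (rule unitization_eqI) (simp_all add: star_star)
    have "?o (star x * x) \<le> (?o x)\<^sup>2"
      using sub[of "star x" x] B[of "star x"] mult_right_mono[OF B[of "star x"] nn[of x]]
      by (simp add: power2_eq_square star_star')
    then have "?o (star x * x) = (?o x)\<^sup>2" using A[of x] by simp
    moreover have "cmod (scalar_part (star x * x)) = (cmod (scalar_part x))\<^sup>2"
      by (simp add: norm_mult power2_eq_square)
    ultimately show ?thesis
      using nn[of x] by (auto simp: norm_unitization_def max_def power_mono
          dest: power2_le_imp_le intro!: antisym)
  qed
next
  fix X :: "nat \<Rightarrow> 'a unitization"
  assume "Cauchy X"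
  have s: "Cauchy (\<lambda>n. scalar_part (X n))"
  proof (rule CauchyI)
    fix e :: real assume "0 < e"
    then obtain M where "\<forall>m\<ge>M. \<forall>n\<ge>M. norm (X m - X n) < e"
      using \<open>Cauchy X\<close> by (meson CauchyD)
    then show "\<exists>M. \<forall>m\<ge>M. \<forall>n\<ge>M. norm (scalar_part (X m) - scalar_part (X n)) < e"
      using norm_scalar_part_le by (metis parts_simps(8) le_less_trans)
  qed
  have a: "Cauchy (\<lambda>n. alg_part (X n))"
  proof (rule CauchyI)
    fix e :: real assume "0 < e"
    then obtain M where M: "\<forall>m\<ge>M. \<forall>n\<ge>M. norm (X m - X n) < e/2"
      using \<open>Cauchy X\<close> by (meson CauchyD half_gt_zero)
    have "norm (alg_part (X m) - alg_part (X n)) < e" if "m \<ge> M" "n \<ge> M" for m n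
    proof -
      \<comment> \<open>The algebra part is what remains after subtracting the scalar part, and a
        scalar has its modulus as norm.\<close>
      have "emb (alg_part (X m) - alg_part (X n))
         = (X m - X n) - scalar_part (X m - X n) *\<^sub>C 1"
        by (rule unitization_eqI) simp_all
      then have "norm (alg_part (X m) - alg_part (X n))
         \<le> norm (X m - X n) + norm (scalar_part (X m - X n) *\<^sub>C (1::'a unitization))"
        by (metis norm_embed norm_triangle_ineq4)
      also have "norm (scalar_part (X m - X n) *\<^sub>C (1::'a unitization)) = cmod (scalar_part (X m - X n))"
      proof -
        have "onorm (\<lambda>b::'a. c *\<^sub>C b) \<le> cmod c" for c
          by (rule onorm_bound) (auto simp: norm_scaleC)
        then show ?thesis by (simp add: norm_unitization_def multiplier_def[abs_def] max_def)
      qed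
      finally show ?thesis using M that norm_scalar_part_le[of "X m - X n"] by fastforce
    qed
    then show "\<exists>M. \<forall>m\<ge>M. \<forall>n\<ge>M. norm (alg_part (X m) - alg_part (X n)) < e" by blast
  qed
  obtain a0 where a0: "(\<lambda>n. alg_part (X n)) \<longlonglongrightarrow> a0" using a Cauchy_convergent convergent_def by blast
  obtain z0 where z0: "(\<lambda>n. scalar_part (X n)) \<longlonglongrightarrow> z0" using s Cauchy_convergent convergent_def by blast
  have bound: "norm (u :: 'a unitization) \<le> norm (alg_part u) + cmod (scalar_part u)" for u
  proof -
    have "onorm (multiplier u) \<le> norm (alg_part u) + cmod (scalar_part u)"
    proof (rule onorm_bound)
      fix b
      have "norm (multiplier u b) \<le> norm (alg_part u * b) + norm (scalar_part u *\<^sub>C b)"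
        unfolding multiplier_def by (rule norm_triangle_ineq)
      also have "\<dots> \<le> norm (alg_part u) * norm b + cmod (scalar_part u) * norm b"
        by (simp add: norm_scaleC norm_mult_ineq)
      finally show "norm (multiplier u b) \<le> (norm (alg_part u) + cmod (scalar_part u)) * norm b"
        by (simp add: algebra_simps)
    qed simp
    then show ?thesis by (simp add: norm_unitization_def)
  qed
  have lim: "(\<lambda>n. norm (alg_part (X n) - a0) + cmod (scalar_part (X n) - z0)) \<longlonglongrightarrow> 0 + 0"
    using a0 z0 by (intro tendsto_add) (simp_all add: tendsto_norm_zero_iff LIM_zero_iff)
  have "(\<lambda>n. X n - unitize a0 z0) \<longlonglongrightarrow> 0"
  proof (rule Lim_null_comparison[rotated])
    show "\<forall>\<^sub>F n in sequentially. norm (X n - unitize a0 z0)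
      \<le> norm (alg_part (X n) - a0) + cmod (scalar_part (X n) - z0)"
      by (rule always_eventually, rule allI, rule order_trans[OF bound]) simp
  qed (use lim in simp)
  then have "X \<longlonglongrightarrow> unitize a0 z0" by (simp add: LIM_zero_iff)
  then show "convergent X" by (auto simp: convergent_def)
qed
end

lemma embed_star: "emb (star a) = star (emb a)"
  by (rule unitization_eqI) simp_all

lemma star_one [simp]: "star (1::'a::cstar_algebra_1) = 1"
proof -
  have "star (1::'a) = star 1 * star (star 1)" by (simp add: star_star)
  also have "\<dots> = star (star 1 * 1)" by (simp only: star_mult)
  also have "\<dots> = 1" by (simp add: star_star)
  finally show ?thesis .
qed

section \<open>Square roots and the positive cone\<close>

text \<open>The limit \<open>d\<close> of this iteration solves \<open>2 d - d\<^sup>2 = c\<close>, that is \<open>(1 - d)\<^sup>2 = 1 - c\<close>.\<close>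

primrec root_iter :: "'a::cstar_algebra_1 \<Rightarrow> nat \<Rightarrow> 'a" where
  "root_iter c 0 = 0"
| "root_iter c (Suc n) = (1/2) *\<^sub>R (c + root_iter c n * root_iter c n)"

definition root_near_one :: "'a::cstar_algebra_1 \<Rightarrow> 'a"
  where "root_near_one u = 1 - lim (root_iter (1 - u))"

text \<open>The map s \<mapsto> (c + s^2) / 2 preserves the ball of radius r because r + r^2 \<le> 2
  r.\<close>

lemma root_iter_norm: "norm c \<le> r \<Longrightarrow> r < 1 \<Longrightarrow> norm (root_iter c n) \<le> r"
proof (induction n)
  case 0 then show ?case by (simp add: order_trans[OF norm_ge_zero])
next
  case (Suc n)
  have r: "0 \<le> r" using Suc.prems(1) norm_ge_zero order_trans by blast
  have "norm (c + root_iter c n * root_iter c n) \<le> r + r * r"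
    using Suc r by (intro norm_triangle_le add_mono order_trans[OF norm_mult_ineq] mult_mono) auto
  also have "\<dots> \<le> 2 * r" using Suc.prems(2) r by (simp add: mult_left_le)
  finally show ?case by simp
qed

text \<open>On the ball of radius r the iteration contracts by r: a difference of two squares splits
  into two terms, each with a factor of norm at most r, and the 1/2 compensates for the two
  terms.\<close>

lemma root_iter_diff:
  assumes "norm c \<le> r" "r < 1"
  shows "norm (root_iter c (Suc n) - root_iter c n) \<le> r ^ n"
proof (induction n)
  case 0 then show ?case using assms by simp
next
  case (Suc n)
  let ?s = "root_iter c"
  have r: "0 \<le> r" using assms(1) norm_ge_zero order_trans by blast
  have "?s (Suc (Suc n)) - ?s (Suc n) = (1/2) *\<^sub>R (?s (Suc n) * ?s (Suc n) - ?s n * ?s n)"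
    by (simp add: scaleR_diff_right algebra_simps)
  also have "?s (Suc n) * ?s (Suc n) - ?s n * ?s n
     = ?s (Suc n) * (?s (Suc n) - ?s n) + (?s (Suc n) - ?s n) * ?s n"
    by (simp only: right_diff_distrib left_diff_distrib) simp
  finally have "norm (?s (Suc (Suc n)) - ?s (Suc n))
    = 1/2 * norm (?s (Suc n) * (?s (Suc n) - ?s n) + (?s (Suc n) - ?s n) * ?s n)" by simp
  also have "\<dots> \<le> 1/2 * (r * r ^ n + r ^ n * r)"
    using r Suc root_iter_norm[OF assms]
    by (intro mult_left_mono norm_triangle_le add_mono order_trans[OF norm_mult_ineq] mult_mono) (auto simp del: root_iter.simps)
  finally show ?case by simp
qed

lemma root_iter_tendsto:
  assumes "norm c < 1"
  shows "root_iter c \<longlonglongrightarrow> lim (root_iter c)"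
proof -
  have "summable (\<lambda>n. root_iter c (Suc n) - root_iter c n)"
    by (rule summable_comparison_test'[where g = "\<lambda>n. norm c ^ n" and N = 0])
      (use root_iter_diff[OF order_refl assms] assms in \<open>auto intro: summable_geometric simp del: root_iter.simps\<close>)
  then have "convergent (\<lambda>m. \<Sum>n<m. root_iter c (Suc n) - root_iter c n)"
    using summable_iff_convergent by blast
  then have "convergent (root_iter c)" unfolding sum_lessThan_telescope by simp
  then show ?thesis by (simp add: convergent_LIMSEQ_iff)
qed

text \<open>The relation passes to every iterate and later to the roots. Two different elements c,
  c' are allowed because \<open>cpos_minus_swap\<close> compares a root on the side of
  \<open>w * star w\<close> with one on the side of \<open>star w * w\<close>.\<close>

lemma root_iter_intertwine:
  assumes "w * c = c' * w"
  shows "w * root_iter c n = root_iter c' n * w"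
proof (induction n)
  case (Suc n)
  have "w * (root_iter c n * root_iter c n) = root_iter c' n * (w * root_iter c n)"
    by (metis Suc mult.assoc)
  also have "\<dots> = root_iter c' n * root_iter c' n * w" by (simp only: Suc mult.assoc)
  finally show ?case using assms by (simp add: distrib_left distrib_right)
qed simp

lemma root_iter_star: "star (root_iter c n) = root_iter (star c) n"
  by (induction n) (simp_all add: star_scaleR star_add star_mult)

context
  fixes u :: "'a::cstar_algebra_1"
  assumes near: "norm (1 - u) < 1"
begin

lemma root_near_one_tendsto: "(\<lambda>n. 1 - root_iter (1 - u) n) \<longlonglongrightarrow> root_near_one u"
  unfolding root_near_one_def by (intro tendsto_intros root_iter_tendsto near)

lemma root_near_one_square: "root_near_one u * root_near_one u = u"
proof -
  let ?d = "lim (root_iter (1 - u))"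
  have lim: "root_iter (1 - u) \<longlonglongrightarrow> ?d" by (rule root_iter_tendsto[OF near])
  have "(\<lambda>n. root_iter (1 - u) (Suc n)) \<longlonglongrightarrow> (1/2) *\<^sub>R ((1 - u) + ?d * ?d)"
    unfolding root_iter.simps by (intro tendsto_intros lim)
  then have "?d = (1/2) *\<^sub>R ((1 - u) + ?d * ?d)"
    using LIMSEQ_Suc[OF lim] LIMSEQ_unique by blast
  then have "2 *\<^sub>R ?d = 2 *\<^sub>R (1/2) *\<^sub>R ((1 - u) + ?d * ?d)" by (rule arg_cong)
  then have "2 *\<^sub>R ?d = (1 - u) + ?d * ?d" by simp
  then show ?thesis
    by (simp add: root_near_one_def algebra_simps scaleR_2)
qed

lemma root_near_one_norm: "norm (1 - root_near_one u) \<le> norm (1 - u)"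
proof -
  have "(\<lambda>n. norm (root_iter (1 - u) n)) \<longlonglongrightarrow> norm (lim (root_iter (1 - u)))"
    by (intro tendsto_norm root_iter_tendsto near)
  then have "norm (lim (root_iter (1 - u))) \<le> norm (1 - u)"
    by (rule Lim_bounded) (use root_iter_norm[OF order_refl near] in auto)
  then show ?thesis by (simp add: root_near_one_def)
qed

lemma root_near_one_star: "star u = u \<Longrightarrow> star (root_near_one u) = root_near_one u"
proof -
  assume "star u = u"
  then have "(\<lambda>n. star (1 - root_iter (1 - u) n)) = (\<lambda>n. 1 - root_iter (1 - u) n)"
    by (simp add: star_diff root_iter_star)
  then show ?thesis
    using tendsto_star[OF root_near_one_tendsto] root_near_one_tendsto LIMSEQ_unique by metis
qed

lemma root_near_one_intertwine:
  assumes "norm (1 - u') < 1" "w * u = u' * w"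
  shows "w * root_near_one u = root_near_one u' * w"
proof -
  have "w * (1 - u) = (1 - u') * w" using assms(2) by (simp add: algebra_simps)
  note int = root_iter_intertwine[OF this]
  have "(\<lambda>n. w * (1 - root_iter (1 - u) n)) \<longlonglongrightarrow> w * root_near_one u"
    by (intro tendsto_intros root_near_one_tendsto)
  moreover have "(\<lambda>n. w * (1 - root_iter (1 - u) n)) = (\<lambda>n. (1 - root_iter (1 - u') n) * w)"
    by (simp add: algebra_simps int)
  moreover have "(\<lambda>n. (1 - root_iter (1 - u') n) * w) \<longlonglongrightarrow> root_near_one u' * w"
    unfolding root_near_one_def by (intro tendsto_intros root_iter_tendsto assms)
  ultimately show ?thesis using LIMSEQ_unique by metis
qed

end

text \<open>The element u = x + i y satisfies \<open>star u * u\<close> = t, so its norm is the root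
  of t, and x is its real part.\<close>

lemma norm_le_of_squares:
  fixes x y :: "'a::cstar_algebra_1"
  assumes "star x = x" "star y = y" "x * y = y * x" "x * x + y * y = t *\<^sub>R 1" "0 \<le> t"
  shows "(norm x)\<^sup>2 \<le> t"
proof -
  let ?u = "x + \<i> *\<^sub>C y"
  have su: "star ?u = x - \<i> *\<^sub>C y"
    by (simp add: star_add star_scaleC assms scaleC_minus_left)
  have "star ?u * ?u = x * x + y * y"
    unfolding su by (simp add: algebra_simps scaleC_mult_left scaleC_mult_right scaleC_scaleC assms(3)
        scaleC_minus_one)
  then have nu: "(norm ?u)\<^sup>2 = t"
    using cstar_identity[of ?u] assms by simp
  have "x = (1/2) *\<^sub>R (?u + star ?u)" unfolding su by (simp flip: scaleR_2)
  then have "norm x = 1/2 * norm (?u + star ?u)" by (metis norm_scaleR abs_of_nonneg zero_le_divide_1_iff zero_le_numeral)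
  then have "norm x \<le> norm ?u" using norm_triangle_ineq[of ?u "star ?u"] by simp
  then show ?thesis using nu power_mono[of "norm x" "norm ?u" 2] by simp
qed

text \<open>If b has norm below 1, then 1 - b^2 has a selfadjoint root s commuting with b, and s^2 +
  b^2 = 1 bounds s. Scaling gives the case of strict inequality, and a small shift of t the
  remaining one.\<close>

lemma norm_minus_square_le:
  fixes c :: "'a::cstar_algebra_1"
  assumes c: "star c = c" and t: "(norm c)\<^sup>2 \<le> t"
  shows "norm (t *\<^sub>R 1 - c * c) \<le> t"
proof -
  have base: "norm (1 - b * b) \<le> 1" if b: "star b = b" "norm b < 1" for b :: 'a
  proof -
    let ?u = "1 - b * b"
    have near: "norm (1 - ?u) < 1" using b by (simp add: norm_square_selfadjoint abs_square_less_1)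
    let ?s = "root_near_one ?u"
    have s: "?s * ?s = ?u" "star ?s = ?s" "b * ?s = ?s * b"
      using near by (simp_all add: root_near_one_square root_near_one_star star_diff star_mult b
          root_near_one_intertwine algebra_simps)
    have "(norm ?s)\<^sup>2 \<le> 1"
      by (rule norm_le_of_squares[of ?s b]) (use s b in auto)
    then show ?thesis using norm_square_selfadjoint[of ?s] s by simp
  qed
  have strict: "norm (s *\<^sub>R 1 - c * c) \<le> s" if s: "(norm c)\<^sup>2 < s" for s
  proof -
    have s0: "0 < s" using s by (meson le_less_trans zero_le_power2)
    let ?b = "(1 / sqrt s) *\<^sub>R c"
    have "norm c < sqrt s" using s by (simp add: real_less_rsqrt)
    then have "norm ?b < 1" using s0 by simp
    then have "norm (1 - ?b * ?b) \<le> 1" using base[of ?b] by (simp add: star_scaleR c)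
    moreover have "?b * ?b = (1 / s) *\<^sub>R (c * c)" using s0 by simp
    ultimately have "norm (s *\<^sub>R (1 - (1/s) *\<^sub>R (c * c))) \<le> s" using s0 by simp
    then show ?thesis using s0 by (simp add: scaleR_diff_right)
  qed
  show ?thesis
  proof (rule field_le_epsilon)
    fix e :: real assume e: "0 < e"
    have "t *\<^sub>R 1 - c * c = ((t + e/2) *\<^sub>R 1 - c * c) - (e/2) *\<^sub>R 1"
      by (simp add: algebra_simps)
    then have "norm (t *\<^sub>R 1 - c * c) \<le> norm ((t + e/2) *\<^sub>R 1 - c * c) + norm ((e/2) *\<^sub>R (1::'a))"
      by (metis norm_triangle_ineq4)
    also have "\<dots> \<le> (t + e/2) + e/2" using e t by (intro add_mono strict) auto
    finally show "norm (t *\<^sub>R 1 - c * c) \<le> t + e" by simp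
  qed
qed

text \<open>The norm form of having spectrum in [0, \<parallel>a\<parallel>]: for selfadjoint a this
  means distance at most \<parallel>a\<parallel> from the scalar \<parallel>a\<parallel>. It makes
  positivity accessible without spectra.\<close>

definition cpos :: "'a::cstar_algebra_1 \<Rightarrow> bool"
  where "cpos a \<longleftrightarrow> star a = a \<and> norm (norm a *\<^sub>R 1 - a) \<le> norm a"

lemma cpos_star: "cpos a \<Longrightarrow> star a = a" by (simp add: cpos_def)

lemma cpos_square: "star k = k \<Longrightarrow> cpos (k * k)"
  unfolding cpos_def by (simp add: star_mult norm_square_selfadjoint norm_minus_square_le)

text \<open>A root of a + \<eta>: the rescaled element differs from 1 by (t - a) / (t + \<eta>), of
  norm below 1, where the iteration converges. The bound t is a parameter so that intertwined
  elements can be rescaled alike.\<close>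

definition shift_root :: "real \<Rightarrow> real \<Rightarrow> 'a::cstar_algebra_1 \<Rightarrow> 'a"
  where "shift_root t \<eta> a = sqrt (t + \<eta>) *\<^sub>R root_near_one ((1 / (t + \<eta>)) *\<^sub>R (a + \<eta> *\<^sub>R 1))"

context
  fixes a :: "'a::cstar_algebra_1" and t \<eta> :: real
  assumes a: "star a = a" "norm (t *\<^sub>R 1 - a) \<le> t" and \<eta>: "\<eta> > 0"
begin

lemma shift_near: "norm (1 - (1 / (t + \<eta>)) *\<^sub>R (a + \<eta> *\<^sub>R 1)) < 1"
proof -
  have t: "0 \<le> t" using a norm_ge_zero order_trans by blast
  have "(1::'a) = (1 / (t + \<eta>)) *\<^sub>R (t + \<eta>) *\<^sub>R 1" using t \<eta> by simp
  then have "1 - (1 / (t + \<eta>)) *\<^sub>R (a + \<eta> *\<^sub>R 1) = (1 / (t + \<eta>)) *\<^sub>R ((t + \<eta>) *\<^sub>R 1 - (a + \<eta> *\<^sub>R 1))"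
    by (metis scaleR_diff_right)
  also have "\<dots> = (1 / (t + \<eta>)) *\<^sub>R (t *\<^sub>R 1 - a)" by (simp add: algebra_simps)
  finally have "norm (1 - (1 / (t + \<eta>)) *\<^sub>R (a + \<eta> *\<^sub>R 1)) = norm (t *\<^sub>R 1 - a) / (t + \<eta>)"
    using t \<eta> by simp
  then show ?thesis using a(2) t \<eta> by simp
qed

lemma shift_root_square: "shift_root t \<eta> a * shift_root t \<eta> a = a + \<eta> *\<^sub>R 1"
proof -
  have t: "0 \<le> t" using a norm_ge_zero order_trans by blast
  show ?thesis using t \<eta> by (simp add: shift_root_def root_near_one_square[OF shift_near])
qed

lemma shift_root_star: "star (shift_root t \<eta> a) = shift_root t \<eta> a"
  by (simp add: shift_root_def star_scaleR root_near_one_star[OF shift_near] star_add a)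

lemma shift_root_intertwine:
  assumes "norm (t *\<^sub>R 1 - a') \<le> t" "w * a = a' * w"
  shows "w * shift_root t \<eta> a = shift_root t \<eta> a' * w"
proof -
  have t: "0 \<le> t" using a norm_ge_zero order_trans by blast
  have "(1::'a) = (1 / (t + \<eta>)) *\<^sub>R (t + \<eta>) *\<^sub>R 1" using t \<eta> by simp
  then have "1 - (1 / (t + \<eta>)) *\<^sub>R (a' + \<eta> *\<^sub>R 1) = (1 / (t + \<eta>)) *\<^sub>R ((t + \<eta>) *\<^sub>R 1 - (a' + \<eta> *\<^sub>R 1))"
    by (metis scaleR_diff_right)
  also have "\<dots> = (1 / (t + \<eta>)) *\<^sub>R (t *\<^sub>R 1 - a')" by (simp add: algebra_simps)
  finally have "norm (1 - (1 / (t + \<eta>)) *\<^sub>R (a' + \<eta> *\<^sub>R 1)) = norm (t *\<^sub>R 1 - a') / (t + \<eta>)"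
    using t \<eta> by simp
  then have "norm (1 - (1 / (t + \<eta>)) *\<^sub>R (a' + \<eta> *\<^sub>R 1)) < 1" using assms t \<eta> by simp
  from root_near_one_intertwine[OF shift_near this, of w] assms(2)
  show ?thesis by (simp add: shift_root_def distrib_left distrib_right)
qed

lemma shift_root_near: "norm (sqrt (t + \<eta>) *\<^sub>R 1 - shift_root t \<eta> a) \<le> sqrt (t + \<eta>)"
proof -
  have "sqrt (t + \<eta>) *\<^sub>R 1 - shift_root t \<eta> a
    = sqrt (t + \<eta>) *\<^sub>R (1 - root_near_one ((1 / (t + \<eta>)) *\<^sub>R (a + \<eta> *\<^sub>R 1)))"
    by (simp add: shift_root_def scaleR_diff_right)
  moreover have "norm (1 - root_near_one ((1 / (t + \<eta>)) *\<^sub>R (a + \<eta> *\<^sub>R 1))) \<le> 1"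
    using root_near_one_norm[OF shift_near] shift_near by simp
  moreover have t: "0 \<le> t" using a norm_ge_zero order_trans by blast
  ultimately show ?thesis using t \<eta> by (simp add: mult_left_le)
qed

end

text \<open>Any bound t may thus replace the norm of a. Since a + e/3 is the square of a selfadjoint
  element, \<open>norm_minus_square_le\<close> applies to it with the constant
  \<open>norm a + e/3\<close>.\<close>

lemma cposI:
  assumes "star a = a" "norm (t *\<^sub>R 1 - a) \<le> t"
  shows "cpos a"
proof -
  have "norm (norm a *\<^sub>R 1 - a) \<le> norm a"
  proof (rule field_le_epsilon)
    fix e :: real assume e: "0 < e"
    let ?k = "shift_root t (e/3) a"
    have k: "?k * ?k = a + (e/3) *\<^sub>R 1" "star ?k = ?k"
      using shift_root_square[OF assms, of "e/3"] shift_root_star[OF assms, of "e/3"] e by auto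
    have "(norm ?k)\<^sup>2 = norm (a + (e/3) *\<^sub>R 1)" using norm_square_selfadjoint[of ?k] k by simp
    also have "\<dots> \<le> norm a + e/3" using norm_triangle_ineq[of a "(e/3) *\<^sub>R 1"] e by simp
    finally have "norm ((norm a + e/3) *\<^sub>R 1 - ?k * ?k) \<le> norm a + e/3"
      by (rule norm_minus_square_le[OF k(2)])
    moreover have "norm a *\<^sub>R 1 - a = (norm a + e/3) *\<^sub>R 1 - ?k * ?k"
      unfolding k by (simp add: algebra_simps)
    ultimately show "norm (norm a *\<^sub>R 1 - a) \<le> norm a + e" using e by simp
  qed
  then show ?thesis using assms by (simp add: cpos_def)
qed

section \<open>Order properties of the positive cone\<close>

lemma cpos_bound: "cpos a \<Longrightarrow> norm a \<le> t \<Longrightarrow> norm (t *\<^sub>R 1 - a) \<le> t"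
proof -
  assume a: "cpos a" "norm a \<le> t"
  have "t *\<^sub>R 1 - a = (norm a *\<^sub>R 1 - a) + (t - norm a) *\<^sub>R 1" by (simp add: algebra_simps)
  then have "norm (t *\<^sub>R 1 - a) \<le> norm (norm a *\<^sub>R 1 - a) + norm ((t - norm a) *\<^sub>R (1::'a))"
    by (metis norm_triangle_ineq)
  then show ?thesis using a by (simp add: cpos_def)
qed

lemma cpos_add: "cpos a \<Longrightarrow> cpos b \<Longrightarrow> cpos (a + b)"
proof (rule cposI[where t = "norm a + norm b"])
  assume ab: "cpos a" "cpos b"
  then show "star (a + b) = a + b" by (simp add: star_add cpos_def)
  have "(norm a + norm b) *\<^sub>R 1 - (a + b) = (norm a *\<^sub>R 1 - a) + (norm b *\<^sub>R 1 - b)"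
    by (simp add: algebra_simps)
  then show "norm ((norm a + norm b) *\<^sub>R 1 - (a + b)) \<le> norm a + norm b"
    using ab norm_triangle_mono unfolding cpos_def by metis
qed

lemma cpos_scaleR: "cpos a \<Longrightarrow> 0 \<le> r \<Longrightarrow> cpos (r *\<^sub>R a)"
proof (rule cposI[where t = "r * norm a"])
  assume a: "cpos a" "0 \<le> r"
  then show "star (r *\<^sub>R a) = r *\<^sub>R a" by (simp add: star_scaleR cpos_def)
  have "norm ((r * norm a) *\<^sub>R 1 - r *\<^sub>R a) = r * norm (norm a *\<^sub>R 1 - a)"
    using a by (metis abs_of_nonneg norm_scaleR scaleR_diff_right scaleR_scaleR)
  then show "norm ((r * norm a) *\<^sub>R 1 - r *\<^sub>R a) \<le> r * norm a"
    using a by (simp add: cpos_def mult_left_mono)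
qed

lemma cpos_0 [simp]: "cpos 0" and cpos_1 [simp]: "cpos 1"
  by (simp_all add: cpos_def)

lemma cpos_limit:
  assumes "\<And>n. cpos (f n)" "f \<longlonglongrightarrow> (a::'a::cstar_algebra_1)"
  shows "cpos a"
proof -
  have "(\<lambda>n. star (f n)) \<longlonglongrightarrow> star a" by (intro tendsto_intros assms)
  then have "f \<longlonglongrightarrow> star a" using assms(1) by (simp add: cpos_star)
  then have "star a = a" using assms(2) LIMSEQ_unique by blast
  moreover have "norm (norm a *\<^sub>R 1 - a) \<le> norm a"
  proof (rule LIMSEQ_le)
    show "(\<lambda>n. norm (norm (f n) *\<^sub>R 1 - f n)) \<longlonglongrightarrow> norm (norm a *\<^sub>R 1 - a)"
      "(\<lambda>n. norm (f n)) \<longlonglongrightarrow> norm a"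
      by (intro tendsto_intros assms)+
  qed (use assms in \<open>auto simp: cpos_def\<close>)
  ultimately show ?thesis by (simp add: cpos_def)
qed

text \<open>The shift by e keeps the rescaled element at distance less than 1 from 1. The order
  properties are derived from these approximate roots; exact roots come later as limits.\<close>

lemma cpos_root_eps:
  assumes "cpos a" "e > 0"
  obtains k where "star k = k" "k * k = a + e *\<^sub>R 1" "\<And>w. w * a = a * w \<Longrightarrow> w * k = k * w"
proof -
  have a: "star a = a" "norm (norm a *\<^sub>R 1 - a) \<le> norm a" using assms by (auto simp: cpos_def)
  show ?thesis
    by (rule that[OF shift_root_star[OF a assms(2)] shift_root_square[OF a assms(2)]
        shift_root_intertwine[OF a assms(2) a(2)]])
qed

text \<open>Commuting roots k and l of a + e/3 and - a + e/3 satisfy k^2 + l^2 = 2e/3, hence a + e/3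
  = k^2 has norm at most 2e/3.\<close>

lemma cpos_antisym:
  assumes "cpos a" "cpos (- a)"
  shows "a = 0"
proof -
  have "norm a \<le> e" if e: "e > 0" for e
  proof -
    have e3: "0 < e/3" using e by simp
    obtain k where k: "star k = k" "k * k = a + (e/3) *\<^sub>R 1" "\<And>w. w * a = a * w \<Longrightarrow> w * k = k * w"
      by (rule cpos_root_eps[OF assms(1) e3]) blast
    obtain l where l: "star l = l" "l * l = - a + (e/3) *\<^sub>R 1" "\<And>w. w * - a = - a * w \<Longrightarrow> w * l = l * w"
      by (rule cpos_root_eps[OF assms(2) e3]) blast
    have "k * a = a * k" using k(3)[of a] by simp
    then have "k * l = l * k" using l(3)[of k] by simp
    then have "(norm k)\<^sup>2 \<le> 2 * (e/3)"
      by (rule norm_le_of_squares[OF k(1) l(1)]) (use e in \<open>simp_all add: k(2) l(2) flip: scaleR_add_left\<close>)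
    then have "norm (a + (e/3) *\<^sub>R 1) \<le> 2 * (e/3)" using norm_square_selfadjoint[OF k(1)] k(2) by simp
    moreover have "norm a \<le> norm (a + (e/3) *\<^sub>R 1) + norm ((e/3) *\<^sub>R (1::'a))"
      by (metis add_diff_cancel_right' norm_triangle_ineq4)
    ultimately show ?thesis using e by simp
  qed
  then have "norm a \<le> 0" using field_le_epsilon[of "norm a" 0] by simp
  then show ?thesis by simp
qed

text \<open>For commuting roots k and l of the shifted elements, k l is selfadjoint and its square
  is the product of these elements; then the shifts tend to 0.\<close>

lemma cpos_mult:
  assumes "cpos x" "cpos y" "x * y = y * x"
  shows "cpos (x * y)"
proof (rule cpos_limit)
  fix n :: nat
  let ?e = "inverse (real (Suc n))"
  have e3: "0 < ?e" by simp
  obtain k where k: "star k = k" "k * k = x + ?e *\<^sub>R 1" "\<And>w. w * x = x * w \<Longrightarrow> w * k = k * w"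
    by (rule cpos_root_eps[OF assms(1) e3]) blast
  obtain l where l: "star l = l" "l * l = y + ?e *\<^sub>R 1" "\<And>w. w * y = y * w \<Longrightarrow> w * l = l * w"
    by (rule cpos_root_eps[OF assms(2) e3]) blast
  have "y * k = k * y" using k(3)[of y] assms by simp
  then have "k * l = l * k" using l(3)[of k] by simp
  note kl = this
  then have "star (k * l) = k * l" using k(1) l(1) by (simp add: star_mult)
  then have "cpos ((k * l) * (k * l))" by (rule cpos_square)
  also have "(k * l) * (k * l) = k * (l * k) * l" by (simp add: mult.assoc)
  also have "\<dots> = (k * k) * (l * l)" by (simp only: kl[symmetric] mult.assoc)
  finally show "cpos ((x + ?e *\<^sub>R 1) * (y + ?e *\<^sub>R 1))"
    unfolding k(2) l(2) .
next
  have "(\<lambda>n. (x + inverse (real (Suc n)) *\<^sub>R 1) * (y + inverse (real (Suc n)) *\<^sub>R 1)) \<longlonglongrightarrow> (x + 0 *\<^sub>R 1) * (y + 0 *\<^sub>R 1)"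
    by (intro tendsto_intros LIMSEQ_inverse_real_of_nat)
  then show "(\<lambda>n. (x + inverse (real (Suc n)) *\<^sub>R 1) * (y + inverse (real (Suc n)) *\<^sub>R 1)) \<longlonglongrightarrow> x * y" by simp
qed

lemma cpos_norm_minus: "star a = a \<Longrightarrow> cpos (norm a *\<^sub>R 1 - a)"
  by (rule cposI[where t = "norm a"]) (simp_all add: star_diff star_scaleR)

lemma cpos_norm_le:
  assumes "cpos a" "cpos (b - a)"
  shows "norm a \<le> norm b"
proof -
  have "star (a + (b - a)) = a + (b - a)" by (intro cpos_star cpos_add assms)
  then have b: "star b = b" by simp
  \<comment> \<open>Comparison with a scalar suffices, because b is below its norm.\<close>
  have main: "norm a \<le> t" if a: "cpos a" "cpos (t *\<^sub>R 1 - a)" for t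
  proof (rule field_le_epsilon)
    fix e :: real assume e: "0 < e"
    let ?e = "e / 3"
    have e3: "0 < ?e" using e by simp
    obtain k where k: "star k = k" "k * k = a + ?e *\<^sub>R 1" "\<And>w. w * a = a * w \<Longrightarrow> w * k = k * w"
      by (rule cpos_root_eps[OF a(1) e3]) blast
    obtain l where l: "star l = l" "l * l = t *\<^sub>R 1 - a + ?e *\<^sub>R 1"
      "\<And>w. w * (t *\<^sub>R 1 - a) = (t *\<^sub>R 1 - a) * w \<Longrightarrow> w * l = l * w"
      by (rule cpos_root_eps[OF a(2) e3]) blast
    have "k * a = a * k" using k(3)[of a] by simp
    then have "k * l = l * k" using l(3)[of k] by (simp add: algebra_simps)
    have sum: "k * k + l * l = (t + 2 * ?e) *\<^sub>R 1" by (simp add: k(2) l(2) flip: scaleR_add_left)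
    \<comment> \<open>The sign of t is not given. A sum of two squares that is a negative scalar
      would contradict \<open>cpos_antisym\<close>.\<close>
    have "0 \<le> t + 2 * ?e"
    proof (rule ccontr)
      assume neg: "\<not> ?thesis"
      have "- (k * k + l * l) = (- (t + 2 * ?e)) *\<^sub>R 1"
        unfolding sum by (rule scaleR_minus_left[symmetric])
      then have "cpos (- (k * k + l * l))" using neg cpos_scaleR[OF cpos_1, of "- (t + 2 * ?e)"] by simp
      moreover have "cpos (k * k + l * l)" by (intro cpos_add cpos_square k(1) l(1))
      ultimately have "k * k + l * l = 0" by (intro cpos_antisym)
      then show False using sum neg by simp
    qed
    then have "(norm k)\<^sup>2 \<le> t + 2 * ?e"
      by (rule norm_le_of_squares[OF k(1) l(1) \<open>k * l = l * k\<close> sum])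
    then have "norm (a + ?e *\<^sub>R 1) \<le> t + 2 * ?e" using norm_square_selfadjoint[OF k(1)] k(2) by simp
    moreover have "norm a \<le> norm (a + ?e *\<^sub>R 1) + norm (?e *\<^sub>R (1::'a))"
      by (metis add_diff_cancel_right' norm_triangle_ineq4)
    ultimately show "norm a \<le> t + e" using e by simp
  qed
  have "norm b *\<^sub>R 1 - a = (norm b *\<^sub>R 1 - b) + (b - a)" by simp
  then show ?thesis using main[OF assms(1)] cpos_add[OF cpos_norm_minus[OF b] assms(2)] by metis
qed

lemma cpos_add_eq_0:
  assumes "cpos a" "cpos b" "a + b = 0"
  shows "a = 0" "b = 0"
proof -
  have "a = - b" using assms(3) by (simp add: eq_neg_iff_add_eq_0)
  then show "b = 0" using assms cpos_antisym by simp
  then show "a = 0" using assms by simp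
qed

lemma selfadjoint_nilpotent:
  fixes d :: "'a::cstar_algebra"
  assumes "star d = d"
  shows "d * d = 0 \<Longrightarrow> d = 0" "d * d * d = 0 \<Longrightarrow> d = 0"
proof -
  show 2: "d * d = 0 \<Longrightarrow> d = 0" using star_mult_eq_0_iff[of d] assms by simp
  assume "d * d * d = 0"
  then have "star (d * d) * (d * d) = 0" using assms by (simp add: star_mult flip: mult.assoc)
  then show "d = 0" using star_mult_eq_0_iff[of "d * d"] 2 by simp
qed

text \<open>With d = v - w the positive elements v d^2 and w d^2 add up to (v^2 - w^2) d = 0, so
  both vanish and d^3 = 0.\<close>

lemma cpos_root_unique:
  assumes "cpos v" "cpos w" "v * w = w * v" "v * v = w * w"
  shows "v = w"
proof -
  let ?d = "v - w"
  have sd: "star ?d = ?d" using assms by (simp add: star_diff cpos_star)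
  have "v * ?d = ?d * v" "w * ?d = ?d * w" using assms(3) by (simp_all add: algebra_simps)
  then have "cpos (v * (?d * ?d))" "cpos (w * (?d * ?d))"
    using assms(1,2) sd by (auto intro!: cpos_mult cpos_square) (metis mult.assoc)+
  moreover have "v * (?d * ?d) + w * (?d * ?d) = (v + w) * ?d * ?d" by (simp add: distrib_right mult.assoc)
  moreover have "(v + w) * ?d = 0" using assms(3,4) by (simp add: algebra_simps)
  ultimately have "v * (?d * ?d) = 0" "w * (?d * ?d) = 0" using cpos_add_eq_0 by (metis mult_zero_left)+
  then have "?d * ?d * ?d = 0"
    using left_diff_distrib[of v w "?d * ?d"] by (simp only: mult.assoc) simp
  then show ?thesis using selfadjoint_nilpotent(2)[OF sd] by simp
qed

section \<open>Exact square roots and absolute values\<close>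

definition csqrt :: "'a::cstar_algebra_1 \<Rightarrow> 'a"
  where "csqrt a = lim (\<lambda>n. shift_root (norm a) (inverse (real (Suc n))) a)"

text \<open>With \<open>R\<close>, \<open>S\<close> the two roots and \<open>T = R - S\<close>, one has
  \<open>T\<^sup>4 + 4 R S T\<^sup>2 = ((R + S) T)\<^sup>2 = (\<epsilon> - \<delta>)\<^sup>2\<close> with both summands positive.\<close>

lemma shift_root_diff:
  assumes a: "star a = a" "norm (t *\<^sub>R 1 - a) \<le> t" and pos: "\<epsilon> > 0" "\<delta> > 0"
  shows "(norm (shift_root t \<epsilon> a - shift_root t \<delta> a))\<^sup>2 \<le> \<bar>\<epsilon> - \<delta>\<bar>"
proof -
  let ?R = "shift_root t \<epsilon> a" and ?S = "shift_root t \<delta> a"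
  let ?T = "?R - ?S"
  have cp: "cpos ?R" "cpos ?S"
    using cposI[OF shift_root_star[OF a] shift_root_near[OF a]] pos by auto
  have "a * ?R = ?R * a" using shift_root_intertwine[OF a pos(1) a(2)] by simp
  then have comm: "?R * ?S = ?S * ?R" using shift_root_intertwine[OF a pos(2) a(2), of ?R] by simp
  have sT: "star ?T = ?T" using cp by (simp add: star_diff cpos_star)
  have commT: "?R * ?T = ?T * ?R" "?S * ?T = ?T * ?S" using comm by (simp_all add: algebra_simps)
  have RS: "cpos (?R * ?S)" using cp comm by (rule cpos_mult)
  have "(?R * ?S) * (?T * ?T) = (?T * ?T) * (?R * ?S)" by (metis commT mult.assoc)
  then have "cpos ((?R * ?S) * (?T * ?T))" by (intro cpos_mult RS cpos_square sT)
  then have 1: "cpos (4 *\<^sub>R ((?R * ?S) * (?T * ?T)))" by (rule cpos_scaleR) simp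
  have prod: "(?R + ?S) * ?T = (\<epsilon> - \<delta>) *\<^sub>R 1"
  proof -
    have "(?R + ?S) * ?T = ?R * ?R - ?S * ?S" using comm by (simp add: algebra_simps)
    also have "\<dots> = (\<epsilon> - \<delta>) *\<^sub>R 1"
      using shift_root_square[OF a pos(1)] shift_root_square[OF a pos(2)] by (simp add: scaleR_left_diff_distrib)
    finally show ?thesis .
  qed
  have "(?T * ?T) + 4 *\<^sub>R (?R * ?S) = (?R + ?S) * (?R + ?S)"
  proof -
    have "4 *\<^sub>R (?R * ?S) = ?R * ?S + ?R * ?S + ?R * ?S + ?R * ?S"
      using scaleR_add_left[of 1 1 "?R * ?S"] scaleR_add_left[of 2 2 "?R * ?S"] by simp
    then show ?thesis using comm by (simp add: algebra_simps)
  qed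
  then have "(?T * ?T) * (?T * ?T) + 4 *\<^sub>R ((?R * ?S) * (?T * ?T)) = (?R + ?S) * (?R + ?S) * (?T * ?T)"
    by (metis distrib_right mult_scaleR_left)
  also have "\<dots> = (?R + ?S) * ((?R + ?S) * ?T) * ?T" by (simp only: mult.assoc)
  also have "\<dots> = (\<epsilon> - \<delta>) *\<^sub>R ((?R + ?S) * ?T)" by (subst prod) simp
  also have "\<dots> = (\<epsilon> - \<delta>)\<^sup>2 *\<^sub>R 1" unfolding prod by (simp add: power2_eq_square)
  finally have "(\<epsilon> - \<delta>)\<^sup>2 *\<^sub>R 1 - (?T * ?T) * (?T * ?T) = 4 *\<^sub>R ((?R * ?S) * (?T * ?T))"
    by (metis add_diff_cancel_left')
  with 1 have "norm ((?T * ?T) * (?T * ?T)) \<le> norm ((\<epsilon> - \<delta>)\<^sup>2 *\<^sub>R (1::'a))"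
    by (intro cpos_norm_le cpos_square) (auto simp: star_mult sT)
  then have "((norm ?T)\<^sup>2)\<^sup>2 \<le> \<bar>\<epsilon> - \<delta>\<bar>\<^sup>2"
    using sT norm_square_selfadjoint[of ?T] norm_square_selfadjoint[of "?T * ?T"] by (simp add: star_mult)
  then show ?thesis by (rule power2_le_imp_le) simp
qed

context
  fixes a :: "'a::cstar_algebra_1"
  assumes cpa: "cpos a"
begin

lemma csqrt_tendsto: "(\<lambda>n. shift_root (norm a) (inverse (real (Suc n))) a) \<longlonglongrightarrow> csqrt a"
proof -
  have a: "star a = a" "norm (norm a *\<^sub>R 1 - a) \<le> norm a" using cpa by (auto simp: cpos_def)
  have "Cauchy (\<lambda>n. shift_root (norm a) (inverse (real (Suc n))) a)"
  proof (rule CauchyI)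
    fix e :: real assume e: "0 < e"
    then obtain N where N: "inverse (real (Suc N)) < e\<^sup>2" using reals_Archimedean[of "e\<^sup>2"] by auto
    have "norm (shift_root (norm a) (inverse (real (Suc m))) a - shift_root (norm a) (inverse (real (Suc n))) a) < e"
      if "m \<ge> N" "n \<ge> N" for m n
    proof -
      have "inverse (real (Suc m)) \<le> inverse (real (Suc N))" "inverse (real (Suc n)) \<le> inverse (real (Suc N))"
        using that by (auto intro!: le_imp_inverse_le)
      moreover have "0 < inverse (real (Suc m))" "0 < inverse (real (Suc n))" by simp_all
      ultimately have "\<bar>inverse (real (Suc m)) - inverse (real (Suc n))\<bar> < e\<^sup>2" using N by linarith
      then have "(norm (shift_root (norm a) (inverse (real (Suc m))) a - shift_root (norm a) (inverse (real (Suc n))) a))\<^sup>2 < e\<^sup>2"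
        by (intro le_less_trans[OF shift_root_diff[OF a]]) simp_all
      then show ?thesis using e power2_less_imp_less by fastforce
    qed
    then show "\<exists>M. \<forall>m\<ge>M. \<forall>n\<ge>M. norm (shift_root (norm a) (inverse (real (Suc m))) a
       - shift_root (norm a) (inverse (real (Suc n))) a) < e" by blast
  qed
  then show ?thesis unfolding csqrt_def by (simp add: Cauchy_convergent_iff convergent_LIMSEQ_iff)
qed

lemma csqrt_cpos: "cpos (csqrt a)"
proof (rule cpos_limit[OF _ csqrt_tendsto])
  have a: "star a = a" "norm (norm a *\<^sub>R 1 - a) \<le> norm a" using cpa by (auto simp: cpos_def)
  show "cpos (shift_root (norm a) (inverse (real (Suc n))) a)" for n
    by (rule cposI[OF shift_root_star[OF a] shift_root_near[OF a]]) simp_all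
qed

lemma csqrt_square: "csqrt a * csqrt a = a"
proof -
  have a: "star a = a" "norm (norm a *\<^sub>R 1 - a) \<le> norm a" using cpa by (auto simp: cpos_def)
  let ?f = "\<lambda>n. shift_root (norm a) (inverse (real (Suc n))) a"
  have "(\<lambda>n. ?f n * ?f n) \<longlonglongrightarrow> csqrt a * csqrt a" by (intro tendsto_intros csqrt_tendsto)
  moreover have "(\<lambda>n. ?f n * ?f n) = (\<lambda>n. a + inverse (real (Suc n)) *\<^sub>R 1)"
    using shift_root_square[OF a] by simp
  moreover have "(\<lambda>n. a + inverse (real (Suc n)) *\<^sub>R 1) \<longlonglongrightarrow> a + 0 *\<^sub>R 1"
    by (intro tendsto_intros LIMSEQ_inverse_real_of_nat)
  ultimately show ?thesis using LIMSEQ_unique by fastforce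
qed

end

text \<open>The approximating roots are rescaled by the norm of the element, so equality of the two
  norms makes the approximations intertwine term by term.\<close>

lemma csqrt_intertwine:
  assumes "cpos a" "cpos a'" "norm a' = norm a" "w * a = a' * w"
  shows "w * csqrt a = csqrt a' * w"
proof -
  have a: "star a = a" "norm (norm a *\<^sub>R 1 - a) \<le> norm a" using assms(1) by (auto simp: cpos_def)
  have a': "norm (norm a *\<^sub>R 1 - a') \<le> norm a" using assms(2,3) by (auto simp: cpos_def)
  let ?f = "\<lambda>n. shift_root (norm a) (inverse (real (Suc n))) a"
  let ?g = "\<lambda>n. shift_root (norm a) (inverse (real (Suc n))) a'"
  have "(\<lambda>n. w * ?f n) \<longlonglongrightarrow> w * csqrt a"
    by (intro tendsto_intros csqrt_tendsto assms(1))
  moreover have "(\<lambda>n. w * ?f n) = (\<lambda>n. ?g n * w)"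
    using shift_root_intertwine[OF a _ a' assms(4)] by simp
  moreover have "(\<lambda>n. ?g n * w) \<longlonglongrightarrow> csqrt a' * w"
    using csqrt_tendsto[OF assms(2)] assms(3) by (intro tendsto_intros) simp
  ultimately show ?thesis using LIMSEQ_unique by metis
qed

lemma csqrt_commute: "cpos a \<Longrightarrow> w * a = a * w \<Longrightarrow> w * csqrt a = csqrt a * w"
  by (rule csqrt_intertwine) simp_all

definition cabs :: "'a::cstar_algebra_1 \<Rightarrow> 'a"
  where "cabs x = csqrt (x * x)"

lemma cabs:
  assumes "star x = x"
  shows "cpos (cabs x)" "cabs x * cabs x = x * x" "w * x = x * w \<Longrightarrow> w * cabs x = cabs x * w"
proof -
  have "cpos (x * x)" by (rule cpos_square[OF assms])
  then show "cpos (cabs x)" "cabs x * cabs x = x * x"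
    by (auto simp: cabs_def csqrt_cpos csqrt_square)
  assume "w * x = x * w"
  then have "w * (x * x) = (x * x) * w" by (metis mult.assoc)
  then show "w * cabs x = cabs x * w" unfolding cabs_def by (rule csqrt_commute[OF \<open>cpos (x * x)\<close>])
qed

lemma cabs_eq:
  assumes "cpos x"
  shows "cabs x = x"
proof -
  note c = cabs[OF cpos_star[OF assms]]
  show ?thesis by (rule cpos_root_unique[OF c(1) assms _ c(2)]) (rule sym, rule c(3), rule refl)
qed

text \<open>This takes the place of the equality of the nonzero spectra of \<open>star w * w\<close>
  and \<open>w * star w\<close>. The roots of their squares are intertwined by
  \<open>star w\<close>; as \<open>cabs (star w * w)\<close> is \<open>- (star w * w)\<close> here,
  \<open>star w\<close> annihilates \<open>cabs M + M\<close> for \<open>M = w * star w\<close>, and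
  so the latter squares to 0.\<close>

lemma cpos_minus_swap:
  assumes "cpos (- (star w * w))"
  shows "cpos (- (w * star w))"
proof -
  let ?M = "w * star w" and ?M' = "star w * w"
  have sM: "star ?M = ?M" and sM': "star ?M' = ?M'" by (simp_all add: star_mult star_star)
  have "star w * (?M * ?M) = (?M' * ?M') * star w" by (simp only: mult.assoc)
  moreover have "norm (?M' * ?M') = norm (?M * ?M)"
    using sM sM' by (simp add: norm_square_selfadjoint cstar_identity cstar_identity')
  ultimately have "star w * cabs ?M = cabs ?M' * star w"
    unfolding cabs_def by (intro csqrt_intertwine cpos_square sM sM')
  moreover have "cabs ?M' = - ?M'"
    using cabs_eq[OF assms] by (simp add: cabs_def)
  ultimately have "star w * (cabs ?M + ?M) = 0" by (simp add: distrib_left mult.assoc)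
  then have 1: "?M * (cabs ?M + ?M) = 0" by (metis mult.assoc mult_zero_right)
  have comm: "?M * cabs ?M = cabs ?M * ?M" using cabs(3)[OF sM, of ?M] by simp
  then have "cabs ?M * (cabs ?M + ?M) = 0" using 1 cabs(2)[OF sM] by (simp add: distrib_left add.commute)
  then have "(cabs ?M + ?M) * (cabs ?M + ?M) = 0" using 1 by (simp add: distrib_right)
  moreover have "star (cabs ?M + ?M) = cabs ?M + ?M"
    using cpos_star[OF cabs(1)[OF sM]] sM by (simp add: star_add)
  ultimately have "cabs ?M + ?M = 0" by (rule selfadjoint_nilpotent(1)[rotated])
  then have "- ?M = cabs ?M" by (intro minus_unique) (simp add: add.commute)
  then show ?thesis using cabs(1)[OF sM] by metis
qed

text \<open>The argument of Kelley and Vaught: for \<open>m = \<bar>h\<bar> - h\<close> and \<open>w = b m\<close>, both \<open>w\<^sup>* w\<close> and \<open>w w\<^sup>*\<close>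
  are negative, while their sum is positive.\<close>

theorem cpos_star_mult: "cpos (star b * b)"
proof -
  define h where "h = star b * b"
  have sh: "star h = h" by (simp add: h_def star_mult star_star)
  let ?a = "cabs h"
  define m where "m = ?a - h"
  have a: "cpos ?a" "?a * ?a = h * h" "h * ?a = ?a * h" using cabs(1,2)[OF sh] cabs(3)[OF sh, of h] by auto
  have sm: "star m = m" using a(1) sh by (simp add: m_def star_diff cpos_star)
  have hm: "h * m = - (?a * m)" by (simp add: m_def a right_diff_distrib)
  have mm: "m * m = 2 *\<^sub>R (?a * m)"
    by (simp add: m_def a algebra_simps scaleR_2)
  have am: "?a * m = m * ?a" by (simp add: m_def algebra_simps a)
  let ?w = "b * m"
  have "star ?w * ?w = m * (h * m)" by (simp add: star_mult sm h_def mult.assoc)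
  then have "- (star ?w * ?w) = m * (?a * m)" using hm by simp
  also have "\<dots> = ?a * (m * m)" by (metis am mult.assoc)
  finally have ww: "- (star ?w * ?w) = ?a * (m * m)" .
  have "?a * (m * m) = (m * m) * ?a" by (metis am mult.assoc)
  then have c1: "cpos (- (star ?w * ?w))" unfolding ww by (intro cpos_mult a cpos_square sm)
  have c2: "cpos (- (?w * star ?w))" using c1 by (rule cpos_minus_swap)
  \<comment> \<open>Up to real factors, the real and imaginary parts of w; their squares add up to
    twice the sum of \<open>star w * w\<close> and \<open>w * star w\<close>.\<close>
  define p q where "p = ?w + star ?w" and "q = \<i> *\<^sub>C (?w - star ?w)"
  have "star p = p" "star q = q"
    by (simp_all add: p_def q_def star_add star_star star_scaleC star_diff scaleC_minus_left scaleC_diff_right add.commute)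
  then have "cpos (p * p + q * q)" by (intro cpos_add cpos_square)
  moreover have "p * p + q * q = 2 *\<^sub>R (star ?w * ?w + ?w * star ?w)"
    by (simp add: p_def q_def scaleC_mult_left scaleC_mult_right scaleC_scaleC scaleC_minus_one
        algebra_simps scaleR_2)
  ultimately have "cpos ((1/2) *\<^sub>R (2 *\<^sub>R (star ?w * ?w + ?w * star ?w)))" by (rule_tac cpos_scaleR) simp_all
  then have "cpos (star ?w * ?w + ?w * star ?w)" by simp
  from cpos_add[OF this c2] have "cpos (star ?w * ?w)" by simp
  then have "star ?w * ?w = 0" using c1 cpos_antisym by blast
  then have "?a * (m * m) = 0" using ww by simp
  moreover have "m * m * m = 2 *\<^sub>R (?a * (m * m))"
    by (subst mm) (simp only: mult_scaleR_left mult.assoc)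
  ultimately have "m * m * m = 0" by simp
  then have "m = 0" by (rule selfadjoint_nilpotent(2)[OF sm])
  then show ?thesis using a(1) by (simp add: m_def h_def)
qed

lemma cpos_iff: "cpos a \<longleftrightarrow> (\<exists>b. a = star b * b)"
  by (metis cpos_star cpos_star_mult csqrt_cpos csqrt_square)

section \<open>Domination by elements of an ideal\<close>

lemma cpos_conj: "cpos a \<Longrightarrow> cpos (star b * a * b)"
proof -
  assume "cpos a"
  then obtain c where "a = star c * c" using cpos_iff by blast
  then have "star b * a * b = star (c * b) * (c * b)" by (simp add: star_mult mult.assoc)
  then show ?thesis by (simp add: cpos_star_mult)
qed

lemma cpos_norm_sq_minus: "cpos ((norm b)\<^sup>2 *\<^sub>R 1 - star b * b)"
  using cpos_norm_minus[OF cpos_star[OF cpos_star_mult[of b]]] by (simp add: cstar_identity)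

text \<open>For numbers s in [0, 1] one has n s (1 - s)^n \<le> 1 - (1 - s)^n. In the algebra this
  is proved by induction: the step from n to n + 1 adds the positive element (n + 1) j^2 (1 - j)^n.
  It measures how fast powers of 1 - j annihilate j.\<close>

lemma cpos_decay:
  assumes j: "cpos j" "norm j \<le> 1"
  shows "norm (1 - j) \<le> 1" "cpos ((1 - j) ^ n)" "j * (1 - j) ^ n = (1 - j) ^ n * j"
    "real n * norm (j * (1 - j) ^ n) \<le> 1"
proof -
  show n1: "norm (1 - j) \<le> 1" using cpos_bound[OF j] by simp
  have q: "cpos (1 - j)"
    by (rule cposI[where t = 1]) (use j in \<open>auto simp: star_diff cpos_star\<close>)
  show comm: "j * (1 - j) ^ n = (1 - j) ^ n * j" for n
    by (rule power_commuting_commutes[symmetric]) (simp add: algebra_simps)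
  show qn: "cpos ((1 - j) ^ n)" for n
  proof (induction n)
    case (Suc n) then show ?case by (auto intro!: cpos_mult q simp: power_commutes)
  qed simp
  have "cpos (1 - (1 - j) ^ n - real n *\<^sub>R (j * (1 - j) ^ n))" for n
  proof (induction n)
    case (Suc n)
    have "cpos (real (Suc n) *\<^sub>R ((j * j) * (1 - j) ^ n))"
      by (intro cpos_scaleR cpos_mult cpos_square qn cpos_star j) (simp_all, metis comm mult.assoc)
    from cpos_add[OF Suc this] show ?case
      by (simp add: algebra_simps scaleR_left_distrib)
  qed simp
  from cpos_add[OF this[of n] qn[of n]] have "cpos (1 - real n *\<^sub>R (j * (1 - j) ^ n))" by simp
  then have "norm (real n *\<^sub>R (j * (1 - j) ^ n)) \<le> norm (1::'a)"
    by (intro cpos_norm_le cpos_scaleR cpos_mult j qn comm) simp_all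
  then show "real n * norm (j * (1 - j) ^ n) \<le> 1" by simp
qed

text \<open>The arithmetic-geometric mean inequality \<open>j \<le> t + j\<^sup>2 / 4t\<close> makes the elements \<open>j\<close> positive
  at the cost of doubling \<open>t\<close>.\<close>

lemma ideal_mem_if_dominated:
  fixes J :: "'a::cstar_algebra_1 set"
  assumes J: "cstar_ideal J" and dom: "\<And>t. t > 0 \<Longrightarrow> \<exists>j\<in>J. cpos (t *\<^sub>R 1 + j - star x * x)"
  shows "x \<in> J"
proof -
  have "\<exists>y\<in>J. dist y x < e" if e: "e > 0" for e
  proof -
    let ?t = "e\<^sup>2 / 8"
    have t: "?t > 0" using e by simp
    obtain j where j: "j \<in> J" "cpos (?t *\<^sub>R 1 + j - star x * x)" using dom[OF t] by blast
    have "star (?t *\<^sub>R 1 + j - star x * x) = ?t *\<^sub>R 1 + j - star x * x" using j(2) by (rule cpos_star)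
    then have sj: "star j = j" by (simp add: star_diff star_add star_scaleR star_mult star_star)
    define m where "m = (1 / (4 * ?t)) *\<^sub>R (j * j)"
    have m: "m \<in> J" "cpos m"
      using J j(1) sj t unfolding m_def
      by (auto intro!: cpos_scaleR cpos_square csubspaceD(4) cstar_idealD)
    define s u where "s = sqrt ?t" and "u = 1 / (2 * s)"
    define r where "r = s *\<^sub>R 1 - u *\<^sub>R j"
    have su: "s * s = ?t" "s > 0" using e by (simp_all add: s_def)
    then have "s * u + u * s = 1" "u * u = 1 / (4 * ?t)" by (simp_all add: u_def flip: su(1))
    moreover have "r * r = (s * s) *\<^sub>R 1 - (s * u + u * s) *\<^sub>R j + (u * u) *\<^sub>R (j * j)"
      unfolding scaleR_left_distrib by (simp add: r_def left_diff_distrib right_diff_distrib scaleR_diff_right mult.commute)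
    ultimately have "r * r = ?t *\<^sub>R 1 - j + m" using su by (simp add: m_def)
    then have "cpos (?t *\<^sub>R 1 - j + m)"
      using cpos_square[of r] sj by (simp add: r_def star_diff star_scaleR)
    from cpos_add[OF this j(2)] have dom2: "cpos ((2 * ?t) *\<^sub>R 1 + m - star x * x)"
      by (simp add: algebra_simps flip: scaleR_add_left)
    define N where "N = norm m + 1"
    have N: "N > 0" by (simp add: N_def add_nonneg_pos)
    define k where "k = (1 / N) *\<^sub>R m"
    have k: "k \<in> J" "cpos k" "norm k \<le> 1" and mk: "m = N *\<^sub>R k"
      using J m N by (auto simp: k_def N_def intro!: cpos_scaleR csubspaceD(4) cstar_idealD)
    obtain n where n: "N / ?t < real n" using reals_Archimedean2 by blast
    then have n0: "0 < real n" using N t by (meson divide_pos_pos less_trans)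
    \<comment> \<open>Since 1 - q lies in J, x - x q approximates x from within J. The error x q is
      small: conjugating the domination by q leaves at most 2t plus N times the norm of q k q, which
      is at most 1/n.\<close>
    let ?q = "(1 - k) ^ n"
    have sq: "star ?q = ?q" by (rule cpos_star) (rule cpos_decay(2)[OF k(2,3)])
    have nq: "norm ?q \<le> 1"
      using norm_power_ineq[of "1 - k" n] power_le_one[OF _ cpos_decay(1)[OF k(2,3)], of n] by force
    have "cpos (star ?q * ((2 * ?t) *\<^sub>R 1 + m - star x * x) * ?q)" by (rule cpos_conj[OF dom2])
    then have "cpos (?q * ((2 * ?t) *\<^sub>R 1 + m) * ?q - star (x * ?q) * (x * ?q))"
      by (simp add: sq star_mult algebra_simps)
    then have "(norm (x * ?q))\<^sup>2 \<le> norm (?q * ((2 * ?t) *\<^sub>R 1 + m) * ?q)"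
      unfolding cstar_identity[symmetric] by (intro cpos_norm_le cpos_star_mult)
    also have "?q * ((2 * ?t) *\<^sub>R 1 + m) * ?q = (2 * ?t) *\<^sub>R (?q * ?q) + N *\<^sub>R (?q * (k * ?q))"
      by (simp add: mk algebra_simps)
    also have "norm \<dots> \<le> 2 * ?t * 1 + N * (1 * (1 / real n))"
    proof (intro norm_triangle_le add_mono)
      have "norm (?q * ?q) \<le> 1 * 1" by (rule order_trans[OF norm_mult_ineq]) (intro mult_mono nq; simp)
      then show "norm ((2 * ?t) *\<^sub>R (?q * ?q)) \<le> 2 * ?t * 1" using t by simp
      have "norm (k * ?q) \<le> 1 / real n"
        using cpos_decay(4)[OF k(2,3), of n] n0 by (simp add: field_simps)
      then have "norm ?q * norm (k * ?q) \<le> 1 * (1 / real n)" using nq by (intro mult_mono) auto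
      then have "norm (?q * (k * ?q)) \<le> 1 * (1 / real n)" by (rule order_trans[OF norm_mult_ineq])
      then have "N * norm (?q * (k * ?q)) \<le> N * (1 * (1 / real n))"
        using N by (intro mult_left_mono) auto
      then show "norm (N *\<^sub>R (?q * (k * ?q))) \<le> N * (1 * (1 / real n))"
        using N by simp
    qed
    also have "\<dots> < 3 * ?t" using n t n0 by (simp add: field_simps)
    also have "\<dots> < e\<^sup>2" using e by simp
    finally have "norm (x * ?q) < e" using e power2_less_imp_less by fastforce
    moreover have "x - x * ?q \<in> J"
    proof -
      have "1 - (1 - k) ^ i \<in> J" for i
      proof (induction i)
        case 0 then show ?case using J by (simp add: csubspaceD(1) cstar_idealD)
      next
        case (Suc i)
        have "1 - (1 - k) ^ Suc i = (1 - (1 - k) ^ i) + k * (1 - k) ^ i" by (simp add: algebra_simps)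
        then show ?case using Suc J k(1) by (metis cstar_idealD(1,4) csubspaceD(2))
      qed
      then have "x * (1 - ?q) \<in> J" using J cstar_idealD(3) by blast
      then show ?thesis by (simp add: right_diff_distrib)
    qed
    ultimately show ?thesis by (intro bexI[of _ "x - x * ?q"]) (simp_all add: dist_norm)
  qed
  then show ?thesis using J closure_approachable[of x J] cstar_idealD(2) closure_closed by blast
qed

text \<open>An element \<open>star x * x\<close> of J dominates itself, so domination puts x into J.
  Closure under \<open>star\<close> is not part of \<open>cstar_ideal\<close>; it follows because
  \<open>x * star x\<close>, the square belonging to \<open>star x\<close>, lies in J with
  x.\<close>

lemma ideal_star_square_1:
  fixes J :: "'a::cstar_algebra_1 set"
  assumes "cstar_ideal J"
  shows "star x * x \<in> J \<Longrightarrow> x \<in> J" "x \<in> J \<Longrightarrow> star x \<in> J"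
proof -
  show *: "star x * x \<in> J \<Longrightarrow> x \<in> J" for x
    by (rule ideal_mem_if_dominated[OF assms]) (auto intro!: bexI[of _ "star x * x"] cpos_scaleR)
  show "x \<in> J \<Longrightarrow> star x \<in> J"
    by (rule *) (simp add: star_star cstar_idealD(4)[OF assms])
qed

lemma embed_tendsto_iff: "(\<lambda>n. emb (f n)) \<longlonglongrightarrow> emb l \<longleftrightarrow> f \<longlonglongrightarrow> l"
proof -
  have "(\<lambda>n. emb (f n)) \<longlonglongrightarrow> emb l \<longleftrightarrow> (\<lambda>n. norm (emb (f n - l))) \<longlonglongrightarrow> 0"
    by (simp add: LIM_zero_iff tendsto_norm_zero_iff embed_arith(2) del: norm_embed)
  then show ?thesis by (simp add: LIM_zero_iff tendsto_norm_zero_iff)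
qed

lemma cstar_ideal_embed:
  assumes J: "cstar_ideal J"
  shows "cstar_ideal (emb ` J)"
  unfolding cstar_ideal_def
proof (intro conjI allI ballI)
  note sub = csubspaceD[OF cstar_idealD(1)[OF J]]
  show "csubspace (emb ` J)"
    by (rule csubspaceI) (auto simp: embed_arith(1,4,5)[symmetric] intro!: imageI sub)
  show "closed (emb ` J)"
    unfolding closed_sequential_limits
  proof (intro allI impI, elim conjE)
    fix f l assume f: "\<forall>n. f n \<in> emb ` J" "f \<longlonglongrightarrow> l"
    have "(\<lambda>n. cmod (scalar_part (f n - l))) \<longlonglongrightarrow> 0"
      by (rule tendsto_sandwich[OF _ _ tendsto_const tendsto_norm_zero[OF LIM_zero[OF f(2)]]])
        (simp_all add: norm_scalar_part_le always_eventually del: parts_simps)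
    moreover have "scalar_part (f n - l) = - scalar_part l" for n using f(1) by (auto simp: image_iff Ball_def) (metis embed_simps(2) diff_0)
    ultimately have "scalar_part l = 0" by (simp add: LIMSEQ_const_iff)
    then have l: "l = emb (alg_part l)" by (intro unitization_eqI) simp_all
    have "\<forall>n. \<exists>b. f n = emb b \<and> b \<in> J" using f(1) by blast
    then obtain g where "\<forall>n. f n = emb (g n) \<and> g n \<in> J" using choice[of "\<lambda>n b. f n = emb b \<and> b \<in> J"] by blast
    then have g: "f = (\<lambda>n. emb (g n))" "g n \<in> J" for n by auto
    then have "g \<longlonglongrightarrow> alg_part l" using f(2) l g(1) embed_tendsto_iff[of g "alg_part l"] by simp
    then have "alg_part l \<in> J"
      using cstar_idealD(2)[OF J] g(2) closed_sequentially by blast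
    then show "l \<in> emb ` J" using l by blast
  qed
next
  note sub = csubspaceD[OF cstar_idealD(1)[OF J]]
  fix a b assume "b \<in> emb ` J"
  then obtain c where c: "b = emb c" "c \<in> J" by blast
  have "a * b = emb (alg_part a * c + scalar_part a *\<^sub>C c)"
    "b * a = emb (c * alg_part a + scalar_part a *\<^sub>C c)"
    by (rule unitization_eqI; simp add: c)+
  then show "a * b \<in> emb ` J" "b * a \<in> emb ` J"
    using c sub cstar_idealD(3,4)[OF J] by (auto intro!: imageI)
qed

lemma embed_mem_iff [simp]: "emb x \<in> emb ` J \<longleftrightarrow> x \<in> J"
  by (metis embed_simps(1) image_iff)

lemma ideal_star_square:
  fixes J :: "'a::cstar_algebra set"
  assumes "cstar_ideal J"
  shows "star x * x \<in> J \<Longrightarrow> x \<in> J" "x \<in> J \<Longrightarrow> star x \<in> J"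
  using ideal_star_square_1[OF cstar_ideal_embed[OF assms], of "emb x"]
  by (simp_all flip: embed_star embed_arith)

section \<open>Hilbert spaces on a carrier\<close>

definition hsub :: "'h hilbert \<Rightarrow> 'h \<Rightarrow> 'h \<Rightarrow> 'h"
  where "hsub H h k = hadd H h (hscale H (-1) k)"

definition hperp :: "'h hilbert \<Rightarrow> 'h set \<Rightarrow> 'h set"
  where "hperp H S = {h \<in> hcarrier H. \<forall>s\<in>S. hinner H s h = 0}"

lemma hdist_hsub: "hdist H h k = hnorm H (hsub H h k)"
  by (simp add: hdist_def hsub_def)

lemma hnorm_nonneg [simp]: "0 \<le> hnorm H h"
  by (simp add: hnorm_def)

lemma hdist_nonneg [simp]: "0 \<le> hdist H h k"
  by (simp add: hdist_hsub)

lemma null_seq_bound: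
  fixes f :: "nat \<Rightarrow> 'b::real_normed_vector"
  assumes "\<And>n. norm (f n) \<le> g n" "g \<longlonglongrightarrow> 0"
  shows "f \<longlonglongrightarrow> 0"
  using assms by (intro Lim_null_comparison[of f g] always_eventually) auto

context hilbert_space
begin

lemmas closed_simps [simp, intro] = zero_closed add_closed scale_closed

lemma hsub_closed [simp, intro]: "h \<in> hcarrier H \<Longrightarrow> k \<in> hcarrier H \<Longrightarrow> hsub H h k \<in> hcarrier H"
  by (simp add: hsub_def)

lemma inner_add_left:
  "\<lbrakk>h \<in> hcarrier H; k \<in> hcarrier H; l \<in> hcarrier H\<rbrakk> \<Longrightarrow> hinner H (hadd H h k) l = hinner H h l + hinner H k l"
  by (metis add_closed complex_cnj_add inner_add_right inner_commute)

lemma inner_scale_left: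
  "\<lbrakk>h \<in> hcarrier H; k \<in> hcarrier H\<rbrakk> \<Longrightarrow> hinner H (hscale H c h) k = cnj c * hinner H h k"
  by (metis complex_cnj_mult inner_commute inner_scale_right scale_closed)

lemma inner_zero_right [simp]: "h \<in> hcarrier H \<Longrightarrow> hinner H h (hzero H) = 0"
  using inner_add_right[of h "hzero H" "hzero H"] add_zero[of "hzero H"] by simp

lemma inner_zero_left [simp]: "h \<in> hcarrier H \<Longrightarrow> hinner H (hzero H) h = 0"
  using inner_commute[of h "hzero H"] by simp

lemma inner_hsub_right:
  "\<lbrakk>h \<in> hcarrier H; k \<in> hcarrier H; l \<in> hcarrier H\<rbrakk> \<Longrightarrow> hinner H l (hsub H h k) = hinner H l h - hinner H l k"
  by (simp add: hsub_def inner_add_right inner_scale_right)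

lemma inner_hsub_left:
  "\<lbrakk>h \<in> hcarrier H; k \<in> hcarrier H; l \<in> hcarrier H\<rbrakk> \<Longrightarrow> hinner H (hsub H h k) l = hinner H h l - hinner H k l"
  by (simp add: hsub_def inner_add_left inner_scale_left)

lemmas inner_simps = inner_add_right inner_add_left inner_scale_right inner_scale_left
  inner_hsub_right inner_hsub_left

lemma inner_self: "h \<in> hcarrier H \<Longrightarrow> hinner H h h = complex_of_real ((hnorm H h)\<^sup>2)"
proof -
  assume h: "h \<in> hcarrier H"
  then have "Im (hinner H h h) = 0" using inner_commute[of h h] by (simp add: complex_eq_iff)
  then have *: "hinner H h h = complex_of_real (Re (hinner H h h))" by (simp add: complex_eq_iff)
  then have "cmod (hinner H h h) = Re (hinner H h h)" using inner_nonneg[OF h] by (metis abs_of_nonneg norm_of_real)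
  then have "(hnorm H h)\<^sup>2 = Re (hinner H h h)" using inner_nonneg[OF h] by (simp add: hnorm_def)
  then show ?thesis using * by metis
qed

lemma hnorm_sq: "h \<in> hcarrier H \<Longrightarrow> (hnorm H h)\<^sup>2 = Re (hinner H h h)"
  by (simp add: inner_self)

lemma hnorm_eq_0: "h \<in> hcarrier H \<Longrightarrow> hnorm H h = 0 \<longleftrightarrow> h = hzero H"
  using inner_definite[of h] inner_self[of h] by auto

lemma hsub_eq_zero: "h \<in> hcarrier H \<Longrightarrow> k \<in> hcarrier H \<Longrightarrow> hsub H h k = hzero H \<longleftrightarrow> h = k"
proof
  assume hk: "h \<in> hcarrier H" "k \<in> hcarrier H" "hsub H h k = hzero H"
  have "hadd H (hsub H h k) k = hadd H h (hadd H k (hscale H (-1) k))"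
    using hk(1,2) by (simp add: hsub_def add_assoc add_commute[of "hscale H (-1) k" k])
  also have "\<dots> = h" using hk(1,2) by (simp add: add_minus add_commute[of h] add_zero)
  finally show "h = k" using hk by (simp add: add_zero)
qed (simp add: hsub_def add_minus)

text \<open>Many vector identities below are verified by testing against all vectors, which turns
  them into identities of complex numbers and spares calculations with the axioms on the
  carrier.\<close>

lemma eqI:
  assumes "h \<in> hcarrier H" "k \<in> hcarrier H" "\<And>l. l \<in> hcarrier H \<Longrightarrow> hinner H l h = hinner H l k"
  shows "h = k"
proof -
  have "hinner H (hsub H h k) (hsub H h k) = 0" using assms by (simp add: inner_hsub_right)
  then have "hsub H h k = hzero H" using inner_definite assms by blast
  then show ?thesis using assms hsub_eq_zero by blast
qed

lemma scale_zero [simp]: "h \<in> hcarrier H \<Longrightarrow> hscale H 0 h = hzero H"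
  by (rule eqI) (simp_all add: inner_simps)

lemma scale_of_zero [simp]: "hscale H c (hzero H) = hzero H"
  by (rule eqI) (simp_all add: inner_simps)

lemma hsub_scale: "h \<in> hcarrier H \<Longrightarrow> k \<in> hcarrier H \<Longrightarrow> hsub H (hscale H c h) (hscale H c k) = hscale H c (hsub H h k)"
  by (rule eqI) (simp_all add: inner_simps algebra_simps)

lemma hsub_add: "\<lbrakk>h \<in> hcarrier H; k \<in> hcarrier H; h' \<in> hcarrier H; k' \<in> hcarrier H\<rbrakk> \<Longrightarrow>
  hsub H (hadd H h k) (hadd H h' k') = hadd H (hsub H h h') (hsub H k k')"
  by (rule eqI) (simp_all add: inner_simps algebra_simps)

lemma hnorm_scale: "h \<in> hcarrier H \<Longrightarrow> hnorm H (hscale H c h) = cmod c * hnorm H h"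
  by (simp add: hnorm_def inner_simps norm_mult real_sqrt_mult flip: mult.assoc)

lemma cauchy_schwarz:
  assumes h: "h \<in> hcarrier H" and k: "k \<in> hcarrier H"
  shows "cmod (hinner H h k) \<le> hnorm H h * hnorm H k"
proof (cases "k = hzero H")
  case False
  let ?n = "(hnorm H k)\<^sup>2"
  have n: "?n > 0" using False hnorm_eq_0[OF k] by simp
  let ?z = "hinner H k h"
  let ?l = "hsub H h (hscale H (?z / of_real ?n) k)"
  have kh: "hinner H h k = cnj ?z" using inner_commute[OF k h] .
  have "0 \<le> Re (hinner H ?l ?l)" by (rule inner_nonneg) (simp add: h k)
  also have "hinner H ?l ?l = hinner H h h - (?z * cnj ?z) / of_real ?n"
    using n by (simp add: inner_simps h k kh inner_self[OF k])
  also have "Re \<dots> = (hnorm H h)\<^sup>2 - (cmod ?z)\<^sup>2 / ?n"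
    unfolding complex_norm_square[symmetric] of_real_divide[symmetric]
    by (simp add: hnorm_sq h del: of_real_power of_real_divide)
  finally have "(cmod ?z)\<^sup>2 \<le> (hnorm H h * hnorm H k)\<^sup>2" using n by (simp add: field_simps power_mult_distrib)
  then have "cmod ?z \<le> hnorm H h * hnorm H k" by (rule power2_le_imp_le) simp
  then show ?thesis by (simp add: kh)
qed (simp add: h)

lemma hnorm_triangle:
  assumes h: "h \<in> hcarrier H" and k: "k \<in> hcarrier H"
  shows "hnorm H (hadd H h k) \<le> hnorm H h + hnorm H k"
proof -
  have "(hnorm H (hadd H h k))\<^sup>2 = (hnorm H h)\<^sup>2 + (hnorm H k)\<^sup>2 + 2 * Re (hinner H h k)"
    using inner_commute[OF h k] by (simp add: hnorm_sq h k inner_simps)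
  also have "\<dots> \<le> (hnorm H h)\<^sup>2 + (hnorm H k)\<^sup>2 + 2 * (hnorm H h * hnorm H k)"
    using cauchy_schwarz[OF h k] complex_Re_le_cmod[of "hinner H h k"] by linarith
  also have "\<dots> = (hnorm H h + hnorm H k)\<^sup>2" by (simp add: power2_sum)
  finally show ?thesis by (rule power2_le_imp_le) simp
qed

lemma hdist_sq: "h \<in> hcarrier H \<Longrightarrow> k \<in> hcarrier H \<Longrightarrow>
  (hdist H h k)\<^sup>2 = Re (hinner H h h) - 2 * Re (hinner H h k) + Re (hinner H k k)"
  using inner_commute[of h k] by (simp add: hdist_hsub hnorm_sq inner_simps)

lemma hdist_self [simp]: "h \<in> hcarrier H \<Longrightarrow> hdist H h h = 0"
  using hsub_eq_zero[of h h] hnorm_eq_0 by (simp add: hdist_hsub)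

lemma hdist_commute: "h \<in> hcarrier H \<Longrightarrow> k \<in> hcarrier H \<Longrightarrow> hdist H h k = hdist H k h"
  using hdist_sq[of h k] hdist_sq[of k h] inner_commute[of h k]
  by (intro power2_eq_imp_eq[of "hdist H h k"]) simp_all

lemma hdist_triangle:
  assumes "h \<in> hcarrier H" "k \<in> hcarrier H" "l \<in> hcarrier H"
  shows "hdist H h l \<le> hdist H h k + hdist H k l"
proof -
  have "hsub H h l = hadd H (hsub H h k) (hsub H k l)"
    using assms by (intro eqI) (simp_all add: inner_simps)
  then show ?thesis using assms hnorm_triangle by (simp add: hdist_hsub)
qed

lemma inner_tendsto:
  assumes "\<And>n. s n \<in> hcarrier H" "h \<in> hcarrier H" "l \<in> hcarrier H" "(\<lambda>n. hdist H (s n) h) \<longlonglongrightarrow> 0"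
  shows "(\<lambda>n. hinner H l (s n)) \<longlonglongrightarrow> hinner H l h" "(\<lambda>n. hinner H (s n) l) \<longlonglongrightarrow> hinner H h l"
proof -
  have 0: "(\<lambda>n. hnorm H l * hdist H (s n) h) \<longlonglongrightarrow> hnorm H l * 0" by (intro tendsto_intros assms)
  have "norm (hinner H l (s n) - hinner H l h) \<le> hnorm H l * hdist H (s n) h" for n
    using cauchy_schwarz[of l "hsub H (s n) h"] assms by (simp add: hdist_hsub inner_simps)
  then have "(\<lambda>n. hinner H l (s n) - hinner H l h) \<longlonglongrightarrow> 0"
    by (rule null_seq_bound) (use 0 in simp)
  then show 1: "(\<lambda>n. hinner H l (s n)) \<longlonglongrightarrow> hinner H l h" by (simp add: LIM_zero_iff)
  have "hinner H (s n) l = cnj (hinner H l (s n))" "hinner H h l = cnj (hinner H l h)" for n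
    by (rule inner_commute; use assms in simp)+
  then show "(\<lambda>n. hinner H (s n) l) \<longlonglongrightarrow> hinner H h l"
    using tendsto_cnj[OF 1] by presburger
qed

lemma hnorm_tendsto:
  assumes "\<And>n. s n \<in> hcarrier H" "h \<in> hcarrier H" "(\<lambda>n. hdist H (s n) h) \<longlonglongrightarrow> 0"
  shows "(\<lambda>n. hnorm H (s n)) \<longlonglongrightarrow> hnorm H h"
proof -
  have "\<bar>hnorm H (s n) - hnorm H h\<bar> \<le> hdist H (s n) h" for n
  proof -
    have "s n = hadd H (hsub H (s n) h) h" "h = hadd H (hsub H h (s n)) (s n)"
      using assms by (intro eqI; simp add: inner_simps)+
    then have "hnorm H (s n) \<le> hdist H (s n) h + hnorm H h" "hnorm H h \<le> hdist H h (s n) + hnorm H (s n)"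
      using hnorm_triangle assms hdist_hsub hsub_closed by metis+
    then show ?thesis using hdist_commute[of h "s n"] assms by force
  qed
  then have "(\<lambda>n. hnorm H (s n) - hnorm H h) \<longlonglongrightarrow> 0"
    by (intro null_seq_bound[OF _ assms(3)]) simp
  then show ?thesis by (simp add: LIM_zero_iff)
qed

lemma hdist_unique:
  assumes "\<And>n. s n \<in> hcarrier H" "h \<in> hcarrier H" "k \<in> hcarrier H"
    "(\<lambda>n. hdist H (s n) h) \<longlonglongrightarrow> 0" "(\<lambda>n. hdist H (s n) k) \<longlonglongrightarrow> 0"
  shows "h = k"
  using assms by (intro eqI) (auto intro: LIMSEQ_unique inner_tendsto(1))

lemma convergent_Cauchy:
  assumes "\<And>n. s n \<in> hcarrier H" "h \<in> hcarrier H" "(\<lambda>n. hdist H (s n) h) \<longlonglongrightarrow> 0" "e > 0"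
  shows "\<exists>N::nat. \<forall>m\<ge>N. \<forall>n\<ge>N. hdist H (s m) (s n) < e"
proof -
  obtain N where N: "\<And>n. n \<ge> N \<Longrightarrow> hdist H (s n) h < e/2"
    using LIMSEQ_D[OF assms(3), of "e/2"] assms(4) by auto
  have "hdist H (s m) (s n) < e" if "m \<ge> N" "n \<ge> N" for m n
    using hdist_triangle[of "s m" h "s n"] hdist_commute[of h "s n"] N[of m] N[of n] that assms by simp
  then show ?thesis by blast
qed

lemma hsubspaceD:
  assumes "hsubspace H V"
  shows "h \<in> V \<Longrightarrow> h \<in> hcarrier H" "hzero H \<in> V" "h \<in> V \<Longrightarrow> k \<in> V \<Longrightarrow> hadd H h k \<in> V"
    "h \<in> V \<Longrightarrow> hscale H c h \<in> V" "h \<in> V \<Longrightarrow> k \<in> V \<Longrightarrow> hsub H h k \<in> V"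
  using assms by (auto simp: hsubspace_def hsub_def)

lemma hclosed_subspaceD:
  assumes "hclosed_subspace H V"
  shows "hsubspace H V" "(\<And>n. s n \<in> V) \<Longrightarrow> h \<in> hcarrier H \<Longrightarrow> (\<lambda>n. hdist H (s n) h) \<longlonglongrightarrow> 0 \<Longrightarrow> h \<in> V"
  using assms by (auto simp: hclosed_subspace_def)

lemma hperp_closed_subspace:
  assumes "S \<subseteq> hcarrier H"
  shows "hclosed_subspace H (hperp H S)"
  unfolding hclosed_subspace_def
proof (intro conjI allI ballI impI)
  show "hsubspace H (hperp H S)"
    using assms by (auto simp: hsubspace_def hperp_def inner_simps subset_iff)
  fix s h assume h: "h \<in> hcarrier H" and s: "\<forall>n. s n \<in> hperp H S" and lim: "(\<lambda>n. hdist H (s n) h) \<longlonglongrightarrow> 0"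
  have "hinner H x h = 0" if "x \<in> S" for x
  proof -
    have "(\<lambda>n. hinner H x (s n)) \<longlonglongrightarrow> hinner H x h"
      using that assms s h lim by (intro inner_tendsto(1)) (auto simp: hperp_def)
    moreover have "hinner H x (s n) = 0" for n using s that by (auto simp: hperp_def)
    ultimately show ?thesis by (simp add: LIMSEQ_const_iff)
  qed
  then show "h \<in> hperp H S" using h by (simp add: hperp_def)
qed

lemma zero_closed_subspace: "hclosed_subspace H {hzero H}"
proof -
  have "hperp H (hcarrier H) = {hzero H}"
    using inner_definite by (auto simp: hperp_def)
  then show ?thesis using hperp_closed_subspace[of "hcarrier H"] by simp
qed

section \<open>Projections, the Riesz representation and adjoints\<close>

lemma projection:
  assumes V: "hclosed_subspace H V" and h: "h \<in> hcarrier H"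
  obtains v where "v \<in> V" "hsub H h v \<in> hperp H V"
proof -
  note VD = hsubspaceD[OF hclosed_subspaceD(1)[OF V]]
  define D where "D = (\<lambda>v. (hdist H h v)\<^sup>2) ` V"
  define d where "d = Inf D"
  have D0: "D \<noteq> {}" using VD(2) by (auto simp: D_def)
  have bdd: "bdd_below D" by (auto simp: D_def intro!: bdd_belowI[of _ 0])
  have dle: "d \<le> (hdist H h v)\<^sup>2" if "v \<in> V" for v
    unfolding d_def by (rule cInf_lower[OF _ bdd]) (use that in \<open>auto simp: D_def\<close>)
  have "\<exists>v\<in>V. (hdist H h v)\<^sup>2 < d + inverse (real (Suc n))" for n
    using cInf_lessD[OF D0, of "d + inverse (real (Suc n))"] by (auto simp: d_def D_def)
  then have "\<forall>n. \<exists>v. v \<in> V \<and> (hdist H h v)\<^sup>2 < d + inverse (real (Suc n))" by blast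
  then obtain s where "\<forall>n. s n \<in> V \<and> (hdist H h (s n))\<^sup>2 < d + inverse (real (Suc n))" by (rule choice[THEN exE])
  then have s: "s n \<in> V" "(hdist H h (s n))\<^sup>2 < d + inverse (real (Suc n))" for n by auto
  note sc = VD(1)[OF s(1)]
  have par: "(hdist H (s m) (s n))\<^sup>2 \<le> 2 * inverse (real (Suc m)) + 2 * inverse (real (Suc n))" for m n
  proof -
    let ?v = "hscale H (1/2) (hadd H (s m) (s n))"
    have "?v \<in> V" by (intro VD s)
    then have "d \<le> (hdist H h ?v)\<^sup>2" by (rule dle)
    moreover have "(hdist H (s m) (s n))\<^sup>2
      = 2 * (hdist H h (s m))\<^sup>2 + 2 * (hdist H h (s n))\<^sup>2 - 4 * (hdist H h ?v)\<^sup>2"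
      using inner_commute[OF h sc[of m]] inner_commute[OF h sc[of n]] inner_commute[OF sc[of m] sc[of n]]
      by (simp add: hdist_sq h sc inner_simps) (simp add: field_simps)
    ultimately show ?thesis using s(2)[of m] s(2)[of n] by linarith
  qed
  have cauchy: "\<exists>N::nat. \<forall>m\<ge>N. \<forall>n\<ge>N. hdist H (s m) (s n) < e" if e: "e > 0" for e
  proof -
    obtain N where N: "inverse (real (Suc N)) < e\<^sup>2 / 4" using reals_Archimedean[of "e\<^sup>2 / 4"] e by auto
    have "hdist H (s m) (s n) < e" if "m \<ge> N" "n \<ge> N" for m n
    proof -
      have "inverse (real (Suc m)) \<le> inverse (real (Suc N))" "inverse (real (Suc n)) \<le> inverse (real (Suc N))"
        using that by (auto intro!: le_imp_inverse_le)
      then have "(hdist H (s m) (s n))\<^sup>2 < e\<^sup>2" using par[of m n] N by linarith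
      then show ?thesis using e power2_less_imp_less by fastforce
    qed
    then show ?thesis by blast
  qed
  obtain v where v: "v \<in> hcarrier H" "(\<lambda>n. hdist H (s n) v) \<longlonglongrightarrow> 0"
    using complete[OF sc cauchy] by blast
  have vV: "v \<in> V" by (rule hclosed_subspaceD(2)[OF V s(1) v])
  have dv: "(hdist H h v)\<^sup>2 \<le> d"
  proof (rule LIMSEQ_le)
    have "(\<lambda>n. hnorm H (hsub H h (s n))) \<longlonglongrightarrow> hnorm H (hsub H h v)"
    proof (rule hnorm_tendsto)
      have "hdist H (hsub H h (s n)) (hsub H h v) = hdist H (s n) v" for n
      proof -
        have "hsub H (hsub H h (s n)) (hsub H h v) = hscale H (-1) (hsub H (s n) v)"
          by (rule eqI) (simp_all add: inner_simps h sc v)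
        then show ?thesis by (simp add: hdist_hsub hnorm_scale sc v)
      qed
      then show "(\<lambda>n. hdist H (hsub H h (s n)) (hsub H h v)) \<longlonglongrightarrow> 0" using v by simp
    qed (simp_all add: h sc v)
    then show "(\<lambda>n. (hdist H h (s n))\<^sup>2) \<longlonglongrightarrow> (hdist H h v)\<^sup>2"
      by (intro tendsto_intros) (simp add: hdist_hsub)
    have "(\<lambda>n. d + inverse (real (Suc n))) \<longlonglongrightarrow> d + 0" by (intro tendsto_intros LIMSEQ_inverse_real_of_nat)
    then show "(\<lambda>n. d + inverse (real (Suc n))) \<longlonglongrightarrow> d" by simp
  qed (use s(2) in \<open>auto intro: less_imp_le\<close>)
  have "hinner H w (hsub H h v) = 0" if w: "w \<in> V" for w
  proof (cases "w = hzero H")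
    case False
    have wc: "w \<in> hcarrier H" using w VD(1) by blast
    let ?n = "(hnorm H w)\<^sup>2"
    have n: "?n > 0" using False hnorm_eq_0[OF wc] by simp
    let ?z = "hinner H w (hsub H h v)"
    \<comment> \<open>The added vector is the projection of h - v onto w: moving v by it would lower
      the squared distance by |z|^2 / n.\<close>
    have "hadd H v (hscale H (?z / of_real ?n) w) \<in> V" by (intro VD vV w)
    then have "(hdist H h v)\<^sup>2 \<le> (hdist H h (hadd H v (hscale H (?z / of_real ?n) w)))\<^sup>2"
      using dle dv order_trans by blast
    moreover have "hsub H h (hadd H v (hscale H (?z / of_real ?n) w))
       = hsub H (hsub H h v) (hscale H (?z / of_real ?n) w)"
      by (rule eqI) (simp_all add: inner_simps h v wc)
    ultimately have "Re (hinner H (hsub H h v) (hsub H h v))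
      \<le> Re (hinner H (hsub H (hsub H h v) (hscale H (?z / of_real ?n) w)) (hsub H (hsub H h v) (hscale H (?z / of_real ?n) w)))"
      by (simp add: hdist_hsub hnorm_sq h v wc)
    also have "hinner H (hsub H (hsub H h v) (hscale H (?z / of_real ?n) w)) (hsub H (hsub H h v) (hscale H (?z / of_real ?n) w))
      = hinner H (hsub H h v) (hsub H h v) - (?z * cnj ?z) / of_real ?n"
      using n inner_commute[OF wc hsub_closed[OF h v(1)]]
      by (simp add: inner_scale_left inner_scale_right inner_hsub_left[of "hsub H h v"]
          inner_hsub_right[of "hsub H h v"] h v wc inner_self[OF wc])
    also have "Re \<dots> = Re (hinner H (hsub H h v) (hsub H h v)) - (cmod ?z)\<^sup>2 / ?n"
      unfolding complex_norm_square[symmetric] of_real_divide[symmetric]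
      by (simp del: of_real_power of_real_divide)
    finally have "(cmod ?z)\<^sup>2 / ?n \<le> 0" by simp
    then have "(cmod ?z)\<^sup>2 \<le> 0" using n by (simp add: divide_le_0_iff)
    then show ?thesis by simp
  qed (simp add: h v)
  then have "hsub H h v \<in> hperp H V" by (simp add: hperp_def h v)
  then show thesis using that vV by blast
qed

lemma hperp_antimono: "S \<subseteq> T \<Longrightarrow> hperp H T \<subseteq> hperp H S"
  by (auto simp: hperp_def)

lemma subset_hperp_hperp: "S \<subseteq> hcarrier H \<Longrightarrow> S \<subseteq> hperp H (hperp H S)"
proof (intro subsetI)
  fix s assume S: "S \<subseteq> hcarrier H" "s \<in> S"
  then have "hinner H x s = 0" if "x \<in> hperp H S" for x
    using that inner_commute[of s x] by (auto simp: hperp_def)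
  then show "s \<in> hperp H (hperp H S)" using S by (auto simp: hperp_def[of H "hperp H S"])
qed

lemma hperp_Int: "V \<subseteq> hcarrier H \<Longrightarrow> h \<in> V \<Longrightarrow> h \<in> hperp H V \<Longrightarrow> h = hzero H"
  using inner_definite by (auto simp: hperp_def)

lemma hperp_hperp:
  assumes V: "hclosed_subspace H V"
  shows "hperp H (hperp H V) = V"
proof
  note VD = hsubspaceD[OF hclosed_subspaceD(1)[OF V]]
  show "V \<subseteq> hperp H (hperp H V)" using subset_hperp_hperp VD(1) by blast
  show "hperp H (hperp H V) \<subseteq> V"
  proof
    fix h assume h: "h \<in> hperp H (hperp H V)"
    then have hc: "h \<in> hcarrier H" by (simp add: hperp_def)
    obtain v where v: "v \<in> V" "hsub H h v \<in> hperp H V" using projection[OF V hc] .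
    have vc: "v \<in> hcarrier H" using v VD(1) by blast
    have "hinner H (hsub H h v) h = 0" using h v(2) by (simp add: hperp_def)
    moreover have "hinner H (hsub H h v) v = 0"
      using v inner_commute[OF vc hsub_closed[OF hc vc]] by (simp add: hperp_def)
    ultimately have "hinner H (hsub H h v) (hsub H h v) = 0"
      using hc vc by (simp add: inner_hsub_right)
    then have "h = v" using hsub_eq_zero hc vc inner_definite by blast
    then show "h \<in> V" using v by simp
  qed
qed

lemma riesz:
  assumes add: "\<And>h k. h \<in> hcarrier H \<Longrightarrow> k \<in> hcarrier H \<Longrightarrow> f (hadd H h k) = f h + f k"
    and scale: "\<And>c h. h \<in> hcarrier H \<Longrightarrow> f (hscale H c h) = c * f h"
    and bound: "\<And>h. h \<in> hcarrier H \<Longrightarrow> cmod (f h) \<le> M * hnorm H h"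
  obtains l where "l \<in> hcarrier H" "\<And>h. h \<in> hcarrier H \<Longrightarrow> f h = hinner H l h"
proof -
  define N where "N = {h \<in> hcarrier H. f h = 0}"
  have f0: "f (hzero H) = 0" using scale[OF zero_closed, of 0] by simp
  have fsub: "f (hsub H h k) = f h - f k" if "h \<in> hcarrier H" "k \<in> hcarrier H" for h k
    using that by (simp add: hsub_def add scale)
  have N: "hclosed_subspace H N"
    unfolding hclosed_subspace_def
  proof (intro conjI allI ballI impI)
    show "hsubspace H N" by (auto simp: N_def hsubspace_def add scale f0)
    fix s h assume h: "h \<in> hcarrier H" and s: "\<forall>n. s n \<in> N" and lim: "(\<lambda>n. hdist H (s n) h) \<longlonglongrightarrow> 0"
    have "cmod (f h) \<le> M * hdist H (s n) h" for n
      using bound[of "hsub H (s n) h"] fsub[of "s n" h] s h by (simp add: N_def hdist_hsub)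
    moreover have "(\<lambda>n. M * hdist H (s n) h) \<longlonglongrightarrow> M * 0" by (intro tendsto_intros lim)
    ultimately have "cmod (f h) \<le> 0" by (intro LIMSEQ_le_const) auto
    then show "h \<in> N" using h by (simp add: N_def)
  qed
  show thesis
  proof (cases "N = hcarrier H")
    case True
    then show thesis using that[of "hzero H"] by (auto simp: N_def)
  next
    case False
    then obtain h0 where h0: "h0 \<in> hcarrier H" "f h0 \<noteq> 0" by (auto simp: N_def)
    obtain v where v: "v \<in> N" "hsub H h0 v \<in> hperp H N" using projection[OF N h0(1)] .
    let ?e = "hsub H h0 v"
    have vc: "v \<in> hcarrier H" using v by (simp add: N_def)
    have ec: "?e \<in> hcarrier H" using h0 vc by simp
    have fe: "f ?e \<noteq> 0" using fsub[OF h0(1) vc] v h0 by (simp add: N_def)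
    have ee: "hinner H ?e ?e \<noteq> 0" using inner_definite[OF ec] fe f0 by auto
    let ?l = "hscale H (cnj (f ?e / hinner H ?e ?e)) ?e"
    have "f h = hinner H ?l h" if h: "h \<in> hcarrier H" for h
    proof -
      let ?k = "hsub H (hscale H (f ?e) h) (hscale H (f h) ?e)"
      have "?k \<in> N" using h ec by (simp add: N_def fsub scale)
      then have "hinner H ?k ?e = 0" using v(2) by (simp add: hperp_def)
      then have "hinner H ?e ?k = 0" using inner_commute[of ?k ?e] h ec by simp
      then have "f ?e * hinner H ?e h = f h * hinner H ?e ?e"
        using h ec by (simp add: inner_hsub_right[of "hscale H (f ?e) h"] inner_scale_right)
      then show ?thesis using ee h ec by (simp add: inner_scale_left field_simps)
    qed
    then show thesis using that[of ?l] ec by blast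
  qed
qed

lemma hadjoint:
  assumes T: "bounded_op H T" and k: "k \<in> hcarrier H"
  shows "hadjoint H T k \<in> hcarrier H" "h \<in> hcarrier H \<Longrightarrow> hinner H (T h) k = hinner H h (hadjoint H T k)"
proof -
  obtain M where M: "\<And>h. h \<in> hcarrier H \<Longrightarrow> hnorm H (T h) \<le> M * hnorm H h"
    and lin: "hlinear H H T" using T by (auto simp: bounded_op_def)
  have Tc: "T h \<in> hcarrier H" if "h \<in> hcarrier H" for h using lin that by (auto simp: hlinear_def)
  have "\<exists>l. l \<in> hcarrier H \<and> (\<forall>h\<in>hcarrier H. hinner H k (T h) = hinner H l h)"
  proof (rule riesz[where f = "\<lambda>h. hinner H k (T h)" and M = "hnorm H k * M"])
    fix h assume h: "h \<in> hcarrier H"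
    have "cmod (hinner H k (T h)) \<le> hnorm H k * hnorm H (T h)" by (rule cauchy_schwarz[OF k Tc[OF h]])
    also have "\<dots> \<le> hnorm H k * (M * hnorm H h)" by (intro mult_left_mono M h) simp
    finally show "cmod (hinner H k (T h)) \<le> hnorm H k * M * hnorm H h" by (simp add: mult.assoc)
  qed (use lin k Tc in \<open>auto simp: hlinear_def inner_simps\<close>)
  then obtain l where l: "l \<in> hcarrier H" "\<And>h. h \<in> hcarrier H \<Longrightarrow> hinner H k (T h) = hinner H l h" by blast
  have l2: "hinner H (T h) k = hinner H h l" if "h \<in> hcarrier H" for h
    using l(2)[OF that] inner_commute[OF k Tc[OF that]] inner_commute[OF l(1) that] by metis
  have "hadjoint H T k = l"
    unfolding hadjoint_def
  proof (rule the_equality)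
    show "l \<in> hcarrier H \<and> (\<forall>h\<in>hcarrier H. hinner H (T h) k = hinner H h l)" using l l2 by blast
    fix l' assume "l' \<in> hcarrier H \<and> (\<forall>h\<in>hcarrier H. hinner H (T h) k = hinner H h l')"
    then show "l' = l" using l l2 by (intro eqI) auto
  qed
  then show "hadjoint H T k \<in> hcarrier H" "h \<in> hcarrier H \<Longrightarrow> hinner H (T h) k = hinner H h (hadjoint H T k)"
    using l l2 by auto
qed

lemma hadjoint_eqI:
  assumes "bounded_op H T" "k \<in> hcarrier H" "l \<in> hcarrier H" "\<And>h. h \<in> hcarrier H \<Longrightarrow> hinner H (T h) k = hinner H h l"
  shows "hadjoint H T k = l"
  using hadjoint[OF assms(1,2)] assms by (intro eqI) auto

text \<open>Density is used from here on through the orthogonal complement, which is easier to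
  compute with than closed subspaces.\<close>

lemma htotal_iff: "S \<subseteq> hcarrier H \<Longrightarrow> htotal H S \<longleftrightarrow> hperp H S = {hzero H}"
proof
  assume S: "S \<subseteq> hcarrier H" "htotal H S"
  have "hclosed_subspace H (hperp H (hperp H S))" by (rule hperp_closed_subspace) (auto simp: hperp_def)
  then have *: "hperp H (hperp H S) = hcarrier H"
    using S(2) subset_hperp_hperp[OF S(1)] unfolding htotal_def by blast
  have "x = hzero H" if x: "x \<in> hperp H S" for x
  proof -
    have xc: "x \<in> hcarrier H" using x by (simp add: hperp_def)
    then have "x \<in> hperp H (hperp H S)" using * by simp
    then have "hinner H x x = 0" using x unfolding hperp_def[of H "hperp H S"] by blast
    then show ?thesis by (rule inner_definite[OF xc])
  qed
  moreover have "hzero H \<in> hperp H S" using S(1) by (auto simp: hperp_def)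
  ultimately show "hperp H S = {hzero H}" by blast
next
  assume S: "S \<subseteq> hcarrier H" "hperp H S = {hzero H}"
  show "htotal H S" unfolding htotal_def
  proof (intro conjI allI impI)
    fix V assume V: "hclosed_subspace H V" "S \<subseteq> V"
    then have "hperp H V \<subseteq> {hzero H}" using hperp_antimono S(2) by blast
    then have "hperp H {hzero H} \<subseteq> hperp H (hperp H V)" by (rule hperp_antimono)
    then have "hcarrier H \<subseteq> V" using hperp_hperp[OF V(1)] by (auto simp: hperp_def)
    then show "V = hcarrier H" using hsubspaceD(1)[OF hclosed_subspaceD(1)[OF V(1)]] by blast
  qed (rule S)
qed

section \<open>Dense subspaces, and closed subspaces as Hilbert spaces\<close>

lemma dense_approx:
  assumes S: "hsubspace H S" "hperp H S = {hzero H}" and h: "h \<in> hcarrier H"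
  obtains s where "\<And>n::nat. s n \<in> S" "(\<lambda>n. hdist H (s n) h) \<longlonglongrightarrow> 0"
proof -
  note SD = hsubspaceD[OF S(1)]
  define C where "C = {h \<in> hcarrier H. \<forall>e>0. \<exists>s\<in>S. hdist H s h < e}"
  have CD: "h \<in> C \<Longrightarrow> e > 0 \<Longrightarrow> \<exists>s\<in>S. hdist H s h < e" for h e by (simp add: C_def)
  have "hsubspace H C"
    unfolding hsubspace_def
  proof (intro conjI ballI allI)
    show "C \<subseteq> hcarrier H" by (auto simp: C_def)
    show "hzero H \<in> C" unfolding C_def using SD(2) by auto (metis hdist_self zero_closed)
  next
    fix h k assume hk: "h \<in> C" "k \<in> C"
    have "\<exists>s\<in>S. hdist H s (hadd H h k) < e" if e: "e > 0" for e
    proof -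
      obtain s t where st: "s \<in> S" "t \<in> S" "hdist H s h < e/2" "hdist H t k < e/2"
        using CD[OF hk(1) half_gt_zero[OF e]] CD[OF hk(2) half_gt_zero[OF e]] by blast
      have "hdist H (hadd H s t) (hadd H h k) \<le> hdist H s h + hdist H t k"
        using hnorm_triangle[of "hsub H s h" "hsub H t k"] hk st SD(1)
        by (simp add: hdist_hsub hsub_add C_def)
      then show ?thesis using st SD(3) by (intro bexI[of _ "hadd H s t"]) auto
    qed
    then show "hadd H h k \<in> C" using hk by (auto simp: C_def)
  next
    fix c h assume h: "h \<in> C"
    have "\<exists>s\<in>S. hdist H s (hscale H c h) < e" if e: "e > 0" for e
    proof -
      have "e / (cmod c + 1) > 0" using e by (simp add: add_nonneg_pos)
      then obtain s where s: "s \<in> S" "hdist H s h < e / (cmod c + 1)"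
        using CD[OF h] by blast
      have "hdist H (hscale H c s) (hscale H c h) = cmod c * hdist H s h"
        using h s SD(1) by (simp add: hdist_hsub hsub_scale hnorm_scale C_def)
      also have "\<dots> \<le> (cmod c + 1) * hdist H s h" by (intro mult_right_mono) auto
      also have "\<dots> < e" using s(2) by (simp add: pos_less_divide_eq add_nonneg_pos mult.commute)
      finally show ?thesis using s SD(4) by (intro bexI[of _ "hscale H c s"]) auto
    qed
    then show "hscale H c h \<in> C" using h by (auto simp: C_def)
  qed
  moreover have "h \<in> C" if h: "h \<in> hcarrier H" and s: "\<And>n. s n \<in> C" and lim: "(\<lambda>n. hdist H (s n) h) \<longlonglongrightarrow> 0" for s h
  proof -
    have "\<exists>x\<in>S. hdist H x h < e" if e: "e > 0" for e
    proof -
      obtain n where n: "hdist H (s n) h < e/2" using LIMSEQ_D[OF lim, of "e/2"] e by auto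
      obtain x where x: "x \<in> S" "hdist H x (s n) < e/2" using CD[OF s[of n] half_gt_zero[OF e]] by blast
      have "hdist H x h \<le> hdist H x (s n) + hdist H (s n) h"
        using x(1) SD(1) s[of n] h by (intro hdist_triangle) (auto simp: C_def)
      then show ?thesis using n x by (intro bexI[of _ x]) auto
    qed
    then show ?thesis using h by (simp add: C_def)
  qed
  ultimately have C: "hclosed_subspace H C" by (auto simp: hclosed_subspace_def)
  have "S \<subseteq> C" using SD(1) unfolding C_def by auto (metis hdist_self)
  then have "C = hcarrier H" using C htotal_iff[of S] S(2) SD(1) by (auto simp: htotal_def)
  then have "h \<in> C" using h by simp
  then have "\<exists>s\<in>S. hdist H s h < inverse (real (Suc n))" for n by (rule CD) simp
  then have "\<forall>n. \<exists>s. s \<in> S \<and> hdist H s h < inverse (real (Suc n))" by blast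
  then obtain s where "\<forall>n. s n \<in> S \<and> hdist H (s n) h < inverse (real (Suc n))" by (rule choice[THEN exE])
  then have s: "\<And>n. s n \<in> S" "\<And>n. hdist H (s n) h < inverse (real (Suc n))" by auto
  have "(\<lambda>n. hdist H (s n) h) \<longlonglongrightarrow> 0"
    by (rule tendsto_sandwich[OF _ _ tendsto_const LIMSEQ_inverse_real_of_nat])
      (use s(2) in \<open>auto intro!: always_eventually less_imp_le\<close>)
  then show thesis using that s(1) by blast
qed

text \<open>A closed subspace keeps all operations and only shrinks the carrier, so a
  subrepresentation can use the very operator map of the representation that contains it.\<close>

lemma subspace_hilbert:
  assumes V: "hclosed_subspace H V"
  shows "hilbert_space (H\<lparr>hcarrier := V\<rparr>)"
proof -
  note VD = hsubspaceD[OF hclosed_subspaceD(1)[OF V]]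
  have d: "hdist (H\<lparr>hcarrier := V\<rparr>) = hdist H"
    by (simp add: fun_eq_iff hdist_def hnorm_def)
  show ?thesis
  proof (unfold_locales, goal_cases)
    case (17 s)
    then have s: "s n \<in> V" for n by simp
    have "\<exists>h\<in>hcarrier H. (\<lambda>n. hdist H (s n) h) \<longlonglongrightarrow> 0"
      using 17(2) VD(1)[OF s] unfolding d by (intro complete) auto
    then show ?case unfolding d using hclosed_subspaceD(2)[OF V s] by auto
  qed (auto simp: VD add_assoc add_zero add_minus scale_add_right scale_add_left
      scale_scale scale_one inner_add_right inner_scale_right inner_nonneg
      intro: inner_definite add_commute inner_commute)
qed

lemma closed_subspace_trans:
  assumes V: "hclosed_subspace H V"
  shows "hclosed_subspace (H\<lparr>hcarrier := V\<rparr>) W \<longleftrightarrow> W \<subseteq> V \<and> hclosed_subspace H W"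
proof -
  have d: "hdist (H\<lparr>hcarrier := V\<rparr>) = hdist H"
    by (simp add: fun_eq_iff hdist_def hnorm_def)
  note VD = hsubspaceD[OF hclosed_subspaceD(1)[OF V]]
  have sub: "hsubspace (H\<lparr>hcarrier := V\<rparr>) W \<longleftrightarrow> W \<subseteq> V \<and> hsubspace H W"
    using VD(1) by (auto simp: hsubspace_def)
  have "h \<in> W" if "W \<subseteq> V" "\<forall>s. \<forall>h\<in>V. (\<forall>n. s n \<in> W) \<longrightarrow> (\<lambda>n. hdist H (s n) h) \<longlonglongrightarrow> 0 \<longrightarrow> h \<in> W"
    "h \<in> hcarrier H" "\<forall>n. s n \<in> W" "(\<lambda>n. hdist H (s n) h) \<longlonglongrightarrow> 0" for s h
  proof -
    have "h \<in> V" by (rule hclosed_subspaceD(2)[OF V _ that(3,5)]) (use that in blast)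
    then show ?thesis using that by blast
  qed
  then show ?thesis
    using VD(1) unfolding hclosed_subspace_def sub d by auto
qed

end

section \<open>Representations\<close>

locale rep =
  fixes H :: "'h hilbert" and \<pi> :: "'a::cstar_algebra \<Rightarrow> 'h \<Rightarrow> 'h"
  assumes rep: "representation H \<pi>"

sublocale rep \<subseteq> hilbert_space H
  using rep by (simp add: representation_def)

context rep
begin

lemma bounded: "bounded_op H (\<pi> a)"
  using rep by (simp add: representation_def op_linear_def)

lemma linear: "hlinear H H (\<pi> a)"
  using bounded by (simp add: bounded_op_def)

lemma op_closed [simp, intro]: "h \<in> hcarrier H \<Longrightarrow> \<pi> a h \<in> hcarrier H"
  using linear[of a] by (auto simp: hlinear_def)

lemma op_add_right: "h \<in> hcarrier H \<Longrightarrow> k \<in> hcarrier H \<Longrightarrow> \<pi> a (hadd H h k) = hadd H (\<pi> a h) (\<pi> a k)"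
  and op_scale_right: "h \<in> hcarrier H \<Longrightarrow> \<pi> a (hscale H c h) = hscale H c (\<pi> a h)"
  using linear[of a] by (auto simp: hlinear_def)

lemma op_add: "h \<in> hcarrier H \<Longrightarrow> \<pi> (a + b) h = hadd H (\<pi> a h) (\<pi> b h)"
  and op_scale: "h \<in> hcarrier H \<Longrightarrow> \<pi> (c *\<^sub>C a) h = hscale H c (\<pi> a h)"
  and op_mult: "h \<in> hcarrier H \<Longrightarrow> \<pi> (a * b) h = \<pi> a (\<pi> b h)"
  using rep by (auto simp: representation_def op_linear_def)

lemma adj: "h \<in> hcarrier H \<Longrightarrow> k \<in> hcarrier H \<Longrightarrow> hinner H (\<pi> a h) k = hinner H h (\<pi> (star a) k)"
  using rep hadjoint(2)[OF bounded, of k h a] by (auto simp: representation_def)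

lemma adj': "h \<in> hcarrier H \<Longrightarrow> k \<in> hcarrier H \<Longrightarrow> hinner H (\<pi> (star a) h) k = hinner H h (\<pi> a k)"
  using adj[of h k "star a"] by (simp add: star_star)

lemma op_zero [simp]: "h \<in> hcarrier H \<Longrightarrow> \<pi> 0 h = hzero H"
  using op_scale[of h 0 0] by simp

lemma op_of_zero [simp]: "\<pi> a (hzero H) = hzero H"
  using op_scale_right[of "hzero H" a 0] by simp

lemma op_hsub: "h \<in> hcarrier H \<Longrightarrow> k \<in> hcarrier H \<Longrightarrow> \<pi> a (hsub H h k) = hsub H (\<pi> a h) (\<pi> a k)"
  by (simp add: hsub_def op_add_right op_scale_right)

lemma op_minus: "h \<in> hcarrier H \<Longrightarrow> \<pi> (- a) h = hscale H (-1) (\<pi> a h)"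
  using op_scale[of h "-1" a] by (simp add: scaleC_minus_one)

lemma op_diff: "h \<in> hcarrier H \<Longrightarrow> \<pi> (a - b) h = hsub H (\<pi> a h) (\<pi> b h)"
  using op_add[of h a "- b"] by (simp add: op_minus hsub_def)

end

text \<open>Linearity of the single operators is derived from the adjoint identity, by testing
  against vectors.\<close>

lemma repI:
  fixes \<pi> :: "'a::cstar_algebra \<Rightarrow> 'h \<Rightarrow> 'h"
  assumes H: "hilbert_space H"
    and closed: "\<And>a h. h \<in> hcarrier H \<Longrightarrow> \<pi> a h \<in> hcarrier H"
    and add: "\<And>a b h. h \<in> hcarrier H \<Longrightarrow> \<pi> (a + b) h = hadd H (\<pi> a h) (\<pi> b h)"
    and scale: "\<And>c a h. h \<in> hcarrier H \<Longrightarrow> \<pi> (c *\<^sub>C a) h = hscale H c (\<pi> a h)"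
    and mult: "\<And>a b h. h \<in> hcarrier H \<Longrightarrow> \<pi> (a * b) h = \<pi> a (\<pi> b h)"
    and adj: "\<And>a h k. h \<in> hcarrier H \<Longrightarrow> k \<in> hcarrier H \<Longrightarrow> hinner H (\<pi> a h) k = hinner H h (\<pi> (star a) k)"
    and bound: "\<And>a. \<exists>M. \<forall>h\<in>hcarrier H. hnorm H (\<pi> a h) \<le> M * hnorm H h"
  shows "rep H \<pi>"
proof
  interpret hilbert_space H by fact
  have adj': "hinner H l (\<pi> a h) = hinner H (\<pi> (star a) l) h" if "h \<in> hcarrier H" "l \<in> hcarrier H" for a h l
    using adj[OF that(2,1), of "star a"] by (simp add: star_star)
  have "hlinear H H (\<pi> a)" for a
    unfolding hlinear_def
  proof (intro conjI ballI allI)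
    fix h k assume "h \<in> hcarrier H" "k \<in> hcarrier H"
    then show "\<pi> a (hadd H h k) = hadd H (\<pi> a h) (\<pi> a k)"
      by (intro eqI) (simp_all add: closed inner_add_right adj')
  next
    fix c h assume "h \<in> hcarrier H"
    then show "\<pi> a (hscale H c h) = hscale H c (\<pi> a h)"
      by (intro eqI) (simp_all add: closed inner_scale_right adj')
  qed (use closed in auto)
  then have bdd: "bounded_op H (\<pi> a)" for a using bound by (simp add: bounded_op_def)
  moreover have "\<pi> (star a) h = hadjoint H (\<pi> a) h" if "h \<in> hcarrier H" for a h
    using that by (intro hadjoint_eqI[symmetric] bdd closed adj)
  ultimately show "representation H \<pi>"
    using H add scale mult by (auto simp: representation_def op_linear_def)
qed

definition rep_ext :: "'h hilbert \<Rightarrow> ('a::cstar_algebra \<Rightarrow> 'h \<Rightarrow> 'h) \<Rightarrow> 'a unitization \<Rightarrow> 'h \<Rightarrow> 'h"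
  where "rep_ext H \<pi> u h = hadd H (\<pi> (alg_part u) h) (hscale H (scalar_part u) h)"

text \<open>Contractivity comes from \<open>b\<^sup>* b \<le> \<parallel>b\<parallel>\<^sup>2\<close> in the unitization.\<close>

lemma (in rep) rep_ext: "rep H (rep_ext H \<pi>)"
  and rep_ext_norm: "h \<in> hcarrier H \<Longrightarrow> hnorm H (rep_ext H \<pi> u h) \<le> norm u * hnorm H h"
proof -
  let ?p = "rep_ext H \<pi>"
  have closed: "?p u h \<in> hcarrier H" if "h \<in> hcarrier H" for u h
    using that by (simp add: rep_ext_def)
  have adj_ext: "hinner H (?p u h) k = hinner H h (?p (star u) k)" if "h \<in> hcarrier H" "k \<in> hcarrier H" for u h k
    using that by (simp add: rep_ext_def inner_simps adj)
  have add: "?p (u + v) h = hadd H (?p u h) (?p v h)" if "h \<in> hcarrier H" for u v h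
    using that by (intro eqI) (simp_all add: rep_ext_def inner_simps op_add algebra_simps)
  have scale: "?p (c *\<^sub>C u) h = hscale H c (?p u h)" if "h \<in> hcarrier H" for u c h
    using that by (intro eqI) (simp_all add: rep_ext_def inner_simps op_scale algebra_simps)
  have mult: "?p (u * v) h = ?p u (?p v h)" if "h \<in> hcarrier H" for u v h
    using that by (intro eqI) (simp_all add: rep_ext_def inner_simps op_scale op_mult op_add
        op_add_right op_scale_right algebra_simps)
  have one: "?p 1 h = h" if "h \<in> hcarrier H" for h
    using that by (simp add: rep_ext_def add_zero scale_one)
  have bound: "hnorm H (?p u h) \<le> norm u * hnorm H h" if h: "h \<in> hcarrier H" for u h
  proof -
    obtain b where b: "(norm u)\<^sup>2 *\<^sub>R 1 - star u * u = star b * b"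
      using cpos_norm_sq_minus[of u] cpos_iff by blast
    then have eq: "complex_of_real ((norm u)\<^sup>2) *\<^sub>C 1 = star u * u + star b * b"
      by (simp add: scaleR_scaleC diff_eq_eq add.commute)
    have sq: "hinner H h (?p (star c * c) h) = of_real ((hnorm H (?p c h))\<^sup>2)" for c
      using adj_ext[OF h closed[OF h, of c], of c] inner_self[OF closed[OF h, of c]] by (simp add: mult h)
    have "of_real ((norm u)\<^sup>2) * hinner H h h = hinner H h (?p (complex_of_real ((norm u)\<^sup>2) *\<^sub>C 1) h)"
      using h by (simp only: scale one inner_scale_right)
    also have "\<dots> = of_real ((hnorm H (?p u h))\<^sup>2) + of_real ((hnorm H (?p b h))\<^sup>2)"
      unfolding eq by (simp add: add closed h inner_add_right sq del: of_real_power)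
    finally have "(hnorm H (?p u h))\<^sup>2 + (hnorm H (?p b h))\<^sup>2 = (norm u)\<^sup>2 * (hnorm H h)\<^sup>2"
      unfolding inner_self[OF h] by (simp only: flip: of_real_mult of_real_add) (simp only: of_real_eq_iff)
    then have "(hnorm H (?p u h))\<^sup>2 \<le> (norm u * hnorm H h)\<^sup>2"
      by (simp add: power_mult_distrib) (metis le_add_same_cancel1 zero_le_power2)
    then show ?thesis by (rule power2_le_imp_le) simp
  qed
  show "rep H ?p"
  proof (rule repI[OF hilbert_space_axioms closed add scale mult adj_ext])
    show "\<exists>M. \<forall>h\<in>hcarrier H. hnorm H (?p u h) \<le> M * hnorm H h" for u
      using bound by blast
  qed
  show "h \<in> hcarrier H \<Longrightarrow> hnorm H (?p u h) \<le> norm u * hnorm H h" by (rule bound)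
qed

lemma (in rep) rep_ext_emb: "h \<in> hcarrier H \<Longrightarrow> rep_ext H \<pi> (emb a) h = \<pi> a h"
  by (rule eqI) (simp_all add: rep_ext_def inner_simps)

lemma (in rep) rep_ext_one: "h \<in> hcarrier H \<Longrightarrow> rep_ext H \<pi> 1 h = h"
  by (simp add: rep_ext_def add_zero scale_one)

lemma (in rep) op_norm: "h \<in> hcarrier H \<Longrightarrow> hnorm H (\<pi> a h) \<le> norm a * hnorm H h"
  using rep_ext_norm[of h "emb a"] by (simp add: rep_ext_emb)

lemma (in rep) inner_star_mult: "h \<in> hcarrier H \<Longrightarrow> hinner H h (\<pi> (star a * a) h) = of_real ((hnorm H (\<pi> a h))\<^sup>2)"
  by (simp add: op_mult adj'[symmetric] star_star inner_self flip: adj)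

lemma (in rep) op_tendsto_alg:
  assumes "f \<longlonglongrightarrow> a" "h \<in> hcarrier H"
  shows "(\<lambda>n. hdist H (\<pi> (f n) h) (\<pi> a h)) \<longlonglongrightarrow> 0"
proof (rule null_seq_bound)
  show "norm (hdist H (\<pi> (f n) h) (\<pi> a h)) \<le> norm (f n - a) * hnorm H h" for n
    using op_norm[of h "f n - a"] assms by (simp add: hdist_hsub op_diff)
  have "(\<lambda>n. norm (f n - a) * hnorm H h) \<longlonglongrightarrow> 0 * hnorm H h"
    using assms by (intro tendsto_intros) (simp add: tendsto_norm_zero_iff LIM_zero_iff)
  then show "(\<lambda>n. norm (f n - a) * hnorm H h) \<longlonglongrightarrow> 0" by simp
qed

lemma (in rep) subrep:
  assumes V: "hclosed_subspace H V" and inv: "\<And>a. \<pi> a ` V \<subseteq> V"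
  shows "rep (H\<lparr>hcarrier := V\<rparr>) \<pi>"
proof (rule repI)
  note VD = hsubspaceD[OF hclosed_subspaceD(1)[OF V]]
  show "hilbert_space (H\<lparr>hcarrier := V\<rparr>)" by (rule subspace_hilbert[OF V])
  show "\<exists>M. \<forall>h\<in>hcarrier (H\<lparr>hcarrier := V\<rparr>). hnorm (H\<lparr>hcarrier := V\<rparr>) (\<pi> a h) \<le> M * hnorm (H\<lparr>hcarrier := V\<rparr>) h" for a
    using op_norm VD(1) by (intro exI[of _ "norm a"]) (simp add: hnorm_def)
qed (use inv hsubspaceD(1)[OF hclosed_subspaceD(1)[OF V]] in \<open>auto simp: op_add op_scale op_mult adj\<close>)

lemma (in rep) hperp_invariant:
  assumes S: "S \<subseteq> hcarrier H" and inv: "\<And>s. s \<in> S \<Longrightarrow> \<pi> (star a) s \<in> S" and h: "h \<in> hperp H S"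
  shows "\<pi> a h \<in> hperp H S"
  using assms adj'[of _ h a, symmetric] by (auto simp: hperp_def)

lemma rep_star_hom_comp:
  assumes "rep K \<rho>" "star_hom f"
  shows "rep K (\<lambda>a. \<rho> (f a))"
proof -
  interpret rep K \<rho> by fact
  have f: "clinear f" "f (a * b) = f a * f b" "f (star a) = star (f a)" for a b
    using assms(2) by (auto simp: star_hom_def)
  show ?thesis
    by (rule repI) (use op_norm in \<open>auto simp: hilbert_space_axioms clinearD[OF f(1)] f(2,3) op_add op_scale op_mult adj\<close>)
qed

section \<open>Unitary maps\<close>

definition unitary :: "'h hilbert \<Rightarrow> 'k hilbert \<Rightarrow> ('h \<Rightarrow> 'k) \<Rightarrow> bool"
  where "unitary H K U \<longleftrightarrow> hlinear H K U \<and> bij_betw U (hcarrier H) (hcarrier K) \<and>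
    (\<forall>h\<in>hcarrier H. \<forall>k\<in>hcarrier H. hinner K (U h) (U k) = hinner H h k)"

lemma unitarily_equivalent_iff:
  "unitarily_equivalent (H, \<pi>) (K, \<sigma>) \<longleftrightarrow>
    (\<exists>U. unitary H K U \<and> (\<forall>a. \<forall>h\<in>hcarrier H. U (\<pi> a h) = \<sigma> a (U h)))"
  by (simp add: unitarily_equivalent_def unitary_def)

lemma unitaryD:
  assumes "unitary H K U"
  shows "h \<in> hcarrier H \<Longrightarrow> U h \<in> hcarrier K"
    "h \<in> hcarrier H \<Longrightarrow> k \<in> hcarrier H \<Longrightarrow> hinner K (U h) (U k) = hinner H h k"
    "h \<in> hcarrier H \<Longrightarrow> k \<in> hcarrier H \<Longrightarrow> U (hadd H h k) = hadd K (U h) (U k)"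
    "h \<in> hcarrier H \<Longrightarrow> U (hscale H c h) = hscale K c (U h)"
    "inj_on U (hcarrier H)" "U ` hcarrier H = hcarrier K"
    "h \<in> hcarrier H \<Longrightarrow> hnorm K (U h) = hnorm H h"
  using assms by (auto simp: unitary_def hlinear_def bij_betw_def hnorm_def)

lemma unitary_inv:
  assumes U: "unitary H K U" and H: "hilbert_space H"
  shows "unitary K H (inv_into (hcarrier H) U)"
    "h \<in> hcarrier H \<Longrightarrow> inv_into (hcarrier H) U (U h) = h"
    "k \<in> hcarrier K \<Longrightarrow> U (inv_into (hcarrier H) U k) = k"
    "k \<in> hcarrier K \<Longrightarrow> inv_into (hcarrier H) U k \<in> hcarrier H"
proof -
  interpret hilbert_space H by fact
  note UD = unitaryD[OF U]
  let ?V = "inv_into (hcarrier H) U"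
  show 1: "h \<in> hcarrier H \<Longrightarrow> ?V (U h) = h" for h using UD(5) by simp
  show 2: "k \<in> hcarrier K \<Longrightarrow> U (?V k) = k" for k using UD(6) f_inv_into_f by metis
  show 3: "k \<in> hcarrier K \<Longrightarrow> ?V k \<in> hcarrier H" for k using UD(6) inv_into_into by metis
  have "?V (hadd K h k) = hadd H (?V h) (?V k)" if "h \<in> hcarrier K" "k \<in> hcarrier K" for h k
    using 1[of "hadd H (?V h) (?V k)"] UD(3)[of "?V h" "?V k"] 2 3 that by simp
  moreover have "?V (hscale K c h) = hscale H c (?V h)" if "h \<in> hcarrier K" for c h
    using 1[of "hscale H c (?V h)"] UD(4)[of "?V h" c] 2 3 that by simp
  moreover have "hinner H (?V h) (?V k) = hinner K h k" if "h \<in> hcarrier K" "k \<in> hcarrier K" for h k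
    using UD(2)[of "?V h" "?V k"] 2 3 that by simp
  moreover have "bij_betw ?V (hcarrier K) (hcarrier H)"
    using bij_betw_inv_into U by (auto simp: unitary_def)
  ultimately show "unitary K H ?V" using 3 by (auto simp: unitary_def hlinear_def)
qed

lemma unitary_comp:
  assumes "unitary H K U" "unitary K L V"
  shows "unitary H L (V \<circ> U)"
  using unitaryD[OF assms(1)] unitaryD[OF assms(2)] assms bij_betw_trans
  unfolding unitary_def hlinear_def by (fastforce simp: image_subset_iff)

lemma unitary_zero:
  assumes "unitary H K U" "hilbert_space H" "hilbert_space K"
  shows "U (hzero H) = hzero K"
  using unitaryD(4)[OF assms(1), of "hzero H" 0] unitaryD(1)[OF assms(1), of "hzero H"]
    hilbert_space.scale_zero[OF assms(2)] hilbert_space.scale_zero[OF assms(3)] hilbert_space.zero_closed[OF assms(2)]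
  by metis

lemma unitary_hdist:
  assumes U: "unitary H K U" and H: "hilbert_space H" and "h \<in> hcarrier H" "k \<in> hcarrier H"
  shows "hdist K (U h) (U k) = hdist H h k"
proof -
  interpret hilbert_space H by fact
  have "hadd K (U h) (hscale K (-1) (U k)) = U (hsub H h k)"
    using assms unitaryD(3,4)[OF U] by (simp add: hsub_def)
  then show ?thesis using assms unitaryD(7)[OF U, of "hsub H h k"] by (simp add: hdist_hsub[of H] hdist_def[of K])
qed

lemma unitarily_equivalent_refl: "unitarily_equivalent p p"
proof -
  obtain H \<pi> where "p = (H, \<pi>)" by fastforce
  moreover have "unitary H H id" by (auto simp: unitary_def hlinear_def)
  ultimately show ?thesis by (auto simp: unitarily_equivalent_iff intro!: exI[of _ id])
qed

lemma unitarily_equivalent_sym: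
  assumes "unitarily_equivalent (H, \<pi>) (K, \<sigma>)" "rep H \<pi>"
  shows "unitarily_equivalent (K, \<sigma>) (H, \<pi>)"
proof -
  interpret rep H \<pi> by fact
  obtain U where U: "unitary H K U" "\<And>a h. h \<in> hcarrier H \<Longrightarrow> U (\<pi> a h) = \<sigma> a (U h)"
    using assms by (auto simp: unitarily_equivalent_iff)
  note inv = unitary_inv[OF U(1) hilbert_space_axioms]
  have "inv_into (hcarrier H) U (\<sigma> a k) = \<pi> a (inv_into (hcarrier H) U k)" if "k \<in> hcarrier K" for a k
    using U(2)[OF inv(4)[OF that], of a] inv(2)[of "\<pi> a (inv_into (hcarrier H) U k)"] inv(3,4)[OF that] by simp
  then show ?thesis using inv(1) by (auto simp: unitarily_equivalent_iff)
qed

lemma unitarily_equivalent_trans: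
  assumes "unitarily_equivalent p q" "unitarily_equivalent q r"
  shows "unitarily_equivalent p r"
proof -
  obtain H \<pi> K \<sigma> L \<tau> where p: "p = (H, \<pi>)" "q = (K, \<sigma>)" "r = (L, \<tau>)" by (metis surj_pair)
  obtain U where U: "unitary H K U" "\<And>a h. h \<in> hcarrier H \<Longrightarrow> U (\<pi> a h) = \<sigma> a (U h)"
    using assms by (auto simp: p unitarily_equivalent_iff)
  obtain V where V: "unitary K L V" "\<And>a h. h \<in> hcarrier K \<Longrightarrow> V (\<sigma> a h) = \<tau> a (V h)"
    using assms by (auto simp: p unitarily_equivalent_iff)
  show ?thesis unfolding p unitarily_equivalent_iff
    using unitary_comp[OF U(1) V(1)] U(2) V(2) unitaryD(1)[OF U(1)] by (intro exI[of _ "V \<circ> U"]) auto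
qed

text \<open>Both dense ranges are parametrized by one vector space; equality of inner products makes
  the correspondence u v \<mapsto> w v well defined and isometric, and completeness extends
  it.\<close>

lemma dense_unitary:
  fixes u :: "'v::complex_vector \<Rightarrow> 'h" and w :: "'v \<Rightarrow> 'k"
  assumes H: "hilbert_space H" and K: "hilbert_space K"
    and u: "\<And>v. u v \<in> hcarrier H" "\<And>v v'. u (v + v') = hadd H (u v) (u v')" "\<And>c v. u (c *\<^sub>C v) = hscale H c (u v)"
    and w: "\<And>v. w v \<in> hcarrier K" "\<And>v v'. w (v + v') = hadd K (w v) (w v')" "\<And>c v. w (c *\<^sub>C v) = hscale K c (w v)"
    and ip: "\<And>v v'. hinner H (u v) (u v') = hinner K (w v) (w v')"
    and du: "hperp H (range u) = {hzero H}" and dw: "hperp K (range w) = {hzero K}"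
  obtains U where "unitary H K U" "\<And>v. U (u v) = w v"
    "\<And>h v. h \<in> hcarrier H \<Longrightarrow> hinner K (w v) (U h) = hinner H (u v) h"
proof -
  interpret H: hilbert_space H by fact
  interpret K: hilbert_space K by fact
  have subspace: "hsubspace L (range f)"
    if "hilbert_space L" "\<And>v. f v \<in> hcarrier L" "\<And>v v'. f (v + v') = hadd L (f v) (f v')" "\<And>c v. f (c *\<^sub>C v) = hscale L c (f v)"
    for L :: "'l hilbert" and f :: "'v \<Rightarrow> 'l"
  proof -
    have "hzero L = f 0" using that(4)[of 0 0] hilbert_space.scale_zero[OF that(1) that(2)] by simp
    then show ?thesis using that(2) unfolding hsubspace_def by (auto simp flip: that(3,4))
  qed
  have zero_diff: "hdist L (f v) (f v') = hnorm L (f (v - v'))"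
    if "\<And>v v'. f (v + v') = hadd L (f v) (f v')" "\<And>c v. f (c *\<^sub>C v) = hscale L c (f v)"
    for L :: "'l hilbert" and f :: "'v \<Rightarrow> 'l" and v v'
    using that(1)[of v "(-1) *\<^sub>C v'"] by (simp add: hdist_def that(2)[symmetric] scaleC_minus_one)
  have uniq: "k = k'" if "k \<in> hcarrier K" "k' \<in> hcarrier K" "\<And>v. hinner K (w v) k = hinner K (w v) k'" for k k'
  proof -
    have "hsub K k k' \<in> hperp K (range w)" using that by (auto simp: hperp_def K.inner_hsub_right w(1))
    then show ?thesis using dw K.hsub_eq_zero that by simp
  qed
  have ex: "\<exists>k\<in>hcarrier K. \<exists>a. (\<forall>v. hinner K (w v) k = hinner H (u v) h) \<and>
     (\<lambda>n. hdist H (u (a n)) h) \<longlonglongrightarrow> 0 \<and> (\<lambda>n. hdist K (w (a n)) k) \<longlonglongrightarrow> 0" if h: "h \<in> hcarrier H" for h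
  proof -
    obtain s where s: "\<And>n. s n \<in> range u" "(\<lambda>n. hdist H (s n) h) \<longlonglongrightarrow> 0"
      using H.dense_approx[OF subspace[OF H u] du h] by blast
    have "\<forall>n. \<exists>a. s n = u a" using s(1) by blast
    then obtain a where "\<forall>n. s n = u (a n)" by (rule choice[THEN exE])
    then have a: "s = (\<lambda>n. u (a n))" by auto
    have lim: "(\<lambda>n. hdist H (u (a n)) h) \<longlonglongrightarrow> 0" using s(2) by (simp add: a)
    have dd: "hdist K (w v) (w v') = hdist H (u v) (u v')" for v v'
      by (simp add: zero_diff[OF u(2,3)] zero_diff[OF w(2,3)] hnorm_def ip)
    obtain k where k: "k \<in> hcarrier K" "(\<lambda>n. hdist K (w (a n)) k) \<longlonglongrightarrow> 0"
      using K.complete[of "\<lambda>n. w (a n)"] w(1) H.convergent_Cauchy[OF u(1) h lim] unfolding dd by blast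
    have "hinner K (w v) k = hinner H (u v) h" for v
    proof (rule LIMSEQ_unique)
      show "(\<lambda>n. hinner K (w v) (w (a n))) \<longlonglongrightarrow> hinner K (w v) k"
        by (rule K.inner_tendsto(1)) (use k w in auto)
      show "(\<lambda>n. hinner K (w v) (w (a n))) \<longlonglongrightarrow> hinner H (u v) h"
        unfolding ip[symmetric] by (rule H.inner_tendsto(1)) (use h u lim in auto)
    qed
    then show ?thesis using k lim by blast
  qed
  \<comment> \<open>The image of h is determined by its inner products with the dense range of w;
    additivity and homogeneity of \<open>U\<close> then follow from uniqueness.\<close>
  define U where "U h = (SOME k. k \<in> hcarrier K \<and> (\<forall>v. hinner K (w v) k = hinner H (u v) h))" for h
  have U0: "U h \<in> hcarrier K \<and> (\<forall>v. hinner K (w v) (U h) = hinner H (u v) h)" if "h \<in> hcarrier H" for h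
    unfolding U_def by (rule someI_ex) (use ex[OF that] in blast)
  then have U: "U h \<in> hcarrier K" "hinner K (w v) (U h) = hinner H (u v) h" if "h \<in> hcarrier H" for h v
    using that by auto
  have Uu: "U (u v) = w v" for v
    by (rule uniq) (use U u w ip in auto)
  have Uip: "hinner K (U h) (U k) = hinner H h k" if hk: "h \<in> hcarrier H" "k \<in> hcarrier H" for h k
  proof -
    obtain k' a where a: "k' \<in> hcarrier K" "\<And>v. hinner K (w v) k' = hinner H (u v) h"
      "(\<lambda>n. hdist H (u (a n)) h) \<longlonglongrightarrow> 0" "(\<lambda>n. hdist K (w (a n)) k') \<longlonglongrightarrow> 0"
      using ex[OF hk(1)] by blast
    have "k' = U h" by (rule uniq) (use U hk a in auto)
    then have "(\<lambda>n. hinner K (w (a n)) (U k)) \<longlonglongrightarrow> hinner K (U h) (U k)"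
      using a(1,4) by (intro K.inner_tendsto(2) w U hk) auto
    moreover have "(\<lambda>n. hinner K (w (a n)) (U k)) \<longlonglongrightarrow> hinner H h k"
      unfolding U(2)[OF hk(2)] by (intro H.inner_tendsto(2) u hk a)
    ultimately show ?thesis by (rule LIMSEQ_unique)
  qed
  have add: "U (hadd H h k) = hadd K (U h) (U k)" if "h \<in> hcarrier H" "k \<in> hcarrier H" for h k
    by (rule uniq) (use that U u w in \<open>auto simp: K.inner_add_right H.inner_add_right\<close>)
  have scale: "U (hscale H c h) = hscale K c (U h)" if "h \<in> hcarrier H" for h c
    by (rule uniq) (use that U u w in \<open>auto simp: K.inner_scale_right H.inner_scale_right\<close>)
  have inj: "inj_on U (hcarrier H)"
  proof (rule inj_onI)
    fix h k assume hk: "h \<in> hcarrier H" "k \<in> hcarrier H" "U h = U k"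
    then have "hinner H l h = hinner H l k" if "l \<in> hcarrier H" for l
      using Uip[OF that hk(1)] Uip[OF that hk(2)] by simp
    then show "h = k" using hk by (intro H.eqI)
  qed
  have surj: "k \<in> U ` hcarrier H" if k: "k \<in> hcarrier K" for k
  proof -
    obtain s where s: "\<And>n. s n \<in> range w" "(\<lambda>n. hdist K (s n) k) \<longlonglongrightarrow> 0"
      using K.dense_approx[OF subspace[OF K w] dw k] by blast
    have "\<forall>n. \<exists>a. s n = w a" using s(1) by blast
    then obtain a where "\<forall>n. s n = w (a n)" by (rule choice[THEN exE])
    then have a: "s = (\<lambda>n. w (a n))" by auto
    have lim: "(\<lambda>n. hdist K (w (a n)) k) \<longlonglongrightarrow> 0" using s(2) by (simp add: a)
    have dd: "hdist H (u v) (u v') = hdist K (w v) (w v')" for v v'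
      by (simp add: zero_diff[OF u(2,3)] zero_diff[OF w(2,3)] hnorm_def ip)
    obtain h where h: "h \<in> hcarrier H" "(\<lambda>n. hdist H (u (a n)) h) \<longlonglongrightarrow> 0"
      using H.complete[of "\<lambda>n. u (a n)"] u(1) K.convergent_Cauchy[OF w(1) k lim] unfolding dd by blast
    have "U h = k"
    proof (rule uniq)
      fix v
      show "hinner K (w v) (U h) = hinner K (w v) k"
      proof (rule LIMSEQ_unique)
        show "(\<lambda>n. hinner K (w v) (w (a n))) \<longlonglongrightarrow> hinner K (w v) (U h)"
          unfolding U(2)[OF h(1)] ip[symmetric] by (rule H.inner_tendsto(1)) (use h u in auto)
        show "(\<lambda>n. hinner K (w v) (w (a n))) \<longlonglongrightarrow> hinner K (w v) k"
          by (rule K.inner_tendsto(1)) (use k w lim in auto)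
      qed
    qed (use U h k in auto)
    then show ?thesis using h by blast
  qed
  have img: "U ` hcarrier H = hcarrier K" using surj U(1) by blast
  have "unitary H K U"
    by (simp add: unitary_def hlinear_def bij_betw_def add scale inj Uip img)
  then show thesis using that Uu U(2) by blast
qed

text \<open>It suffices that both dense maps respect one action \<open>act\<close> on the
  parameters: an inner product of \<open>\<sigma> a (U h)\<close> with the dense range is computed
  by moving a to the other side as an adjoint.\<close>

lemma dense_intertwiner:
  fixes u :: "'v::complex_vector \<Rightarrow> 'h" and w :: "'v \<Rightarrow> 'k"
  assumes H: "rep H \<pi>" and K: "rep K \<sigma>"
    and u: "\<And>v. u v \<in> hcarrier H" "\<And>v v'. u (v + v') = hadd H (u v) (u v')" "\<And>c v. u (c *\<^sub>C v) = hscale H c (u v)"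
    and w: "\<And>v. w v \<in> hcarrier K" "\<And>v v'. w (v + v') = hadd K (w v) (w v')" "\<And>c v. w (c *\<^sub>C v) = hscale K c (w v)"
    and ip: "\<And>v v'. hinner H (u v) (u v') = hinner K (w v) (w v')"
    and du: "hperp H (range u) = {hzero H}" and dw: "hperp K (range w) = {hzero K}"
    and act: "\<And>a v. \<pi> a (u v) = u (act a v)" "\<And>a v. \<sigma> a (w v) = w (act a v)"
  obtains U where "unitary H K U" "\<And>v. U (u v) = w v" "\<And>a h. h \<in> hcarrier H \<Longrightarrow> U (\<pi> a h) = \<sigma> a (U h)"
proof -
  interpret H: rep H \<pi> by fact
  interpret K: rep K \<sigma> by fact
  obtain U where U: "unitary H K U" "\<And>v. U (u v) = w v"
    "\<And>h v. h \<in> hcarrier H \<Longrightarrow> hinner K (w v) (U h) = hinner H (u v) h"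
    using dense_unitary[OF H.hilbert_space_axioms K.hilbert_space_axioms u w ip du dw] by blast
  have "U (\<pi> a h) = \<sigma> a (U h)" if h: "h \<in> hcarrier H" for a h
  proof -
    have Uh: "U h \<in> hcarrier K" "U (\<pi> a h) \<in> hcarrier K" using unitaryD(1)[OF U(1)] h by auto
    have "hinner K (w v) (U (\<pi> a h)) = hinner K (w v) (\<sigma> a (U h))" for v
    proof -
      have "hinner K (w v) (\<sigma> a (U h)) = hinner K (\<sigma> (star a) (w v)) (U h)"
        using K.adj' w(1) Uh by simp
      also have "\<dots> = hinner H (\<pi> (star a) (u v)) h" by (simp add: act U h)
      also have "\<dots> = hinner H (u v) (\<pi> a h)" using H.adj' u(1) h by simp
      finally show ?thesis using U(3) h by simp
    qed
    then have "hsub K (U (\<pi> a h)) (\<sigma> a (U h)) \<in> hperp K (range w)"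
      using Uh w(1) by (auto simp: hperp_def K.inner_hsub_right)
    then show ?thesis using dw Uh K.hsub_eq_zero[of "U (\<pi> a h)" "\<sigma> a (U h)"] by simp
  qed
  then show thesis using that U by blast
qed

text \<open>Carries a Hilbert space over to the image of an injection. The spectrum and the
  universal property only speak of carriers inside fixed types, so representations found elsewhere
  have to be moved there.\<close>

definition transport :: "'h hilbert \<Rightarrow> ('h \<Rightarrow> 'k) \<Rightarrow> 'k hilbert"
  where "transport H j = (let i = inv_into (hcarrier H) j in
    \<lparr>hcarrier = j ` hcarrier H, hzero = j (hzero H), hadd = (\<lambda>h k. j (hadd H (i h) (i k))),
     hscale = (\<lambda>c h. j (hscale H c (i h))), hinner = (\<lambda>h k. hinner H (i h) (i k))\<rparr>)"

lemma (in hilbert_space) transport: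
  assumes j: "inj_on j (hcarrier H)"
  shows "hilbert_space (transport H j)" "unitary H (transport H j) j"
proof -
  let ?K = "transport H j"
  have ij [simp]: "inv_into (hcarrier H) j (j h) = h" if "h \<in> hcarrier H" for h using j that by simp
  show U: "unitary H ?K j"
    using j by (auto simp: unitary_def hlinear_def transport_def Let_def bij_betw_def)
  have d: "hdist ?K (j h) (j k) = hdist H h k" if "h \<in> hcarrier H" "k \<in> hcarrier H" for h k
    by (rule unitary_hdist[OF U hilbert_space_axioms that])
  show "hilbert_space ?K"
  proof (unfold_locales, goal_cases)
    case (17 s)
    have "\<forall>n. \<exists>h. h \<in> hcarrier H \<and> s n = j h" using 17(1) by (auto simp: transport_def Let_def)
    then obtain t where "\<forall>n. t n \<in> hcarrier H \<and> s n = j (t n)" by (rule choice[THEN exE])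
    then have t: "t n \<in> hcarrier H" "s n = j (t n)" for n by auto
    have "\<exists>h\<in>hcarrier H. (\<lambda>n. hdist H (t n) h) \<longlonglongrightarrow> 0"
      using 17(2) t(1) by (intro complete) (auto simp: t d)
    then obtain h where h: "h \<in> hcarrier H" "(\<lambda>n. hdist H (t n) h) \<longlonglongrightarrow> 0" by blast
    then have "(\<lambda>n. hdist ?K (s n) (j h)) \<longlonglongrightarrow> 0" by (simp add: t d)
    then show ?case using unitaryD(1)[OF U h(1)] by blast
  qed (auto simp: transport_def Let_def add_assoc add_zero add_minus scale_add_right scale_add_left
      scale_scale scale_one inner_add_right inner_scale_right inner_nonneg
      dest: inner_definite intro: inner_commute, simp add: add_commute)
qed

lemma (in rep) transport_rep:
  assumes j: "inj_on j (hcarrier H)"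
  shows "rep (transport H j) (\<lambda>a k. j (\<pi> a (inv_into (hcarrier H) j k)))"
    "unitary H (transport H j) j" "h \<in> hcarrier H \<Longrightarrow> inv_into (hcarrier H) j (j h) = h"
proof -
  let ?K = "transport H j"
  show U: "unitary H ?K j" by (rule transport(2)[OF j])
  note UD = unitaryD[OF U]
  show ij: "inv_into (hcarrier H) j (j h) = h" if "h \<in> hcarrier H" for h using j that by simp
  interpret K: hilbert_space ?K by (rule transport(1)[OF j])
  have all: "\<exists>h\<in>hcarrier H. k = j h" if "k \<in> hcarrier ?K" for k using UD(6) that by blast
  show "rep ?K (\<lambda>a k. j (\<pi> a (inv_into (hcarrier H) j k)))"
  proof (rule repI)
    show "\<exists>M. \<forall>k\<in>hcarrier ?K. hnorm ?K (j (\<pi> a (inv_into (hcarrier H) j k))) \<le> M * hnorm ?K k" for a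
      using op_norm UD(7) all by (intro exI[of _ "norm a"]) (force simp: ij)
  qed (use UD(1) in \<open>auto simp: K.hilbert_space_axioms ij op_add op_scale op_mult adj UD(2) UD(3)[symmetric] UD(4)[symmetric] dest!: all\<close>)
qed

section \<open>Completion of a semi-inner product space\<close>

text \<open>A vector of the completion is represented by the functional \<open>v \<mapsto> \<langle>v, \<phi>\<rangle>\<close> on the original
  space, which makes representatives unique.\<close>

locale semi_inner =
  fixes s :: "'v::complex_vector \<Rightarrow> 'v \<Rightarrow> complex"
  assumes s_add: "s v (w + w') = s v w + s v w'"
    and s_scale: "s v (c *\<^sub>C w) = c * s v w"
    and s_commute: "s w v = cnj (s v w)"
    and s_nonneg: "0 \<le> Re (s v v)"
begin

definition sn :: "'v \<Rightarrow> real" where "sn v = sqrt (Re (s v v))"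

lemma s_add_left: "s (v + v') w = s v w + s v' w"
  by (metis s_commute s_add complex_cnj_add)

lemma s_scale_left: "s (c *\<^sub>C v) w = cnj c * s v w"
  by (metis s_commute s_scale complex_cnj_mult)

lemma s_minus: "s v (- w) = - s v w" and s_minus_left: "s (- v) w = - s v w"
  using s_scale[of v "-1" w] s_scale_left[of "-1" v w] by (simp_all add: scaleC_minus_one)

lemma s_diff: "s v (w - w') = s v w - s v w'" and s_diff_left: "s (v - v') w = s v w - s v' w"
  using s_add[of v w "- w'"] s_add_left[of v "- v'" w] by (simp_all add: s_minus s_minus_left)

lemmas s_simps = s_add s_add_left s_scale s_scale_left s_minus s_minus_left s_diff s_diff_left

lemma sn_sq: "(sn v)\<^sup>2 = Re (s v v)" and sn_nonneg [simp]: "0 \<le> sn v"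
  using s_nonneg[of v] by (simp_all add: sn_def)

lemma s_self: "s v v = of_real ((sn v)\<^sup>2)"
  using s_commute[of v v] by (simp add: complex_eq_iff sn_sq del: of_real_power)

lemma s_cauchy_schwarz: "cmod (s v w) \<le> sn v * sn w"
proof -
  let ?z = "s w v"
  have key: "0 \<le> (sn v)\<^sup>2 - 2 * t * (cmod ?z)\<^sup>2 + t\<^sup>2 * (cmod ?z)\<^sup>2 * (sn w)\<^sup>2" for t :: real
  proof -
    have "0 \<le> Re (s (v - (of_real t * ?z) *\<^sub>C w) (v - (of_real t * ?z) *\<^sub>C w))" by (rule s_nonneg)
    also have "s (v - (of_real t * ?z) *\<^sub>C w) (v - (of_real t * ?z) *\<^sub>C w)
      = s v v - 2 * of_real t * (?z * cnj ?z) + (of_real t)\<^sup>2 * (?z * cnj ?z) * s w w"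
      using s_commute[of v w] by (simp add: s_simps algebra_simps power2_eq_square)
    also have "\<dots> = of_real ((sn v)\<^sup>2 - 2 * t * (cmod ?z)\<^sup>2 + t\<^sup>2 * (cmod ?z)\<^sup>2 * (sn w)\<^sup>2)"
      unfolding complex_norm_square[symmetric] s_self by simp
    finally show ?thesis by simp
  qed
  have "(cmod ?z)\<^sup>2 \<le> (sn v)\<^sup>2 * (sn w)\<^sup>2"
  proof (cases "sn w = 0")
    case False
    have "2 * (1 / (sn w)\<^sup>2) * (cmod ?z)\<^sup>2 - (1 / (sn w)\<^sup>2)\<^sup>2 * (cmod ?z)\<^sup>2 * (sn w)\<^sup>2 = (cmod ?z)\<^sup>2 / (sn w)\<^sup>2"
      using False by (simp add: field_simps power2_eq_square)
    then have "(cmod ?z)\<^sup>2 / (sn w)\<^sup>2 \<le> (sn v)\<^sup>2" using key[of "1 / (sn w)\<^sup>2"] by linarith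
    then show ?thesis using False by (simp add: field_simps)
  next
    case True
    have "(cmod ?z)\<^sup>2 = 0"
    proof (rule ccontr)
      assume "(cmod ?z)\<^sup>2 \<noteq> 0"
      then have "2 * (((sn v)\<^sup>2 + 1) / (2 * (cmod ?z)\<^sup>2)) * (cmod ?z)\<^sup>2 = (sn v)\<^sup>2 + 1" by simp
      then show False using key[of "((sn v)\<^sup>2 + 1) / (2 * (cmod ?z)\<^sup>2)"] unfolding True by simp
    qed
    then show ?thesis by simp
  qed
  then have "(cmod ?z)\<^sup>2 \<le> (sn v * sn w)\<^sup>2" by (simp add: power_mult_distrib)
  then have "cmod ?z \<le> sn v * sn w" by (rule power2_le_imp_le) simp
  then show ?thesis using s_commute[of v w] by simp
qed

lemma sn_triangle: "sn (v + w) \<le> sn v + sn w"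
proof -
  have "(sn (v + w))\<^sup>2 = (sn v)\<^sup>2 + (sn w)\<^sup>2 + 2 * Re (s v w)"
    using s_commute[of v w] by (simp add: sn_sq s_simps)
  also have "\<dots> \<le> (sn v)\<^sup>2 + (sn w)\<^sup>2 + 2 * (sn v * sn w)"
    using s_cauchy_schwarz[of v w] complex_Re_le_cmod[of "s v w"] by linarith
  also have "\<dots> = (sn v + sn w)\<^sup>2" by (simp add: power2_sum)
  finally show ?thesis by (rule power2_le_imp_le) simp
qed

lemma sn_diff_triangle: "sn (u - w) \<le> sn (u - v) + sn (v - w)"
  using sn_triangle[of "u - v" "v - w"] by simp

definition sCauchy :: "(nat \<Rightarrow> 'v) \<Rightarrow> bool"
  where "sCauchy u \<longleftrightarrow> (\<forall>e>0. \<exists>N. \<forall>m\<ge>N. \<forall>n\<ge>N. sn (u m - u n) < e)"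

definition represents :: "(nat \<Rightarrow> 'v) \<Rightarrow> ('v \<Rightarrow> complex) \<Rightarrow> bool"
  where "represents u \<phi> \<longleftrightarrow> sCauchy u \<and> (\<forall>v. (\<lambda>n. s v (u n)) \<longlonglongrightarrow> \<phi> v)"

text \<open>A chosen Cauchy sequence fixes the inner product; \<open>completion_inner\<close> shows
  that every other one gives the same value.\<close>

definition some_seq :: "('v \<Rightarrow> complex) \<Rightarrow> nat \<Rightarrow> 'v"
  where "some_seq \<phi> = (SOME u. represents u \<phi>)"

definition completion :: "('v \<Rightarrow> complex) hilbert"
  where "completion = \<lparr>hcarrier = {\<phi>. \<exists>u. represents u \<phi>}, hzero = (\<lambda>_. 0),
    hadd = (\<lambda>\<phi> \<psi> v. \<phi> v + \<psi> v), hscale = (\<lambda>c \<phi> v. c * \<phi> v),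
    hinner = (\<lambda>\<phi> \<psi>. lim (\<lambda>n. \<psi> (some_seq \<phi> n)))\<rparr>"

definition incl :: "'v \<Rightarrow> 'v \<Rightarrow> complex" where "incl v w = s w v"

lemma sCauchyD: "sCauchy u \<Longrightarrow> e > 0 \<Longrightarrow> \<exists>N. \<forall>m\<ge>N. \<forall>n\<ge>N. sn (u m - u n) < e"
  by (simp add: sCauchy_def)

lemma sCauchy_bounded:
  assumes "sCauchy u"
  obtains B where "B > 0" "\<And>n. sn (u n) \<le> B"
proof -
  obtain N where N: "\<And>m n. m \<ge> N \<Longrightarrow> n \<ge> N \<Longrightarrow> sn (u m - u n) < 1" using sCauchyD[OF assms, of 1] by auto
  define B where "B = Max ((\<lambda>n. sn (u n)) ` {..N}) + 1"
  have *: "sn (u n) \<le> Max ((\<lambda>n. sn (u n)) ` {..N})" if "n \<le> N" for n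
    by (rule Max_ge) (use that in auto)
  have "sn (u n) \<le> B" for n
  proof (cases "n \<le> N")
    case True then show ?thesis using * by (simp add: B_def add_increasing2)
  next
    case False
    then have "sn (u n - u N) < 1" using N by simp
    then show ?thesis using sn_triangle[of "u n - u N" "u N"] *[OF order_refl]
      unfolding B_def diff_add_cancel by linarith
  qed
  moreover have "B > 0" using order_trans[OF sn_nonneg *[of 0]] unfolding B_def by simp
  ultimately show thesis using that by blast
qed

lemma represents_converges:
  assumes "sCauchy u"
  obtains \<phi> where "represents u \<phi>"
proof -
  have "convergent (\<lambda>n. s v (u n))" for v
  proof (rule Cauchy_convergent, rule CauchyI)
    fix e :: real assume e: "0 < e"
    have "e / (sn v + 1) > 0" using e by (simp add: add_nonneg_pos)
    then obtain N where N: "\<forall>m\<ge>N. \<forall>n\<ge>N. sn (u m - u n) < e / (sn v + 1)" using sCauchyD[OF assms] by blast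
    have "norm (s v (u m) - s v (u n)) < e" if "m \<ge> N" "n \<ge> N" for m n
    proof -
      have "norm (s v (u m) - s v (u n)) \<le> sn v * sn (u m - u n)"
        using s_cauchy_schwarz[of v "u m - u n"] by (simp add: s_diff)
      also have "\<dots> \<le> (sn v + 1) * sn (u m - u n)" by (intro mult_right_mono) auto
      also have "\<dots> < e" using N that by (simp add: pos_less_divide_eq add_nonneg_pos mult.commute)
      finally show ?thesis .
    qed
    then show "\<exists>M. \<forall>m\<ge>M. \<forall>n\<ge>M. norm (s v (u m) - s v (u n)) < e" by blast
  qed
  then have "represents u (\<lambda>v. lim (\<lambda>n. s v (u n)))"
    using assms by (simp add: represents_def convergent_LIMSEQ_iff)
  then show thesis using that by blast
qed

text \<open>The convergence is uniform in v relative to \<open>sn v\<close>, which allows v to run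
  along with n in \<open>represents_pair\<close>.\<close>

lemma represents_close:
  assumes u: "represents u \<phi>" and e: "e > 0"
  obtains N where "\<And>n v. n \<ge> N \<Longrightarrow> cmod (\<phi> v - s v (u n)) \<le> sn v * e"
proof -
  obtain N where N: "\<forall>m\<ge>N. \<forall>n\<ge>N. sn (u m - u n) < e" using u e by (auto simp: represents_def dest: sCauchyD)
  have "cmod (\<phi> v - s v (u n)) \<le> sn v * e" if "n \<ge> N" for n v
  proof (rule Lim_bounded)
    have "(\<lambda>m. s v (u m)) \<longlonglongrightarrow> \<phi> v" using u by (simp add: represents_def)
    then show "(\<lambda>m. cmod (s v (u m) - s v (u n))) \<longlonglongrightarrow> cmod (\<phi> v - s v (u n))" by (intro tendsto_intros)
    show "\<forall>m\<ge>N. cmod (s v (u m) - s v (u n)) \<le> sn v * e"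
    proof (intro allI impI)
      fix m assume "m \<ge> N"
      then have "sn v * sn (u m - u n) \<le> sn v * e" using N that by (intro mult_left_mono) (auto intro: less_imp_le)
      then show "cmod (s v (u m) - s v (u n)) \<le> sn v * e"
        using s_cauchy_schwarz[of v "u m - u n"] by (simp add: s_diff)
    qed
  qed
  then show thesis using that by blast
qed

lemma represents_pair:
  assumes u: "sCauchy u" and w: "represents w \<psi>"
  shows "(\<lambda>n. \<psi> (u n) - s (u n) (w n)) \<longlonglongrightarrow> 0"
proof (rule LIMSEQ_I)
  fix e :: real assume e: "0 < e"
  obtain B where B: "B > 0" "\<And>n. sn (u n) \<le> B" using sCauchy_bounded[OF u] by blast
  obtain N where N: "\<And>n v. n \<ge> N \<Longrightarrow> cmod (\<psi> v - s v (w n)) \<le> sn v * (e / (2 * B))"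
    using represents_close[OF w, of "e / (2 * B)"] e B by auto
  have "norm (\<psi> (u n) - s (u n) (w n) - 0) < e" if "n \<ge> N" for n
  proof -
    have "cmod (\<psi> (u n) - s (u n) (w n)) \<le> sn (u n) * (e / (2 * B))" using N that by simp
    also have "\<dots> \<le> B * (e / (2 * B))" using B e by (intro mult_right_mono) auto
    also have "\<dots> < e" using B e by simp
    finally show ?thesis by simp
  qed
  then show "\<exists>no. \<forall>n\<ge>no. norm (\<psi> (u n) - s (u n) (w n) - 0) < e" by blast
qed

lemma pair_convergent:
  assumes u: "sCauchy u" and w: "sCauchy w"
  shows "convergent (\<lambda>n. s (u n) (w n))"
proof (rule Cauchy_convergent, rule CauchyI)
  fix e :: real assume e: "0 < e"
  obtain B where B: "B > 0" "\<And>n. sn (u n) \<le> B" using sCauchy_bounded[OF u] by blast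
  obtain C where C: "C > 0" "\<And>n. sn (w n) \<le> C" using sCauchy_bounded[OF w] by blast
  obtain N where N: "\<forall>m\<ge>N. \<forall>n\<ge>N. sn (u m - u n) < e / (2 * C)" using sCauchyD[OF u, of "e / (2 * C)"] e C by auto
  obtain N' where N': "\<forall>m\<ge>N'. \<forall>n\<ge>N'. sn (w m - w n) < e / (2 * B)" using sCauchyD[OF w, of "e / (2 * B)"] e B by auto
  have "norm (s (u m) (w m) - s (u n) (w n)) < e" if "m \<ge> max N N'" "n \<ge> max N N'" for m n
  proof -
    have "s (u m) (w m) - s (u n) (w n) = s (u m - u n) (w m) + s (u n) (w m - w n)" by (simp add: s_simps)
    then have "norm (s (u m) (w m) - s (u n) (w n)) \<le> cmod (s (u m - u n) (w m)) + cmod (s (u n) (w m - w n))"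
      by (metis norm_triangle_ineq)
    also have "\<dots> \<le> sn (u m - u n) * sn (w m) + sn (u n) * sn (w m - w n)" by (intro add_mono s_cauchy_schwarz)
    also have "\<dots> \<le> sn (u m - u n) * C + B * sn (w m - w n)" using B C by (intro add_mono mult_mono) auto
    also have "\<dots> < e / (2 * C) * C + B * (e / (2 * B))"
      using N N' that B C by (intro add_strict_mono mult_strict_right_mono mult_strict_left_mono) auto
    also have "\<dots> = e" using B C by simp
    finally show ?thesis .
  qed
  then show "\<exists>M. \<forall>m\<ge>M. \<forall>n\<ge>M. norm (s (u m) (w m) - s (u n) (w n)) < e" by blast
qed

lemma completion_simps [simp]:
  "hzero completion = (\<lambda>_. 0)" "hadd completion \<phi> \<psi> = (\<lambda>v. \<phi> v + \<psi> v)"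
  "hscale completion c \<phi> = (\<lambda>v. c * \<phi> v)"
  by (simp_all add: completion_def)

lemma completion_carrier: "\<phi> \<in> hcarrier completion \<longleftrightarrow> (\<exists>u. represents u \<phi>)"
  by (simp add: completion_def)

lemma completion_inner:
  assumes u: "represents u \<phi>" and w: "represents w \<psi>"
  shows "(\<lambda>n. \<psi> (u n)) \<longlonglongrightarrow> hinner completion \<phi> \<psi>"
    "(\<lambda>n. s (u n) (w n)) \<longlonglongrightarrow> hinner completion \<phi> \<psi>"
proof -
  have cu: "sCauchy u" and cw: "sCauchy w" using u w by (auto simp: represents_def)
  have step: "\<exists>l. (\<lambda>n. \<psi> (u n)) \<longlonglongrightarrow> l \<and> (\<lambda>n. s (u n) (w n)) \<longlonglongrightarrow> l \<and> (\<lambda>n. \<phi> (w n)) \<longlonglongrightarrow> cnj l"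
    if u: "represents u \<phi>" for u
  proof -
    have cu: "sCauchy u" using u by (simp add: represents_def)
    obtain l where l: "(\<lambda>n. s (u n) (w n)) \<longlonglongrightarrow> l" using pair_convergent[OF cu cw] by (auto simp: convergent_def)
    have 1: "(\<lambda>n. \<psi> (u n)) \<longlonglongrightarrow> l" using tendsto_add[OF represents_pair[OF cu w] l] by simp
    have "(\<lambda>n. s (w n) (u n)) \<longlonglongrightarrow> cnj l"
      unfolding s_commute[of "w _" "u _"] by (intro tendsto_intros l)
    from tendsto_add[OF represents_pair[OF cw u] this] have "(\<lambda>n. \<phi> (w n)) \<longlonglongrightarrow> cnj l" by simp
    with 1 l show ?thesis by blast
  qed
  have sr: "represents (some_seq \<phi>) \<phi>" unfolding some_seq_def by (rule someI[of "\<lambda>u. represents u \<phi>" u]) (rule u)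
  obtain l where l: "(\<lambda>n. \<psi> (u n)) \<longlonglongrightarrow> l" "(\<lambda>n. s (u n) (w n)) \<longlonglongrightarrow> l" "(\<lambda>n. \<phi> (w n)) \<longlonglongrightarrow> cnj l"
    using step[OF u] by blast
  obtain l' where l': "(\<lambda>n. \<psi> (some_seq \<phi> n)) \<longlonglongrightarrow> l'" "(\<lambda>n. \<phi> (w n)) \<longlonglongrightarrow> cnj l'"
    using step[OF sr] by blast
  have "cnj l = cnj l'" using LIMSEQ_unique[OF l(3) l'(2)] .
  then have "l = l'" by simp
  moreover have "hinner completion \<phi> \<psi> = l'" using limI[OF l'(1)] by (simp add: completion_def)
  ultimately show "(\<lambda>n. \<psi> (u n)) \<longlonglongrightarrow> hinner completion \<phi> \<psi>"
    "(\<lambda>n. s (u n) (w n)) \<longlonglongrightarrow> hinner completion \<phi> \<psi>" using l by auto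
qed

lemma represents_add:
  assumes "represents u \<phi>" "represents w \<psi>"
  shows "represents (\<lambda>n. u n + w n) (\<lambda>v. \<phi> v + \<psi> v)"
  unfolding represents_def sCauchy_def
proof (intro conjI allI impI)
  fix e :: real assume e: "e > 0"
  obtain N where N: "\<forall>m\<ge>N. \<forall>n\<ge>N. sn (u m - u n) < e/2" using assms e by (auto simp: represents_def dest: sCauchyD[of _ "e/2"])
  obtain N' where N': "\<forall>m\<ge>N'. \<forall>n\<ge>N'. sn (w m - w n) < e/2" using assms e by (auto simp: represents_def dest: sCauchyD[of _ "e/2"])
  have "sn (u m + w m - (u n + w n)) < e" if "m \<ge> max N N'" "n \<ge> max N N'" for m n
  proof -
    have "sn (u m + w m - (u n + w n)) \<le> sn (u m - u n) + sn (w m - w n)"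
      using sn_triangle[of "u m - u n" "w m - w n"] by (simp add: algebra_simps)
    moreover have "sn (u m - u n) < e/2" "sn (w m - w n) < e/2" using N N' that by auto
    ultimately show ?thesis by linarith
  qed
  then show "\<exists>N. \<forall>m\<ge>N. \<forall>n\<ge>N. sn (u m + w m - (u n + w n)) < e" by blast
next
  show "(\<lambda>n. s v (u n + w n)) \<longlonglongrightarrow> \<phi> v + \<psi> v" for v
    using assms unfolding s_add represents_def by (intro tendsto_intros) auto
qed

lemma represents_scale:
  assumes "represents u \<phi>"
  shows "represents (\<lambda>n. c *\<^sub>C u n) (\<lambda>v. c * \<phi> v)"
  unfolding represents_def sCauchy_def
proof (intro conjI allI impI)
  fix e :: real assume e: "e > 0"
  have "e / (cmod c + 1) > 0" using e by (simp add: add_nonneg_pos)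
  then obtain N where N: "\<forall>m\<ge>N. \<forall>n\<ge>N. sn (u m - u n) < e / (cmod c + 1)"
    using assms by (auto simp: represents_def dest: sCauchyD)
  have "sn (c *\<^sub>C u m - c *\<^sub>C u n) < e" if "m \<ge> N" "n \<ge> N" for m n
  proof -
    have "sn (c *\<^sub>C u m - c *\<^sub>C u n) = cmod c * sn (u m - u n)"
    proof -
      have "(sn (c *\<^sub>C (u m - u n)))\<^sup>2 = Re ((c * cnj c) * s (u m - u n) (u m - u n))"
        by (simp only: sn_sq s_scale s_scale_left mult_ac)
      also have "\<dots> = (cmod c * sn (u m - u n))\<^sup>2"
        unfolding complex_norm_square[symmetric] s_self of_real_mult[symmetric] by (simp only: Re_complex_of_real power_mult_distrib)
      finally show ?thesis by (simp add: power2_eq_iff_nonneg flip: scaleC_diff_right)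
    qed
    also have "\<dots> \<le> (cmod c + 1) * sn (u m - u n)" by (intro mult_right_mono) auto
    also have "\<dots> < e" using N that by (simp add: pos_less_divide_eq add_nonneg_pos mult.commute)
    finally show ?thesis .
  qed
  then show "\<exists>N. \<forall>m\<ge>N. \<forall>n\<ge>N. sn (c *\<^sub>C u m - c *\<^sub>C u n) < e" by blast
next
  show "(\<lambda>n. s v (c *\<^sub>C u n)) \<longlonglongrightarrow> c * \<phi> v" for v
    using assms unfolding s_scale represents_def by (intro tendsto_intros) auto
qed

lemma represents_const: "represents (\<lambda>_. v) (incl v)"
proof -
  have "sn 0 = 0" using s_scale[of 0 0 0] by (simp add: sn_def)
  then show ?thesis by (simp add: represents_def sCauchy_def incl_def)
qed

lemma represents_diff_norm:
  assumes u: "represents u \<phi>" and w: "represents w \<psi>"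
  shows "(\<lambda>n. sn (u n - w n)) \<longlonglongrightarrow> hdist completion \<phi> \<psi>"
proof -
  let ?d = "\<lambda>v. \<phi> v + (-1) * \<psi> v"
  have r: "represents (\<lambda>n. u n + (-1) *\<^sub>C w n) ?d" by (intro represents_add represents_scale u w)
  have "(\<lambda>n. sqrt (cmod (s (u n + (-1) *\<^sub>C w n) (u n + (-1) *\<^sub>C w n)))) \<longlonglongrightarrow> sqrt (cmod (hinner completion ?d ?d))"
    by (intro tendsto_intros completion_inner[OF r r])
  moreover have "sqrt (cmod (s v v)) = sn v" for v by (simp add: s_self norm_power)
  ultimately show ?thesis by (simp add: scaleC_minus_one hdist_def hnorm_def)
qed

lemma represents_norm:
  assumes u: "represents u \<phi>"
  shows "(\<lambda>n. sn (u n)) \<longlonglongrightarrow> hnorm completion \<phi>"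
proof -
  have "(\<lambda>n. sqrt (cmod (s (u n) (u n)))) \<longlonglongrightarrow> sqrt (cmod (hinner completion \<phi> \<phi>))"
    by (intro tendsto_intros completion_inner[OF u u])
  moreover have "sqrt (cmod (s v v)) = sn v" for v by (simp add: s_self norm_power)
  ultimately show ?thesis by (simp add: hnorm_def)
qed

lemma completion_hilbert: "hilbert_space completion"
proof (unfold_locales, goal_cases)
  case 1 then show ?case using represents_scale[OF represents_const[of 0], of 0]
    by (auto simp: completion_carrier)
next
  case (2 h k) then show ?case
    using represents_add unfolding completion_carrier completion_simps by blast
next
  case (3 h c) then show ?case
    using represents_scale unfolding completion_carrier completion_simps by blast
next
  case (12 h k l)
  then obtain u v w where r: "represents u h" "represents v k" "represents w l" by (auto simp: completion_carrier)
  show ?case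
    using completion_inner(1)[OF r(1) represents_add[OF r(2,3)]] LIMSEQ_unique
      tendsto_add[OF completion_inner(1)[OF r(1,2)] completion_inner(1)[OF r(1,3)]] by fastforce
next
  case (13 h k c)
  then obtain u v where r: "represents u h" "represents v k" by (auto simp: completion_carrier)
  show ?case
    using completion_inner(1)[OF r(1) represents_scale[OF r(2)]] LIMSEQ_unique
      tendsto_mult[OF tendsto_const completion_inner(1)[OF r]] by fastforce
next
  case (14 h k)
  then obtain u v where r: "represents u h" "represents v k" by (auto simp: completion_carrier)
  have "(\<lambda>n. s (v n) (u n)) \<longlonglongrightarrow> cnj (hinner completion h k)"
    unfolding s_commute[of "v _" "u _"] by (intro tendsto_intros completion_inner(2) r)
  then show ?case using completion_inner(2)[OF r(2,1)] LIMSEQ_unique by blast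
next
  case (15 h)
  then obtain u where r: "represents u h" by (auto simp: completion_carrier)
  have "(\<lambda>n. Re (s (u n) (u n))) \<longlonglongrightarrow> Re (hinner completion h h)"
    by (intro tendsto_intros completion_inner(2) r)
  then show ?case by (rule LIMSEQ_le_const) (use s_nonneg in auto)
next
  case (16 h)
  then obtain u where r: "represents u h" by (auto simp: completion_carrier)
  have "hnorm completion h = 0" using 16 by (simp add: hnorm_def)
  then have lim: "(\<lambda>n. sn (u n)) \<longlonglongrightarrow> 0" using represents_norm[OF r] by simp
  have "h v = 0" for v
  proof -
    have "(\<lambda>n. sn v * sn (u n)) \<longlonglongrightarrow> sn v * 0" by (intro tendsto_intros lim)
    then have "(\<lambda>n. s v (u n)) \<longlonglongrightarrow> 0"
      unfolding mult_zero_right by (rule null_seq_bound[OF s_cauchy_schwarz])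
    then show ?thesis using r LIMSEQ_unique by (auto simp: represents_def)
  qed
  then show ?case by auto
next
  case (17 \<Phi>)
  have "\<forall>n. \<exists>u. represents u (\<Phi> n)" using 17(1) by (simp add: completion_carrier)
  then obtain U where "\<forall>n. represents (U n) (\<Phi> n)" by (rule choice[THEN exE])
  then have U: "represents (U n) (\<Phi> n)" for n by blast
  have "\<exists>N. \<forall>k\<ge>N. \<forall>l\<ge>N. sn (U m k - U m l) < inverse (real (Suc m))" for m
    using U[of m] by (auto simp: represents_def intro: sCauchyD)
  then have "\<forall>m. \<exists>N. \<forall>k\<ge>N. \<forall>l\<ge>N. sn (U m k - U m l) < inverse (real (Suc m))" by blast
  then obtain N where "\<forall>m. \<forall>k\<ge>N m. \<forall>l\<ge>N m. sn (U m k - U m l) < inverse (real (Suc m))" by (rule choice[THEN exE])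
  then have N: "sn (U m k - U m l) < inverse (real (Suc m))" if "k \<ge> N m" "l \<ge> N m" for m k l
    using that by blast
  \<comment> \<open>A diagonal sequence: v m is within 1 / (m + 1) of the tail of the sequence that
    represents \<Phi> m.\<close>
  define v where "v m = U m (N m)" for m
  have cv: "sCauchy v"
    unfolding sCauchy_def
  proof (intro allI impI)
    fix e :: real assume e: "e > 0"
    obtain N1 where N1: "\<forall>m\<ge>N1. \<forall>n\<ge>N1. hdist completion (\<Phi> m) (\<Phi> n) < e/4" using 17(2)[of "e/4"] e by auto
    obtain N2 where N2: "inverse (real (Suc N2)) < e/4" using reals_Archimedean[of "e/4"] e by auto
    have "sn (v m - v n) < e" if mn: "m \<ge> max N1 N2" "n \<ge> max N1 N2" for m n
    proof -
      have "hdist completion (\<Phi> m) (\<Phi> n) < e/4" using N1 mn by auto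
      then have "\<forall>\<^sub>F k in sequentially. sn (U m k - U n k) < e/4"
        using represents_diff_norm[OF U[of m] U[of n]] order_tendstoD(2) by blast
      then obtain K where K: "\<And>k. k \<ge> K \<Longrightarrow> sn (U m k - U n k) < e/4" by (auto simp: eventually_sequentially)
      define k where "k = max K (max (N m) (N n))"
      have "inverse (real (Suc m)) \<le> inverse (real (Suc N2))" "inverse (real (Suc n)) \<le> inverse (real (Suc N2))"
        using mn by (auto intro!: le_imp_inverse_le)
      moreover have kN: "N m \<le> k" "N n \<le> k" by (simp_all add: k_def)
      ultimately have "sn (v m - U m k) < e/4" "sn (U n k - v n) < e/4"
        using N[OF order_refl kN(1)] N[OF kN(2) order_refl] N2 unfolding v_def by linarith+
      moreover have "sn (U m k - U n k) < e/4" by (rule K) (simp add: k_def)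
      moreover have "sn (v m - v n) \<le> sn (v m - U m k) + (sn (U m k - U n k) + sn (U n k - v n))"
        using sn_diff_triangle[of "v m" "v n" "U m k"] sn_diff_triangle[of "U m k" "v n" "U n k"] by linarith
      ultimately show ?thesis using e by linarith
    qed
    then show "\<exists>N. \<forall>m\<ge>N. \<forall>n\<ge>N. sn (v m - v n) < e" by blast
  qed
  obtain \<phi> where \<phi>: "represents v \<phi>" using represents_converges[OF cv] .
  have "(\<lambda>m. hdist completion (\<Phi> m) \<phi>) \<longlonglongrightarrow> 0"
  proof (rule LIMSEQ_I)
    fix e :: real assume e: "0 < e"
    obtain N1 where N1: "\<forall>m\<ge>N1. \<forall>n\<ge>N1. sn (v m - v n) < e/4" using sCauchyD[OF cv, of "e/4"] e by auto
    obtain N2 where N2: "inverse (real (Suc N2)) < e/4" using reals_Archimedean[of "e/4"] e by auto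
    have "norm (hdist completion (\<Phi> m) \<phi> - 0) < e" if m: "m \<ge> max N1 N2" for m
    proof -
      have "hdist completion (\<Phi> m) \<phi> \<le> e/2"
      proof (rule Lim_bounded[OF represents_diff_norm[OF U[of m] \<phi>]])
        show "\<forall>n\<ge>max N1 (N m). sn (U m n - v n) \<le> e/2"
        proof (intro allI impI)
          fix n assume n: "n \<ge> max N1 (N m)"
          have "inverse (real (Suc m)) \<le> inverse (real (Suc N2))" using m by (auto intro!: le_imp_inverse_le)
          moreover have "N m \<le> n" using n by simp
          ultimately have "sn (U m n - v m) < e/4" using N[OF _ order_refl, of m n] N2 unfolding v_def by linarith
          moreover have "sn (v m - v n) < e/4" using N1 m n by auto
          ultimately show "sn (U m n - v n) \<le> e/2" using sn_diff_triangle[of "U m n" "v n" "v m"] by linarith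
        qed
      qed
      then show ?thesis using e by simp
    qed
    then show "\<exists>no. \<forall>m\<ge>no. norm (hdist completion (\<Phi> m) \<phi> - 0) < e" by blast
  qed
  then show ?case using \<phi> unfolding completion_carrier[symmetric] Bex_def
    using completion_carrier by blast
qed (auto simp: algebra_simps)

lemma incl_closed [simp]: "incl v \<in> hcarrier completion"
  using represents_const by (auto simp: completion_carrier)

lemma incl_inner: "\<psi> \<in> hcarrier completion \<Longrightarrow> hinner completion (incl v) \<psi> = \<psi> v"
  using completion_inner(1)[OF represents_const[of v]] by (auto simp: completion_carrier LIMSEQ_const_iff)

lemma incl_inner_incl: "hinner completion (incl v) (incl w) = s v w"
  using incl_inner[OF incl_closed] by (simp add: incl_def)

lemma incl_dense: "hperp completion (range incl) = {hzero completion}"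
proof -
  have "\<phi> = (\<lambda>_. 0)" if "\<phi> \<in> hperp completion (range incl)" for \<phi>
    using that incl_inner[of \<phi>] by (auto simp: hperp_def)
  moreover have "(\<lambda>_. 0) \<in> hperp completion (range incl)"
    using hilbert_space.zero_closed[OF completion_hilbert] by (simp add: hperp_def incl_inner)
  ultimately show ?thesis unfolding completion_simps by blast
qed

end

section \<open>The Gelfand-Naimark-Segal construction\<close>

text \<open>\<open>F_bound\<close> makes left multiplication bounded for the seminorm of F. In a
  unital algebra \<open>complexify_positive\<close> derives it by conjugating the positive element
  \<open>(norm b)\<^sup>2 *\<^sub>R 1 - star b * b\<close> with a.\<close>

locale positive_functional =
  fixes F :: "'c::cstar_algebra \<Rightarrow> complex"
  assumes F_add: "F (a + b) = F a + F b" and F_scale: "F (c *\<^sub>C a) = c * F a"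
    and F_star: "F (star a) = cnj (F a)"
    and F_nonneg: "0 \<le> Re (F (star a * a))"
    and F_bound: "Re (F (star (b * a) * (b * a))) \<le> (norm b)\<^sup>2 * Re (F (star a * a))"

sublocale positive_functional \<subseteq> semi_inner "\<lambda>a b. F (star a * b)"
proof
  show "F (star w * v) = cnj (F (star v * w))" for v w
    using F_star[of "star v * w"] by (simp add: star_mult star_star)
qed (simp_all add: distrib_left F_add scaleC_mult_right F_scale F_nonneg)

context positive_functional
begin

text \<open>Vectors are functionals v \<mapsto> \<langle>v, \<phi>\<rangle>, so b acts on them
  through its adjoint on the argument.\<close>

definition gns :: "'c \<Rightarrow> ('c \<Rightarrow> complex) \<Rightarrow> 'c \<Rightarrow> complex"
  where "gns b \<phi> v = \<phi> (star b * v)"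

lemma sn_mult: "sn (b * a) \<le> norm b * sn a"
  using F_bound[of b a] real_sqrt_le_mono by (fastforce simp: sn_def real_sqrt_mult)

lemma represents_gns:
  assumes "represents u \<phi>"
  shows "represents (\<lambda>n. b * u n) (gns b \<phi>)"
  unfolding represents_def sCauchy_def
proof (intro conjI allI impI)
  fix e :: real assume e: "e > 0"
  have "e / (norm b + 1) > 0" using e by (simp add: add_nonneg_pos)
  then obtain N where N: "\<forall>m\<ge>N. \<forall>n\<ge>N. sn (u m - u n) < e / (norm b + 1)"
    using assms by (auto simp: represents_def dest: sCauchyD)
  have "sn (b * u m - b * u n) < e" if "m \<ge> N" "n \<ge> N" for m n
  proof -
    have "sn (b * u m - b * u n) \<le> norm b * sn (u m - u n)" using sn_mult[of b "u m - u n"] by (simp add: right_diff_distrib)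
    also have "\<dots> \<le> (norm b + 1) * sn (u m - u n)" by (intro mult_right_mono) auto
    also have "\<dots> < e" using N that by (simp add: pos_less_divide_eq add_nonneg_pos mult.commute)
    finally show ?thesis .
  qed
  then show "\<exists>N. \<forall>m\<ge>N. \<forall>n\<ge>N. sn (b * u m - b * u n) < e" by blast
next
  fix v
  have "(\<lambda>n. F (star (star b * v) * u n)) \<longlonglongrightarrow> \<phi> (star b * v)" using assms by (simp add: represents_def)
  then show "(\<lambda>n. F (star v * (b * u n))) \<longlonglongrightarrow> gns b \<phi> v"
    by (simp add: gns_def star_mult star_star mult.assoc)
qed

lemma gns_incl: "gns b (incl v) = incl (b * v)"
  by (simp add: gns_def incl_def fun_eq_iff star_mult star_star mult.assoc)

lemma gns_rep: "rep completion gns"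
proof (rule repI[OF completion_hilbert])
  fix a b :: 'c and c :: complex and h k :: "'c \<Rightarrow> complex" assume h: "h \<in> hcarrier completion"
  then obtain u where u: "represents u h" by (auto simp: completion_carrier)
  show "gns a h \<in> hcarrier completion" using represents_gns[OF u] by (auto simp: completion_carrier)
  have lin: "h (v + w) = h v + h w" "h (c *\<^sub>C v) = cnj c * h v" for v w c
  proof -
    have L: "(\<lambda>n. F (star x * u n)) \<longlonglongrightarrow> h x" for x using u by (simp add: represents_def)
    show "h (v + w) = h v + h w"
      using LIMSEQ_unique[OF L[of "v + w"]] tendsto_add[OF L[of v] L[of w]] by (simp add: s_add_left)
    show "h (c *\<^sub>C v) = cnj c * h v"
      using LIMSEQ_unique[OF L[of "c *\<^sub>C v"]] tendsto_mult[OF tendsto_const L[of v]] by (simp add: s_scale_left)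
  qed
  show "gns (a + b) h = hadd completion (gns a h) (gns b h)" "gns (c *\<^sub>C a) h = hscale completion c (gns a h)"
    "gns (a * b) h = gns a (gns b h)"
    by (simp_all add: gns_def fun_eq_iff star_add star_scaleC star_mult distrib_right scaleC_mult_left lin mult.assoc)
  show "hinner completion (gns a h) k = hinner completion h (gns (star a) k)" if k: "k \<in> hcarrier completion"
  proof -
    obtain w where w: "represents w k" using k by (auto simp: completion_carrier)
    show ?thesis
      using completion_inner(1)[OF represents_gns[OF u, of a] w] completion_inner(1)[OF u represents_gns[OF w, of "star a"]]
        LIMSEQ_unique by (fastforce simp: gns_def star_star)
  qed
next
  show "\<exists>M. \<forall>h\<in>hcarrier completion. hnorm completion (gns a h) \<le> M * hnorm completion h" for a
  proof (intro exI ballI)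
    fix h assume "h \<in> hcarrier completion"
    then obtain u where u: "represents u h" by (auto simp: completion_carrier)
    show "hnorm completion (gns a h) \<le> norm a * hnorm completion h"
    proof (rule LIMSEQ_le[OF represents_norm[OF represents_gns[OF u]]])
      show "(\<lambda>n. norm a * sn (u n)) \<longlonglongrightarrow> norm a * hnorm completion h"
        by (intro tendsto_intros represents_norm u)
    qed (use sn_mult in auto)
  qed
qed

end

section \<open>Extreme dominated functionals\<close>

definition sublinear :: "('v::real_vector \<Rightarrow> real) \<Rightarrow> bool"
  where "sublinear p \<longleftrightarrow> (\<forall>x y. p (x + y) \<le> p x + p y) \<and> (\<forall>r>0. \<forall>x. p (r *\<^sub>R x) \<le> r * p x)"

text \<open>The functionals below \<open>q\<close> form a face of the set of functionals below \<open>p\<close>.\<close>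

definition facial :: "('v::real_vector \<Rightarrow> real) \<Rightarrow> ('v \<Rightarrow> real) \<Rightarrow> bool"
  where "facial p q \<longleftrightarrow> sublinear q \<and> q \<le> p \<and>
    (\<forall>g h t. linear g \<longrightarrow> linear h \<longrightarrow> g \<le> p \<longrightarrow> h \<le> p \<longrightarrow> 0 < t \<longrightarrow> t < 1 \<longrightarrow>
      (\<lambda>x. t * g x + (1 - t) * h x) \<le> q \<longrightarrow> g \<le> q \<and> h \<le> q)"

text \<open>The linear functionals below it are those f \<le> q with f a = q a: for them f x = f (x
  + t a) - t q a.\<close>

definition restrict_face :: "('v::real_vector \<Rightarrow> real) \<Rightarrow> 'v \<Rightarrow> 'v \<Rightarrow> real"
  where "restrict_face q a x = Inf {q (x + t *\<^sub>R a) - t * q a |t. t \<ge> 0}"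

lemma sublinearD:
  assumes "sublinear p"
  shows "p (x + y) \<le> p x + p y" "r > 0 \<Longrightarrow> p (r *\<^sub>R x) = r * p x" "p 0 = 0" "- p (- x) \<le> p x"
proof -
  show 1: "p (x + y) \<le> p x + p y" for x y using assms by (simp add: sublinear_def)
  have le: "r > 0 \<Longrightarrow> p (r *\<^sub>R x) \<le> r * p x" for r x using assms by (simp add: sublinear_def)
  show "r > 0 \<Longrightarrow> p (r *\<^sub>R x) = r * p x"
    using le[of r x] le[of "inverse r" "r *\<^sub>R x"] by (simp add: field_simps)
  show 0: "p 0 = 0" using 1[of 0 0] le[of "1/2" 0] by simp
  show "- p (- x) \<le> p x" using 1[of x "- x"] 0 by simp
qed

lemma facialD:
  assumes "facial p q"
  shows "sublinear q" "q \<le> p" "linear g \<Longrightarrow> linear h \<Longrightarrow> g \<le> p \<Longrightarrow> h \<le> p \<Longrightarrow> 0 < t \<Longrightarrow> t < 1 \<Longrightarrow>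
      (\<lambda>x. t * g x + (1 - t) * h x) \<le> q \<Longrightarrow> g \<le> q \<and> h \<le> q"
  using assms unfolding facial_def by blast+

lemma restrict_face:
  assumes q: "sublinear q"
  shows "t \<ge> 0 \<Longrightarrow> restrict_face q a x \<le> q (x + t *\<^sub>R a) - t * q a"
    "(\<And>t. t \<ge> 0 \<Longrightarrow> c \<le> q (x + t *\<^sub>R a) - t * q a) \<Longrightarrow> c \<le> restrict_face q a x"
    "restrict_face q a \<le> q" "restrict_face q a (- a) \<le> - q a" "sublinear (restrict_face q a)"
proof -
  note qD = sublinearD[OF q]
  have lower: "- q (- x) \<le> q (x + t *\<^sub>R a) - t * q a" if "t \<ge> 0" for t x
  proof -
    have "q (t *\<^sub>R a) = t * q a" using qD(2,3) that by (cases "t = 0") auto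
    then show ?thesis using qD(1)[of "x + t *\<^sub>R a" "- x"] by (simp add: algebra_simps)
  qed
  show 1: "t \<ge> 0 \<Longrightarrow> restrict_face q a x \<le> q (x + t *\<^sub>R a) - t * q a" for t x
    unfolding restrict_face_def by (rule cInf_lower) (auto intro!: bdd_belowI[of _ "- q (- x)"] lower)
  show 2: "c \<le> restrict_face q a x" if "\<And>t. t \<ge> 0 \<Longrightarrow> c \<le> q (x + t *\<^sub>R a) - t * q a" for c x
    unfolding restrict_face_def
    by (rule cInf_greatest) (use that in \<open>auto intro: exI[of _ "0::real"]\<close>)
  show "restrict_face q a \<le> q" using 1[of 0] by (auto simp: le_fun_def)
  show "restrict_face q a (- a) \<le> - q a" using 1[of 1 "- a"] qD(3) by simp
  show "sublinear (restrict_face q a)"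
    unfolding sublinear_def
  proof (intro conjI allI impI)
    fix x y
    have "restrict_face q a (x + y) \<le> (q (x + t *\<^sub>R a) - t * q a) + (q (y + s *\<^sub>R a) - s * q a)"
      if "t \<ge> 0" "s \<ge> 0" for t s
    proof -
      have "restrict_face q a (x + y) \<le> q (x + y + (t + s) *\<^sub>R a) - (t + s) * q a"
        using 1[of "t + s"] that by simp
      moreover have "q (x + y + (t + s) *\<^sub>R a) \<le> q (x + t *\<^sub>R a) + q (y + s *\<^sub>R a)"
        using qD(1)[of "x + t *\<^sub>R a" "y + s *\<^sub>R a"] by (simp add: algebra_simps)
      ultimately show ?thesis by (simp add: algebra_simps)
    qed
    then have "restrict_face q a (x + y) - (q (y + s *\<^sub>R a) - s * q a) \<le> restrict_face q a x" if "s \<ge> 0" for s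
      using that by (intro 2) (force simp: algebra_simps)
    then have "restrict_face q a (x + y) - restrict_face q a x \<le> restrict_face q a y"
      by (intro 2) (force simp: algebra_simps)
    then show "restrict_face q a (x + y) \<le> restrict_face q a x + restrict_face q a y" by simp
  next
    fix r :: real and x assume r: "0 < r"
    have "restrict_face q a (r *\<^sub>R x) / r \<le> restrict_face q a x"
    proof (rule 2)
      fix t :: real assume t: "t \<ge> 0"
      have "restrict_face q a (r *\<^sub>R x) \<le> q (r *\<^sub>R x + (r * t) *\<^sub>R a) - (r * t) * q a"
        using r t by (intro 1) simp
      also have "q (r *\<^sub>R x + (r * t) *\<^sub>R a) = r * q (x + t *\<^sub>R a)"
        using qD(2)[OF r, of "x + t *\<^sub>R a"] by (simp add: scaleR_add_right)
      finally show "restrict_face q a (r *\<^sub>R x) / r \<le> q (x + t *\<^sub>R a) - t * q a"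
        using r by (simp add: field_simps)
    qed
    then show "restrict_face q a (r *\<^sub>R x) \<le> r * restrict_face q a x" using r by (simp add: field_simps)
  qed
qed

lemma facial_restrict_face:
  assumes pq: "facial p q"
  shows "facial p (restrict_face q a)"
  unfolding facial_def
proof (intro conjI allI impI)
  have q: "sublinear q" "q \<le> p" using facialD[OF pq] by auto
  show "sublinear (restrict_face q a)" by (rule restrict_face(5)[OF q(1)])
  show "restrict_face q a \<le> p" using restrict_face(3)[OF q(1)] q(2) by (rule order_trans)
  fix g h :: "'a \<Rightarrow> real" and t :: real
  assume gh: "linear g" "linear h" "g \<le> p" "h \<le> p" and t: "0 < t" "t < 1"
    and le: "(\<lambda>x. t * g x + (1 - t) * h x) \<le> restrict_face q a"
  have "(\<lambda>x. t * g x + (1 - t) * h x) \<le> q" using le restrict_face(3)[OF q(1)] by (rule order_trans)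
  then have ghq: "g \<le> q" "h \<le> q" using facialD(3)[OF pq gh t] by auto
  have "t * g (- a) + (1 - t) * h (- a) \<le> - q a"
    using le restrict_face(4)[OF q(1), of a] order_trans by (fastforce simp: le_fun_def)
  then have ge: "q a \<le> t * g a + (1 - t) * h a" by (simp add: linear_neg[OF gh(1)] linear_neg[OF gh(2)])
  have ga: "g a \<le> q a" and ha: "h a \<le> q a" using ghq by (auto simp: le_fun_def)
  have "t * g a \<le> t * q a" "(1 - t) * h a \<le> (1 - t) * q a" using ga ha t by (auto intro: mult_left_mono)
  then have "t * q a \<le> t * g a" "(1 - t) * q a \<le> (1 - t) * h a" using ge by (auto simp: algebra_simps)
  then have eq: "g a = q a" "h a = q a" using ga ha t by auto
  have "k \<le> restrict_face q a" if k: "linear k" "k \<le> q" "k a = q a" for k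
  proof (intro le_funI restrict_face(2)[OF q(1)])
    fix x and s :: real assume "s \<ge> 0"
    have "k x = k (x + s *\<^sub>R a) - s * k a" using k(1) by (simp add: linear_add linear_scale)
    also have "\<dots> \<le> q (x + s *\<^sub>R a) - s * q a" using k by (simp add: le_fun_def)
    finally show "k x \<le> q (x + s *\<^sub>R a) - s * q a" .
  qed
  then show "g \<le> restrict_face q a" "h \<le> restrict_face q a" using gh ghq eq by auto
qed

text \<open>Lower bounds of chains for Zorn's lemma. Subadditivity uses comparability: values of two
  members are bounded below by those of the smaller one.\<close>

lemma facial_chain_Inf:
  assumes C: "C \<noteq> {}" "\<And>q. q \<in> C \<Longrightarrow> facial p q" "\<And>q r. q \<in> C \<Longrightarrow> r \<in> C \<Longrightarrow> q \<le> r \<or> r \<le> q"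
  shows "facial p (\<lambda>x. INF q\<in>C. q x)" "q \<in> C \<Longrightarrow> (\<lambda>x. INF q\<in>C. q x) \<le> q"
proof -
  let ?i = "\<lambda>x. INF q\<in>C. q x"
  have bdd: "bdd_below ((\<lambda>q. q x) ` C)" for x
  proof (intro bdd_belowI2)
    fix q assume q: "q \<in> C"
    have "- q (- x) \<le> q x" by (rule sublinearD(4)[OF facialD(1)[OF C(2)[OF q]]])
    moreover have "q (- x) \<le> p (- x)" using facialD(2)[OF C(2)[OF q]] by (simp add: le_fun_def)
    ultimately show "- p (- x) \<le> q x" by linarith
  qed
  have low: "?i x \<le> q x" if "q \<in> C" for q x by (rule cINF_lower[OF bdd that])
  then show iq: "q \<in> C \<Longrightarrow> ?i \<le> q" for q by (auto simp: le_fun_def)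
  have great: "c \<le> ?i x" if "\<And>q. q \<in> C \<Longrightarrow> c \<le> q x" for c x
    by (rule cINF_greatest[OF C(1)]) (rule that)
  show "facial p ?i"
    unfolding facial_def
  proof (intro conjI allI impI)
    show "sublinear ?i"
      unfolding sublinear_def
    proof (intro conjI allI impI)
      fix x y
      have "?i (x + y) \<le> q x + r y" if qr: "q \<in> C" "r \<in> C" for q r
      proof -
        obtain s where s: "s \<in> C" "s \<le> q" "s \<le> r" using C(3)[OF qr] qr by blast
        have "?i (x + y) \<le> s (x + y)" by (rule low[OF s(1)])
        also have "\<dots> \<le> s x + s y" by (rule sublinearD(1)[OF facialD(1)[OF C(2)[OF s(1)]]])
        also have "\<dots> \<le> q x + r y" using s by (auto simp: le_fun_def add_mono)
        finally show ?thesis .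
      qed
      then have "?i (x + y) - r y \<le> ?i x" if "r \<in> C" for r using that by (intro great) (force simp: algebra_simps)
      then have "?i (x + y) - ?i x \<le> ?i y" by (intro great) (force simp: algebra_simps)
      then show "?i (x + y) \<le> ?i x + ?i y" by simp
    next
      fix r :: real and x assume r: "0 < r"
      have "?i (r *\<^sub>R x) / r \<le> ?i x"
      proof (rule great)
        fix q assume q: "q \<in> C"
        have "?i (r *\<^sub>R x) \<le> q (r *\<^sub>R x)" by (rule low[OF q])
        also have "\<dots> = r * q x" by (rule sublinearD(2)[OF facialD(1)[OF C(2)[OF q]] r])
        finally show "?i (r *\<^sub>R x) / r \<le> q x" using r by (simp add: field_simps)
      qed
      then show "?i (r *\<^sub>R x) \<le> r * ?i x" using r by (simp add: field_simps)
    qed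
    obtain q0 where "q0 \<in> C" using C(1) by blast
    then show "?i \<le> p" using iq[of q0] facialD(2)[OF C(2)] order_trans by blast
    fix g h :: "'a \<Rightarrow> real" and t :: real
    assume gh: "linear g" "linear h" "g \<le> p" "h \<le> p" and t: "0 < t" "t < 1"
      and le: "(\<lambda>x. t * g x + (1 - t) * h x) \<le> ?i"
    have "g \<le> q \<and> h \<le> q" if "q \<in> C" for q
      by (rule facialD(3)[OF C(2)[OF that] gh t order_trans[OF le iq[OF that]]])
    then show "g \<le> ?i" "h \<le> ?i" by (auto simp: le_fun_def intro!: great)
  qed
qed

text \<open>Hahn-Banach and Krein-Milman in one. A minimal facial function m below
  \<open>restrict_face p a\<close> equals each of its own restrictions
  \<open>restrict_face m x\<close>, hence m (- x) = - m x and m is linear. Being facial then means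
  being extreme, and m a = p a because m stays below \<open>restrict_face p a\<close>.\<close>

theorem extreme_dominated_functional:
  fixes p :: "'v::real_vector \<Rightarrow> real"
  assumes p: "sublinear p"
  obtains f where "linear f" "f \<le> p" "f a = p a"
    "\<And>g h t. linear g \<Longrightarrow> linear h \<Longrightarrow> g \<le> p \<Longrightarrow> h \<le> p \<Longrightarrow> 0 < t \<Longrightarrow> t < 1 \<Longrightarrow>
      (\<And>x. f x = t * g x + (1 - t) * h x) \<Longrightarrow> g = f"
proof -
  define A where "A = {q. facial p q \<and> q \<le> restrict_face p a}"
  have fp: "facial p p" using p by (auto simp: facial_def)
  have pA: "restrict_face p a \<in> A" using facial_restrict_face[OF fp] by (simp add: A_def)
  let ?P = "\<lambda>q r :: 'v \<Rightarrow> real. r \<le> q"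
  have "\<exists>m\<in>A. \<forall>q\<in>A. ?P m q \<longrightarrow> q = m"
  proof (rule predicate_Zorn)
    show "partial_order_on A (relation_of ?P A)"
      by (rule partial_order_on_relation_ofI) (auto intro: order_trans)
    fix C assume "C \<in> Chains (relation_of ?P A)"
    then have C: "C \<subseteq> A" "\<And>q r. q \<in> C \<Longrightarrow> r \<in> C \<Longrightarrow> q \<le> r \<or> r \<le> q"
      by (auto simp: Chains_def relation_of_def)
    show "\<exists>u\<in>A. \<forall>q\<in>C. ?P q u"
    proof (cases "C = {}")
      case False
      have fC: "facial p q" if "q \<in> C" for q using C that by (auto simp: A_def)
      note inf = facial_chain_Inf[OF False fC C(2)]
      obtain q0 where q0: "q0 \<in> C" using False by blast
      have "(\<lambda>x. INF q\<in>C. q x) \<le> restrict_face p a"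
        using inf(2)[OF _ _ _ q0] q0 C(1) by (auto simp: A_def intro: order_trans)
      then show ?thesis using inf by (intro bexI[of _ "\<lambda>x. INF q\<in>C. q x"]) (auto simp: A_def)
    qed (use pA in auto)
  qed
  then obtain m where m: "m \<in> A" and max: "\<And>q. q \<in> A \<Longrightarrow> q \<le> m \<Longrightarrow> q = m" by blast
  have fm: "facial p m" and mp: "m \<le> p" and ma: "m \<le> restrict_face p a"
    using m facialD(2) by (auto simp: A_def)
  note sm = facialD(1)[OF fm]
  note mD = sublinearD[OF sm]
  have neg: "m (- x) = - m x" for x
  proof -
    have "restrict_face m x \<in> A"
      using facial_restrict_face[OF fm] order_trans[OF restrict_face(3)[OF sm] ma] by (auto simp: A_def)
    then have "restrict_face m x = m" using max restrict_face(3)[OF sm] by blast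
    then have "m (- x) \<le> - m x" using restrict_face(4)[OF sm, of x] by simp
    then show ?thesis using mD(4)[of x] by linarith
  qed
  have lin: "linear m"
  proof (rule linearI)
    fix x y
    show "m (x + y) = m x + m y" using mD(1)[of x y] mD(1)[of "x + y" "- y"] neg[of y] by simp
  next
    fix r :: real and x
    show "m (r *\<^sub>R x) = r *\<^sub>R m x"
      using mD(2)[of r x] mD(2)[of "- r" x] mD(3) neg[of "r *\<^sub>R x"]
      by (cases r "0::real" rule: linorder_cases) auto
  qed
  have ext: "g = m" if gh: "linear g" "linear h" "g \<le> p" "h \<le> p" "0 < t" "t < 1"
    "\<And>x. m x = t * g x + (1 - t) * h x" for g h t
  proof -
    have "g \<le> m" using facialD(3)[OF fm gh(1-6)] gh(7) by (auto simp: le_fun_def)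
    then have "g x \<le> m x" "g (- x) \<le> m (- x)" for x by (auto simp: le_fun_def)
    then show "g = m" using neg gh(1) by (intro ext antisym) (auto simp: linear_neg)
  qed
  have "m (- a) \<le> - p a" using ma restrict_face(4)[OF p, of a] order_trans by (fastforce simp: le_fun_def)
  then have "m a = p a" using neg[of a] mp by (intro antisym) (auto simp: le_fun_def)
  then show thesis using that[OF lin mp] ext by blast
qed

text \<open>Every functional below p', the infimum of p (x - i w) + f w over w, lies below p and
  agrees with f along i; the preceding theorem supplies one.\<close>

lemma dominated_extension:
  fixes p :: "'v::real_vector \<Rightarrow> real" and i :: "'w::real_vector \<Rightarrow> 'v"
  assumes p: "sublinear p" and i: "linear i" and f: "linear f" "\<And>w. f w \<le> p (i w)"
  obtains F where "linear F" "F \<le> p" "\<And>w. F (i w) = f w"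
proof -
  note pD = sublinearD[OF p]
  define p' where "p' x = Inf (range (\<lambda>w. p (x - i w) + f w))" for x
  have low: "- p (- x) \<le> p (x - i w) + f w" for x w
    using pD(1)[of "x - i w" "- x"] f(2)[of "- w"] by (simp add: linear_neg[OF i] linear_neg[OF f(1)])
  have le: "p' x \<le> p (x - i w) + f w" for x w
    unfolding p'_def by (rule cInf_lower) (auto intro!: bdd_belowI[of _ "- p (- x)"] low)
  have ge: "c \<le> p' x" if "\<And>w. c \<le> p (x - i w) + f w" for c x
    unfolding p'_def by (rule cInf_greatest) (use that in auto)
  have "sublinear p'"
    unfolding sublinear_def
  proof (intro conjI allI impI)
    fix x y
    have "p' (x + y) \<le> (p (x - i w) + f w) + (p (y - i v) + f v)" for v w
    proof -
      have "p' (x + y) \<le> p (x + y - i (w + v)) + f (w + v)" by (rule le)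
      also have "x + y - i (w + v) = (x - i w) + (y - i v)" by (simp add: linear_add[OF i])
      also have "p \<dots> \<le> p (x - i w) + p (y - i v)" by (rule pD(1))
      finally show ?thesis by (simp add: linear_add[OF f(1)])
    qed
    then have "p' (x + y) - (p (y - i v) + f v) \<le> p' x" for v by (intro ge) (simp add: algebra_simps)
    then have "p' (x + y) - p' x \<le> p (y - i v) + f v" for v by (smt (verit))
    then have "p' (x + y) - p' x \<le> p' y" by (rule ge)
    then show "p' (x + y) \<le> p' x + p' y" by simp
  next
    fix r :: real and x assume r: "0 < r"
    have "p' (r *\<^sub>R x) / r \<le> p' x"
    proof (rule ge)
      fix w
      have "p' (r *\<^sub>R x) \<le> p (r *\<^sub>R x - i (r *\<^sub>R w)) + f (r *\<^sub>R w)" by (rule le)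
      also have "r *\<^sub>R x - i (r *\<^sub>R w) = r *\<^sub>R (x - i w)" by (simp add: linear_scale[OF i] scaleR_diff_right)
      finally have "p' (r *\<^sub>R x) \<le> r * p (x - i w) + r * f w"
        unfolding pD(2)[OF r] linear_scale[OF f(1)] by simp
      then show "p' (r *\<^sub>R x) / r \<le> p (x - i w) + f w" using r by (simp add: field_simps)
    qed
    then show "p' (r *\<^sub>R x) \<le> r * p' x" using r by (simp add: field_simps)
  qed
  then obtain F where F: "linear F" "F \<le> p'" by (rule extreme_dominated_functional)
  have "F \<le> p" using F(2) le[of _ 0] order_trans by (fastforce simp: le_fun_def linear_0[OF i] linear_0[OF f(1)])
  moreover have "F (i w) = f w" for w
  proof -
    have "F (i v) \<le> f v" for v using F(2) le[of "i v" v] pD(3) order_trans by (fastforce simp: le_fun_def)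
    from this[of w] this[of "- w"] show ?thesis
      by (simp add: linear_neg[OF i] linear_neg[OF F(1)] linear_neg[OF f(1)])
  qed
  ultimately show thesis using that F(1) by blast
qed

section \<open>States modulo an ideal\<close>

definition re_part :: "'u::cstar_algebra \<Rightarrow> 'u"
  where "re_part u = (1/2) *\<^sub>R (u + star u)"

lemma star_re_part [simp]: "star (re_part u) = re_part u"
  by (simp add: re_part_def star_scaleR star_add star_star add.commute)

lemma re_part_selfadjoint: "star u = u \<Longrightarrow> re_part u = u"
  by (simp add: re_part_def flip: scaleR_2)

lemma linear_re_part: "linear re_part"
  by (rule linearI) (simp_all add: re_part_def star_add star_scaleR algebra_simps)

definition complexify :: "('u::complex_vector \<Rightarrow> real) \<Rightarrow> 'u \<Rightarrow> complex"
  where "complexify q u = Complex (q u) (- q (\<i> *\<^sub>C u))"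

lemma complexify_linear:
  assumes q: "linear q"
  shows "complexify q (u + v) = complexify q u + complexify q v" "complexify q (c *\<^sub>C u) = c * complexify q u"
proof -
  show "complexify q (u + v) = complexify q u + complexify q v"
    by (simp add: complexify_def scaleC_add_right linear_add[OF q] complex_eq_iff)
  have s: "q (c *\<^sub>C u) = Re c * q u + Im c * q (\<i> *\<^sub>C u)" for c u
  proof -
    have "c *\<^sub>C u = Re c *\<^sub>R u + Im c *\<^sub>R (\<i> *\<^sub>C u)"
      by (simp add: scaleR_scaleC scaleC_scaleC mult.commute flip: scaleC_add_left complex_eq)
    then show ?thesis by (simp add: linear_add[OF q] linear_scale[OF q])
  qed
  show "complexify q (c *\<^sub>C u) = c * complexify q u"
    using s[of c u] s[of "\<i> * c" u] by (simp add: complexify_def complex_eq_iff scaleC_scaleC)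
qed

lemma complexify_positive:
  fixes q :: "'u::cstar_algebra_1 \<Rightarrow> real"
  assumes q: "linear q" and star: "\<And>u. q (star u) = q u" and pos: "\<And>u. cpos u \<Longrightarrow> 0 \<le> q u"
  shows "positive_functional (complexify q)"
proof
  fix a b :: 'u and c :: complex
  show "complexify q (a + b) = complexify q a + complexify q b" "complexify q (c *\<^sub>C a) = c * complexify q a"
    using complexify_linear[OF q] by auto
  have "\<i> *\<^sub>C star a = star (- (\<i> *\<^sub>C a))" by (simp add: star_scaleC scaleC_minus_left)
  then have "q (\<i> *\<^sub>C star a) = - q (\<i> *\<^sub>C a)" by (simp only: star linear_neg[OF q])
  then show "complexify q (star a) = cnj (complexify q a)" by (simp add: complexify_def star complex_eq_iff)
  show "0 \<le> Re (complexify q (star a * a))" by (simp add: complexify_def pos cpos_star_mult)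
  have "cpos (star a * ((norm b)\<^sup>2 *\<^sub>R 1 - star b * b) * a)" by (rule cpos_conj[OF cpos_norm_sq_minus])
  then have "0 \<le> q (star a * ((norm b)\<^sup>2 *\<^sub>R 1 - star b * b) * a)" by (rule pos)
  then show "Re (complexify q (star (b * a) * (b * a))) \<le> (norm b)\<^sup>2 * Re (complexify q (star a * a))"
    by (simp add: complexify_def star_mult algebra_simps linear_diff[OF q] linear_scale[OF q])
qed

text \<open>The functionals below \<open>ideal_gauge J\<close> are the real parts of the states of the unitization
  that vanish on \<open>J\<close>.\<close>

definition ideal_gauge :: "'c::cstar_algebra set \<Rightarrow> 'c unitization \<Rightarrow> real"
  where "ideal_gauge J b = Inf {t. \<exists>j\<in>J. cpos (t *\<^sub>R 1 - re_part b - emb j)}"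

lemma cpos_scalar_part: "cpos u \<Longrightarrow> 0 \<le> Re (scalar_part u)"
  using cpos_iff[of u] by auto

context
  fixes J :: "'c::cstar_algebra set"
  assumes J: "cstar_ideal J"
begin

lemma ideal_gauge_le: "j \<in> J \<Longrightarrow> cpos (t *\<^sub>R 1 - re_part b - emb j) \<Longrightarrow> ideal_gauge J b \<le> t"
  and le_ideal_gauge: "(\<And>t j. j \<in> J \<Longrightarrow> cpos (t *\<^sub>R 1 - re_part b - emb j) \<Longrightarrow> c \<le> t) \<Longrightarrow> c \<le> ideal_gauge J b"
proof -
  \<comment> \<open>\<open>scalar_part\<close> is a character of the unitization that vanishes on
    \<open>emb j\<close>, which bounds the set from below.\<close>
  have low: "Re (scalar_part b) \<le> t" if "cpos (t *\<^sub>R 1 - re_part b - emb j)" for t b and j :: 'c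
    using cpos_scalar_part[OF that] by (simp add: re_part_def)
  show "j \<in> J \<Longrightarrow> cpos (t *\<^sub>R 1 - re_part b - emb j) \<Longrightarrow> ideal_gauge J b \<le> t"
    unfolding ideal_gauge_def
    by (rule cInf_lower, blast, rule bdd_belowI[of _ "Re (scalar_part b)"]) (use low in blast)
  have "cpos (norm (re_part b) *\<^sub>R 1 - re_part b - emb 0)"
    using cpos_norm_minus[of "re_part b"] by (simp add: embed_arith)
  moreover have "0 \<in> J" by (rule csubspaceD(1)[OF cstar_idealD(1)[OF J]])
  ultimately show "(\<And>t j. j \<in> J \<Longrightarrow> cpos (t *\<^sub>R 1 - re_part b - emb j) \<Longrightarrow> c \<le> t) \<Longrightarrow> c \<le> ideal_gauge J b"
    unfolding ideal_gauge_def by (intro cInf_greatest) auto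
qed

lemma sublinear_ideal_gauge: "sublinear (ideal_gauge J)"
  unfolding sublinear_def
proof (intro conjI allI impI)
  note sub = csubspaceD[OF cstar_idealD(1)[OF J]]
  fix x y :: "'c unitization"
  have "ideal_gauge J (x + y) \<le> t + s" if "j \<in> J" "cpos (t *\<^sub>R 1 - re_part x - emb j)"
    "k \<in> J" "cpos (s *\<^sub>R 1 - re_part y - emb k)" for t s j k
  proof (rule ideal_gauge_le)
    show "j + k \<in> J" by (intro sub(2) that)
    show "cpos ((t + s) *\<^sub>R 1 - re_part (x + y) - emb (j + k))"
      using cpos_add[OF that(2,4)] by (simp add: embed_arith linear_add[OF linear_re_part] algebra_simps)
  qed
  then have "ideal_gauge J (x + y) - s \<le> ideal_gauge J x" if "k \<in> J" "cpos (s *\<^sub>R 1 - re_part y - emb k)" for s k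
    using that by (intro le_ideal_gauge) (force simp: algebra_simps)
  then have "ideal_gauge J (x + y) - ideal_gauge J x \<le> ideal_gauge J y"
    by (intro le_ideal_gauge) (force simp: algebra_simps)
  then show "ideal_gauge J (x + y) \<le> ideal_gauge J x + ideal_gauge J y" by simp
next
  note sub = csubspaceD[OF cstar_idealD(1)[OF J]]
  fix r :: real and x :: "'c unitization" assume r: "0 < r"
  have "ideal_gauge J (r *\<^sub>R x) / r \<le> ideal_gauge J x"
  proof (rule le_ideal_gauge)
    fix t j assume j: "j \<in> J" "cpos (t *\<^sub>R 1 - re_part x - emb j)"
    have "ideal_gauge J (r *\<^sub>R x) \<le> r * t"
    proof (rule ideal_gauge_le)
      show "r *\<^sub>R j \<in> J" by (intro sub(4) j)
      show "cpos ((r * t) *\<^sub>R 1 - re_part (r *\<^sub>R x) - emb (r *\<^sub>R j))"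
        using cpos_scaleR[OF j(2), of r] r by (simp add: embed_arith linear_scale[OF linear_re_part] scaleR_diff_right)
    qed
    then show "ideal_gauge J (r *\<^sub>R x) / r \<le> t" using r by (simp add: field_simps)
  qed
  then show "ideal_gauge J (r *\<^sub>R x) \<le> r * ideal_gauge J x" using r by (simp add: field_simps)
qed

text \<open>The equalities arise as pairs of inequalities: the gauge is bounded above at an element
  and at its negative, by elements of J or by the scalars 1 and - 1.\<close>

lemma below_ideal_gauge_iff:
  assumes q: "linear q"
  shows "q \<le> ideal_gauge J \<longleftrightarrow>
    (\<forall>u. cpos u \<longrightarrow> 0 \<le> q u) \<and> (\<forall>j\<in>J. q (emb j) = 0) \<and> (\<forall>u. q (star u) = q u) \<and> q 1 = 1"
proof
  note sub = csubspaceD[OF cstar_idealD(1)[OF J]]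
  assume le: "q \<le> ideal_gauge J"
  have bound: "q b \<le> t" if "j \<in> J" "cpos (t *\<^sub>R 1 - re_part b - emb j)" for b t j
    using le ideal_gauge_le[OF that] order_trans by (auto simp: le_fun_def)
  have zero: "q b \<le> 0" if "j \<in> J" "re_part b = - emb j" for b j
    by (rule bound[OF that(1)]) (simp add: that)
  have "0 \<le> q u" if "cpos u" for u
    using bound[OF sub(1), of 0 "- u"] that
    by (simp add: linear_neg[OF linear_re_part] re_part_selfadjoint cpos_star embed_arith linear_neg[OF q])
  moreover have "q (emb j) = 0" if j: "j \<in> J" for j
  proof -
    have "(1/2) *\<^sub>R (j + star j) \<in> J" by (intro sub(4) sub(2) j ideal_star_square(2)[OF J])
    moreover have "re_part (emb j) = emb ((1/2) *\<^sub>R (j + star j))"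
      by (simp add: re_part_def embed_arith embed_star)
    ultimately show ?thesis
      using zero[of "- ((1/2) *\<^sub>R (j + star j))" "emb j"] zero[of "(1/2) *\<^sub>R (j + star j)" "- emb j"] sub(5)
      by (simp add: linear_neg[OF linear_re_part] embed_arith(3) linear_neg[OF q])
  qed
  moreover have "q (star u) = q u" for u
  proof -
    have "re_part (u - star u) = 0" by (simp add: re_part_def star_diff star_star)
    then have "q (u - star u) \<le> 0" "q (- (u - star u)) \<le> 0"
      using zero[OF sub(1)] by (simp_all only: linear_neg[OF linear_re_part] embed_arith(4)) simp_all
    then show ?thesis by (simp add: linear_neg[OF q] linear_diff[OF q])
  qed
  moreover have "q 1 = 1"
    using bound[OF sub(1), of 1 1] bound[OF sub(1), of "-1" "-1"]
    by (simp add: linear_neg[OF linear_re_part] re_part_selfadjoint embed_arith linear_neg[OF q])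
  ultimately show "(\<forall>u. cpos u \<longrightarrow> 0 \<le> q u) \<and> (\<forall>j\<in>J. q (emb j) = 0) \<and> (\<forall>u. q (star u) = q u) \<and> q 1 = 1"
    by blast
next
  assume *: "(\<forall>u. cpos u \<longrightarrow> 0 \<le> q u) \<and> (\<forall>j\<in>J. q (emb j) = 0) \<and> (\<forall>u. q (star u) = q u) \<and> q 1 = 1"
  show "q \<le> ideal_gauge J"
  proof (intro le_funI le_ideal_gauge)
    fix b t j assume "j \<in> J" "cpos (t *\<^sub>R 1 - re_part b - emb j)"
    then have "0 \<le> q (t *\<^sub>R 1 - re_part b - emb j)" "q (emb j) = 0" using * by auto
    moreover have "q (re_part b) = q b" using * by (simp add: re_part_def linear_add[OF q] linear_scale[OF q])
    ultimately show "q b \<le> t" using * by (simp add: linear_diff[OF q] linear_scale[OF q])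
  qed
qed

end

section \<open>Irreducible representations and pure states\<close>

lemma (in hilbert_space) range_hsubspace:
  fixes u :: "'v::complex_vector \<Rightarrow> 'h"
  assumes "\<And>v. u v \<in> hcarrier H" "\<And>v v'. u (v + v') = hadd H (u v) (u v')" "\<And>c v. u (c *\<^sub>C v) = hscale H c (u v)"
  shows "hsubspace H (range u)"
proof -
  have "hzero H = u 0" using assms(3)[of 0 0] scale_zero[OF assms(1)] by simp
  then show ?thesis using assms(1) unfolding hsubspace_def by (auto simp flip: assms(2,3))
qed

lemma (in hilbert_space) dense_seq:
  fixes u :: "'v::complex_vector \<Rightarrow> 'h"
  assumes "\<And>v. u v \<in> hcarrier H" "\<And>v v'. u (v + v') = hadd H (u v) (u v')" "\<And>c v. u (c *\<^sub>C v) = hscale H c (u v)"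
    and "hperp H (range u) = {hzero H}" "h \<in> hcarrier H"
  obtains a where "(\<lambda>n. hdist H (u (a n)) h) \<longlonglongrightarrow> 0"
proof -
  obtain s where s: "\<And>n. s n \<in> range u" "(\<lambda>n. hdist H (s n) h) \<longlonglongrightarrow> 0"
    using dense_approx[OF range_hsubspace[OF assms(1-3)] assms(4,5)] by blast
  have "\<forall>n. \<exists>a. s n = u a" using s(1) by blast
  then obtain a where "\<forall>n. s n = u (a n)" by (rule choice[THEN exE])
  then show thesis using that s(2) by simp
qed

text \<open>The functional is only given on the parameters of a dense map; the bound lets it descend
  to the range and extend by continuity.\<close>

lemma (in hilbert_space) riesz_dense:
  fixes u :: "'v::complex_vector \<Rightarrow> 'h" and f :: "'v \<Rightarrow> complex"
  assumes u: "\<And>v. u v \<in> hcarrier H" "\<And>v v'. u (v + v') = hadd H (u v) (u v')" "\<And>c v. u (c *\<^sub>C v) = hscale H c (u v)"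
    and dense: "hperp H (range u) = {hzero H}"
    and f: "\<And>v v'. f (v + v') = f v + f v'" "\<And>c v. f (c *\<^sub>C v) = c * f v" "\<And>v. cmod (f v) \<le> M * hnorm H (u v)"
  obtains l where "l \<in> hcarrier H" "\<And>v. f v = hinner H l (u v)"
proof -
  have diff: "cmod (f v - f v') \<le> M * hdist H (u v) (u v')" for v v'
    using f(3)[of "v + (-1) *\<^sub>C v'"] unfolding f(1,2) u(2,3) by (simp add: hdist_hsub hsub_def)
  have M: "0 \<le> M * hdist H (u v) (u v')" for v v' using diff[of v v'] norm_ge_zero order_trans by blast
  define S where "S h = (SOME a. (\<lambda>n. hdist H (u (a n)) h) \<longlonglongrightarrow> 0)" for h
  have S: "(\<lambda>n. hdist H (u (S h n)) h) \<longlonglongrightarrow> 0" if h: "h \<in> hcarrier H" for h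
  proof -
    obtain a where "(\<lambda>n. hdist H (u (a n)) h) \<longlonglongrightarrow> 0" using dense_seq[OF u dense h] .
    then show ?thesis unfolding S_def by (rule someI[of "\<lambda>a. (\<lambda>n. hdist H (u (a n)) h) \<longlonglongrightarrow> 0"])
  qed
  have close: "(\<lambda>n. f (a n) - f (b n)) \<longlonglongrightarrow> 0" if h: "h \<in> hcarrier H"
    and "(\<lambda>n. hdist H (u (a n)) h) \<longlonglongrightarrow> 0" "(\<lambda>n. hdist H (u (b n)) h) \<longlonglongrightarrow> 0" for h a b
  proof (rule null_seq_bound)
    show "norm (f (a n) - f (b n)) \<le> \<bar>M\<bar> * (hdist H (u (a n)) h + hdist H (u (b n)) h)" for n
    proof -
      have "norm (f (a n) - f (b n)) \<le> \<bar>M\<bar> * hdist H (u (a n)) (u (b n))"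
        using diff[of "a n" "b n"] M[of "a n" "b n"] by (simp add: abs_mult_pos)
      also have "\<dots> \<le> \<bar>M\<bar> * (hdist H (u (a n)) h + hdist H (u (b n)) h)"
        using hdist_triangle[OF u(1) h u(1), of "a n" "b n"] hdist_commute[OF h u(1), of "b n"]
        by (intro mult_left_mono) auto
      finally show ?thesis .
    qed
    have "(\<lambda>n. \<bar>M\<bar> * (hdist H (u (a n)) h + hdist H (u (b n)) h)) \<longlonglongrightarrow> \<bar>M\<bar> * (0 + 0)"
      by (intro tendsto_intros that)
    then show "(\<lambda>n. \<bar>M\<bar> * (hdist H (u (a n)) h + hdist H (u (b n)) h)) \<longlonglongrightarrow> 0" by simp
  qed
  have conv: "convergent (\<lambda>n. f (S h n))" if h: "h \<in> hcarrier H" for h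
  proof (rule Cauchy_convergent, rule CauchyI)
    fix e :: real assume e: "0 < e"
    have "e / (\<bar>M\<bar> + 1) > 0" using e by (simp add: add_nonneg_pos)
    then obtain N where N: "\<forall>m\<ge>N. \<forall>n\<ge>N. hdist H (u (S h m)) (u (S h n)) < e / (\<bar>M\<bar> + 1)"
      using convergent_Cauchy[OF u(1) h S[OF h]] by blast
    have "norm (f (S h m) - f (S h n)) < e" if "m \<ge> N" "n \<ge> N" for m n
    proof -
      have "norm (f (S h m) - f (S h n)) \<le> M * hdist H (u (S h m)) (u (S h n))" by (rule diff)
      also have "\<dots> \<le> (\<bar>M\<bar> + 1) * hdist H (u (S h m)) (u (S h n))" by (intro mult_right_mono) auto
      also have "\<dots> < e" using N that by (simp add: pos_less_divide_eq add_nonneg_pos mult.commute)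
      finally show ?thesis .
    qed
    then show "\<exists>N. \<forall>m\<ge>N. \<forall>n\<ge>N. norm (f (S h m) - f (S h n)) < e" by blast
  qed
  define \<phi> where "\<phi> h = lim (\<lambda>n. f (S h n))" for h
  have \<phi>: "(\<lambda>n. f (a n)) \<longlonglongrightarrow> \<phi> h" if h: "h \<in> hcarrier H" and a: "(\<lambda>n. hdist H (u (a n)) h) \<longlonglongrightarrow> 0" for h a
  proof -
    have "(\<lambda>n. f (S h n)) \<longlonglongrightarrow> \<phi> h" using conv[OF h] by (simp add: \<phi>_def convergent_LIMSEQ_iff)
    from tendsto_add[OF close[OF h a S[OF h]] this] show ?thesis by simp
  qed
  have \<phi>u: "\<phi> (u v) = f v" for v
    using LIMSEQ_unique[OF \<phi>[OF u(1), of "\<lambda>_. v" v] tendsto_const] u(1) by simp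
  have "\<exists>l. l \<in> hcarrier H \<and> (\<forall>h\<in>hcarrier H. \<phi> h = hinner H l h)"
  proof (rule riesz[where f = \<phi> and M = M])
    fix h k assume hk: "h \<in> hcarrier H" "k \<in> hcarrier H"
    have "(\<lambda>n. hdist H (u (S h n + S k n)) (hadd H h k)) \<longlonglongrightarrow> 0"
    proof (rule null_seq_bound)
      show "norm (hdist H (u (S h n + S k n)) (hadd H h k)) \<le> hdist H (u (S h n)) h + hdist H (u (S k n)) k" for n
        using hnorm_triangle[of "hsub H (u (S h n)) h" "hsub H (u (S k n)) k"] u(1) hk
        by (simp add: u(2) hdist_hsub hsub_add)
      show "(\<lambda>n. hdist H (u (S h n)) h + hdist H (u (S k n)) k) \<longlonglongrightarrow> 0"
        using tendsto_add[OF S[OF hk(1)] S[OF hk(2)]] by simp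
    qed
    then have "(\<lambda>n. f (S h n + S k n)) \<longlonglongrightarrow> \<phi> (hadd H h k)" by (rule \<phi>[OF add_closed[OF hk]])
    then show "\<phi> (hadd H h k) = \<phi> h + \<phi> k"
      unfolding f(1)
      by (rule LIMSEQ_unique[OF _ tendsto_add[OF \<phi>[OF hk(1) S[OF hk(1)]] \<phi>[OF hk(2) S[OF hk(2)]]]])
  next
    fix c h assume h: "h \<in> hcarrier H"
    have "(\<lambda>n. hdist H (u (c *\<^sub>C S h n)) (hscale H c h)) \<longlonglongrightarrow> 0"
    proof -
      have "hdist H (u (c *\<^sub>C S h n)) (hscale H c h) = cmod c * hdist H (u (S h n)) h" for n
        using u(1) h by (simp add: u(3) hdist_hsub hsub_scale hnorm_scale)
      moreover have "(\<lambda>n. cmod c * hdist H (u (S h n)) h) \<longlonglongrightarrow> cmod c * 0" by (intro tendsto_intros S h)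
      ultimately show ?thesis by simp
    qed
    then have "(\<lambda>n. f (c *\<^sub>C S h n)) \<longlonglongrightarrow> \<phi> (hscale H c h)" by (rule \<phi>[OF scale_closed[OF h]])
    then show "\<phi> (hscale H c h) = c * \<phi> h"
      unfolding f(2) by (rule LIMSEQ_unique[OF _ tendsto_mult[OF tendsto_const \<phi>[OF h S[OF h]]]])
  next
    fix h assume h: "h \<in> hcarrier H"
    show "cmod (\<phi> h) \<le> M * hnorm H h"
    proof (rule LIMSEQ_le)
      show "(\<lambda>n. cmod (f (S h n))) \<longlonglongrightarrow> cmod (\<phi> h)" by (intro tendsto_intros \<phi>[OF h S[OF h]])
      show "(\<lambda>n. M * hnorm H (u (S h n))) \<longlonglongrightarrow> M * hnorm H h"
        by (intro tendsto_intros hnorm_tendsto u h S)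
    qed (use f(3) in auto)
  qed blast
  then obtain l where l: "l \<in> hcarrier H" "\<And>h. h \<in> hcarrier H \<Longrightarrow> \<phi> h = hinner H l h" by blast
  show thesis by (rule that[OF l(1)]) (use l(2)[OF u(1)] \<phi>u in simp)
qed

section \<open>Irreducibility and purity of vector states\<close>

lemma irreducibleD:
  assumes "irreducible_rep H \<pi>"
  shows "rep H \<pi>" "\<exists>a. \<exists>h\<in>hcarrier H. \<pi> a h \<noteq> hzero H"
    "hclosed_subspace H V \<Longrightarrow> (\<And>a. \<pi> a ` V \<subseteq> V) \<Longrightarrow> V = {hzero H} \<or> V = hcarrier H"
  using assms by (auto simp: irreducible_rep_def rep_def)

lemma irreducibleI:
  assumes "rep H \<pi>" "h \<in> hcarrier H" "\<pi> a h \<noteq> hzero H"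
    "\<And>V. hclosed_subspace H V \<Longrightarrow> (\<And>a. \<pi> a ` V \<subseteq> V) \<Longrightarrow> V = {hzero H} \<or> V = hcarrier H"
  shows "irreducible_rep H \<pi>"
  using assms by (auto simp: irreducible_rep_def rep_def)

text \<open>The complement of the orbit is invariant. If it were everything, the orbit would vanish
  and \<xi> would be orthogonal to all vectors \<pi> a k; their complement would then be everything
  as well, although \<pi> is nonzero.\<close>

lemma irreducible_dense:
  assumes irr: "irreducible_rep H \<pi>" and \<xi>: "\<xi> \<in> hcarrier H" "\<xi> \<noteq> hzero H"
  shows "hperp H (range (\<lambda>a. \<pi> a \<xi>)) = {hzero H}"
proof -
  interpret rep H \<pi> using irreducibleD(1)[OF irr] .
  have inv: "\<pi> a ` hperp H S \<subseteq> hperp H S" if "S \<subseteq> hcarrier H" "\<And>a s. s \<in> S \<Longrightarrow> \<pi> a s \<in> S" for a S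
    using hperp_invariant[OF that(1)] that(2) by blast
  let ?S = "range (\<lambda>a. \<pi> a \<xi>)"
  have S: "?S \<subseteq> hcarrier H" "\<And>a s. s \<in> ?S \<Longrightarrow> \<pi> a s \<in> ?S" using \<xi> by (auto simp flip: op_mult)
  have "hperp H ?S \<noteq> hcarrier H"
  proof
    assume all: "hperp H ?S = hcarrier H"
    define T where "T = {\<pi> a k |a k. k \<in> hcarrier H}"
    have T: "T \<subseteq> hcarrier H" "\<And>a s. s \<in> T \<Longrightarrow> \<pi> a s \<in> T" by (auto simp: T_def)
    have "\<pi> a \<xi> = hzero H" for a
    proof -
      have "\<pi> a \<xi> \<in> hperp H ?S" using all \<xi> by simp
      then show ?thesis using hperp_Int[OF S(1)] by blast
    qed
    then have "hinner H (\<pi> a k) \<xi> = 0" if "k \<in> hcarrier H" for a k using adj[OF that \<xi>(1)] that by simp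
    then have "\<xi> \<in> hperp H T" using \<xi> by (auto simp: hperp_def T_def)
    then have "hperp H T \<noteq> {hzero H}" using \<xi> by blast
    then have TC: "hperp H T = hcarrier H"
      using irreducibleD(3)[OF irr hperp_closed_subspace[OF T(1)]] inv[OF T] by blast
    obtain a h where ah: "h \<in> hcarrier H" "\<pi> a h \<noteq> hzero H" using irreducibleD(2)[OF irr] by blast
    have "\<pi> a h \<in> hperp H T" "\<pi> a h \<in> T" using ah TC by (auto simp: T_def)
    then show False using hperp_Int[OF T(1)] ah by blast
  qed
  then show ?thesis using irreducibleD(3)[OF irr hperp_closed_subspace[OF S(1)]] inv[OF S] by blast
qed

lemma rep_ext_dense:
  assumes irr: "irreducible_rep H \<pi>" and \<xi>: "\<xi> \<in> hcarrier H" "\<xi> \<noteq> hzero H"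
  shows "hperp H (range (\<lambda>u. rep_ext H \<pi> u \<xi>)) = {hzero H}"
proof -
  interpret rep H \<pi> using irreducibleD(1)[OF irr] .
  interpret R: rep H "rep_ext H \<pi>" by (rule rep_ext)
  have "range (\<lambda>a. \<pi> a \<xi>) \<subseteq> range (\<lambda>u. rep_ext H \<pi> u \<xi>)"
    using rep_ext_emb[OF \<xi>(1)] by (metis (mono_tags, lifting) image_subsetI rangeI)
  then have "hperp H (range (\<lambda>u. rep_ext H \<pi> u \<xi>)) \<subseteq> {hzero H}"
    using hperp_antimono irreducible_dense[OF irr \<xi>] by blast
  moreover have "hzero H \<in> hperp H (range (\<lambda>u. rep_ext H \<pi> u \<xi>))" using \<xi> by (auto simp: hperp_def)
  ultimately show ?thesis by blast
qed

lemma (in rep) vector_functional: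
  assumes z: "z \<in> hcarrier H"
  shows "linear (\<lambda>u. Re (hinner H z (\<pi> u z)))" "Re (hinner H z (\<pi> (star u) z)) = Re (hinner H z (\<pi> u z))"
    "Re (hinner H z (\<pi> (star u * u) z)) = (hnorm H (\<pi> u z))\<^sup>2"
proof -
  show "linear (\<lambda>u. Re (hinner H z (\<pi> u z)))"
    by (rule linearI) (simp_all add: z op_add op_scale scaleR_scaleC inner_simps)
  show "Re (hinner H z (\<pi> (star u) z)) = Re (hinner H z (\<pi> u z))"
    using adj[OF z z, of u] inner_commute[of z "\<pi> u z"] z by (metis complex_cnj cnj.sel(1) op_closed)
  show "Re (hinner H z (\<pi> (star u * u) z)) = (hnorm H (\<pi> u z))\<^sup>2"
    by (simp only: inner_star_mult[OF z] Re_complex_of_real)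
qed

lemma (in rep) real_parts_determine:
  assumes "h \<in> hcarrier H" "k \<in> hcarrier H" "h' \<in> hcarrier H" "k' \<in> hcarrier H"
    and eq: "\<And>u. Re (hinner H h (\<pi> u k)) = t * Re (hinner H h' (\<pi> u k'))"
  shows "hinner H h (\<pi> u k) = of_real t * hinner H h' (\<pi> u k')"
  using eq[of u] eq[of "\<i> *\<^sub>C u"] assms by (simp add: op_scale inner_simps complex_eq_iff)

text \<open>An extreme point of the functionals
  between \<open>0\<close> and \<open>\<omega> = \<langle>\<xi>, \<cdot> \<xi>\<rangle>\<close> has the form \<open>f = \<langle>\<xi>, \<cdot> \<eta>\<rangle>\<close>, and it is the mean of \<open>q = \<langle>\<eta>, \<cdot> \<eta>\<rangle>\<close> and
  \<open>2 f - q\<close>, which lie in the same interval; so \<open>\<xi> - \<eta>\<close> is orthogonal to the orbit of \<open>\<eta>\<close>.\<close>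

theorem irreducible_pure:
  fixes \<pi> :: "'a::cstar_algebra \<Rightarrow> 'h \<Rightarrow> 'h"
  assumes irr: "irreducible_rep H \<pi>" and \<xi>: "\<xi> \<in> hcarrier H"
    and g0: "linear g0" "\<And>u. g0 (star u) = g0 u" "\<And>u. 0 \<le> g0 (star u * u)"
      "\<And>u. g0 (star u * u) \<le> Re (hinner H \<xi> (rep_ext H \<pi> (star u * u) \<xi>))"
  obtains l where "\<And>u. g0 u = l * Re (hinner H \<xi> (rep_ext H \<pi> u \<xi>))"
proof -
  have rp: "rep H \<pi>" using irreducibleD(1)[OF irr] .
  interpret hilbert_space H using rep.rep[OF rp] by (simp add: representation_def)
  interpret P: rep H \<pi> by (rule rp)
  let ?r = "rep_ext H \<pi>"
  interpret rep H ?r by (rule P.rep_ext)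
  have one: "?r 1 h = h" if "h \<in> hcarrier H" for h using P.rep_ext_one[OF that] .
  define om where "om u = Re (hinner H \<xi> (?r u \<xi>))" for u
  have om: "linear om" "om (star u) = om u" "om (star u * u) = (hnorm H (?r u \<xi>))\<^sup>2" for u
    using vector_functional[OF \<xi>] by (auto simp: om_def[abs_def])
  define Q where "Q = {g. linear g \<and> (\<forall>u. g (star u) = g u) \<and> (\<forall>u. 0 \<le> g (star u * u) \<and> g (star u * u) \<le> om (star u * u))}"
  have QD: "linear g" "g (star u) = g u" "0 \<le> g (star u * u)" "g (star u * u) \<le> om (star u * u)" if "g \<in> Q" for g u
    using that by (auto simp: Q_def)
  have Qcpos: "0 \<le> g u" if "g \<in> Q" "cpos u" for g u using that cpos_iff QD(3) by metis
  have Q0: "(\<lambda>_. 0) \<in> Q" by (auto simp: Q_def om linear_iff)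
  have g0Q: "g0 \<in> Q" using g0 by (simp add: Q_def om_def)
  have Qb: "g u \<le> norm (re_part u) * om 1" if g: "g \<in> Q" for g u
  proof -
    note lin = QD(1)[OF g]
    have "0 \<le> g (norm (re_part u) *\<^sub>R 1 - re_part u)" by (intro Qcpos g cpos_norm_minus) simp
    moreover have "g (re_part u) = g u" using QD(2)[OF g] by (simp add: re_part_def linear_add[OF lin] linear_scale[OF lin])
    moreover have "norm (re_part u) * g 1 \<le> norm (re_part u) * om 1"
      using QD(4)[OF g, of 1] by (intro mult_left_mono) auto
    ultimately show ?thesis by (simp add: linear_diff[OF lin] linear_scale[OF lin])
  qed
  \<comment> \<open>The support function of Q. The conditions defining Q are upper bounds on values,
    some after a change of sign, so a linear g \<le> p belongs to Q again.\<close>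
  define p where "p u = Sup ((\<lambda>g. g u) ` Q)" for u
  have pU: "g u \<le> p u" if "g \<in> Q" for g u
    unfolding p_def by (rule cSup_upper) (use that Qb in \<open>auto intro!: bdd_aboveI2[of _ _ "norm (re_part u) * om 1"]\<close>)
  have pL: "p u \<le> c" if "\<And>g. g \<in> Q \<Longrightarrow> g u \<le> c" for u c
    unfolding p_def by (rule cSup_least) (use that Q0 in auto)
  have sub: "sublinear p"
    unfolding sublinear_def
  proof (intro conjI allI impI)
    show "p (x + y) \<le> p x + p y" for x y
      using pU by (intro pL) (simp add: linear_add[OF QD(1)] add_mono)
    show "p (r *\<^sub>R x) \<le> r * p x" if "0 < r" for r x
      using pU that by (intro pL) (simp add: linear_scale[OF QD(1)])
  qed
  have inQ: "g \<in> Q" if lin: "linear g" and le: "g \<le> p" for g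
  proof -
    have le': "g u \<le> c" if "\<And>g'. g' \<in> Q \<Longrightarrow> g' u \<le> c" for u c
    proof -
      have "g u \<le> p u" using le by (simp add: le_fun_def)
      also have "p u \<le> c" by (rule pL) (rule that)
      finally show ?thesis .
    qed
    have np: "g (u - star u) \<le> 0" for u by (rule le') (simp add: linear_diff[OF QD(1)] QD(2))
    have "g (star u) = g u" for u
      using np[of u] np[of "star u"] by (simp add: linear_diff[OF lin] star_star)
    moreover have "g (- (star u * u)) \<le> 0" for u by (rule le') (simp add: linear_neg[OF QD(1)] QD(3))
    moreover have "g (star u * u) \<le> om (star u * u)" for u by (rule le') (rule QD(4))
    ultimately show ?thesis using lin by (simp add: Q_def linear_neg[OF lin])
  qed
  \<comment> \<open>Choosing an extreme point f of Q with f a = p a, it suffices to show that f a is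
    0 or \<open>om a\<close>.\<close>
  have pmax: "p a \<le> max 0 (om a)" for a
  proof (cases "\<xi> = hzero H")
    case True
    have "om u = 0" for u by (simp add: om_def True)
    have "g a \<le> 0" if g: "g \<in> Q" for g using Qb[OF g, of a] \<open>\<And>u. om u = 0\<close> by simp
    then have "p a \<le> 0" by (rule pL)
    then show ?thesis by simp
  next
    case \<xi>0: False
    let ?u = "\<lambda>a. ?r a \<xi>"
    have u: "?u a \<in> hcarrier H" "?u (a + b) = hadd H (?u a) (?u b)" "?u (c *\<^sub>C a) = hscale H c (?u a)" for a b c
      using \<xi> by (simp_all add: op_add op_scale)
    note dense = rep_ext_dense[OF irr \<xi> \<xi>0]
    obtain f where f: "linear f" "f \<le> p" "f a = p a"
      and ext: "\<And>g h t. linear g \<Longrightarrow> linear h \<Longrightarrow> g \<le> p \<Longrightarrow> h \<le> p \<Longrightarrow> 0 < t \<Longrightarrow> t < 1 \<Longrightarrow>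
        (\<And>x. f x = t * g x + (1 - t) * h x) \<Longrightarrow> g = f"
      using extreme_dominated_functional[OF sub] by blast
    have fQ: "f \<in> Q" by (rule inQ[OF f(1,2)])
    interpret G: positive_functional "complexify f"
      by (rule complexify_positive) (use f(1) QD(2)[OF fQ] Qcpos[OF fQ] in auto)
    let ?G = "complexify f"
    have sn: "G.sn b \<le> hnorm H (?u b)" for b
      using QD(4)[OF fQ, of b] om(3)[of b] real_sqrt_le_mono[of "f (star b * b)" "(hnorm H (?u b))\<^sup>2"]
      unfolding G.sn_def by (simp add: complexify_def)
    obtain \<eta> where \<eta>: "\<eta> \<in> hcarrier H" "\<And>b. ?G b = hinner H \<eta> (?u b)"
    proof (rule riesz_dense[OF u dense G.F_add G.F_scale])
      fix b
      have "cmod (?G b) \<le> G.sn 1 * G.sn b" using G.s_cauchy_schwarz[of 1 b] by simp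
      also have "\<dots> \<le> G.sn 1 * hnorm H (?u b)" by (intro mult_left_mono sn) simp
      finally show "cmod (?G b) \<le> G.sn 1 * hnorm H (?u b)" .
    qed blast
    have \<eta>2: "hinner H \<xi> (?r b \<eta>) = ?G b" for b
    proof -
      have "hinner H \<xi> (?r b \<eta>) = hinner H (?r (star b) \<xi>) \<eta>" using adj'[OF \<xi> \<eta>(1)] by simp
      also have "\<dots> = cnj (?G (star b))" unfolding \<eta>(2) by (rule inner_commute) (simp_all add: \<eta> \<xi>)
      finally show ?thesis by (simp add: G.F_star)
    qed
    \<comment> \<open>Against a vector c \<xi> of the orbit, a \<eta> has an inner product that is
      the value of \<open>?G\<close> at \<open>star c * a\<close>, which Cauchy-Schwarz for
      \<open>?G\<close> controls; then c \<xi> tends to a \<eta> itself.\<close>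
    have bound: "(hnorm H (?r a \<eta>))\<^sup>2 \<le> f (star a * a)" for a
    proof -
      let ?e = "?r a \<eta>"
      have ec: "?e \<in> hcarrier H" using \<eta> by simp
      obtain b where b: "(\<lambda>n. hdist H (?u (b n)) ?e) \<longlonglongrightarrow> 0" using dense_seq[OF u dense ec] by blast
      have "cmod (hinner H ?e ?e) \<le> hnorm H ?e * G.sn a"
      proof (rule LIMSEQ_le)
        show "(\<lambda>n. cmod (hinner H (?u (b n)) ?e)) \<longlonglongrightarrow> cmod (hinner H ?e ?e)"
          by (intro tendsto_intros inner_tendsto(2) u ec b)
        show "(\<lambda>n. hnorm H (?u (b n)) * G.sn a) \<longlonglongrightarrow> hnorm H ?e * G.sn a"
          by (intro tendsto_intros hnorm_tendsto u ec b)
        have "cmod (hinner H (?u c) ?e) \<le> hnorm H (?u c) * G.sn a" for c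
        proof -
          have "hinner H (?u c) ?e = ?G (star c * a)"
            using adj[OF \<xi> ec, of c] by (simp add: \<eta>2[symmetric] op_mult \<eta>)
          also have "cmod \<dots> \<le> G.sn c * G.sn a" by (rule G.s_cauchy_schwarz)
          also have "\<dots> \<le> hnorm H (?u c) * G.sn a" by (intro mult_right_mono sn) simp
          finally show ?thesis .
        qed
        then show "\<exists>N. \<forall>n\<ge>N. cmod (hinner H (?u (b n)) ?e) \<le> hnorm H (?u (b n)) * G.sn a" by blast
      qed
      then have sq: "hnorm H ?e * hnorm H ?e \<le> hnorm H ?e * G.sn a"
        unfolding inner_self[OF ec] norm_of_real by (simp add: power2_eq_square)
      have "hnorm H ?e \<le> G.sn a"
      proof (cases "hnorm H ?e = 0")
        case False
        then have "0 < hnorm H ?e" using hnorm_nonneg[of H ?e] by linarith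
        then show ?thesis using sq mult_le_cancel_left_pos by blast
      qed simp
      then have "(hnorm H ?e)\<^sup>2 \<le> (G.sn a)\<^sup>2" by (intro power_mono) auto
      then show ?thesis unfolding G.sn_sq by (simp add: complexify_def)
    qed
    define q where "q u = Re (hinner H \<eta> (?r u \<eta>))" for u
    have q: "linear q" "q (star u) = q u" "q (star u * u) = (hnorm H (?r u \<eta>))\<^sup>2" for u
      using vector_functional[OF \<eta>(1)] by (auto simp: q_def[abs_def])
    have qf: "0 \<le> q (star u * u)" "q (star u * u) \<le> f (star u * u)" for u using q(3) bound by auto
    have "q (star u * u) \<le> om (star u * u)" for u using order_trans[OF qf(2) QD(4)[OF fQ]] .
    then have qQ: "q \<in> Q" using q(1,2) qf(1) by (simp add: Q_def)
    define r where "r u = 2 * f u - q u" for u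
    have lr: "linear r"
      by (rule linearI) (simp_all add: r_def linear_add[OF f(1)] linear_add[OF q(1)] linear_scale[OF f(1)]
          linear_scale[OF q(1)] algebra_simps)
    \<comment> \<open>Here \<open>om - r\<close> is the vector functional of \<xi> - \<eta>, hence
      nonnegative on squares.\<close>
    have "r (star u * u) \<le> om (star u * u)" for u
    proof -
      let ?d = "hsub H \<xi> \<eta>"
      have dc: "?d \<in> hcarrier H" using \<xi> \<eta> by simp
      have "hinner H ?d (?r v ?d) = hinner H \<xi> (?r v \<xi>) - hinner H \<xi> (?r v \<eta>) - hinner H \<eta> (?r v \<xi>) + hinner H \<eta> (?r v \<eta>)" for v
        using \<xi> \<eta>(1) by (simp add: op_hsub inner_hsub_right inner_hsub_left)
      then have "Re (hinner H ?d (?r v ?d)) = om v - r v" for v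
        unfolding \<eta>2 \<eta>(2)[symmetric] by (simp add: om_def r_def q_def complexify_def)
      moreover have "0 \<le> Re (hinner H ?d (?r (star u * u) ?d))"
        unfolding vector_functional(3)[OF dc] by simp
      ultimately show ?thesis by simp
    qed
    moreover have "0 \<le> r (star u * u)" for u using qf[of u] by (simp add: r_def)
    ultimately have rQ: "r \<in> Q" using lr q(2) QD(2)[OF fQ] by (auto simp: Q_def r_def)
    have "q \<le> p" "r \<le> p" using pU qQ rQ by (auto simp: le_fun_def)
    moreover have "f x = (1/2) * q x + (1 - 1/2) * r x" for x by (simp add: r_def field_simps)
    ultimately have qeq: "q = f" using ext[OF q(1) lr, of "1/2"] by simp
    have "hinner H \<eta> (?r u \<eta>) = of_real 1 * hinner H \<xi> (?r u \<eta>)" for u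
    proof (rule real_parts_determine)
      show "Re (hinner H \<eta> (?r u \<eta>)) = 1 * Re (hinner H \<xi> (?r u \<eta>))" for u
        using fun_cong[OF qeq, of u] unfolding \<eta>2 by (simp add: q_def complexify_def)
    qed (use \<xi> \<eta> in auto)
    then have "hinner H (hsub H \<xi> \<eta>) (?r u \<eta>) = 0" for u using \<xi> \<eta>(1) by (simp add: inner_hsub_left)
    then have orth: "hsub H \<xi> \<eta> \<in> hperp H (range (\<lambda>u. ?r u \<eta>))"
      using \<xi> \<eta>(1) inner_commute[of "hsub H \<xi> \<eta>"] by (auto simp: hperp_def)
    show ?thesis
    proof (cases "\<eta> = hzero H")
      case True
      then have "f a = 0" using \<eta>(2)[of a] \<xi> by (simp add: complexify_def complex_eq_iff)
      then show ?thesis using f(3) by simp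
    next
      case False
      then have "hsub H \<xi> \<eta> = hzero H" using orth rep_ext_dense[OF irr \<eta>(1)] by blast
      then have "\<xi> = \<eta>" using hsub_eq_zero[OF \<xi> \<eta>(1)] by simp
      then have "f a = om a" using \<eta>(2)[of a] by (simp add: om_def complexify_def complex_eq_iff)
      then show ?thesis using f(3) by simp
    qed
  qed
  \<comment> \<open>Used for u and - u, this shows that g0 vanishes wherever \<open>om\<close> does,
    so that the two are proportional.\<close>
  have le: "g0 u \<le> max 0 (om u)" for u using pU[OF g0Q, of u] pmax[of u] by linarith
  have ker: "g0 u = 0" if "om u = 0" for u
    using le[of u] le[of "- u"] that by (simp add: linear_neg[OF g0(1)] linear_neg[OF om(1)])
  show thesis
  proof (cases "om 1 = 0")
    case True
    have np: "g0 u \<le> 0" for u using Qb[OF g0Q, of u] True by simp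
    have "g0 u = 0" for u using np[of u] np[of "- u"] by (simp add: linear_neg[OF g0(1)])
    then show thesis using that[of 0] by simp
  next
    case False
    have "g0 u = g0 1 / om 1 * om u" for u
    proof -
      have "om (u - (om u / om 1) *\<^sub>R 1) = 0" using False by (simp add: linear_diff[OF om(1)] linear_scale[OF om(1)])
      then have "g0 (u - (om u / om 1) *\<^sub>R 1) = 0" by (rule ker)
      then show ?thesis by (simp add: linear_diff[OF g0(1)] linear_scale[OF g0(1)])
    qed
    then show thesis using that unfolding om_def by blast
  qed
qed

section \<open>Representations from states that vanish on an ideal\<close>

lemma star_hom_emb: "star_hom emb"
  by (auto simp: star_hom_def embed_arith embed_star intro: clinearI)

lemma complexify_zero: "q b = 0 \<Longrightarrow> q (\<i> *\<^sub>C b) = 0 \<Longrightarrow> complexify q b = 0"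
  by (simp add: complexify_def complex_eq_iff)

text \<open>Elements of J act as 0 because q vanishes on the image of J, which is an ideal of the
  unitization: each \<open>emb (star j) * v\<close> is a null vector.\<close>

lemma gns_state:
  fixes J :: "'c::cstar_algebra set"
  assumes J: "cstar_ideal J" and q: "linear q" "q \<le> ideal_gauge J"
  obtains K :: "('c unitization \<Rightarrow> complex) hilbert" and \<rho> \<omega> where
    "rep K \<rho>" "\<And>h. h \<in> hcarrier K \<Longrightarrow> \<rho> 1 h = h" "\<omega> \<in> hcarrier K"
    "\<And>u. hinner K \<omega> (\<rho> u \<omega>) = complexify q u" "hnorm K \<omega> = 1"
    "hperp K (range (\<lambda>u. \<rho> u \<omega>)) = {hzero K}"
    "\<And>j h. j \<in> J \<Longrightarrow> h \<in> hcarrier K \<Longrightarrow> \<rho> (emb j) h = hzero K"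
proof -
  have qD: "cpos u \<Longrightarrow> 0 \<le> q u" "j \<in> J \<Longrightarrow> q (emb j) = 0" "q (star u) = q u" "q 1 = 1" for u j
    using below_ideal_gauge_iff[OF J q(1)] q(2) by auto
  interpret F: positive_functional "complexify q"
    by (rule complexify_positive) (use q(1) qD in auto)
  interpret G: rep F.completion F.gns by (rule F.gns_rep)
  have incl: "F.gns u (F.incl 1) = F.incl u" for u by (simp add: F.gns_incl)
  have ip: "hinner F.completion (F.incl 1) (F.gns u (F.incl 1)) = complexify q u" for u
    unfolding incl F.incl_inner_incl by simp
  have one: "F.gns 1 h = h" for h by (simp add: F.gns_def fun_eq_iff)
  have emb_zero: "complexify q x = 0" if x: "x \<in> emb ` J" for x
  proof -
    have "\<i> *\<^sub>C x \<in> emb ` J"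
      by (rule csubspaceD(3)[OF cstar_idealD(1)[OF cstar_ideal_embed[OF J]] x])
    then show ?thesis using x qD(2) by (intro complexify_zero) auto
  qed
  have kill: "F.gns (emb j) h = hzero F.completion" if j: "j \<in> J" and h: "h \<in> hcarrier F.completion" for j h
  proof -
    have "hinner F.completion (F.incl v) (F.gns (emb j) h) = 0" for v
    proof -
      have sj: "emb (star j) \<in> emb ` J" using ideal_star_square(2)[OF J j] by simp
      have "complexify q (star w * (emb (star j) * v)) = 0" for w
        by (rule emb_zero, rule cstar_idealD(3)[OF cstar_ideal_embed[OF J]],
            rule cstar_idealD(4)[OF cstar_ideal_embed[OF J]], rule sj)
      then have "F.incl (emb (star j) * v) = hzero F.completion"
        unfolding F.incl_def F.completion_simps by (rule ext)
      then have "F.gns (star (emb j)) (F.incl v) = hzero F.completion"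
        by (simp only: F.gns_incl embed_star)
      then show ?thesis using G.adj'[OF F.incl_closed h, of "emb j" v] h by (simp only: G.inner_zero_left)
    qed
    then have "F.gns (emb j) h \<in> hperp F.completion (range F.incl)" using h by (auto simp: hperp_def)
    then show ?thesis using F.incl_dense by blast
  qed
  have "hinner F.completion (F.incl 1) (F.incl 1) = 1"
    using ip[of 1] unfolding one F.incl_inner_incl
    using qD(3)[of "\<i> *\<^sub>C 1"] qD(4) by (simp add: complexify_def star_scaleC linear_neg[OF q(1)] complex_eq_iff)
  then have "hnorm F.completion (F.incl 1) = 1" by (simp add: hnorm_def)
  then show thesis
    using that[OF F.gns_rep one F.incl_closed[of 1] ip] kill F.incl_dense by (simp only: incl eta_contract_eq)
qed

lemma (in hilbert_space) orthogonal_parts: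
  assumes V: "hclosed_subspace H V" and h: "h \<in> hcarrier H"
  obtains v w where "v \<in> V" "w \<in> hperp H V" "v \<in> hcarrier H" "w \<in> hcarrier H" "h = hadd H v w"
proof -
  obtain v where v: "v \<in> V" "hsub H h v \<in> hperp H V" using projection[OF V h] .
  have vc: "v \<in> hcarrier H" using v hsubspaceD(1)[OF hclosed_subspaceD(1)[OF V]] by blast
  have "h = hadd H v (hsub H h v)" by (rule eqI) (simp_all add: h vc inner_simps)
  then show thesis using that v vc h hsub_closed by blast
qed

lemma (in rep) orthogonal_functional:
  assumes V: "\<And>a. \<pi> a ` V \<subseteq> V" and vw: "v \<in> V" "w \<in> hperp H V" "v \<in> hcarrier H"
  shows "hinner H (hadd H v w) (\<pi> a (hadd H v w)) = hinner H v (\<pi> a v) + hinner H w (\<pi> a w)"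
proof -
  have wc: "w \<in> hcarrier H" using vw by (simp add: hperp_def)
  have 1: "hinner H x w = 0" if "x \<in> V" for x using vw(2) that by (simp add: hperp_def)
  have "hinner H v (\<pi> a w) = hinner H (\<pi> (star a) v) w" using adj'[OF vw(3) wc, of a] by simp
  also have "\<dots> = 0" using 1 V vw by blast
  finally have 2: "hinner H v (\<pi> a w) = 0" .
  have "hinner H w (\<pi> a v) = cnj (hinner H (\<pi> a v) w)" by (rule inner_commute) (simp_all add: vw wc)
  also have "\<dots> = 0" using 1 V vw by (simp add: image_subset_iff)
  finally have 3: "hinner H w (\<pi> a v) = 0" .
  show ?thesis using vw wc by (simp add: op_add_right inner_simps 2 3)
qed

text \<open>A state q that is extreme among those vanishing on I and of maximal value at
  \<open>star c * c\<close> does not kill c. An invariant subspace splits its GNS vector into v + w,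
  and q into a convex combination whose weight is the squared norm of v; extremality rules this out
  unless v or w is 0.\<close>

theorem separating_irrep:
  fixes I :: "'c::cstar_algebra set"
  assumes I: "cstar_ideal I" and c: "c \<notin> I"
  obtains H :: "('c unitization \<Rightarrow> complex) hilbert" and \<pi> where "irreducible_rep H \<pi>"
    "\<And>a h. a \<in> I \<Longrightarrow> h \<in> hcarrier H \<Longrightarrow> \<pi> a h = hzero H" "\<exists>h\<in>hcarrier H. \<pi> c h \<noteq> hzero H"
proof -
  let ?p = "ideal_gauge I"
  let ?a = "emb (star c * c)"
  have re: "re_part ?a = star (emb c) * emb c"
    by (simp add: re_part_selfadjoint star_mult star_star embed_arith embed_star)
  \<comment> \<open>Otherwise, for every t > 0, \<open>star c * c\<close> would be below t + j for
    some j in I, and c would lie in I by \<open>ideal_mem_if_dominated\<close>.\<close>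
  have pos: "0 < ?p ?a"
  proof (rule ccontr)
    assume np: "\<not> 0 < ?p ?a"
    have "emb c \<in> emb ` I"
    proof (rule ideal_mem_if_dominated[OF cstar_ideal_embed[OF I]])
      fix t :: real assume t: "t > 0"
      have "\<exists>s j. s < t \<and> j \<in> I \<and> cpos (s *\<^sub>R 1 - re_part ?a - emb j)"
      proof (rule ccontr)
        assume "\<not> ?thesis"
        then have "t \<le> ?p ?a" by (intro le_ideal_gauge[OF I]) (metis not_le)
        then show False using np t by simp
      qed
      then obtain s j where sj: "s < t" "j \<in> I" "cpos (s *\<^sub>R 1 - re_part ?a - emb j)" by blast
      have "cpos ((t - s) *\<^sub>R 1)" using sj by (intro cpos_scaleR) auto
      from cpos_add[OF sj(3) this] have "cpos (t *\<^sub>R 1 + emb (- j) - star (emb c) * emb c)"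
        by (simp add: re embed_arith(3) algebra_simps)
      moreover have "emb (- j) \<in> emb ` I" using csubspaceD(5)[OF cstar_idealD(1)[OF I] sj(2)] by blast
      ultimately show "\<exists>j\<in>emb ` I. cpos (t *\<^sub>R 1 + j - star (emb c) * emb c)" by blast
    qed
    then show False using c by simp
  qed
  obtain q where q: "linear q" "q \<le> ?p" "q ?a = ?p ?a" and
    ext: "\<And>g h t. linear g \<Longrightarrow> linear h \<Longrightarrow> g \<le> ?p \<Longrightarrow> h \<le> ?p \<Longrightarrow> 0 < t \<Longrightarrow> t < 1 \<Longrightarrow>
      (\<And>x. q x = t * g x + (1 - t) * h x) \<Longrightarrow> g = q"
    using extreme_dominated_functional[OF sublinear_ideal_gauge[OF I]] by blast
  obtain K :: "('c unitization \<Rightarrow> complex) hilbert" and \<rho> \<omega> where K: "rep K \<rho>" and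
    one: "\<And>h. h \<in> hcarrier K \<Longrightarrow> \<rho> 1 h = h" and \<omega>: "\<omega> \<in> hcarrier K" and
    ip: "\<And>u. hinner K \<omega> (\<rho> u \<omega>) = complexify q u" and n1: "hnorm K \<omega> = 1" and
    dense: "hperp K (range (\<lambda>u. \<rho> u \<omega>)) = {hzero K}" and
    kill: "\<And>j h. j \<in> I \<Longrightarrow> h \<in> hcarrier K \<Longrightarrow> \<rho> (emb j) h = hzero K"
    using gns_state[OF I q(1,2)] by blast
  interpret rep K \<rho> by (rule K)
  define \<pi> where "\<pi> a = \<rho> (emb a)" for a
  have rp: "rep K \<pi>" unfolding \<pi>_def[abs_def] by (rule rep_star_hom_comp[OF K star_hom_emb])
  have qu: "q u = Re (hinner K \<omega> (\<rho> u \<omega>))" for u unfolding ip by (simp add: complexify_def)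
  have nz: "\<pi> c \<omega> \<noteq> hzero K"
  proof
    assume "\<pi> c \<omega> = hzero K"
    then have "hinner K \<omega> (\<rho> ?a \<omega>) = 0"
      using \<omega> by (simp add: embed_arith embed_star op_mult \<pi>_def)
    then show False using pos q(3) qu by simp
  qed
  have below: "(\<lambda>u. Re (hinner K z (\<rho> u z)) / (hnorm K z)\<^sup>2) \<le> ?p"
    "linear (\<lambda>u. Re (hinner K z (\<rho> u z)) / (hnorm K z)\<^sup>2)"
    if z: "z \<in> hcarrier K" "z \<noteq> hzero K" for z
  proof -
    have n0: "hnorm K z \<noteq> 0" using hnorm_eq_0 z by simp
    note vf = vector_functional[OF z(1)]
    show lin: "linear (\<lambda>u. Re (hinner K z (\<rho> u z)) / (hnorm K z)\<^sup>2)"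
      using linear_compose_scale_right[OF vf(1), of "1 / (hnorm K z)\<^sup>2"] by simp
    show "(\<lambda>u. Re (hinner K z (\<rho> u z)) / (hnorm K z)\<^sup>2) \<le> ?p"
      unfolding below_ideal_gauge_iff[OF I lin]
    proof (intro conjI allI ballI impI)
      fix u :: "'c unitization" assume "cpos u"
      then obtain b where "u = star b * b" using cpos_iff by blast
      then show "0 \<le> Re (hinner K z (\<rho> u z)) / (hnorm K z)\<^sup>2" by (simp add: vf(3))
    next
      show "Re (hinner K z (\<rho> 1 z)) / (hnorm K z)\<^sup>2 = 1" using n0 z by (simp add: one inner_self)
    qed (simp_all add: vf(2) kill z)
  qed
  have "irreducible_rep K \<pi>"
  proof (rule irreducibleI[OF rp \<omega> nz])
    fix V assume V: "hclosed_subspace K V" and inv0: "\<And>a. \<pi> a ` V \<subseteq> V"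
    note VD = hsubspaceD[OF hclosed_subspaceD(1)[OF V]]
    have inv: "\<rho> u ` V \<subseteq> V" for u
    proof
      fix x assume "x \<in> \<rho> u ` V"
      then obtain v where v: "v \<in> V" "x = \<rho> u v" by blast
      have "x = \<rho> (emb (alg_part u) + scalar_part u *\<^sub>C 1) v" using v unitization_decomp[of u] by simp
      also have "\<dots> = hadd K (\<pi> (alg_part u) v) (hscale K (scalar_part u) v)"
        using VD(1)[OF v(1)] by (simp add: op_add op_scale one \<pi>_def)
      also have "\<dots> \<in> V" using inv0 v VD(3,4) by (simp add: image_subset_iff)
      finally show "x \<in> V" .
    qed
    have Vc: "V \<subseteq> hcarrier K" using VD(1) by blast
    have winv: "\<rho> u w \<in> hperp K V" if "w \<in> hperp K V" for u w
      by (rule hperp_invariant[OF Vc _ that]) (use inv in blast)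
    obtain v w where vw: "v \<in> V" "w \<in> hperp K V" "v \<in> hcarrier K" "w \<in> hcarrier K" "\<omega> = hadd K v w"
      using orthogonal_parts[OF V \<omega>] .
    have sum: "q u = Re (hinner K v (\<rho> u v)) + Re (hinner K w (\<rho> u w))" for u
      unfolding qu vw(5) orthogonal_functional[OF inv vw(1-3)] by simp
    show "V = {hzero K} \<or> V = hcarrier K"
    proof (cases "v = hzero K \<or> w = hzero K")
      case True
      then show ?thesis
      proof
        assume "v = hzero K"
        then have "\<omega> \<in> hperp K V" using vw by (simp add: add_zero)
        then have "range (\<lambda>u. \<rho> u \<omega>) \<subseteq> hperp K V" using winv by blast
        then have "hperp K (hperp K V) \<subseteq> {hzero K}" using hperp_antimono dense by blast
        then show ?thesis using hperp_hperp[OF V] VD(2) by blast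
      next
        assume "w = hzero K"
        then have "\<omega> \<in> V" using vw by (simp add: add_commute[of v] add_zero)
        then have "range (\<lambda>u. \<rho> u \<omega>) \<subseteq> V" using inv by blast
        then have "hperp K V \<subseteq> {hzero K}" using hperp_antimono dense by blast
        then have "hperp K {hzero K} \<subseteq> V" using hperp_antimono hperp_hperp[OF V] by blast
        then show ?thesis using Vc by (auto simp: hperp_def)
      qed
    next
      case False
      let ?t = "(hnorm K v)\<^sup>2"
      have wt: "(hnorm K w)\<^sup>2 = 1 - ?t"
      proof -
        have "q 1 = 1" using below_ideal_gauge_iff[OF I q(1)] q(2) by blast
        then show ?thesis using sum[of 1] vw by (simp add: one inner_self)
      qed
      have t: "0 < ?t" "?t < 1" using False hnorm_eq_0 vw wt by (smt (verit) zero_less_power2)+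
      \<comment> \<open>The normalized vector state of v equals q. This makes v - t \<omega>
        orthogonal to the orbit of \<omega>, so v = t \<omega>; but then the squared norm t of v is
        also t^2, although 0 < t < 1.\<close>
      have "(\<lambda>u. Re (hinner K v (\<rho> u v)) / ?t) = q"
      proof (rule ext[OF below(2) below(2) below(1) below(1) t])
        show "q x = ?t * (Re (hinner K v (\<rho> x v)) / ?t) + (1 - ?t) * (Re (hinner K w (\<rho> x w)) / (hnorm K w)\<^sup>2)" for x
          unfolding wt sum using t by simp
      qed (use vw False in auto)
      then have "Re (hinner K v (\<rho> u v)) = ?t * Re (hinner K \<omega> (\<rho> u \<omega>))" for u
        using t unfolding qu by (auto simp: fun_eq_iff field_simps)
      then have eq: "hinner K v (\<rho> u v) = of_real ?t * hinner K \<omega> (\<rho> u \<omega>)" for u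
        by (rule real_parts_determine[OF vw(3) vw(3) \<omega> \<omega>])
      have "hinner K (\<rho> u \<omega>) (hsub K v (hscale K (of_real ?t) \<omega>)) = 0" for u
      proof -
        have "hinner K (\<rho> u \<omega>) v = hinner K \<omega> (\<rho> (star u) v)" by (rule adj[OF \<omega> vw(3)])
        also have "\<dots> = hinner K v (\<rho> (star u) v)"
        proof -
          have "\<rho> (star u) v \<in> V" using inv vw by blast
          then have "hinner K (\<rho> (star u) v) w = 0" using vw(2) by (simp add: hperp_def)
          then have "hinner K w (\<rho> (star u) v) = 0" using inner_commute[of "\<rho> (star u) v" w] vw by simp
          then show ?thesis using vw by (simp add: inner_add_left)
        qed
        also have "\<dots> = of_real ?t * hinner K (\<rho> u \<omega>) \<omega>" unfolding eq adj[OF \<omega> \<omega>] ..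
        finally show ?thesis using vw \<omega> by (simp add: inner_hsub_right inner_scale_right)
      qed
      then have "hsub K v (hscale K (of_real ?t) \<omega>) \<in> hperp K (range (\<lambda>u. \<rho> u \<omega>))"
        using vw \<omega> by (auto simp: hperp_def)
      then have veq: "v = hscale K (of_real ?t) \<omega>" using dense hsub_eq_zero[of v "hscale K (of_real ?t) \<omega>"] vw \<omega> by simp
      have "hinner K v \<omega> = of_real ?t"
        using vw by (simp add: inner_add_right inner_self hperp_def)
      moreover have "hinner K v v = of_real ?t" using vw(3) by (rule inner_self)
      moreover have "hinner K v v = of_real ?t * hinner K v \<omega>"
        using inner_scale_right[OF vw(3) \<omega>, of "of_real ?t"] veq by simp
      ultimately have "complex_of_real ?t = of_real (?t * ?t)" by (simp only: of_real_mult)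
      then have "?t = ?t * ?t" by (simp only: of_real_eq_iff)
      then have False using mult_strict_left_mono[OF t(2) t(1)] by linarith
      then show ?thesis ..
    qed
  qed
  then show thesis using that kill nz \<omega> unfolding \<pi>_def[abs_def] by blast
qed

section \<open>Positive parts and kernels\<close>

text \<open>Here g is twice the positive part of x. The identities come from
  \<open>x * g = cabs x * g\<close>; being algebraic, they survive unital homomorphisms, which is
  how \<open>state_extension\<close> uses them.\<close>

lemma positive_part:
  fixes x :: "'u::cstar_algebra_1"
  assumes "star x = x"
  defines "g \<equiv> cabs x + x" and "k \<equiv> csqrt (cabs x)"
  shows "star g = g" "star k = k" "k * k = cabs x" "g * x * g = star (k * g) * (k * g)"
    "g * g = 2 *\<^sub>R (k * (k * g))" "cpos (cabs x)"
proof -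
  note c = cabs(1,2)[OF assms(1)] cabs(3)[OF assms(1), of x, OF refl]
  show "cpos (cabs x)" by (rule c)
  show k: "star k = k" "k * k = cabs x"
    using csqrt_cpos[OF c(1)] csqrt_square[OF c(1)] by (auto simp: k_def cpos_star)
  show g: "star g = g" using assms(1) cpos_star[OF c(1)] by (simp add: g_def star_add)
  have xg: "x * g = cabs x * g" by (simp add: g_def distrib_left c)
  show "g * x * g = star (k * g) * (k * g)"
    using xg by (simp add: star_mult g k(1) mult.assoc) (simp flip: mult.assoc add: k(2))
  have "g * g = cabs x * g + x * g" by (simp add: g_def distrib_right)
  also have "\<dots> = 2 *\<^sub>R (cabs x * g)" by (simp add: xg scaleR_2)
  finally show "g * g = 2 *\<^sub>R (k * (k * g))" by (simp add: k(2) flip: mult.assoc)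
qed

text \<open>The positive part of \<open>b\<^sup>* b - r\<^sup>2\<close>, up to a factor 2; it lies in the algebra itself.\<close>

definition cutoff :: "real \<Rightarrow> 'a::cstar_algebra \<Rightarrow> 'a"
  where "cutoff r b = (let x = star (emb b) * emb b - (r\<^sup>2) *\<^sub>R 1 in alg_part (cabs x + x))"

text \<open>The scalar part is a character, so on \<open>cabs x\<close> it is the nonnegative root
  of the square of \<open>- r\<^sup>2\<close>, which cancels the scalar part of x. A vanishing
  cutoff would make x negative and force \<open>norm b \<le> r\<close>.\<close>

lemma
  fixes b :: "'a::cstar_algebra"
  assumes r: "0 \<le> r"
  defines "x \<equiv> star (emb b) * emb b - (r\<^sup>2) *\<^sub>R 1"
  shows emb_cutoff: "emb (cutoff r b) = cabs x + x" and cutoff_nonzero: "r < norm b \<Longrightarrow> cutoff r b \<noteq> 0"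
proof -
  have sx: "star x = x" by (simp add: x_def star_diff star_mult star_star star_scaleR)
  have cp: "cpos (cabs x)" by (rule cabs(1)[OF sx])
  have "scalar_part (cabs x) * scalar_part (cabs x) = (of_real (r\<^sup>2))\<^sup>2"
  proof -
    have "scalar_part (cabs x * cabs x) = scalar_part (x * x)" by (simp add: cabs(2)[OF sx])
    then show ?thesis by (simp add: x_def power2_eq_square)
  qed
  then have sq: "(scalar_part (cabs x))\<^sup>2 = (of_real (r\<^sup>2))\<^sup>2" by (simp only: power2_eq_square)
  have "0 \<le> Re (scalar_part (cabs x))" by (rule cpos_scalar_part[OF cp])
  moreover have "scalar_part (cabs x) = of_real (r\<^sup>2) \<or> scalar_part (cabs x) = - of_real (r\<^sup>2)"
    using sq by (simp only: power2_eq_iff)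
  ultimately have "scalar_part (cabs x) = of_real (r\<^sup>2)"
    by (cases "r = 0") auto
  then show eq: "emb (cutoff r b) = cabs x + x"
    by (intro unitization_eqI) (simp_all add: cutoff_def Let_def x_def)
  show "cutoff r b \<noteq> 0" if lt: "r < norm b"
  proof
    assume "cutoff r b = 0"
    then have "cabs x + x = 0" using eq by (simp add: embed_arith)
    then have "- x = cabs x" by (metis add.commute minus_unique)
    then have "cpos (- x)" using cp by simp
    then have "norm (star (emb b) * emb b) \<le> norm ((r\<^sup>2) *\<^sub>R (1::'a unitization))"
      by (intro cpos_norm_le cpos_star_mult) (simp add: x_def)
    then have "(norm b)\<^sup>2 \<le> r\<^sup>2" by (simp add: cstar_identity)
    then have "norm b \<le> r" using r by (rule power2_le_imp_le)
    then show False using lt by simp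
  qed
qed

text \<open>For g and k as in \<open>positive_part\<close>, the bound on \<pi> b gives \<langle>g h,
  x g h\<rangle> \<le> 0, while this number is the squared norm of k g h. So k g kills h, and then
  g^2 and g do.\<close>

lemma (in rep) cutoff_kernel:
  assumes r: "0 \<le> r" and bound: "\<And>h. h \<in> hcarrier H \<Longrightarrow> hnorm H (\<pi> b h) \<le> r * hnorm H h"
    and h: "h \<in> hcarrier H"
  shows "\<pi> (cutoff r b) h = hzero H"
proof -
  let ?r = "rep_ext H \<pi>"
  interpret R: rep H ?r by (rule rep_ext)
  define x where "x = star (emb b) * emb b - (r\<^sup>2) *\<^sub>R 1"
  have sx: "star x = x" by (simp add: x_def star_diff star_mult star_star star_scaleR)
  define g k where "g = cabs x + x" and "k = csqrt (cabs x)"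
  note pp = positive_part[OF sx, folded g_def k_def]
  have gh: "?r g h \<in> hcarrier H" using h by simp
  have "of_real ((hnorm H (?r (k * g) h))\<^sup>2) = hinner H h (?r (g * x * g) h)"
    unfolding pp(4) R.inner_star_mult[OF h] ..
  also have "\<dots> = hinner H (?r g h) (?r x (?r g h))"
    using R.adj[OF h, of "?r x (?r g h)" g] h pp(1) by (simp add: R.op_mult)
  also have "\<dots> = of_real ((hnorm H (\<pi> b (?r g h)))\<^sup>2) - of_real (r\<^sup>2 * (hnorm H (?r g h))\<^sup>2)"
    using R.inner_star_mult[OF gh, of "emb b"] gh
    by (simp add: x_def R.op_diff R.op_scale scaleR_scaleC rep_ext_one inner_simps rep_ext_emb inner_self R.op_mult del: of_real_power)
  finally have "(hnorm H (?r (k * g) h))\<^sup>2 = (hnorm H (\<pi> b (?r g h)))\<^sup>2 - r\<^sup>2 * (hnorm H (?r g h))\<^sup>2"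
    unfolding of_real_diff[symmetric] of_real_eq_iff .
  moreover have "(hnorm H (\<pi> b (?r g h)))\<^sup>2 \<le> (r * hnorm H (?r g h))\<^sup>2"
    by (intro power_mono bound gh) simp
  ultimately have "(hnorm H (?r (k * g) h))\<^sup>2 \<le> 0" by (simp add: power_mult_distrib)
  then have "?r (k * g) h = hzero H" using hnorm_eq_0[of "?r (k * g) h"] h by simp
  then have "?r (g * g) h = hzero H"
    unfolding pp(5) using h by (simp add: scaleR_scaleC R.op_scale R.op_mult)
  then have "of_real ((hnorm H (?r g h))\<^sup>2) = (0::complex)"
    using R.inner_star_mult[OF h, of g] h by (simp add: pp(1))
  then have "?r g h = hzero H" using hnorm_eq_0[OF gh] by simp
  then show ?thesis
    using emb_cutoff[OF r, of b] rep_ext_emb[OF h, of "cutoff r b"] by (simp add: g_def x_def)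
qed

section \<open>Extension of states\<close>

text \<open>By \<open>dominated_extension\<close> it suffices to bound the vector functional q0 by
  the gauge of J. If the real part of i u plus an element of J is at most t, then the positive part
  of x = \<open>re_part u - t *\<^sub>R 1\<close> is mapped into J by i; so \<pi> kills it, and q0 x
  \<le> 0.\<close>

theorem state_extension:
  fixes f :: "'a::cstar_algebra \<Rightarrow> 'b::cstar_algebra"
  assumes f: "star_hom f" and J: "cstar_ideal J" and \<pi>: "rep H \<pi>"
    and kill: "\<And>a h. f a \<in> J \<Longrightarrow> h \<in> hcarrier H \<Longrightarrow> \<pi> a h = hzero H"
    and z: "z \<in> hcarrier H" "hnorm H z = 1"
  obtains K :: "('b unitization \<Rightarrow> complex) hilbert" and \<rho> \<omega> where
    "rep K \<rho>" "\<omega> \<in> hcarrier K" "hnorm K \<omega> = 1"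
    "\<And>j h. j \<in> J \<Longrightarrow> h \<in> hcarrier K \<Longrightarrow> \<rho> j h = hzero K"
    "\<And>a. hinner K \<omega> (\<rho> (f a) \<omega>) = hinner H z (\<pi> a z)"
proof -
  interpret rep H \<pi> by (rule \<pi>)
  let ?r = "rep_ext H \<pi>"
  interpret R: rep H ?r by (rule rep_ext)
  have fD: "clinear f" "f (a * b) = f a * f b" "f (star a) = star (f a)" for a b
    using f by (auto simp: star_hom_def)
  note fl = clinearD[OF fD(1)]
  define i where "i u = unitize (f (alg_part u)) (scalar_part u)" for u
  have i: "i (u + v) = i u + i v" "i (s *\<^sub>R u) = s *\<^sub>R i u" "i (u * v) = i u * i v" "i (star u) = star (i u)"
    "i 1 = 1" "i (u - v) = i u - i v" "i (emb a) = emb (f a)" for u v s a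
    by (rule unitization_eqI; simp add: i_def fl fD)+
  have li: "linear i" by (rule linearI) (simp_all add: i)
  define q0 where "q0 u = Re (hinner H z (?r u z))" for u
  note vf = R.vector_functional[OF z(1), folded q0_def]
  have lq0: "linear q0" using vf(1) by (simp add: q0_def[abs_def])
  have q01: "q0 1 = 1" using z by (simp add: q0_def rep_ext_one inner_self)
  have q0_cpos: "0 \<le> q0 u" if "cpos u" for u using that vf(3) cpos_iff by (metis zero_le_power2)
  have "q0 u \<le> ideal_gauge J (i u)" for u
  proof (rule le_ideal_gauge[OF J])
    fix t j assume j: "j \<in> J" "cpos (t *\<^sub>R 1 - re_part (i u) - emb j)"
    define x where "x = re_part u - t *\<^sub>R 1"
    have sx: "star x = x" by (simp add: x_def star_diff star_scaleR)
    define g k where "g = cabs x + x" and "k = csqrt (cabs x)"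
    note pp = positive_part[OF sx, folded g_def k_def]
    have ix: "- i x = t *\<^sub>R 1 - re_part (i u)" by (simp add: x_def i re_part_def)
    have sg: "star (i g) = i g" using i(4)[of g] pp(1) by simp
    note EJ = cstar_ideal_embed[OF J]
    have "cpos (star (i g) * (- i x - emb j) * i g)" using j(2) unfolding ix by (rule cpos_conj)
    moreover have "star (i g) * (- i x - emb j) * i g = - (i g * emb j * i g) - i g * i x * i g"
      by (simp add: sg algebra_simps)
    moreover have "i g * i x * i g = star (i (k * g)) * i (k * g)"
      using arg_cong[OF pp(4), of i] by (simp only: i(3,4))
    ultimately have cp: "cpos (- (i g * emb j * i g) - star (i (k * g)) * i (k * g))" by simp
    \<comment> \<open>Conjugation by i g has put the square of i (k g), which is i g * i x * i g,
      below an element of J.\<close>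
    have "i (k * g) \<in> emb ` J"
    proof (rule ideal_mem_if_dominated[OF EJ])
      fix s :: real assume "s > 0"
      then have "cpos (s *\<^sub>R 1)" by (intro cpos_scaleR) auto
      from cpos_add[OF this cp] have "cpos (s *\<^sub>R 1 + - (i g * emb j * i g) - star (i (k * g)) * i (k * g))"
        by (simp add: algebra_simps)
      moreover have "- (i g * emb j * i g) \<in> emb ` J"
        using j(1) by (intro csubspaceD(5)[OF cstar_idealD(1)[OF EJ]] cstar_idealD(3,4)[OF EJ]) simp
      ultimately show "\<exists>y\<in>emb ` J. cpos (s *\<^sub>R 1 + y - star (i (k * g)) * i (k * g))" by blast
    qed
    moreover have "i (g * g) = 2 *\<^sub>R (i k * i (k * g))" by (simp only: pp(5) i(2) i(3)[of k "k * g"])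
    ultimately have "i (g * g) \<in> emb ` J"
      using csubspaceD(4)[OF cstar_idealD(1)[OF EJ] cstar_idealD(3)[OF EJ]] by simp
    then have "star (i g) * i g \<in> emb ` J" by (simp add: sg i(3))
    then have "i g \<in> emb ` J" by (rule ideal_star_square_1(1)[OF EJ])
    then obtain b where b: "b \<in> J" "i g = emb b" by blast
    have "scalar_part g = 0" "f (alg_part g) = b"
      using arg_cong[OF b(2), of scalar_part] arg_cong[OF b(2), of alg_part] by (simp_all add: i_def)
    then have "?r g z = hzero H" using kill[of "alg_part g"] b(1) z by (simp add: rep_ext_def add_zero)
    then have "q0 g = 0" using z by (simp add: q0_def)
    moreover have "0 \<le> q0 (cabs x)" by (rule q0_cpos[OF pp(6)])
    moreover have "x = g - cabs x" by (simp add: g_def)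
    ultimately have "q0 x \<le> 0" using linear_diff[OF lq0, of g "cabs x"] by simp
    moreover have "q0 (re_part u) = q0 u" by (simp add: re_part_def linear_add[OF lq0] linear_scale[OF lq0] vf(2)[folded q0_def])
    ultimately show "q0 u \<le> t" by (simp add: x_def linear_diff[OF lq0] linear_scale[OF lq0] q01)
  qed
  then obtain q where q: "linear q" "q \<le> ideal_gauge J" "\<And>u. q (i u) = q0 u"
    using dominated_extension[OF sublinear_ideal_gauge[OF J] li lq0] by blast
  obtain K :: "('b unitization \<Rightarrow> complex) hilbert" and \<rho> \<omega> where K: "rep K \<rho>" and
    "\<And>h. h \<in> hcarrier K \<Longrightarrow> \<rho> 1 h = h" and \<omega>: "\<omega> \<in> hcarrier K" and
    ip: "\<And>u. hinner K \<omega> (\<rho> u \<omega>) = complexify q u" and n1: "hnorm K \<omega> = 1" and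
    "hperp K (range (\<lambda>u. \<rho> u \<omega>)) = {hzero K}" and
    kill: "\<And>j h. j \<in> J \<Longrightarrow> h \<in> hcarrier K \<Longrightarrow> \<rho> (emb j) h = hzero K"
    using gns_state[OF J q(1,2)] by blast
  have "hinner K \<omega> (\<rho> (emb (f a)) \<omega>) = hinner H z (\<pi> a z)" for a
  proof -
    have "\<i> *\<^sub>C emb (f a) = i (emb (\<i> *\<^sub>C a))" by (subst i(7)) (simp add: fl embed_arith)
    then have "complexify q (emb (f a)) = Complex (q0 (emb a)) (- q0 (emb (\<i> *\<^sub>C a)))"
      by (simp add: complexify_def q(3) flip: i(7))
    also have "\<dots> = hinner H z (\<pi> a z)"
      using z by (simp add: q0_def rep_ext_emb op_scale inner_scale_right complex_eq_iff)
    finally show ?thesis unfolding ip .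
  qed
  then show thesis
    using that[OF rep_star_hom_comp[OF K star_hom_emb] \<omega> n1] kill by blast
qed

section \<open>Non-orthogonal irreducible subspaces\<close>

text \<open>Let p be the projection of m to N, nonzero by assumption. Its vector functional is
  dominated by that of m, hence by purity a multiple l of it. So the orbit of m, scaled by the root
  of l, has the inner products of the orbit of p, and \<open>dense_intertwiner\<close>
  applies.\<close>

lemma unitarily_equivalent_if_not_orthogonal:
  assumes \<sigma>: "rep K \<sigma>" and M: "hclosed_subspace K M" "\<And>a. \<sigma> a ` M \<subseteq> M" "irreducible_rep (K\<lparr>hcarrier := M\<rparr>) \<sigma>"
    and N: "hclosed_subspace K N" "\<And>a. \<sigma> a ` N \<subseteq> N" "irreducible_rep (K\<lparr>hcarrier := N\<rparr>) \<sigma>"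
    and mn: "m \<in> M" "n \<in> N" "hinner K m n \<noteq> 0"
  shows "unitarily_equivalent (K\<lparr>hcarrier := M\<rparr>, \<sigma>) (K\<lparr>hcarrier := N\<rparr>, \<sigma>)"
proof -
  interpret hilbert_space K using rep.rep[OF \<sigma>] by (simp add: representation_def)
  interpret S: rep K \<sigma> by (rule \<sigma>)
  let ?r = "rep_ext K \<sigma>"
  interpret rep K ?r by (rule S.rep_ext)
  let ?M = "K\<lparr>hcarrier := M\<rparr>" and ?N = "K\<lparr>hcarrier := N\<rparr>"
  have rM: "rep_ext ?M \<sigma> = ?r" and rN: "rep_ext ?N \<sigma> = ?r" by (simp_all add: rep_ext_def fun_eq_iff)
  note MD = hsubspaceD[OF hclosed_subspaceD(1)[OF M(1)]]
  note ND = hsubspaceD[OF hclosed_subspaceD(1)[OF N(1)]]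
  have "\<sigma> a x \<in> M" if "x \<in> M" for a x using M(2) that by blast
  then have inv: "?r u x \<in> M" if "x \<in> M" for u x
    using that by (simp add: rep_ext_def MD(3,4))
  have "\<sigma> a x \<in> N" if "x \<in> N" for a x using N(2) that by blast
  then have invN: "?r u x \<in> N" if "x \<in> N" for u x
    using that by (simp add: rep_ext_def ND(3,4))
  have mc: "m \<in> hcarrier K" and nc: "n \<in> hcarrier K" using mn MD(1) ND(1) by auto
  obtain p w where pw: "p \<in> N" "w \<in> hperp K N" "p \<in> hcarrier K" "w \<in> hcarrier K" "m = hadd K p w"
    using orthogonal_parts[OF N(1) mc] .
  have p0: "p \<noteq> hzero K"
  proof
    assume "p = hzero K"
    then have "m = w" using pw by (simp add: add_zero)
    then have "hinner K n m = 0" using pw mn by (simp add: hperp_def)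
    then show False using mn inner_commute[OF nc mc] by simp
  qed
  have m0: "m \<noteq> hzero K" using mn nc by auto
  define g where "g u = Re (hinner K p (?r u p))" for u
  note vf = vector_functional[OF pw(3)] vector_functional[OF pw(4)] vector_functional[OF mc]
  obtain l where l: "\<And>u. g u = l * Re (hinner ?M m (rep_ext ?M \<sigma> u m))"
  proof (rule irreducible_pure[OF M(3), of m g])
    show "linear g" unfolding g_def[abs_def] by (rule vf)
    show "g (star u) = g u" "0 \<le> g (star u * u)" for u by (simp_all add: g_def vf)
    fix u
    have "hinner K m (?r (star u * u) m) = hinner K p (?r (star u * u) p) + hinner K w (?r (star u * u) w)"
      unfolding pw(5) by (rule orthogonal_functional[OF _ pw(1-3)]) (use invN in blast)
    then show "g (star u * u) \<le> Re (hinner ?M m (rep_ext ?M \<sigma> (star u * u) m))"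
      unfolding rM by (simp add: g_def vf)
  qed (use mn in auto)
  then have l': "Re (hinner K p (?r u p)) = l * Re (hinner K m (?r u m))" for u
    unfolding rM by (simp add: g_def)
  have eq: "hinner K p (?r u p) = of_real l * hinner K m (?r u m)" for u
    by (rule real_parts_determine[OF pw(3) pw(3) mc mc l'])
  have "(hnorm K p)\<^sup>2 = l * (hnorm K m)\<^sup>2"
    using l'[of 1] S.rep_ext_one pw mc by (simp add: inner_self)
  moreover have "0 < (hnorm K p)\<^sup>2" "0 < (hnorm K m)\<^sup>2" using p0 m0 pw mc hnorm_eq_0 by auto
  ultimately have lpos: "0 < l" by (metis zero_less_mult_pos2)
  let ?c = "complex_of_real (sqrt l)"
  have cc: "?c * ?c = of_real l" using lpos by (simp flip: of_real_mult)
  obtain U where "unitary ?M ?N U" "\<And>a h. h \<in> hcarrier ?M \<Longrightarrow> U (\<sigma> a h) = \<sigma> a (U h)"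
  proof (rule dense_intertwiner[OF irreducibleD(1)[OF M(3)] irreducibleD(1)[OF N(3)],
        where u = "\<lambda>v. hscale K ?c (?r v m)" and w = "\<lambda>v. ?r v p" and act = "\<lambda>a v. emb a * v"])
    show "hinner ?M (hscale K ?c (?r v m)) (hscale K ?c (?r v' m)) = hinner ?N (?r v p) (?r v' p)" for v v'
    proof -
      have "hinner K (?r v p) (?r v' p) = of_real l * hinner K (?r v m) (?r v' m)"
        using adj[OF pw(3), of "?r v' p" v] adj[OF mc, of "?r v' m" v] pw mc eq[of "star v * v'"] by (simp add: op_mult)
      then show ?thesis using mc pw cc by (simp add: inner_simps flip: mult.assoc)
    qed
    show "hperp ?N (range (\<lambda>v. ?r v p)) = {hzero ?N}"
      using rep_ext_dense[OF N(3), of p] pw p0 unfolding rN by simp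
    have "hinner K (hscale K ?c x) y = 0 \<longleftrightarrow> hinner K x y = 0" if "x \<in> hcarrier K" "y \<in> hcarrier K" for x y
      using that lpos by (simp add: inner_scale_left)
    then have "hperp ?M (range (\<lambda>v. hscale K ?c (?r v m))) = hperp ?M (range (\<lambda>v. ?r v m))"
      using mc MD(1) by (auto simp: hperp_def)
    then show "hperp ?M (range (\<lambda>v. hscale K ?c (?r v m))) = {hzero ?M}"
      using rep_ext_dense[OF M(3), of m] mn m0 unfolding rM by simp
    show "\<sigma> a (hscale K ?c (?r v m)) = hscale K ?c (?r (emb a * v) m)" "\<sigma> a (?r v p) = ?r (emb a * v) p" for a v
      using mc pw by (simp_all add: S.op_scale_right op_mult S.rep_ext_emb)
  qed (use inv invN mn pw mc MD(4) in \<open>simp_all add: op_add op_scale scale_add_right scale_scale mult.commute\<close>)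
  then show ?thesis unfolding unitarily_equivalent_iff by blast
qed

section \<open>Points of the spectrum\<close>

lemma irreducible_unitary:
  assumes irr: "irreducible_rep H \<pi>" and K: "rep K \<sigma>"
    and U: "unitary H K U" "\<And>a h. h \<in> hcarrier H \<Longrightarrow> U (\<pi> a h) = \<sigma> a (U h)"
  shows "irreducible_rep K \<sigma>"
proof -
  interpret H: rep H \<pi> by (rule irreducibleD(1)[OF irr])
  interpret K: rep K \<sigma> by (rule K)
  note UD = unitaryD[OF U(1)]
  have U0: "U (hzero H) = hzero K" by (rule unitary_zero[OF U(1) H.hilbert_space_axioms K.hilbert_space_axioms])
  have Ueq0: "U h = hzero K \<longleftrightarrow> h = hzero H" if "h \<in> hcarrier H" for h
    using inj_onD[OF UD(5) _ that H.zero_closed] U0 by auto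
  obtain a h where ah: "h \<in> hcarrier H" "\<pi> a h \<noteq> hzero H" using irreducibleD(2)[OF irr] by blast
  show ?thesis
  proof (rule irreducibleI[OF K UD(1)[OF ah(1)]])
    show "\<sigma> a (U h) \<noteq> hzero K" using ah U(2) Ueq0[of "\<pi> a h"] by simp
    fix W assume W: "hclosed_subspace K W" and inv: "\<And>a. \<sigma> a ` W \<subseteq> W"
    note WD = K.hsubspaceD[OF K.hclosed_subspaceD(1)[OF W]]
    define V where "V = {h \<in> hcarrier H. U h \<in> W}"
    have "hclosed_subspace H V"
      unfolding hclosed_subspace_def
    proof (intro conjI allI ballI impI)
      show "hsubspace H V" unfolding hsubspace_def V_def using WD UD U0 by auto
      fix s h assume h: "h \<in> hcarrier H" and s: "\<forall>n. s n \<in> V" and lim: "(\<lambda>n. hdist H (s n) h) \<longlonglongrightarrow> 0"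
      have d: "hdist K (U (s n)) (U h) = hdist H (s n) h" for n
        by (rule unitary_hdist[OF U(1) H.hilbert_space_axioms]) (use s h in \<open>auto simp: V_def\<close>)
      have "U h \<in> W"
      proof (rule K.hclosed_subspaceD(2)[OF W, of "\<lambda>n. U (s n)"])
        show "U (s n) \<in> W" for n using s by (simp add: V_def)
        show "U h \<in> hcarrier K" by (rule UD(1)[OF h])
      qed (use lim in \<open>simp add: d\<close>)
      then show "h \<in> V" using h by (simp add: V_def)
    qed
    moreover have "\<sigma> a x \<in> W" if "x \<in> W" for a x using inv that by blast
    then have "\<pi> a ` V \<subseteq> V" for a by (auto simp: V_def U(2))
    ultimately have "V = {hzero H} \<or> V = hcarrier H" by (rule irreducibleD(3)[OF irr])
    moreover have "W = U ` V" using UD(6) WD(1) by (auto simp: V_def)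
    ultimately show "W = {hzero K} \<or> W = hcarrier K" using UD(6) U0 by auto
  qed
qed

lemma (in rep) transport_equivalent:
  assumes j: "inj_on j (hcarrier H)"
  defines "\<sigma> \<equiv> \<lambda>a k. j (\<pi> a (inv_into (hcarrier H) j k))"
  shows "rep (transport H j) \<sigma>" "unitary H (transport H j) j"
    "h \<in> hcarrier H \<Longrightarrow> j (\<pi> a h) = \<sigma> a (j h)"
  using transport_rep[OF j] by (simp_all add: \<sigma>_def)

lemma irreducible_irreps:
  fixes \<pi> :: "'a::cstar_algebra \<Rightarrow> 'h \<Rightarrow> 'h"
  assumes irr: "irreducible_rep H \<pi>"
  obtains q :: "'a irrep" where "q \<in> irreps" "unitarily_equivalent (H, \<pi>) q"
proof -
  interpret rep H \<pi> by (rule irreducibleD(1)[OF irr])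
  obtain a \<xi> where \<xi>: "\<xi> \<in> hcarrier H" "\<pi> a \<xi> \<noteq> hzero H" using irreducibleD(2)[OF irr] by blast
  then have \<xi>0: "\<xi> \<noteq> hzero H" by auto
  define j where "j h = (SOME a. (\<lambda>n. hdist H (\<pi> (a n) \<xi>) h) \<longlonglongrightarrow> 0)" for h
  have j: "(\<lambda>n. hdist H (\<pi> (j h n) \<xi>) h) \<longlonglongrightarrow> 0" if h: "h \<in> hcarrier H" for h
  proof -
    have "\<exists>a. (\<lambda>n. hdist H (\<pi> (a n) \<xi>) h) \<longlonglongrightarrow> 0"
      by (rule dense_seq[OF _ _ _ irreducible_dense[OF irr \<xi>(1) \<xi>0] h]) (use \<xi> in \<open>auto simp: op_add op_scale\<close>)
    then show ?thesis unfolding j_def by (rule someI_ex)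
  qed
  have inj: "inj_on j (hcarrier H)"
  proof (rule inj_onI)
    fix h k assume hk: "h \<in> hcarrier H" "k \<in> hcarrier H" "j h = j k"
    show "h = k" by (rule hdist_unique[OF _ hk(1,2) j[OF hk(1)]]) (use \<xi> j[OF hk(2)] hk(3) in auto)
  qed
  note t = transport_equivalent[OF inj]
  show thesis
    by (rule that[of "(transport H j, \<lambda>a k. j (\<pi> a (inv_into (hcarrier H) j k)))"])
      (use irreducible_unitary[OF irr t] t in \<open>auto simp: irreps_def unitarily_equivalent_iff\<close>)
qed

text \<open>The point of the spectrum given by an irreducible representation on any Hilbert space,
  in particular by a subspace of a representation of the crossed product;
  \<open>irreducible_irreps\<close> makes it nonempty.\<close>

definition cls :: "('a::cstar_algebra, 'h) rep \<Rightarrow> 'a irrep set"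
  where "cls p = {q \<in> irreps. unitarily_equivalent p q}"

lemma irrepsD: "q \<in> irreps \<Longrightarrow> irreducible_rep (fst q) (snd q)"
  by (auto simp: irreps_def)

lemma equivalent_sym:
  assumes "irreducible_rep (fst p) (snd p)" "unitarily_equivalent p q"
  shows "unitarily_equivalent q p"
  using unitarily_equivalent_sym[of "fst p" "snd p" "fst q" "snd q", OF _ irreducibleD(1)[OF assms(1)]] assms(2)
  by simp

lemma cls_eq:
  assumes "irreducible_rep (fst p) (snd p)" "unitarily_equivalent p q"
  shows "cls p = cls q"
  using unitarily_equivalent_trans[OF assms(2)] unitarily_equivalent_trans[OF equivalent_sym[OF assms]]
  by (auto simp: cls_def)

lemma cls_spectrum:
  assumes irr: "irreducible_rep (fst p) (snd p)"
  shows "cls p \<in> spectrum" "\<exists>q. q \<in> cls p"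
proof -
  obtain q where q: "q \<in> irreps" "unitarily_equivalent p q"
    using irreducible_irreps[OF irr] by (metis prod.collapse)
  have "cls p = {(p, q). p \<in> irreps \<and> q \<in> irreps \<and> unitarily_equivalent p q} `` {q}"
    unfolding cls_eq[OF irr q(2)] using q by (auto simp: cls_def)
  then show "cls p \<in> spectrum" using q by (auto simp: spectrum_def quotient_def)
  show "\<exists>q. q \<in> cls p" using q unfolding cls_def by blast
qed

lemma spectrumE:
  assumes "C \<in> spectrum"
  obtains p where "p \<in> irreps" "p \<in> C" "C = cls p"
proof -
  obtain p where p: "p \<in> irreps" "C = {(p, q). p \<in> irreps \<and> q \<in> irreps \<and> unitarily_equivalent p q} `` {p}"
    using assms by (auto simp: spectrum_def quotient_def)
  then have "C = cls p" by (auto simp: cls_def)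
  moreover have "p \<in> C" using p unitarily_equivalent_refl by blast
  ultimately show thesis using that p by blast
qed

lemma ideal_spectrum_cls:
  assumes irr: "irreducible_rep (fst p) (snd p)"
  shows "cls p \<in> ideal_spectrum I \<longleftrightarrow> (\<exists>a\<in>I. \<exists>h\<in>hcarrier (fst p). snd p a h \<noteq> hzero (fst p))"
proof -
  have nz: "\<exists>a\<in>I. \<exists>h\<in>hcarrier K. \<sigma> a h \<noteq> hzero K"
    if eq: "unitarily_equivalent (H, \<pi>) (K, \<sigma>)" and "rep H \<pi>" "rep K \<sigma>"
      and ex: "\<exists>a\<in>I. \<exists>h\<in>hcarrier H. \<pi> a h \<noteq> hzero H"
    for H :: "'x hilbert" and K :: "'y hilbert" and \<pi> \<sigma>
  proof -
    interpret H: rep H \<pi> by fact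
    interpret K: rep K \<sigma> by fact
    obtain U where U: "unitary H K U" "\<And>a h. h \<in> hcarrier H \<Longrightarrow> U (\<pi> a h) = \<sigma> a (U h)"
      using eq by (auto simp: unitarily_equivalent_iff)
    obtain a h where ah: "a \<in> I" "h \<in> hcarrier H" "\<pi> a h \<noteq> hzero H" using ex by blast
    have "hnorm K (\<sigma> a (U h)) = hnorm H (\<pi> a h)" using unitaryD(7)[OF U(1), of "\<pi> a h"] U(2) ah by simp
    also have "\<dots> \<noteq> 0" using ah H.hnorm_eq_0 by simp
    finally have "\<sigma> a (U h) \<noteq> hzero K" using K.hnorm_eq_0 by auto
    then show ?thesis using ah unitaryD(1)[OF U(1)] by blast
  qed
  have reps: "rep (fst q) (snd q)" "unitarily_equivalent p q" "unitarily_equivalent q p" if q: "q \<in> cls p" for q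
  proof -
    have qi: "q \<in> irreps" "unitarily_equivalent p q" using q unfolding cls_def by blast+
    show "rep (fst q) (snd q)" by (rule irreducibleD(1)[OF irrepsD[OF qi(1)]])
    show "unitarily_equivalent p q" by (rule qi(2))
    show "unitarily_equivalent q p" by (rule equivalent_sym[OF irr qi(2)])
  qed
  obtain q where q: "q \<in> cls p" using cls_spectrum(2)[OF irr] by blast
  show ?thesis
  proof
    assume "cls p \<in> ideal_spectrum I"
    then obtain q where q: "q \<in> cls p" "\<exists>a\<in>I. \<exists>h\<in>hcarrier (fst q). snd q a h \<noteq> hzero (fst q)"
      by (auto simp: ideal_spectrum_def split: prod.splits)
    show "\<exists>a\<in>I. \<exists>h\<in>hcarrier (fst p). snd p a h \<noteq> hzero (fst p)"
      using nz[of "fst q" "snd q" "fst p" "snd p"] irreducibleD(1)[OF irr] q(2) reps[OF q(1)] by simp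
  next
    assume "\<exists>a\<in>I. \<exists>h\<in>hcarrier (fst p). snd p a h \<noteq> hzero (fst p)"
    then have "\<exists>a\<in>I. \<exists>h\<in>hcarrier (fst q). snd q a h \<noteq> hzero (fst q)"
      using nz[of "fst p" "snd p" "fst q" "snd q"] irreducibleD(1)[OF irr] reps[OF q] by simp
    then show "cls p \<in> ideal_spectrum I"
      using q cls_spectrum(1)[OF irr] by (auto simp: ideal_spectrum_def intro!: bexI[of _ q] split: prod.splits)
  qed
qed

lemma irreducible_nonzero:
  assumes irr: "irreducible_rep H \<pi>"
  obtains z where "z \<in> hcarrier H" "hnorm H z = 1"
proof -
  interpret rep H \<pi> by (rule irreducibleD(1)[OF irr])
  obtain a h where ah: "h \<in> hcarrier H" "\<pi> a h \<noteq> hzero H" using irreducibleD(2)[OF irr] by blast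
  then have "h \<noteq> hzero H" by auto
  then have n: "hnorm H h \<noteq> 0" using hnorm_eq_0 ah by simp
  show thesis by (rule that[of "hscale H (of_real (1 / hnorm H h)) h"]) (use ah n in \<open>simp_all add: hnorm_scale norm_divide\<close>)
qed

section \<open>Induced representations\<close>

context right_hilbert_module
begin

context
  fixes H :: "'h hilbert" and \<pi> :: "'a \<Rightarrow> 'h \<Rightarrow> 'h" and K :: "'k hilbert" and t :: "'x \<Rightarrow> 'h \<Rightarrow> 'k"
  assumes irr: "irreducible_rep H \<pi>" and T: "interior_tensor ipR H \<pi> K t"
begin

lemma tensor:
  "hilbert_space K" "h \<in> hcarrier H \<Longrightarrow> t x h \<in> hcarrier K"
  "h \<in> hcarrier H \<Longrightarrow> k \<in> hcarrier H \<Longrightarrow> t x (hadd H h k) = hadd K (t x h) (t x k)"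
  "h \<in> hcarrier H \<Longrightarrow> t x (hscale H c h) = hscale K c (t x h)"
  "h \<in> hcarrier H \<Longrightarrow> t (x + y) h = hadd K (t x h) (t y h)"
  "h \<in> hcarrier H \<Longrightarrow> t (c *\<^sub>C x) h = hscale K c (t x h)"
  "h \<in> hcarrier H \<Longrightarrow> k \<in> hcarrier H \<Longrightarrow> hinner K (t x h) (t y k) = hinner H h (\<pi> (ipR x y) k)"
  "htotal K {t x h |x h. h \<in> hcarrier H}"
  using T by (auto simp: interior_tensor_def hlinear_def image_subset_iff)

text \<open>One vector suffices: x a \<otimes> h = x \<otimes> \<pi> a h follows from the inner
  products and totality, and the vectors \<pi> a \<xi> are dense. Thus x \<mapsto> x \<otimes> \<xi>
  is a linear map with dense range, as \<open>dense_intertwiner\<close> requires.\<close>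

lemma tensor_orbit_dense:
  assumes \<xi>: "\<xi> \<in> hcarrier H" "\<xi> \<noteq> hzero H"
  shows "hperp K (range (\<lambda>x. t x \<xi>)) = {hzero K}"
proof -
  interpret H: rep H \<pi> by (rule irreducibleD(1)[OF irr])
  interpret K: hilbert_space K by (rule tensor(1))
  let ?S = "{t x h |x h. h \<in> hcarrier H}"
  have S: "?S \<subseteq> hcarrier K" using tensor(2) by auto
  have SP: "hperp K ?S = {hzero K}" using K.htotal_iff[OF S] tensor(8) by simp
  have bal: "t (ract x a) h = t x (\<pi> a h)" if h: "h \<in> hcarrier H" for x a h
  proof -
    have "hsub K (t (ract x a) h) (t x (\<pi> a h)) \<in> hperp K ?S"
      using h tensor(2) by (auto simp: hperp_def K.inner_hsub_right tensor(7) ipR_ract H.op_mult)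
    then show ?thesis using SP h tensor(2) K.hsub_eq_zero[of "t (ract x a) h" "t x (\<pi> a h)"] by simp
  qed
  have "v \<in> hperp K ?S" if v: "v \<in> hperp K (range (\<lambda>x. t x \<xi>))" for v
  proof -
    have vc: "v \<in> hcarrier K" using v by (simp add: hperp_def)
    have "hinner K (t x h) v = 0" if h: "h \<in> hcarrier H" for x h
    proof -
      obtain a where a: "(\<lambda>n. hdist H (\<pi> (a n) \<xi>) h) \<longlonglongrightarrow> 0"
        by (rule H.dense_seq[OF _ _ _ irreducible_dense[OF irr \<xi>] h]) (use \<xi> in \<open>auto simp: H.op_add H.op_scale\<close>)
      let ?s = "\<lambda>n. \<pi> (a n) \<xi>"
      have "(\<lambda>n. hdist K (t x (?s n)) (t x h)) \<longlonglongrightarrow> 0"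
      proof (rule null_seq_bound)
        show "norm (hdist K (t x (?s n)) (t x h)) \<le> sqrt (norm (ipR x x)) * hdist H (?s n) h" for n
        proof -
          let ?d = "hsub H (?s n) h"
          have dc: "?d \<in> hcarrier H" using \<xi> h by simp
          have "hadd K (t x (?s n)) (hscale K (-1) (t x h)) = t x ?d"
            using \<xi> h by (simp add: hsub_def tensor(3,4))
          then have "(hdist K (t x (?s n)) (t x h))\<^sup>2 = Re (hinner H ?d (\<pi> (ipR x x) ?d))"
            using K.hnorm_sq[OF tensor(2)[OF dc], of x] tensor(7)[OF dc dc, of x x] by (simp add: hdist_def)
          also have "\<dots> \<le> cmod (hinner H ?d (\<pi> (ipR x x) ?d))" by (rule complex_Re_le_cmod)
          also have "\<dots> \<le> hnorm H ?d * (norm (ipR x x) * hnorm H ?d)"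
            using H.cauchy_schwarz[OF dc H.op_closed[OF dc]] mult_left_mono[OF H.op_norm[OF dc] hnorm_nonneg]
            by (rule order_trans)
          also have "\<dots> = (sqrt (norm (ipR x x)) * hdist H (?s n) h)\<^sup>2"
            by (simp add: hdist_hsub power_mult_distrib power2_eq_square)
          finally have "hdist K (t x (?s n)) (t x h) \<le> sqrt (norm (ipR x x)) * hdist H (?s n) h"
            by (rule power2_le_imp_le) simp
          then show ?thesis by simp
        qed
        have "(\<lambda>n. sqrt (norm (ipR x x)) * hdist H (?s n) h) \<longlonglongrightarrow> sqrt (norm (ipR x x)) * 0"
          by (intro tendsto_intros a)
        then show "(\<lambda>n. sqrt (norm (ipR x x)) * hdist H (?s n) h) \<longlonglongrightarrow> 0" by simp
      qed
      then have "(\<lambda>n. hinner K (t x (?s n)) v) \<longlonglongrightarrow> hinner K (t x h) v"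
        using \<xi> h vc tensor(2) by (intro K.inner_tendsto(2)) auto
      moreover have "hinner K (t x (?s n)) v = 0" for n
        using v bal[OF \<xi>(1), of x "a n", symmetric] by (auto simp: hperp_def)
      ultimately show ?thesis by (simp add: LIMSEQ_const_iff)
    qed
    then show ?thesis using vc by (auto simp: hperp_def)
  qed
  moreover have "hzero K \<in> hperp K (range (\<lambda>x. t x \<xi>))" using \<xi> tensor(2) by (auto simp: hperp_def)
  ultimately show ?thesis using SP by blast
qed

end

lemma induced_unique:
  fixes H :: "'h hilbert" and K :: "'k hilbert" and H' :: "'h2 hilbert" and K' :: "'k2 hilbert"
  assumes irr: "irreducible_rep H \<pi>" "irreducible_rep H' \<pi>'"
    and ind: "induced_rep lact ipR (H, \<pi>) (K, \<sigma>)" "induced_rep lact ipR (H', \<pi>') (K', \<sigma>')"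
    and eq: "unitarily_equivalent (H, \<pi>) (H', \<pi>')"
  shows "unitarily_equivalent (K, \<sigma>) (K', \<sigma>')"
proof -
  interpret H: rep H \<pi> by (rule irreducibleD(1)[OF irr(1)])
  interpret H': rep H' \<pi>' by (rule irreducibleD(1)[OF irr(2)])
  obtain t where t: "interior_tensor ipR H \<pi> K t" "\<And>a x h. h \<in> hcarrier H \<Longrightarrow> \<sigma> a (t x h) = t (lact a x) h"
    and K: "rep K \<sigma>" using ind(1) by (auto simp: induced_rep_def rep_def)
  obtain t' where t': "interior_tensor ipR H' \<pi>' K' t'" "\<And>a x h. h \<in> hcarrier H' \<Longrightarrow> \<sigma>' a (t' x h) = t' (lact a x) h"
    and K': "rep K' \<sigma>'" using ind(2) by (auto simp: induced_rep_def rep_def)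
  obtain U where U: "unitary H H' U" "\<And>a h. h \<in> hcarrier H \<Longrightarrow> U (\<pi> a h) = \<pi>' a (U h)"
    using eq by (auto simp: unitarily_equivalent_iff)
  obtain z where z: "z \<in> hcarrier H" "hnorm H z = 1" using irreducible_nonzero[OF irr(1)] .
  then have z0: "z \<noteq> hzero H" using H.hnorm_eq_0[OF z(1)] by simp
  have Uz: "U z \<in> hcarrier H'" "hnorm H' (U z) = 1" using unitaryD(1,7)[OF U(1) z(1)] z by auto
  then have Uz0: "U z \<noteq> hzero H'" using H'.hnorm_eq_0[OF Uz(1)] by simp
  note T = tensor[OF irr(1) t(1)] and T' = tensor[OF irr(2) t'(1)]
  obtain V where "unitary K K' V" "\<And>a h. h \<in> hcarrier K \<Longrightarrow> V (\<sigma> a h) = \<sigma>' a (V h)"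
  proof (rule dense_intertwiner[OF K K', where u = "\<lambda>x. t x z" and w = "\<lambda>x. t' x (U z)" and act = lact])
    show "hinner K (t x z) (t y z) = hinner K' (t' x (U z)) (t' y (U z))" for x y
      using T(7)[OF z(1) z(1)] T'(7)[OF Uz(1) Uz(1)] unitaryD(2)[OF U(1) z(1)] z U(2)[OF z(1), symmetric] by simp
  qed (use T T' z Uz t t' tensor_orbit_dense[OF irr(1) t(1) z(1) z0] tensor_orbit_dense[OF irr(2) t'(1) Uz(1) Uz0] in simp_all)
  then show ?thesis unfolding unitarily_equivalent_iff by blast
qed

text \<open>Together with \<open>induced_unique\<close> this shows that \<open>dual_map\<close>
  sends a class to a full class: source and target may be replaced by equivalent copies.\<close>

lemma induced_equivalent:
  fixes H :: "'h hilbert" and K :: "'k hilbert" and H' :: "'h2 hilbert" and K' :: "'k2 hilbert"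
  assumes irr: "irreducible_rep H \<pi>" and H': "rep H' \<pi>'" and K': "rep K' \<sigma>'"
    and ind: "induced_rep lact ipR (H, \<pi>) (K, \<sigma>)"
    and eq: "unitarily_equivalent (H, \<pi>) (H', \<pi>')" "unitarily_equivalent (K, \<sigma>) (K', \<sigma>')"
  shows "induced_rep lact ipR (H', \<pi>') (K', \<sigma>')"
proof -
  interpret H: rep H \<pi> by (rule irreducibleD(1)[OF irr])
  interpret H': rep H' \<pi>' by fact
  interpret K': rep K' \<sigma>' by fact
  obtain t where t: "interior_tensor ipR H \<pi> K t" "\<And>a x h. h \<in> hcarrier H \<Longrightarrow> \<sigma> a (t x h) = t (lact a x) h"
    and K: "rep K \<sigma>" using ind by (auto simp: induced_rep_def rep_def)
  interpret K: rep K \<sigma> by (rule K)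
  obtain U where U: "unitary H H' U" "\<And>a h. h \<in> hcarrier H \<Longrightarrow> U (\<pi> a h) = \<pi>' a (U h)"
    using eq by (auto simp: unitarily_equivalent_iff)
  obtain V where V: "unitary K K' V" "\<And>a h. h \<in> hcarrier K \<Longrightarrow> V (\<sigma> a h) = \<sigma>' a (V h)"
    using eq by (auto simp: unitarily_equivalent_iff)
  note T = tensor[OF irr t(1)] and VD = unitaryD[OF V(1)] and UD = unitaryD[OF U(1)]
  define W where "W = inv_into (hcarrier H) U"
  note inv = unitary_inv[OF U(1) H.hilbert_space_axioms, folded W_def]
  note WD = unitaryD[OF inv(1)]
  define t' where "t' x h = V (t x (W h))" for x h
  have W\<pi>: "W (\<pi>' a h) = \<pi> a (W h)" if "h \<in> hcarrier H'" for a h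
    using U(2)[OF inv(4)[OF that], of a] inv(2)[of "\<pi> a (W h)"] inv(3,4)[OF that] by simp
  have "interior_tensor ipR H' \<pi>' K' t'"
    unfolding interior_tensor_def
  proof (intro conjI allI ballI)
    show "hilbert_space K'" by (rule K'.hilbert_space_axioms)
    show "hlinear H' K' (t' x)" for x
      using T WD VD by (auto simp: hlinear_def t'_def)
    let ?S = "{t x h |x h. h \<in> hcarrier H}" and ?S' = "{t' x h |x h. h \<in> hcarrier H'}"
    have S: "?S \<subseteq> hcarrier K" "?S' \<subseteq> hcarrier K'" using T(2) WD(1) VD(1) by (auto simp: t'_def)
    have "v = hzero K'" if v: "v \<in> hperp K' ?S'" for v
    proof -
      have "v \<in> hcarrier K'" using v by (simp add: hperp_def)
      then obtain k where k: "k \<in> hcarrier K" "v = V k" using VD(6) by blast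
      have "hinner K (t x h) k = 0" if h: "h \<in> hcarrier H" for x h
      proof -
        have "t' x (U h) \<in> ?S'" using UD(1)[OF h] by blast
        then have "hinner K' (t' x (U h)) v = 0" using v by (simp add: hperp_def)
        then show ?thesis using k VD(2)[OF T(2)[OF h] k(1)] by (simp add: t'_def inv(2)[OF h])
      qed
      then have "k \<in> hperp K ?S" using k by (auto simp: hperp_def)
      then have "k = hzero K" using K.htotal_iff[OF S(1)] T(8) by simp
      then show ?thesis using k unitary_zero[OF V(1) K.hilbert_space_axioms K'.hilbert_space_axioms] by simp
    qed
    moreover have "hzero K' \<in> hperp K' ?S'"
      using K'.inner_zero_right[OF subsetD[OF S(2)]] K'.zero_closed unfolding hperp_def by blast
    ultimately have "hperp K' ?S' = {hzero K'}" by blast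
    then show "htotal K' ?S'" using K'.htotal_iff[OF S(2)] by simp
  qed (use T WD VD W\<pi> in \<open>auto simp: t'_def simp flip: WD(2)\<close>)
  moreover have "\<sigma>' a (t' x h) = t' (lact a x) h" if "h \<in> hcarrier H'" for a x h
    using that WD(1) T(2) t(2) V(2) by (simp add: t'_def flip: V(2))
  ultimately show ?thesis using K'.rep by (auto simp: induced_rep_def)
qed

end

section \<open>Covariant pairs\<close>

locale covariant_pair = hilbert_bimodule lact ract ipL ipR
  for lact :: "'a::cstar_algebra \<Rightarrow> 'x::complex_vector \<Rightarrow> 'x" and ract ipL ipR +
  fixes iA :: "'a \<Rightarrow> 'b::cstar_algebra" and iX :: "'x \<Rightarrow> 'b"
  assumes iA: "star_hom iA" and iX: "clinear iX"
    and iX_lact: "iX (lact a x) = iA a * iX x" and iX_ract: "iX (ract x a) = iX x * iA a"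
    and iA_ipR: "iA (ipR x y) = star (iX x) * iX y" and iA_ipL: "iA (ipL x y) = iX x * star (iX y)"
begin

lemma iA_simps: "iA (a + b) = iA a + iA b" "iA (c *\<^sub>C a) = c *\<^sub>C iA a" "iA 0 = 0" "iA (- a) = - iA a"
  "iA (a - b) = iA a - iA b" "iA (a * b) = iA a * iA b" "iA (star a) = star (iA a)"
  using iA clinearD[of iA] by (auto simp: star_hom_def)

lemma iX_simps: "iX (x + y) = iX x + iX y" "iX (c *\<^sub>C x) = c *\<^sub>C iX x" "iX 0 = 0"
  using clinearD[OF iX] by auto

text \<open>The double orthogonal complement serves as the closed linear span.\<close>

definition next_space :: "'k hilbert \<Rightarrow> ('b \<Rightarrow> 'k \<Rightarrow> 'k) \<Rightarrow> 'k set \<Rightarrow> 'k set"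
  where "next_space K \<rho> M = hperp K (hperp K {\<rho> (iX x) m |x m. m \<in> M})"

context
  fixes K :: "'k hilbert" and \<rho> :: "'b \<Rightarrow> 'k \<Rightarrow> 'k" and M :: "'k set"
  assumes K: "rep K \<rho>" and M: "hclosed_subspace K M" and inv: "\<And>a. \<rho> (iA a) ` M \<subseteq> M"
begin

interpretation rep K \<rho> by (rule K)

private abbreviation "S \<equiv> {\<rho> (iX x) m |x m. m \<in> M}"
private abbreviation "N \<equiv> next_space K \<rho> M"

lemma M_closed: "m \<in> M \<Longrightarrow> m \<in> hcarrier K"
  using hsubspaceD(1)[OF hclosed_subspaceD(1)[OF M]] .

lemma S_closed: "S \<subseteq> hcarrier K" using M_closed by auto

lemma next_space_closed: "hclosed_subspace K N"
  unfolding next_space_def by (rule hperp_closed_subspace) (auto simp: hperp_def)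

lemma next_space_carrier: "n \<in> N \<Longrightarrow> n \<in> hcarrier K"
  using hsubspaceD(1)[OF hclosed_subspaceD(1)[OF next_space_closed]] .

lemma next_spaceI: "m \<in> M \<Longrightarrow> \<rho> (iX x) m \<in> N"
  using subset_hperp_hperp[OF S_closed] by (auto simp: next_space_def)

lemma next_space_orth: "n \<in> N \<Longrightarrow> n \<in> hperp K S \<Longrightarrow> n = hzero K"
  using hperp_Int[of "hperp K S" n] by (auto simp: next_space_def hperp_def)

lemma next_space_invariant: "\<rho> (iA a) ` N \<subseteq> N"
proof -
  have S: "\<rho> (iA a) s \<in> S" if s: "s \<in> S" for a s
  proof -
    obtain x m where xm: "m \<in> M" "s = \<rho> (iX x) m" using s by blast
    then have "\<rho> (iA a) s = \<rho> (iX (lact a x)) m" using M_closed by (simp add: iX_lact op_mult)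
    then show ?thesis using xm by blast
  qed
  have S': "\<rho> (iA a) s \<in> hperp K S" if "s \<in> hperp K S" for a s
    by (rule hperp_invariant[OF S_closed _ that]) (use S[of _ "star a"] in \<open>simp add: iA_simps\<close>)
  show ?thesis
    unfolding next_space_def
  proof
    fix h assume "h \<in> \<rho> (iA a) ` hperp K (hperp K S)"
    then obtain g where g: "g \<in> hperp K (hperp K S)" "h = \<rho> (iA a) g" by blast
    show "h \<in> hperp K (hperp K S)"
      unfolding g(2) by (rule hperp_invariant[OF _ _ g(1)])
        (use S'[of _ "star a"] in \<open>auto simp: iA_simps hperp_def[of K S]\<close>)
  qed
qed

text \<open>X maps the complement of M into the complement of \<rho>(X) M, because
  \<open>star (iX x) * iX y\<close> comes from A and A preserves M. Taking adjoints leads from N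
  back into M.\<close>

lemma back_into: assumes n: "n \<in> N" shows "\<rho> (star (iX x)) n \<in> M"
proof -
  have nc: "n \<in> hcarrier K" using next_space_carrier[OF n] .
  have "hinner K m' (\<rho> (star (iX x)) n) = 0" if m': "m' \<in> hperp K M" for m'
  proof -
    have m'c: "m' \<in> hcarrier K" using m' by (simp add: hperp_def)
    have "hinner K (\<rho> (iX y) m) (\<rho> (iX x) m') = 0" if m: "m \<in> M" for y m
    proof -
      have "hinner K (\<rho> (iX y) m) (\<rho> (iX x) m') = hinner K (\<rho> (star (iX x)) (\<rho> (iX y) m)) m'"
        using adj'[of "\<rho> (iX y) m" m' "iX x"] M_closed[OF m] m'c by simp
      also have "\<dots> = hinner K (\<rho> (iA (ipR x y)) m) m'" using M_closed[OF m] by (simp add: iA_ipR op_mult)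
      also have "\<dots> = 0" using m' inv m by (auto simp: hperp_def)
      finally show ?thesis .
    qed
    then have "\<rho> (iX x) m' \<in> hperp K S" using m'c by (auto simp: hperp_def)
    then have "hinner K (\<rho> (iX x) m') n = 0" using n by (auto simp: next_space_def hperp_def)
    then show ?thesis using adj[OF m'c nc, of "iX x"] by simp
  qed
  then have "\<rho> (star (iX x)) n \<in> hperp K (hperp K M)" using nc by (auto simp: hperp_def[of K "hperp K M"])
  then show ?thesis using hperp_hperp[OF M] by simp
qed

context
  assumes irrM: "irreducible_rep (K\<lparr>hcarrier := M\<rparr>) (\<lambda>a. \<rho> (iA a))" and nz: "N \<noteq> {hzero K}"
begin

text \<open>An invariant W in N is pulled back to the closed span M0 in M of its images under
  adjoints of X. If M0 = 0, then W is orthogonal to \<rho>(X) M; if M0 = M, every vector orthogonal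
  to W is orthogonal to \<rho>(X) M, since \<open>iX x * star (iX y)\<close> comes from A.\<close>

lemma next_space_irreducible: "irreducible_rep (K\<lparr>hcarrier := N\<rparr>) (\<lambda>a. \<rho> (iA a))"
proof -
  have zN: "hzero K \<in> N" using hsubspaceD(2)[OF hclosed_subspaceD(1)[OF next_space_closed]] .
  have "\<not> S \<subseteq> {hzero K}"
  proof
    assume "S \<subseteq> {hzero K}"
    then have "\<rho> (iX x) m = hzero K" if "m \<in> M" for x m using that by blast
    then have "hcarrier K \<subseteq> hperp K S" by (auto simp: hperp_def)
    then have "n = hzero K" if "n \<in> N" for n using next_space_orth[OF that] next_space_carrier[OF that] by blast
    then show False using nz zN by blast
  qed
  then obtain x m where xm: "m \<in> M" "\<rho> (iX x) m \<noteq> hzero K" by blast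
  note mc = M_closed[OF xm(1)]
  let ?m = "\<rho> (star (iX x)) (\<rho> (iX x) m)"
  have "hinner K m ?m = of_real ((hnorm K (\<rho> (iX x) m))\<^sup>2)"
    using adj[OF mc, of "\<rho> (iX x) m" "iX x"] mc by (simp add: inner_self del: of_real_power)
  then have "hinner K m ?m \<noteq> 0" using xm(2) hnorm_eq_0[of "\<rho> (iX x) m"] mc by simp
  then have m0: "?m \<noteq> hzero K" using mc by auto
  have nN: "\<rho> (iX x) m \<in> N" using next_spaceI[OF xm(1)] .
  have "hinner K (\<rho> (iX x) m) (\<rho> (iA (ipL x x)) (\<rho> (iX x) m)) = of_real ((hnorm K ?m)\<^sup>2)"
    using adj'[of "\<rho> (iX x) m" ?m "iX x"] mc by (simp add: iA_ipL op_mult inner_self del: of_real_power)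
  then have "hinner K (\<rho> (iX x) m) (\<rho> (iA (ipL x x)) (\<rho> (iX x) m)) \<noteq> 0"
    using m0 hnorm_eq_0[of ?m] mc by simp
  then have nz': "\<rho> (iA (ipL x x)) (\<rho> (iX x) m) \<noteq> hzero K" using mc by auto
  have rK: "rep K (\<lambda>a. \<rho> (iA a))" by (rule rep_star_hom_comp[OF K iA])
  have rN: "rep (K\<lparr>hcarrier := N\<rparr>) (\<lambda>a. \<rho> (iA a))"
    by (rule rep.subrep[OF rK next_space_closed next_space_invariant])
  show ?thesis
  proof (rule irreducibleI[OF rN, of "\<rho> (iX x) m" "ipL x x"])
    fix W assume W0: "hclosed_subspace (K\<lparr>hcarrier := N\<rparr>) W" and Winv: "\<And>a. \<rho> (iA a) ` W \<subseteq> W"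
    have W: "hclosed_subspace K W" "W \<subseteq> N" using W0 closed_subspace_trans[OF next_space_closed] by auto
    have Wc: "w \<in> hcarrier K" if "w \<in> W" for w using W(2) next_space_carrier that by blast
    define T where "T = {\<rho> (star (iX x)) w |x w. w \<in> W}"
    have Tc: "T \<subseteq> hcarrier K" using Wc by (auto simp: T_def)
    have TM: "T \<subseteq> M" using back_into W(2) by (auto simp: T_def)
    have Ti: "\<rho> (iA a) s \<in> T" if s: "s \<in> T" for a s
    proof -
      obtain x w where xw: "w \<in> W" "s = \<rho> (star (iX x)) w" using s by (auto simp: T_def)
      have "star (iX (ract x (star a))) = iA a * star (iX x)" by (simp add: iX_ract star_mult iA_simps star_star)
      then have "\<rho> (iA a) s = \<rho> (star (iX (ract x (star a)))) w" using Wc[OF xw(1)] xw by (simp add: op_mult)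
      then show ?thesis using xw by (auto simp: T_def)
    qed
    define M0 where "M0 = hperp K (hperp K T)"
    have M0: "hclosed_subspace K M0" unfolding M0_def by (rule hperp_closed_subspace) (auto simp: hperp_def)
    have M0M: "M0 \<subseteq> M"
      unfolding M0_def using hperp_antimono[OF hperp_antimono[OF TM]] hperp_hperp[OF M] by blast
    have "\<rho> (iA a) ` M0 \<subseteq> M0" for a
    proof -
      have T': "\<rho> (iA a) s \<in> hperp K T" if "s \<in> hperp K T" for a s
        by (rule hperp_invariant[OF Tc _ that]) (use Ti[of _ "star a"] in \<open>simp add: iA_simps\<close>)
      have "\<rho> (iA a) g \<in> M0" if "g \<in> M0" for g
        unfolding M0_def by (rule hperp_invariant[OF _ _ that[unfolded M0_def]])
          (use T'[of _ "star a"] in \<open>auto simp: iA_simps hperp_def[of K T]\<close>)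
      then show ?thesis by blast
    qed
    then have "M0 = {hzero K} \<or> M0 = M"
      using irreducibleD(3)[OF irrM, of M0] closed_subspace_trans[OF M, of M0] M0 M0M by simp
    then have "W = {hzero K} \<or> W = N"
    proof
      assume M00: "M0 = {hzero K}"
      have "w = hzero K" if w: "w \<in> W" for w
      proof (rule next_space_orth)
        show "w \<in> N" using w W by blast
        have "hinner K (\<rho> (iX x) m) w = 0" if m: "m \<in> M" for x m
        proof -
          have "\<rho> (star (iX x)) w \<in> T" using w by (auto simp: T_def)
          then have "\<rho> (star (iX x)) w = hzero K" using M00 subset_hperp_hperp[OF Tc] by (auto simp: M0_def)
          then show ?thesis using adj[OF M_closed[OF m] Wc[OF w], of "iX x"] M_closed[OF m] by simp
        qed
        then show "w \<in> hperp K S" using Wc[OF w] by (auto simp: hperp_def)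
      qed
      then show ?thesis using hsubspaceD(2)[OF hclosed_subspaceD(1)[OF W(1)]] by blast
    next
      assume M0M': "M0 = M"
      have "hperp K W \<subseteq> hperp K S"
      proof
        fix z assume z: "z \<in> hperp K W"
        then have zc: "z \<in> hcarrier K" by (simp add: hperp_def)
        have "hinner K (\<rho> (iX x) m) z = 0" if m: "m \<in> M" for x m
        proof -
          have "hinner K (\<rho> (star (iX y)) w) (\<rho> (star (iX x)) z) = 0" if w: "w \<in> W" for y w
          proof -
            have "hinner K (\<rho> (star (iX y)) w) (\<rho> (star (iX x)) z) = hinner K (\<rho> (iX x) (\<rho> (star (iX y)) w)) z"
              using adj[of "\<rho> (star (iX y)) w" z "iX x"] Wc[OF w] zc by simp
            also have "\<dots> = hinner K (\<rho> (iA (ipL x y)) w) z" using Wc[OF w] by (simp add: iA_ipL op_mult)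
            also have "\<dots> = 0" using z Winv w by (auto simp: hperp_def)
            finally show ?thesis .
          qed
          then have "\<rho> (star (iX x)) z \<in> hperp K T" using zc by (auto simp: hperp_def T_def)
          moreover have "m \<in> hperp K (hperp K T)" using m M0M' by (simp add: M0_def)
          ultimately have "hinner K (\<rho> (star (iX x)) z) m = 0" by (simp add: hperp_def)
          then have "hinner K m (\<rho> (star (iX x)) z) = 0"
            using inner_commute[of "\<rho> (star (iX x)) z" m] zc M_closed[OF m] by simp
          then show ?thesis using adj[OF M_closed[OF m] zc, of "iX x"] by simp
        qed
        then show "z \<in> hperp K S" using zc by (auto simp: hperp_def)
      qed
      then have "N \<subseteq> W" using hperp_antimono hperp_hperp[OF W(1)] unfolding next_space_def by blast
      then show ?thesis using W(2) by blast
    qed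
    then show "W = {hzero (K\<lparr>hcarrier := N\<rparr>)} \<or> W = hcarrier (K\<lparr>hcarrier := N\<rparr>)" by simp
  qed (use nN nz' in simp_all)
qed

text \<open>The vector \<rho> (iX x) m serves as x \<otimes> m; \<open>iA_ipR\<close> gives the
  inner products and \<open>next_space_orth\<close> the totality.\<close>

lemma next_space_induced:
  "induced_rep lact ipR (K\<lparr>hcarrier := M\<rparr>, \<lambda>a. \<rho> (iA a)) (K\<lparr>hcarrier := N\<rparr>, \<lambda>a. \<rho> (iA a))"
proof -
  let ?N = "K\<lparr>hcarrier := N\<rparr>"
  interpret N: rep ?N "\<lambda>a. \<rho> (iA a)" by (rule irreducibleD(1)[OF next_space_irreducible])
  have "interior_tensor ipR (K\<lparr>hcarrier := M\<rparr>) (\<lambda>a. \<rho> (iA a)) ?N (\<lambda>x. \<rho> (iX x))"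
    unfolding interior_tensor_def
  proof (intro conjI allI ballI)
    show "hilbert_space ?N" by (rule N.hilbert_space_axioms)
    show "hlinear (K\<lparr>hcarrier := M\<rparr>) ?N (\<rho> (iX x))" for x
      using next_spaceI M_closed by (auto simp: hlinear_def op_add_right op_scale_right)
    fix x y h k assume "h \<in> hcarrier (K\<lparr>hcarrier := M\<rparr>)" "k \<in> hcarrier (K\<lparr>hcarrier := M\<rparr>)"
    then show "hinner ?N (\<rho> (iX x) h) (\<rho> (iX y) k) = hinner (K\<lparr>hcarrier := M\<rparr>) h (\<rho> (iA (ipR x y)) k)"
      using adj[of h "\<rho> (iX y) k" "iX x"] M_closed by (simp add: iA_ipR op_mult)
  next
    have SN: "S \<subseteq> hcarrier ?N" using next_spaceI by auto
    have "hperp ?N S = {hzero ?N}"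
      using next_space_orth hsubspaceD(2)[OF hclosed_subspaceD(1)[OF next_space_closed]] next_space_carrier M_closed
      by (auto simp: hperp_def)
    then show "htotal ?N {\<rho> (iX x) h |x h. h \<in> hcarrier (K\<lparr>hcarrier := M\<rparr>)}"
      using N.htotal_iff[OF SN] by simp
  qed (use M_closed in \<open>auto simp: iX_simps op_add op_scale\<close>)
  then show ?thesis
    using N.rep M_closed by (auto simp: induced_rep_def iX_lact op_mult intro!: exI[of _ "\<lambda>x. \<rho> (iX x)"])
qed

lemma dual_map_next_space:
  "cls (K\<lparr>hcarrier := M\<rparr>, \<lambda>a. \<rho> (iA a)) \<in> ideal_spectrum (ip_ideal ipR)"
  "dual_map lact ipR (cls (K\<lparr>hcarrier := M\<rparr>, \<lambda>a. \<rho> (iA a))) = cls (K\<lparr>hcarrier := N\<rparr>, \<lambda>a. \<rho> (iA a))"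
proof -
  let ?M = "(K\<lparr>hcarrier := M\<rparr>, \<lambda>a. \<rho> (iA a))" and ?N = "(K\<lparr>hcarrier := N\<rparr>, \<lambda>a. \<rho> (iA a))"
  have "\<exists>m\<in>M. \<exists>x. \<rho> (iX x) m \<noteq> hzero K"
  proof (rule ccontr)
    assume "\<not> ?thesis"
    then have "hcarrier K \<subseteq> hperp K S" by (auto simp: hperp_def)
    then have "n = hzero K" if "n \<in> N" for n using next_space_orth[OF that] next_space_carrier[OF that] by blast
    then show False using nz hsubspaceD(2)[OF hclosed_subspaceD(1)[OF next_space_closed]] by blast
  qed
  then obtain m x where xm: "m \<in> M" "\<rho> (iX x) m \<noteq> hzero K" by blast
  note mc = M_closed[OF xm(1)]
  have "hinner K m (\<rho> (iA (ipR x x)) m) = of_real ((hnorm K (\<rho> (iX x) m))\<^sup>2)"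
    using inner_star_mult[OF mc, of "iX x"] by (simp add: iA_ipR)
  then have "\<rho> (iA (ipR x x)) m \<noteq> hzero K" using xm(2) hnorm_eq_0[of "\<rho> (iX x) m"] mc by auto
  moreover have "ipR x x \<in> ip_ideal ipR"
    unfolding ip_ideal_def by (rule subsetD[OF closure_subset complex_vector.span_base]) blast
  ultimately show "cls ?M \<in> ideal_spectrum (ip_ideal ipR)"
    using ideal_spectrum_cls[of ?M] irrM xm(1) by auto
  show "dual_map lact ipR (cls ?M) = cls ?N"
  proof
    show "dual_map lact ipR (cls ?M) \<subseteq> cls ?N"
    proof
      fix q assume "q \<in> dual_map lact ipR (cls ?M)"
      then obtain p where p: "q \<in> irreps" "p \<in> irreps" "unitarily_equivalent ?M p" "induced_rep lact ipR p q"
        by (auto simp: dual_map_def cls_def)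
      have "unitarily_equivalent ?N (fst q, snd q)"
        by (rule induced_unique[OF irrM irrepsD[OF p(2)] next_space_induced]) (use p in simp_all)
      then show "q \<in> cls ?N" using p by (simp add: cls_def)
    qed
    show "cls ?N \<subseteq> dual_map lact ipR (cls ?M)"
    proof
      fix q assume q: "q \<in> cls ?N"
      obtain p where p: "p \<in> cls ?M" using cls_spectrum(2)[of ?M] irrM by auto
      have "induced_rep lact ipR (fst p, snd p) (fst q, snd q)"
        by (rule induced_equivalent[OF irrM irreducibleD(1)[OF irrepsD] irreducibleD(1)[OF irrepsD] next_space_induced])
          (use p q in \<open>auto simp: cls_def\<close>)
      then have "induced_rep lact ipR p q" by simp
      then show "q \<in> dual_map lact ipR (cls ?M)" using p q unfolding dual_map_def cls_def by blast
    qed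
  qed
qed

end
end
end

section \<open>Ideals and extensions of irreducible representations\<close>

lemma cstar_ideal_Inter: "(\<And>I. I \<in> \<I> \<Longrightarrow> cstar_ideal I) \<Longrightarrow> cstar_ideal (\<Inter>\<I>)"
  by (auto simp: cstar_ideal_def intro!: complex_vector.subspace_Inter closed_Inter)

lemma (in rep) kernel_ideal: "cstar_ideal {a. \<forall>h\<in>hcarrier H. \<pi> a h = hzero H}"
  unfolding cstar_ideal_def
proof (intro conjI allI ballI)
  show "csubspace {a. \<forall>h\<in>hcarrier H. \<pi> a h = hzero H}"
    by (rule csubspaceI) (simp_all add: op_add op_scale add_zero)
  show "closed {a. \<forall>h\<in>hcarrier H. \<pi> a h = hzero H}"
    unfolding closed_sequential_limits
  proof (intro allI impI, elim conjE)
    fix s a assume s: "\<forall>n. s n \<in> {a. \<forall>h\<in>hcarrier H. \<pi> a h = hzero H}" and lim: "s \<longlonglongrightarrow> a"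
    have "\<pi> a h = hzero H" if h: "h \<in> hcarrier H" for h
    proof (rule hdist_unique)
      show "(\<lambda>n. hdist H (\<pi> (s n) h) (\<pi> a h)) \<longlonglongrightarrow> 0" by (rule op_tendsto_alg[OF lim h])
      show "(\<lambda>n. hdist H (\<pi> (s n) h) (hzero H)) \<longlonglongrightarrow> 0" using s h by (simp add: hdist_self)
    qed (use h in auto)
    then show "a \<in> {a. \<forall>h\<in>hcarrier H. \<pi> a h = hzero H}" by simp
  qed
qed (auto simp: op_mult)

text \<open>Closedness comes from representations: an element outside the preimage is detected by an
  irreducible representation killing J, whose pullback to A has a closed kernel. So the preimage is
  the intersection of the ideals containing it.\<close>

lemma cstar_ideal_vimage:
  fixes f :: "'a::cstar_algebra \<Rightarrow> 'b::cstar_algebra"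
  assumes f: "star_hom f" and J: "cstar_ideal J"
  shows "cstar_ideal (f -` J)"
proof -
  define \<I> where "\<I> = {I. cstar_ideal I \<and> f -` J \<subseteq> I}"
  have "a \<in> f -` J" if a: "a \<in> \<Inter>\<I>" for a
  proof (rule ccontr)
    assume "a \<notin> f -` J"
    then obtain H :: "('b unitization \<Rightarrow> complex) hilbert" and \<pi> where H: "irreducible_rep H \<pi>"
      "\<And>a h. a \<in> J \<Longrightarrow> h \<in> hcarrier H \<Longrightarrow> \<pi> a h = hzero H" "\<exists>h\<in>hcarrier H. \<pi> (f a) h \<noteq> hzero H"
      using separating_irrep[OF J, of "f a"] by auto
    interpret rep H "\<lambda>a. \<pi> (f a)" by (rule rep_star_hom_comp[OF irreducibleD(1)[OF H(1)] f])
    have "{a. \<forall>h\<in>hcarrier H. \<pi> (f a) h = hzero H} \<in> \<I>" using kernel_ideal H(2) by (auto simp: \<I>_def)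
    then show False using a H(3) by blast
  qed
  then have "f -` J = \<Inter>\<I>" by (auto simp: \<I>_def)
  then show ?thesis using cstar_ideal_Inter[of \<I>] by (simp add: \<I>_def)
qed

lemma (in rep) cyclic_subspace:
  assumes \<omega>: "\<omega> \<in> hcarrier H"
  defines "S \<equiv> range (\<lambda>a. \<pi> a \<omega>)"
  defines "M \<equiv> hperp H (hperp H S)"
  shows "hclosed_subspace H M" "\<pi> a ` M \<subseteq> M" "S \<subseteq> M" "hperp (H\<lparr>hcarrier := M\<rparr>) S = {hzero H}"
proof -
  have S: "S \<subseteq> hcarrier H" using \<omega> by (auto simp: S_def)
  show SM: "S \<subseteq> M" unfolding M_def by (rule subset_hperp_hperp[OF S])
  show M: "hclosed_subspace H M" unfolding M_def by (rule hperp_closed_subspace) (auto simp: hperp_def)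
  have Mc: "M \<subseteq> hcarrier H" by (auto simp: M_def hperp_def)
  have invS: "\<pi> a s \<in> S" if "s \<in> S" for a s
    using that \<omega> by (auto simp: S_def simp flip: op_mult)
  have invS': "\<pi> a s \<in> hperp H S" if "s \<in> hperp H S" for a s
    by (rule hperp_invariant[OF S invS that])
  have "\<pi> a h \<in> M" if "h \<in> M" for h
    unfolding M_def by (rule hperp_invariant[OF _ invS' that[unfolded M_def]]) (auto simp: hperp_def)
  then show "\<pi> a ` M \<subseteq> M" by blast
  have *: "h = hzero H" if h: "h \<in> hperp (H\<lparr>hcarrier := M\<rparr>) S" for h
    by (rule hperp_Int[of "hperp H S"]) (use h Mc in \<open>auto simp: hperp_def M_def\<close>)
  have "hzero H \<in> M" using hsubspaceD(2)[OF hclosed_subspaceD(1)[OF M]] .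
  then have "hzero H \<in> hperp (H\<lparr>hcarrier := M\<rparr>) S" using S by (auto simp: hperp_def)
  with * show "hperp (H\<lparr>hcarrier := M\<rparr>) S = {hzero H}" by blast
qed

lemma extended_subspace:
  fixes f :: "'a::cstar_algebra \<Rightarrow> 'b::cstar_algebra"
  assumes f: "star_hom f" and J: "cstar_ideal J" and irr: "irreducible_rep H \<pi>"
    and kill: "\<And>a h. f a \<in> J \<Longrightarrow> h \<in> hcarrier H \<Longrightarrow> \<pi> a h = hzero H"
    and z: "z \<in> hcarrier H" "hnorm H z = 1"
  obtains K :: "('b unitization \<Rightarrow> complex) hilbert" and \<rho> M \<omega> where
    "rep K \<rho>" "\<And>j h. j \<in> J \<Longrightarrow> h \<in> hcarrier K \<Longrightarrow> \<rho> j h = hzero K"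
    "hclosed_subspace K M" "\<And>a. \<rho> (f a) ` M \<subseteq> M"
    "irreducible_rep (K\<lparr>hcarrier := M\<rparr>) (\<lambda>a. \<rho> (f a))"
    "unitarily_equivalent (H, \<pi>) (K\<lparr>hcarrier := M\<rparr>, \<lambda>a. \<rho> (f a))"
    "\<omega> \<in> M" "hnorm K \<omega> = 1" "\<And>a. hinner K \<omega> (\<rho> (f a) \<omega>) = hinner H z (\<pi> a z)"
proof -
  obtain K :: "('b unitization \<Rightarrow> complex) hilbert" and \<rho> \<omega> where
    \<rho>: "rep K \<rho>" and \<omega>: "\<omega> \<in> hcarrier K" "hnorm K \<omega> = 1"
    and kill': "\<And>j h. j \<in> J \<Longrightarrow> h \<in> hcarrier K \<Longrightarrow> \<rho> j h = hzero K"
    and state: "\<And>a. hinner K \<omega> (\<rho> (f a) \<omega>) = hinner H z (\<pi> a z)"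
    using state_extension[OF f J irreducibleD(1)[OF irr] kill z] by blast
  interpret H: rep H \<pi> by (rule irreducibleD(1)[OF irr])
  interpret R: rep K "\<lambda>a. \<rho> (f a)" by (rule rep_star_hom_comp[OF \<rho> f])
  let ?\<sigma> = "\<lambda>a. \<rho> (f a)"
  define S where "S = range (\<lambda>a. ?\<sigma> a \<omega>)"
  define M where "M = hperp K (hperp K S)"
  note cyc = R.cyclic_subspace[OF \<omega>(1), folded S_def M_def]
  have M: "hclosed_subspace K M" and SM: "S \<subseteq> M" by (fact cyc)+
  have Mc: "M \<subseteq> hcarrier K" by (auto simp: M_def hperp_def)
  let ?M = "K\<lparr>hcarrier := M\<rparr>"
  interpret N: rep ?M ?\<sigma> by (rule R.subrep[OF M cyc(2)])
  have z0: "z \<noteq> hzero H" using z H.hnorm_eq_0[OF z(1)] by auto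
  obtain U where U: "unitary H ?M U" "\<And>a. U (\<pi> a z) = ?\<sigma> a \<omega>" "\<And>a h. h \<in> hcarrier H \<Longrightarrow> U (\<pi> a h) = ?\<sigma> a (U h)"
  proof (rule dense_intertwiner[OF H.rep_axioms N.rep_axioms, where u = "\<lambda>a. \<pi> a z" and w = "\<lambda>a. ?\<sigma> a \<omega>" and act = "(*)"])
    show "hinner H (\<pi> a z) (\<pi> b z) = hinner ?M (?\<sigma> a \<omega>) (?\<sigma> b \<omega>)" for a b
      using state[of "star a * b"] z \<omega> by (simp add: H.op_mult R.op_mult H.adj R.adj)
    show "?\<sigma> a \<omega> \<in> hcarrier ?M" for a using SM by (auto simp: S_def)
    show "hperp H (range (\<lambda>a. \<pi> a z)) = {hzero H}" by (rule irreducible_dense[OF irr z(1) z0])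
    show "hperp ?M (range (\<lambda>a. ?\<sigma> a \<omega>)) = {hzero ?M}" using cyc(4) by (simp add: S_def)
  qed (use z \<omega> in \<open>simp_all add: H.op_add H.op_scale R.op_add R.op_scale H.op_mult R.op_mult\<close>)
  have UM: "U z \<in> M" using unitaryD(1)[OF U(1) z(1)] by simp
  then have Uc: "U z \<in> hcarrier K" using Mc by blast
  \<comment> \<open>As A may lack a unit, it has to be shown that \<omega> lies in its own closed
    orbit. The vector \<omega> - U z is orthogonal to the orbit, hence to U z; as \<omega> and U z
    have norm 1, they coincide.\<close>
  let ?d = "hsub K \<omega> (U z)"
  have dc: "?d \<in> hcarrier K" using Uc \<omega> by simp
  have "hinner K s ?d = 0" if "s \<in> S" for s
  proof -
    obtain a where a: "s = ?\<sigma> a \<omega>" using \<open>s \<in> S\<close> by (auto simp: S_def)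
    have "hinner K s (U z) = hinner H (\<pi> a z) z"
      using unitaryD(2)[OF U(1) H.op_closed[OF z(1), of a] z(1)] by (simp add: a U(2))
    also have "\<dots> = hinner K s \<omega>" using z \<omega> by (simp add: a H.adj R.adj state)
    finally show ?thesis using a Uc \<omega> by (simp add: R.inner_hsub_right)
  qed
  then have "?d \<in> hperp K S" using dc by (auto simp: hperp_def)
  then have Ud: "hinner K ?d (U z) = 0" using UM by (simp add: M_def hperp_def)
  have Ud': "hinner K (U z) ?d = 0" using R.inner_commute[OF dc Uc] Ud by simp
  have UU: "hinner K (U z) (U z) = 1"
    using unitaryD(2)[OF U(1) z(1) z(1)] H.inner_self[OF z(1)] z by simp
  have "hinner K \<omega> (U z) = 1" using Ud UU Uc \<omega> by (simp add: R.inner_hsub_left)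
  then have "hinner K ?d ?d = 0"
    using Ud' Uc \<omega> R.inner_self[OF \<omega>(1)] by (simp add: R.inner_hsub_left R.inner_hsub_right)
  then have "?d = hzero K" by (rule R.inner_definite[OF dc])
  then have "\<omega> = U z" using R.hsub_eq_zero[OF \<omega>(1) Uc] by simp
  then have "\<omega> \<in> M" using UM by simp
  moreover have "irreducible_rep ?M ?\<sigma>" by (rule irreducible_unitary[OF irr N.rep_axioms U(1,3)])
  moreover have "unitarily_equivalent (H, \<pi>) (?M, ?\<sigma>)"
    unfolding unitarily_equivalent_iff using U(1,3) by blast
  ultimately show thesis using that[OF \<rho> kill' M cyc(2) _ _ _ \<omega>(2) state] by blast
qed

lemma (in rep) op_cspan_zero:
  assumes "\<And>a. a \<in> S \<Longrightarrow> \<pi> a h = hzero H" "h \<in> hcarrier H" "a \<in> closure (cspan S)"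
  shows "\<pi> a h = hzero H"
proof -
  let ?Z = "{a. \<pi> a h = hzero H}"
  have "csubspace ?Z" by (rule csubspaceI) (use assms in \<open>simp_all add: op_add op_scale add_zero\<close>)
  then have "cspan S \<subseteq> ?Z" by (intro complex_vector.span_minimal) (use assms in auto)
  then obtain s where s: "\<And>n. s n \<in> ?Z" "s \<longlonglongrightarrow> a" using assms(3) unfolding closure_sequential by blast
  show ?thesis
  proof (rule hdist_unique)
    show "(\<lambda>n. hdist H (\<pi> (s n) h) (\<pi> a h)) \<longlonglongrightarrow> 0" by (rule op_tendsto_alg[OF s(2) assms(2)])
    show "(\<lambda>n. hdist H (\<pi> (s n) h) (hzero H)) \<longlonglongrightarrow> 0" using s(1) by (simp add: hdist_self)
  qed (use assms in auto)
qed


text \<open>Primeness of the kernel of an irreducible representation, in the form in which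
  \<open>induced_kills\<close> cancels a factor that acts nontrivially.\<close>

lemma irreducible_zero:
  assumes irr: "irreducible_rep H \<pi>" and v: "v \<in> hcarrier H" "v \<noteq> hzero H"
    and zero: "\<And>c. \<pi> a (\<pi> c v) = hzero H" and h: "h \<in> hcarrier H"
  shows "\<pi> a h = hzero H"
proof -
  interpret rep H \<pi> by (rule irreducibleD(1)[OF irr])
  have star: "\<pi> (star a) k = hzero H" if k: "k \<in> hcarrier H" for k
  proof -
    have "hinner H (\<pi> c v) (\<pi> (star a) k) = 0" for c
      using adj[OF op_closed[OF v(1)] k, of a c] zero k by simp
    then have "\<pi> (star a) k \<in> hperp H (range (\<lambda>c. \<pi> c v))" using k by (auto simp: hperp_def)
    then show ?thesis using irreducible_dense[OF irr v] by simp
  qed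
  have "hinner H (\<pi> a h) (\<pi> a h) = 0" using adj[OF h op_closed[OF h], of a a] star[OF op_closed[OF h]] h by simp
  then show ?thesis by (rule inner_definite[OF op_closed[OF h]])
qed

section \<open>Ideals and open sets of the spectrum\<close>

lemma ideal_spectrum_UNIV: "ideal_spectrum UNIV = spectrum"
proof
  show "spectrum \<subseteq> ideal_spectrum (UNIV :: 'a set)"
  proof
    fix C :: "'a irrep set" assume "C \<in> spectrum"
    then obtain p where p: "p \<in> irreps" "C = cls p" by (rule spectrumE)
    then show "C \<in> ideal_spectrum UNIV"
      using ideal_spectrum_cls[OF irrepsD[OF p(1)], of UNIV] irreducibleD(2)[OF irrepsD[OF p(1)]] by simp
  qed
qed (auto simp: ideal_spectrum_def)

lemma cstar_ideal_UNIV: "cstar_ideal UNIV"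
  by (simp add: cstar_ideal_def)

lemma cstar_ideal_zero: "cstar_ideal {0}"
  by (auto simp: cstar_ideal_def intro: csubspaceI)

lemma topspace_spectrum: "topspace spectrum_topology = spectrum"
proof -
  have "ideal_spectrum I \<subseteq> spectrum" for I :: "'a set" by (auto simp: ideal_spectrum_def)
  then show ?thesis
    using cstar_ideal_UNIV ideal_spectrum_UNIV unfolding spectrum_topology_def topology_generated_by_topspace by blast
qed

lemma openin_ideal_spectrum: "cstar_ideal I \<Longrightarrow> openin spectrum_topology (ideal_spectrum I)"
  unfolding spectrum_topology_def by (rule topology_generated_by_Basis) blast

lemma separating_point:
  fixes I :: "'a::cstar_algebra set"
  assumes "cstar_ideal I" "c \<notin> I"
  obtains C where "C \<in> spectrum" "C \<notin> ideal_spectrum I" "\<And>I'. c \<in> I' \<Longrightarrow> C \<in> ideal_spectrum I'"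
proof -
  obtain H :: "('a unitization \<Rightarrow> complex) hilbert" and \<pi> where H: "irreducible_rep H \<pi>"
    "\<And>a h. a \<in> I \<Longrightarrow> h \<in> hcarrier H \<Longrightarrow> \<pi> a h = hzero H" "\<exists>h\<in>hcarrier H. \<pi> c h \<noteq> hzero H"
    using separating_irrep[OF assms] by blast
  have irr: "irreducible_rep (fst (H, \<pi>)) (snd (H, \<pi>))" using H(1) by simp
  show thesis
  proof (rule that[of "cls (H, \<pi>)"])
    show "cls (H, \<pi>) \<notin> ideal_spectrum I" using ideal_spectrum_cls[OF irr, of I] H(2) by simp
    show "cls (H, \<pi>) \<in> ideal_spectrum I'" if "c \<in> I'" for I'
      using ideal_spectrum_cls[OF irr, of I'] H(3) that by auto
  qed (rule cls_spectrum(1)[OF irr])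
qed

section \<open>Restricting an ideal of the crossed product to the coefficient algebra\<close>

context covariant_pair
begin

abbreviation "dual_dom \<equiv> ideal_spectrum (ip_ideal ipR)"
abbreviation "dual \<equiv> dual_map lact ipR"

text \<open>If X killed h, so would all \<open>ipR x y\<close> and, by continuity, their closed
  span, which acts nontrivially at points of the domain.\<close>

lemma next_space_nonzero:
  assumes K: "rep K \<rho>" and M: "hclosed_subspace K M" "\<And>a. \<rho> (iA a) ` M \<subseteq> M"
    and irr: "irreducible_rep (K\<lparr>hcarrier := M\<rparr>) (\<lambda>a. \<rho> (iA a))"
    and dom: "cls (K\<lparr>hcarrier := M\<rparr>, \<lambda>a. \<rho> (iA a)) \<in> dual_dom"
  shows "next_space K \<rho> M \<noteq> {hzero K}"
proof
  assume N: "next_space K \<rho> M = {hzero K}"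
  interpret K: rep K \<rho> by (rule K)
  interpret M: rep "K\<lparr>hcarrier := M\<rparr>" "\<lambda>a. \<rho> (iA a)" by (rule irreducibleD(1)[OF irr])
  obtain a h where ah: "a \<in> ip_ideal ipR" "h \<in> M" "\<rho> (iA a) h \<noteq> hzero K"
    using dom ideal_spectrum_cls[of "(K\<lparr>hcarrier := M\<rparr>, \<lambda>a. \<rho> (iA a))" "ip_ideal ipR"] irr by auto
  have hK: "h \<in> hcarrier K" by (rule M_closed[OF K M ah(2)])
  have "\<rho> (iX x) h = hzero K" for x using next_spaceI[OF K M ah(2), of x] N by simp
  then have "\<rho> (iA c) h = hzero K" if "c \<in> {ipR x y |x y. True}" for c
    using that hK by (auto simp: iA_ipR K.op_mult)
  then have "\<rho> (iA a) h = hzero K"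
    using M.op_cspan_zero[of "{ipR x y |x y. True}" h a] ah by (simp add: ip_ideal_def)
  with ah(3) show False by simp
qed

text \<open>If \<open>iA b\<close> lies in J, so does the image of \<open>ipL (ract y b) z\<close>,
  which is b flanked by elements of X. Compatibility of the two inner products turns
  \<open>ipR x y * (b * ipR z w)\<close> into \<open>ipR x (lact (ipL (ract y b) z) w)\<close>,
  which \<pi> kills. Primeness strips off the outer factors, as some \<open>ipR z w\<close> acts
  nontrivially.\<close>

lemma induced_kills:
  assumes J: "cstar_ideal J" and irr: "irreducible_rep H \<pi>" "irreducible_rep K \<sigma>"
    and ind: "induced_rep lact ipR (H, \<pi>) (K, \<sigma>)"
    and kill: "\<And>a k. iA a \<in> J \<Longrightarrow> k \<in> hcarrier K \<Longrightarrow> \<sigma> a k = hzero K"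
    and nz: "c \<in> ip_ideal ipR" "k \<in> hcarrier H" "\<pi> c k \<noteq> hzero H"
    and b: "iA b \<in> J" and h: "h \<in> hcarrier H"
  shows "\<pi> b h = hzero H"
proof (rule ccontr)
  assume bh: "\<pi> b h \<noteq> hzero H"
  interpret H: rep H \<pi> by (rule irreducibleD(1)[OF irr(1)])
  interpret K: rep K \<sigma> by (rule irreducibleD(1)[OF irr(2)])
  obtain t where t: "interior_tensor ipR H \<pi> K t" "\<And>a x h. h \<in> hcarrier H \<Longrightarrow> \<sigma> a (t x h) = t (lact a x) h"
    using ind by (auto simp: induced_rep_def)
  note T = tensor[OF irr(1) t(1)]
  have lact0: "\<pi> (ipR x (lact a y)) h = hzero H" if a: "iA a \<in> J" and h: "h \<in> hcarrier H" for x y a h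
  proof (rule H.eqI)
    fix g assume g: "g \<in> hcarrier H"
    have "t (lact a y) h = hzero K" using kill[OF a T(2)[OF h]] t(2)[OF h] by metis
    then show "hinner H g (\<pi> (ipR x (lact a y)) h) = hinner H g (hzero H)"
      using T(7)[OF g h, of x "lact a y"] T(2)[OF g] g by simp
  qed (use h in auto)
  have prod0: "\<pi> (ipR x y * (b * ipR z w)) h = hzero H" if b: "iA b \<in> J" and h: "h \<in> hcarrier H" for x y z w b h
  proof -
    have "ipR x y * (b * ipR z w) = ipR x (ract (ract y b) (ipR z w))"
      by (simp add: mult.assoc ipR_ract ract_mult)
    also have "\<dots> = ipR x (lact (ipL (ract y b) z) w)" by (simp add: ip_compat)
    finally have *: "ipR x y * (b * ipR z w) = ipR x (lact (ipL (ract y b) z) w)" .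
    have "iA (ipL (ract y b) z) \<in> J"
      using b by (simp add: iA_ipL iX_ract cstar_idealD[OF J])
    then show ?thesis unfolding * using lact0 h by blast
  qed
  have "\<not> (\<forall>a\<in>{ipR x y |x y. True}. \<pi> a k = hzero H)"
    using H.op_cspan_zero[of "{ipR x y |x y. True}" k c] nz unfolding ip_ideal_def by blast
  then obtain z w where zw: "\<pi> (ipR z w) k \<noteq> hzero H" by blast
  have zero: "\<pi> (ipR x y * b) g = hzero H" if b: "iA b \<in> J" and g: "g \<in> hcarrier H" for x y b g
  proof (rule irreducible_zero[OF irr(1) H.op_closed[OF nz(2)] zw _ g])
    fix d
    have "iA (b * d) \<in> J" using b by (simp add: iA_simps cstar_idealD[OF J])
    from prod0[OF this nz(2), of x y z w]
    show "\<pi> (ipR x y * b) (\<pi> d (\<pi> (ipR z w) k)) = hzero H" using nz(2) by (simp add: H.op_mult)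
  qed
  have "\<pi> (ipR z w) k = hzero H"
  proof (rule irreducible_zero[OF irr(1) H.op_closed[OF h] bh _ nz(2)])
    fix d
    have "iA (d * b) \<in> J" using b by (simp add: iA_simps cstar_idealD[OF J])
    from zero[OF this h, of z w]
    show "\<pi> (ipR z w) (\<pi> d (\<pi> b h)) = hzero H" using h by (simp add: H.op_mult)
  qed
  with zw show False by simp
qed

text \<open>In the forward inclusion the next space lies in the same representation of the crossed
  product, so J kills it as well; \<open>induced_kills\<close> gives the converse.\<close>

lemma vimage_invariant:
  fixes J :: "'b set"
  assumes J: "cstar_ideal J"
  shows "invariant_set dual_dom dual (spectrum - ideal_spectrum (iA -` J))" (is "invariant_set _ _ ?V")
  unfolding invariant_set_def
proof
  show "dual ` (?V \<inter> dual_dom) \<subseteq> ?V \<inter> dual ` dual_dom"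
  proof
    fix D assume "D \<in> dual ` (?V \<inter> dual_dom)"
    then obtain C where C: "C \<in> spectrum" "C \<notin> ideal_spectrum (iA -` J)" "C \<in> dual_dom" "D = dual C" by blast
    obtain p where p: "p \<in> irreps" "C = cls p" using C(1) by (rule spectrumE)
    obtain H \<pi> where Hp: "p = (H, \<pi>)" by (cases p)
    have irr: "irreducible_rep H \<pi>" using irrepsD[OF p(1)] Hp by simp
    then have irr': "irreducible_rep (fst (H, \<pi>)) (snd (H, \<pi>))" by simp
    have kill: "\<pi> a h = hzero H" if "iA a \<in> J" "h \<in> hcarrier H" for a h
      using C(2) ideal_spectrum_cls[OF irr', of "iA -` J"] that by (auto simp: p Hp)
    obtain z where z: "z \<in> hcarrier H" "hnorm H z = 1" by (rule irreducible_nonzero[OF irr])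
    obtain K :: "('b unitization \<Rightarrow> complex) hilbert" and \<rho> \<omega> M where
      K: "rep K \<rho>" "\<And>j h. j \<in> J \<Longrightarrow> h \<in> hcarrier K \<Longrightarrow> \<rho> j h = hzero K"
      and M: "hclosed_subspace K M" "\<And>a. \<rho> (iA a) ` M \<subseteq> M"
      "irreducible_rep (K\<lparr>hcarrier := M\<rparr>) (\<lambda>a. \<rho> (iA a))"
      and eq: "unitarily_equivalent (H, \<pi>) (K\<lparr>hcarrier := M\<rparr>, \<lambda>a. \<rho> (iA a))"
      and \<omega>: "\<omega> \<in> M" "hnorm K \<omega> = 1" "\<And>a. hinner K \<omega> (\<rho> (iA a) \<omega>) = hinner H z (\<pi> a z)"
    proof (rule extended_subspace[OF iA J irr _ z], goal_cases)
      case (2 K \<rho> M \<omega>)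
      show ?case by (rule 2(1)) (fact 2)+
    qed (use kill in blast)
    have C': "C = cls (K\<lparr>hcarrier := M\<rparr>, \<lambda>a. \<rho> (iA a))" unfolding p(2) Hp by (rule cls_eq[OF irr' eq])
    have nz: "next_space K \<rho> M \<noteq> {hzero K}" by (rule next_space_nonzero[OF K(1) M]) (use C(3) C' in simp)
    let ?q = "(K\<lparr>hcarrier := next_space K \<rho> M\<rparr>, \<lambda>a. \<rho> (iA a))"
    have D: "D = cls ?q" unfolding C(4) C' by (rule dual_map_next_space(2)[OF K(1) M nz])
    have irrN: "irreducible_rep (fst ?q) (snd ?q)" using next_space_irreducible[OF K(1) M nz] by simp
    have "D \<notin> ideal_spectrum (iA -` J)"
      unfolding D ideal_spectrum_cls[OF irrN] using K(2) next_space_carrier[OF K(1) M(1,2)] by simp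
    moreover have "D \<in> spectrum" unfolding D by (rule cls_spectrum(1)[OF irrN])
    ultimately show "D \<in> ?V \<inter> dual ` dual_dom" using C by blast
  qed
  show "?V \<inter> dual ` dual_dom \<subseteq> dual ` (?V \<inter> dual_dom)"
  proof
    fix D assume "D \<in> ?V \<inter> dual ` dual_dom"
    then obtain C where D: "D \<in> spectrum" "D \<notin> ideal_spectrum (iA -` J)" and C: "C \<in> dual_dom" "D = dual C" by blast
    obtain q where q: "q \<in> irreps" "q \<in> D" "D = cls q" using D(1) by (rule spectrumE)
    have "C \<in> spectrum" using C(1) by (simp add: ideal_spectrum_def)
    then obtain p0 where p0: "p0 \<in> irreps" "C = cls p0" by (rule spectrumE)
    obtain p where p: "p \<in> C" "induced_rep lact ipR p q" using q(2) unfolding C(2) dual_map_def by blast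
    have pi: "p \<in> irreps" "unitarily_equivalent p0 p" using p(1) unfolding p0(2) cls_def by blast+
    have Cp: "C = cls p" unfolding p0(2) by (rule cls_eq[OF irrepsD[OF p0(1)] pi(2)])
    obtain c k where ck: "c \<in> ip_ideal ipR" "k \<in> hcarrier (fst p)" "snd p c k \<noteq> hzero (fst p)"
      using C(1) ideal_spectrum_cls[OF irrepsD[OF pi(1)]] unfolding Cp by blast
    have kill: "snd q a h = hzero (fst q)" if "iA a \<in> J" "h \<in> hcarrier (fst q)" for a h
      using D(2) ideal_spectrum_cls[OF irrepsD[OF q(1)], of "iA -` J"] that unfolding q(3) by blast
    have ind: "induced_rep lact ipR (fst p, snd p) (fst q, snd q)" using p(2) by simp
    have "snd p a h = hzero (fst p)" if "iA a \<in> J" "h \<in> hcarrier (fst p)" for a h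
      by (rule induced_kills[OF J irrepsD[OF pi(1)] irrepsD[OF q(1)] ind kill ck that])
    then have "C \<notin> ideal_spectrum (iA -` J)"
      unfolding Cp ideal_spectrum_cls[OF irrepsD[OF pi(1)]] by blast
    then show "D \<in> dual ` (?V \<inter> dual_dom)" using C \<open>C \<in> spectrum\<close> by blast
  qed
qed

lemma vimage_trivial:
  assumes min: "minimal_map spectrum_topology dual_dom dual" and J: "cstar_ideal J"
  shows "iA -` J = {0} \<or> iA -` J = UNIV"
proof -
  let ?I = "iA -` J"
  have I: "cstar_ideal ?I" by (rule cstar_ideal_vimage[OF iA J])
  have "closedin spectrum_topology (spectrum - ideal_spectrum ?I)"
    using openin_ideal_spectrum[OF I] topspace_spectrum by (metis closedin_diff closedin_topspace)
  then have "spectrum - ideal_spectrum ?I = {} \<or> spectrum - ideal_spectrum ?I = spectrum"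
    using min vimage_invariant[OF J] unfolding minimal_map_def topspace_spectrum by blast
  then show ?thesis
  proof
    assume empty: "spectrum - ideal_spectrum ?I = {}"
    have "c \<in> ?I" for c
    proof (rule ccontr)
      assume "c \<notin> ?I"
      then obtain C where "C \<in> spectrum" "C \<notin> ideal_spectrum ?I" by (rule separating_point[OF I])
      then show False using empty by blast
    qed
    then show ?thesis by blast
  next
    assume all: "spectrum - ideal_spectrum ?I = spectrum"
    have "c = 0" if c: "c \<in> ?I" for c
    proof (rule ccontr)
      assume "c \<noteq> 0"
      then have "c \<notin> {0}" by simp
      then obtain C where "C \<in> spectrum" "\<And>I'. c \<in> I' \<Longrightarrow> C \<in> ideal_spectrum I'"
        using separating_point[OF cstar_ideal_zero] by blast
      then show False using all c by blast
    qed
    then show ?thesis using csubspaceD(1)[OF cstar_idealD(1)[OF I]] by blast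
  qed
qed

lemma ideal_UNIV:
  assumes gen: "cstar_generates (range iA \<union> range iX)" and J: "cstar_ideal J" and I: "iA -` J = UNIV"
  shows "J = UNIV"
proof -
  have "iA a \<in> J" for a using I by blast
  moreover have "iX x \<in> J" for x
    by (rule ideal_star_square(1)[OF J]) (use I in \<open>auto simp flip: iA_ipR\<close>)
  moreover have "cstar_subalgebra J"
    using cstar_idealD[OF J] ideal_star_square(2)[OF J] by (auto simp: cstar_subalgebra_def)
  ultimately show ?thesis using gen unfolding cstar_generates_def by blast
qed

end

section \<open>The grading by powers of the bimodule\<close>

context covariant_pair
begin

text \<open>The span of products of k elements of X, and the image of A for k = 0. Factors are added
  on the left only, so that \<open>star (iX x)\<close> directly meets the factor with which it
  cancels.\<close>

inductive pow :: "nat \<Rightarrow> 'b \<Rightarrow> bool" where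
  pow_iA: "pow 0 (iA a)"
| pow_iX: "pow (Suc 0) (iX x)"
| pow_add: "pow k v \<Longrightarrow> pow k w \<Longrightarrow> pow k (v + w)"
| pow_scale: "pow k w \<Longrightarrow> pow k (c *\<^sub>C w)"
| pow_mult_iX: "pow k w \<Longrightarrow> pow (Suc k) (iX x * w)"

text \<open>Products and adjoints are built in; \<open>graded_pow\<close> recovers the normal form,
  elements of the k-th power of X for k \<ge> 0 and adjoints of such for k \<le> 0.\<close>

inductive graded :: "int \<Rightarrow> 'b \<Rightarrow> bool" where
  graded_iA: "graded 0 (iA a)"
| graded_iX: "graded 1 (iX x)"
| graded_add: "graded k v \<Longrightarrow> graded k w \<Longrightarrow> graded k (v + w)"
| graded_scale: "graded k w \<Longrightarrow> graded k (c *\<^sub>C w)"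
| graded_mult: "graded k v \<Longrightarrow> graded l w \<Longrightarrow> graded (k + l) (v * w)"
| graded_star: "graded k w \<Longrightarrow> graded (- k) (star w)"

lemma pow_0: "pow 0 w \<longleftrightarrow> w \<in> range iA"
proof -
  have "w \<in> range iA" if "pow k w" "k = 0" for k
    using that by (induction rule: pow.induct) (auto simp flip: iA_simps(1,2))
  then show ?thesis by (auto intro: pow_iA)
qed

lemma pow_iA_mult: "pow k w \<Longrightarrow> pow k (iA a * w)"
proof (induction rule: pow.induct)
  case (pow_mult_iX k w x)
  then show ?case using pow.pow_mult_iX[of k w "lact a x"] by (simp add: iX_lact mult.assoc)
qed (auto intro: pow.intros simp: distrib_left scaleC_mult_right simp flip: iA_simps(6) iX_lact)

lemma pow_mult_iA: "pow k w \<Longrightarrow> pow k (w * iA a)"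
  by (induction rule: pow.induct)
    (auto intro: pow.intros simp: distrib_right scaleC_mult_left mult.assoc simp flip: iA_simps(6) iX_ract)

lemma pow_star_iX_mult: "pow (Suc k) w \<Longrightarrow> pow k (star (iX x) * w)"
proof -
  have "pow m w \<Longrightarrow> m = Suc k \<Longrightarrow> pow k (star (iX x) * w)" for m k
  proof (induction rule: pow.induct)
    case (pow_mult_iX l w y)
    then show ?case using pow_iA_mult[of l w "ipR x y"] by (simp add: iA_ipR mult.assoc)
  qed (auto intro: pow.intros simp: distrib_left scaleC_mult_right simp flip: iA_ipR)
  then show "pow (Suc k) w \<Longrightarrow> pow k (star (iX x) * w)" by blast
qed

lemma pow_mult_star_iX: "pow (Suc k) w \<Longrightarrow> pow k (w * star (iX x))"
proof -
  have "pow m w \<Longrightarrow> m = Suc k \<Longrightarrow> pow k (w * star (iX x))" for m k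
  proof (induction arbitrary: k rule: pow.induct)
    case (pow_mult_iX l w y)
    show ?case
    proof (cases l)
      \<comment> \<open>The rightmost factor from X is reached: with A in between, it and the
        adjoint combine to a left inner product.\<close>
      case 0
      then obtain a where "w = iA a" using pow_mult_iX pow_0 by auto
      then have "iX y * w * star (iX x) = iA (ipL (ract y a) x)" by (simp add: iA_ipL iX_ract)
      then show ?thesis using 0 pow_mult_iX pow_iA by simp
    next
      case (Suc m)
      then show ?thesis using pow_mult_iX pow.pow_mult_iX[of m "w * star (iX x)" y] by (simp add: mult.assoc)
    qed
  qed (auto intro: pow.intros simp: distrib_right scaleC_mult_left simp flip: iA_ipL)
  then show "pow (Suc k) w \<Longrightarrow> pow k (w * star (iX x))" by blast
qed

lemma pow_mult: "pow k v \<Longrightarrow> pow l w \<Longrightarrow> pow (k + l) (v * w)"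
proof (induction rule: pow.induct)
qed (auto intro: pow.intros pow_iA_mult simp: distrib_right scaleC_mult_left mult.assoc)

lemma pow_mult_star: "pow l v \<Longrightarrow> pow k w \<Longrightarrow> l \<le> k \<Longrightarrow> pow (k - l) (w * star v)"
proof (induction arbitrary: k w rule: pow.induct)
  case (pow_iA a)
  then show ?case using pow_mult_iA[of k w "star a"] by (simp add: iA_simps)
next
  case (pow_iX x)
  then show ?case using pow_mult_star_iX[of "k - 1" w x] by simp
next
  case (pow_mult_iX l v x)
  then have "pow (Suc (k - Suc l)) (w * star v)" by (simp add: Suc_diff_Suc)
  from pow_mult_star_iX[OF this] show ?case by (simp add: star_mult mult.assoc)
qed (simp_all add: star_add star_scaleC distrib_left scaleC_mult_right pow_add pow_scale)

lemma pow_star_mult: "pow k w \<Longrightarrow> pow l v \<Longrightarrow> k \<le> l \<Longrightarrow> pow (l - k) (star w * v)"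
proof (induction arbitrary: l v rule: pow.induct)
  case (pow_iA a)
  then show ?case using pow_iA_mult[of l v "star a"] by (simp add: iA_simps)
next
  case (pow_iX x)
  then show ?case using pow_star_iX_mult[of "l - 1" v x] by simp
next
  case (pow_mult_iX k w x)
  then have "pow (l - 1) (star (iX x) * v)" using pow_star_iX_mult[of "l - 1" v x] by simp
  from pow_mult_iX.IH[OF this] pow_mult_iX.prems(2) show ?case by (simp add: star_mult mult.assoc)
qed (simp_all add: star_add star_scaleC distrib_right scaleC_mult_left pow_add pow_scale)

lemma graded_pow: "graded k w \<Longrightarrow> (0 \<le> k \<longrightarrow> pow (nat k) w) \<and> (k \<le> 0 \<longrightarrow> pow (nat (- k)) (star w))"
proof (induction rule: graded.induct)
  case (graded_iA a)
  then show ?case using pow_iA[of a] pow_iA[of "star a"] by (simp add: iA_simps)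
next
  case (graded_mult k v l w)
  consider "0 \<le> k" "0 \<le> l" | "0 \<le> k" "l \<le> 0" | "k \<le> 0" "0 \<le> l" | "k \<le> 0" "l \<le> 0" by linarith
  then show ?case
  proof cases
    case 1
    then show ?thesis
      \<comment> \<open>The second instance of \<open>pow_mult\<close> serves k = l = 0, where the
        claim on adjoints applies too.\<close>
      using graded_mult pow_mult[of "nat k" v "nat l" w] pow_mult[of 0 "star w" 0 "star v"]
      by (auto simp: nat_add_distrib star_mult)
  next
    case 2
    have "nat k - nat (- l) = nat (k + l)" "nat (- l) - nat k = nat (- (k + l))" using 2 by arith+
    then show ?thesis
      using graded_mult 2 pow_mult_star[of "nat (- l)" "star w" "nat k" v] pow_mult_star[of "nat k" v "nat (- l)" "star w"]
      by (intro conjI impI) (simp_all add: star_mult star_star)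
  next
    case 3
    have "nat l - nat (- k) = nat (k + l)" "nat (- k) - nat l = nat (- (k + l))" using 3 by arith+
    then show ?thesis
      using graded_mult 3 pow_star_mult[of "nat (- k)" "star v" "nat l" w] pow_star_mult[of "nat l" w "nat (- k)" "star v"]
      by (intro conjI impI) (simp_all add: star_mult star_star)
  next
    case 4
    have "nat (- l) + nat (- k) = nat (- (k + l))" using 4 by arith
    with 4 show ?thesis
      using graded_mult pow_mult[of "nat (- l)" "star w" "nat (- k)" "star v"] pow_mult[of 0 v 0 w]
      by (auto simp: star_mult)
  qed
qed (auto intro: pow.intros simp: star_add star_scaleC star_star)

lemma graded_zero: "graded k 0"
proof -
  have "graded k w \<Longrightarrow> ?thesis" for w using graded_scale[of k w 0] by simp
  moreover have "\<exists>w. graded (int n) w" for n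
  proof (induction n)
    case (Suc n)
    then show ?case using graded_mult[OF graded_iX[of 0]] by (metis of_nat_Suc)
  qed (use graded_iA in auto)
  ultimately show ?thesis
    by (metis graded_star int_cases2)
qed

lemma graded_0: "graded 0 w \<Longrightarrow> w \<in> range iA"
  using graded_pow[of 0 w] pow_0 by simp


section \<open>Graded components modulo an ideal\<close>

lemma (in -) iterate_domain_iff:
  "x \<in> iterate_domain T \<Delta> \<phi> n \<longleftrightarrow> x \<in> topspace T \<and> (\<forall>i<n. (\<phi> ^^ i) x \<in> \<Delta>)"
  by (induction n) (auto simp: less_Suc_eq)

text \<open>It excludes all periods k \<le> n at once through n!. A finite union of sets with empty
  interior may have interior, but the points with a period up to n all lie in the single set of
  points of period n!.\<close>

lemma (in -) periodic_multiple:
  assumes x: "x \<in> iterate_domain T \<Delta> \<phi> k" "(\<phi> ^^ k) x = x" and "0 < k" "k dvd n"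
  shows "x \<in> iterate_domain T \<Delta> \<phi> n" "(\<phi> ^^ n) x = x"
proof -
  have mod: "(\<phi> ^^ i) x = (\<phi> ^^ (i mod k)) x" for i using funpow_mod_eq[OF x(2)] by simp
  show "(\<phi> ^^ n) x = x" using mod[of n] \<open>k dvd n\<close> by (simp add: mod_eq_0_iff_dvd[symmetric])
  show "x \<in> iterate_domain T \<Delta> \<phi> n"
    unfolding iterate_domain_iff
  proof (intro conjI allI impI)
    fix i
    have "(\<phi> ^^ (i mod k)) x \<in> \<Delta>" using x(1) \<open>0 < k\<close> by (simp add: iterate_domain_iff)
    then show "(\<phi> ^^ i) x \<in> \<Delta>" by (subst mod)
  qed (use x(1) in \<open>simp add: iterate_domain_iff\<close>)
qed

definition spaces :: "'k hilbert \<Rightarrow> ('b \<Rightarrow> 'k \<Rightarrow> 'k) \<Rightarrow> 'k set \<Rightarrow> nat \<Rightarrow> 'k set"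
  where "spaces K \<rho> M k = (next_space K \<rho> ^^ k) M"

context
  fixes K :: "'k hilbert" and \<rho> :: "'b \<Rightarrow> 'k \<Rightarrow> 'k" and M :: "'k set"
  assumes K: "rep K \<rho>" and M: "hclosed_subspace K M" "\<And>a. \<rho> (iA a) ` M \<subseteq> M"
begin

interpretation rep K \<rho> by (rule K)

private abbreviation "pt V \<equiv> cls (K\<lparr>hcarrier := V\<rparr>, \<lambda>a. \<rho> (iA a))"

lemma spaces_invariant:
  "hclosed_subspace K (spaces K \<rho> M k)" "\<rho> (iA a) ` spaces K \<rho> M k \<subseteq> spaces K \<rho> M k"
proof -
  have "hclosed_subspace K (spaces K \<rho> M k) \<and> (\<forall>a. \<rho> (iA a) ` spaces K \<rho> M k \<subseteq> spaces K \<rho> M k)"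
  proof (induction k)
    case 0
    show ?case using M by (simp add: spaces_def)
  next
    case (Suc k)
    then show ?case
      using next_space_closed[OF K, of "spaces K \<rho> M k"] next_space_invariant[OF K, of "spaces K \<rho> M k"]
      by (simp add: spaces_def)
  qed
  then show "hclosed_subspace K (spaces K \<rho> M k)" "\<rho> (iA a) ` spaces K \<rho> M k \<subseteq> spaces K \<rho> M k" by auto
qed

lemma spaces_pow: "pow k w \<Longrightarrow> m \<in> M \<Longrightarrow> \<rho> w m \<in> spaces K \<rho> M k"
proof (induction rule: pow.induct)
  case (pow_iA a)
  then show ?case using M(2) by (auto simp: spaces_def)
next
  case (pow_iX x)
  then show ?case using next_spaceI[OF K M] by (simp add: spaces_def)
next
  case (pow_mult_iX k w x)
  have mK: "m \<in> hcarrier K" by (rule M_closed[OF K M pow_mult_iX.prems])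
  have "\<rho> (iX x) (\<rho> w m) \<in> next_space K \<rho> (spaces K \<rho> M k)"
    by (rule next_spaceI[OF K spaces_invariant]) (use pow_mult_iX in simp)
  then show ?case using mK by (simp add: op_mult spaces_def)
qed (simp_all add: op_add op_scale M_closed[OF K M] hsubspaceD[OF hclosed_subspaceD(1)[OF spaces_invariant(1)]])

lemma next_space_zero: "next_space K \<rho> {hzero K} = {hzero K}"
proof -
  have S: "{\<rho> (iX x) m |x m. m \<in> {hzero K}} = {hzero K}" by auto
  show ?thesis unfolding next_space_def S by (rule hperp_hperp[OF zero_closed_subspace])
qed

lemma spaces_point:
  assumes irr: "irreducible_rep (K\<lparr>hcarrier := M\<rparr>) (\<lambda>a. \<rho> (iA a))"
  shows "spaces K \<rho> M k \<noteq> {hzero K} \<Longrightarrow>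
    irreducible_rep (K\<lparr>hcarrier := spaces K \<rho> M k\<rparr>) (\<lambda>a. \<rho> (iA a)) \<and>
    pt (spaces K \<rho> M k) = (dual ^^ k) (pt M) \<and>
    pt M \<in> iterate_domain spectrum_topology dual_dom dual k"
proof (induction k)
  case 0
  show ?case
    using irr cls_spectrum(1)[of "(K\<lparr>hcarrier := M\<rparr>, \<lambda>a. \<rho> (iA a))"] by (simp add: spaces_def topspace_spectrum)
next
  case (Suc k)
  let ?V = "spaces K \<rho> M k"
  have step: "spaces K \<rho> M (Suc k) = next_space K \<rho> ?V" by (simp add: spaces_def)
  then have nz: "next_space K \<rho> ?V \<noteq> {hzero K}" using Suc.prems by simp
  have V0: "?V \<noteq> {hzero K}"
  proof
    assume e: "?V = {hzero K}"
    show False using nz unfolding e next_space_zero by simp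
  qed
  from Suc.IH[OF V0] have V: "irreducible_rep (K\<lparr>hcarrier := ?V\<rparr>) (\<lambda>a. \<rho> (iA a))"
    and pV: "pt ?V = (dual ^^ k) (pt M)" and dom: "pt M \<in> iterate_domain spectrum_topology dual_dom dual k"
    by blast+
  note dm = dual_map_next_space[OF K spaces_invariant V nz]
  have "pt (next_space K \<rho> ?V) = (dual ^^ Suc k) (pt M)" unfolding dm(2)[symmetric] pV by simp
  moreover have "pt M \<in> iterate_domain spectrum_topology dual_dom dual (Suc k)"
    using dom dm(1) unfolding pV by simp
  ultimately show ?case
    unfolding step by (intro conjI next_space_irreducible[OF K spaces_invariant V nz])
qed

text \<open>A k-th space not orthogonal to M is nonzero, so the point of M lies in the domain of the
  k-th iterate; being equivalent to M, the space exhibits the period k.\<close>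

lemma spaces_orthogonal:
  assumes irr: "irreducible_rep (K\<lparr>hcarrier := M\<rparr>) (\<lambda>a. \<rho> (iA a))"
    and np: "\<not> (pt M \<in> iterate_domain spectrum_topology dual_dom dual k \<and> (dual ^^ k) (pt M) = pt M)"
    and m: "m \<in> M" and v: "v \<in> spaces K \<rho> M k"
  shows "hinner K m v = 0"
proof (rule ccontr)
  assume nz: "hinner K m v \<noteq> 0"
  have "v \<noteq> hzero K" using nz M_closed[OF K M m] by auto
  then have "spaces K \<rho> M k \<noteq> {hzero K}" using v by blast
  from spaces_point[OF irr this]
  have V: "irreducible_rep (K\<lparr>hcarrier := spaces K \<rho> M k\<rparr>) (\<lambda>a. \<rho> (iA a))"
    "pt (spaces K \<rho> M k) = (dual ^^ k) (pt M)" "pt M \<in> iterate_domain spectrum_topology dual_dom dual k" by auto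
  have "unitarily_equivalent (K\<lparr>hcarrier := M\<rparr>, \<lambda>a. \<rho> (iA a)) (K\<lparr>hcarrier := spaces K \<rho> M k\<rparr>, \<lambda>a. \<rho> (iA a))"
    by (rule unitarily_equivalent_if_not_orthogonal[OF rep_star_hom_comp[OF K iA] M irr spaces_invariant V(1) m v nz])
  then have "pt M = pt (spaces K \<rho> M k)" using irr by (intro cls_eq) simp_all
  then show False using np V by simp
qed

end

end

text \<open>The gauge of the zero ideal is at least \<open>(norm b)\<^sup>2\<close> at
  \<open>star b * b\<close>, so a state attaining the gauge there has a GNS vector at which b
  attains its norm.\<close>

lemma norming_rep:
  fixes b :: "'b::cstar_algebra"
  obtains K :: "('b unitization \<Rightarrow> complex) hilbert" and \<pi> \<omega> where
    "rep K \<pi>" "\<omega> \<in> hcarrier K" "hnorm K \<omega> = 1" "norm b \<le> hnorm K (\<pi> b \<omega>)"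
proof -
  let ?a = "star (emb b) * emb b"
  let ?p = "ideal_gauge {0 :: 'b}"
  have re: "re_part ?a = ?a" by (simp add: re_part_selfadjoint star_mult star_star)
  obtain q where q: "linear q" "q \<le> ?p" "q ?a = ?p ?a" and
    ext: "\<And>g h t. linear g \<Longrightarrow> linear h \<Longrightarrow> g \<le> ?p \<Longrightarrow> h \<le> ?p \<Longrightarrow> 0 < t \<Longrightarrow> t < 1 \<Longrightarrow>
      (\<And>x. q x = t * g x + (1 - t) * h x) \<Longrightarrow> g = q"
    using extreme_dominated_functional[OF sublinear_ideal_gauge[OF cstar_ideal_zero]] by blast
  have "(norm b)\<^sup>2 \<le> ?p ?a"
  proof (rule le_ideal_gauge[OF cstar_ideal_zero])
    fix t and j :: 'b assume "j \<in> {0}" "cpos (t *\<^sub>R 1 - re_part ?a - emb j)"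
    then have "cpos (t *\<^sub>R 1 - ?a)" by (simp add: re embed_arith)
    moreover from cpos_add[OF this cpos_star_mult[of "emb b"]] have "0 \<le> t"
      using cpos_scalar_part[of "t *\<^sub>R 1 :: 'b unitization"] by simp
    ultimately have "norm ?a \<le> t" using cpos_norm_le[OF cpos_star_mult[of "emb b"], of "t *\<^sub>R 1"] by simp
    then show "(norm b)\<^sup>2 \<le> t" by (simp add: cstar_identity)
  qed
  obtain K :: "('b unitization \<Rightarrow> complex) hilbert" and \<rho> \<omega> where K: "rep K \<rho>" and
    one: "\<And>h. h \<in> hcarrier K \<Longrightarrow> \<rho> 1 h = h" and \<omega>: "\<omega> \<in> hcarrier K" and
    ip: "\<And>u. hinner K \<omega> (\<rho> u \<omega>) = complexify q u" and n1: "hnorm K \<omega> = 1" and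
    dense: "hperp K (range (\<lambda>u. \<rho> u \<omega>)) = {hzero K}" and
    kill: "\<And>j h. j \<in> {0} \<Longrightarrow> h \<in> hcarrier K \<Longrightarrow> \<rho> (emb j) h = hzero K"
    using gns_state[OF cstar_ideal_zero q(1,2)] by blast
  interpret rep K \<rho> by (rule K)
  have "(norm b)\<^sup>2 \<le> Re (hinner K \<omega> (\<rho> ?a \<omega>))"
    using \<open>(norm b)\<^sup>2 \<le> ?p ?a\<close> q(3) unfolding ip by (simp add: complexify_def)
  then have "(norm b)\<^sup>2 \<le> (hnorm K (\<rho> (emb b) \<omega>))\<^sup>2" by (simp add: inner_star_mult[OF \<omega>])
  then have "norm b \<le> hnorm K (\<rho> (emb b) \<omega>)" by (rule power2_le_imp_le) simp
  then show thesis using that[OF rep_star_hom_comp[OF K star_hom_emb] \<omega> n1] by blast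
qed

lemma star_hom_norm:
  fixes f :: "'a::cstar_algebra \<Rightarrow> 'b::cstar_algebra"
  assumes f: "star_hom f"
  shows "norm (f a) \<le> norm a"
proof -
  obtain K :: "('b unitization \<Rightarrow> complex) hilbert" and \<pi> \<omega> where
    K: "rep K \<pi>" "\<omega> \<in> hcarrier K" "hnorm K \<omega> = 1" "norm (f a) \<le> hnorm K (\<pi> (f a) \<omega>)"
    by (rule norming_rep)
  interpret rep K "\<lambda>a. \<pi> (f a)" by (rule rep_star_hom_comp[OF K(1) f])
  show ?thesis using op_norm[OF K(2), of a] K by simp
qed

context covariant_pair
begin

lemma component_norm_0:
  assumes free: "topologically_free spectrum_topology dual_dom dual"
    and J: "cstar_ideal J" and I: "iA -` J = {0}"
    and F: "finite F" and c: "\<And>k. k \<in> F \<Longrightarrow> graded k (c k)" "0 \<in> F" and j: "j \<in> J"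
  shows "norm (c 0) \<le> norm ((\<Sum>k\<in>F. c k) - j)"
proof -
  obtain b where b: "c 0 = iA b" using graded_0[OF c(1)] c(2) by blast
  obtain n where n: "\<And>k. k \<in> F \<Longrightarrow> nat \<bar>k\<bar> \<le> n"
    using F Max_ge[of "(\<lambda>k. nat \<bar>k\<bar>) ` F"] by (metis finite_imageI image_eqI)
  have main: "r \<le> norm ((\<Sum>k\<in>F. c k) - j)" if r: "0 \<le> r" "r < norm b" for r
  proof -
    \<comment> \<open>Kernels of the representations in which b is bounded by r. Every point of the
      open set belonging to \<Inter>\<I> therefore has \<parallel>\<pi> b\<parallel> > r, and this
      set is nonempty because all these kernels contain the nonzero
      \<open>cutoff r b\<close>.\<close>
    define \<I> :: "'a set set" where "\<I> = {{a. \<forall>h\<in>hcarrier H. \<pi> a h = hzero H} |(H :: (nat \<Rightarrow> 'a) hilbert) \<pi>.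
      rep H \<pi> \<and> (\<forall>h\<in>hcarrier H. hnorm H (\<pi> b h) \<le> r * hnorm H h)}"
    have Ir: "cstar_ideal (\<Inter>\<I>)" by (rule cstar_ideal_Inter) (auto simp: \<I>_def intro: rep.kernel_ideal)
    have "cutoff r b \<in> \<Inter>\<I>"
      unfolding \<I>_def by clarify (rule rep.cutoff_kernel[OF _ r(1)], auto)
    moreover have "cutoff r b \<notin> {0}" using cutoff_nonzero[OF r] by simp
    ultimately obtain C0 where C0: "C0 \<in> ideal_spectrum (\<Inter>\<I>)"
      using separating_point[OF cstar_ideal_zero] by metis
    define P where "P = {C \<in> iterate_domain spectrum_topology dual_dom dual (fact n). (dual ^^ fact n) C = C}"
    have P: "spectrum_topology interior_of P = {}"
      using free by (simp add: topologically_free_def P_def)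
    have "\<not> ideal_spectrum (\<Inter>\<I>) \<subseteq> P"
    proof
      assume "ideal_spectrum (\<Inter>\<I>) \<subseteq> P"
      from interior_of_maximal[OF this openin_ideal_spectrum[OF Ir]] show False using P C0 by blast
    qed
    then obtain C where C: "C \<in> ideal_spectrum (\<Inter>\<I>)"
      "\<not> (C \<in> iterate_domain spectrum_topology dual_dom dual (fact n) \<and> (dual ^^ fact n) C = C)"
      unfolding P_def by blast
    have np: "\<not> (C \<in> iterate_domain spectrum_topology dual_dom dual k \<and> (dual ^^ k) C = C)" if "0 < k" "k \<le> n" for k
      using C(2) periodic_multiple[of C spectrum_topology dual_dom dual k "fact n"] dvd_fact[of k n] that by auto
    have "C \<in> spectrum" using C(1) by (simp add: ideal_spectrum_def)
    then obtain p where p: "p \<in> irreps" "C = cls p" by (rule spectrumE)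
    obtain H \<pi> where Hp: "p = (H, \<pi>)" by (cases p)
    have irr: "irreducible_rep H \<pi>" using irrepsD[OF p(1)] Hp by simp
    then have irr': "irreducible_rep (fst (H, \<pi>)) (snd (H, \<pi>))" by simp
    interpret H: rep H \<pi> by (rule irreducibleD(1)[OF irr])
    have "\<exists>z\<in>hcarrier H. r * hnorm H z < hnorm H (\<pi> b z)"
    proof (rule ccontr)
      assume "\<not> ?thesis"
      then have "{a. \<forall>h\<in>hcarrier H. \<pi> a h = hzero H} \<in> \<I>"
        using H.rep_axioms by (auto simp: \<I>_def not_less)
      moreover obtain a h where "a \<in> \<Inter>\<I>" "h \<in> hcarrier H" "\<pi> a h \<noteq> hzero H"
        using C(1) ideal_spectrum_cls[OF irr', of "\<Inter>\<I>"] unfolding p Hp by auto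
      ultimately show False by blast
    qed
    then obtain z0 where z0: "z0 \<in> hcarrier H" "r * hnorm H z0 < hnorm H (\<pi> b z0)" by blast
    have "z0 \<noteq> hzero H" using z0 H.hnorm_eq_0[OF H.zero_closed] by auto
    then have n0: "hnorm H z0 > 0" using H.hnorm_eq_0[OF z0(1)] by (simp add: less_le)
    define z where "z = hscale H (of_real (1 / hnorm H z0)) z0"
    have z: "z \<in> hcarrier H" "hnorm H z = 1" using z0 n0 by (simp_all add: z_def H.hnorm_scale norm_divide)
    have rz: "r < hnorm H (\<pi> b z)"
      using z0 n0 by (simp add: z_def H.op_scale_right H.hnorm_scale norm_divide field_simps)
    have "a = 0" if "iA a \<in> J" for a
      using I that by (metis singletonD vimageI)
    then have kill: "\<pi> a h = hzero H" if "iA a \<in> J" "h \<in> hcarrier H" for a h using that H.op_zero by blast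
    obtain K :: "('b unitization \<Rightarrow> complex) hilbert" and \<rho> \<omega> M where
      K: "rep K \<rho>" "\<And>j h. j \<in> J \<Longrightarrow> h \<in> hcarrier K \<Longrightarrow> \<rho> j h = hzero K"
      and M: "hclosed_subspace K M" "\<And>a. \<rho> (iA a) ` M \<subseteq> M"
      "irreducible_rep (K\<lparr>hcarrier := M\<rparr>) (\<lambda>a. \<rho> (iA a))"
      and eq: "unitarily_equivalent (H, \<pi>) (K\<lparr>hcarrier := M\<rparr>, \<lambda>a. \<rho> (iA a))"
      and \<omega>: "\<omega> \<in> M" "hnorm K \<omega> = 1" "\<And>a. hinner K \<omega> (\<rho> (iA a) \<omega>) = hinner H z (\<pi> a z)"
    proof (rule extended_subspace[OF iA J irr _ z], goal_cases)
      case (2 K \<rho> M \<omega>)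
      show ?case by (rule 2(1)) (fact 2)+
    qed (use kill in blast)
    interpret K: rep K \<rho> by (rule K(1))
    note Mc = M_closed[OF K(1) M(1,2)]
    have CM: "C = cls (K\<lparr>hcarrier := M\<rparr>, \<lambda>a. \<rho> (iA a))" unfolding p(2) Hp by (rule cls_eq[OF irr' eq])
    \<comment> \<open>Testing against this vector of M isolates degree 0, which contributes the
      squared norm of \<eta>. A positive degree moves \<omega> to a vector orthogonal to M; for a
      negative one the adjoint moves \<eta> instead.\<close>
    define \<eta> where "\<eta> = \<rho> (iA b) \<omega>"
    have \<eta>: "\<eta> \<in> M" using M(2) \<omega>(1) by (auto simp: \<eta>_def)
    have orth: "hinner K g (\<rho> w h) = 0" if "pow k w" "0 < k" "k \<le> n" "g \<in> M" "h \<in> M" for g h w k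
      by (rule spaces_orthogonal[OF K(1) M _ that(4) spaces_pow[OF K(1) M(1,2) that(1,5)]])
        (use np[OF that(2,3)] CM in simp)
    have zero: "hinner K \<eta> (\<rho> (c k) \<omega>) = 0" if k: "k \<in> F" "k \<noteq> 0" for k
    proof (cases "0 < k")
      case True
      then show ?thesis using orth[of "nat k" "c k" \<eta> \<omega>] graded_pow[OF c(1)[OF k(1)]] n[OF k(1)] \<eta> \<omega> by simp
    next
      case False
      then have "hinner K \<omega> (\<rho> (star (c k)) \<eta>) = 0"
        using orth[of "nat (- k)" "star (c k)" \<omega> \<eta>] graded_pow[OF c(1)[OF k(1)]] n[OF k(1)] k \<eta> \<omega> by simp
      then show ?thesis
        using K.adj[OF Mc[OF \<omega>(1)] Mc[OF \<eta>], of "c k"] K.inner_commute[OF _ Mc[OF \<eta>], of "\<rho> (c k) \<omega>"] Mc[OF \<omega>(1)] by simp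
    qed
    have lin: "hinner K \<eta> (\<rho> (\<Sum>k\<in>F'. c k) \<omega>) = (\<Sum>k\<in>F'. hinner K \<eta> (\<rho> (c k) \<omega>))" if "finite F'" for F'
      using that Mc[OF \<eta>] Mc[OF \<omega>(1)] by (induction F') (simp_all add: K.op_add K.inner_add_right)
    have "hinner K \<eta> (\<rho> ((\<Sum>k\<in>F. c k) - j) \<omega>) = (\<Sum>k\<in>F. hinner K \<eta> (\<rho> (c k) \<omega>))"
      using Mc[OF \<eta>] Mc[OF \<omega>(1)] K(2)[OF j] by (simp add: K.op_diff K.inner_hsub_right lin[OF F])
    also have "\<dots> = hinner K \<eta> (\<rho> (c 0) \<omega>)"
      using zero by (subst sum.remove[OF F c(2)]) simp
    also have "\<dots> = of_real ((hnorm K \<eta>)\<^sup>2)" using K.inner_self[OF Mc[OF \<eta>]] by (simp add: b \<eta>_def)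
    finally have "(hnorm K \<eta>)\<^sup>2 = cmod (hinner K \<eta> (\<rho> ((\<Sum>k\<in>F. c k) - j) \<omega>))"
      by (simp add: norm_power)
    also have "\<dots> \<le> hnorm K \<eta> * hnorm K (\<rho> ((\<Sum>k\<in>F. c k) - j) \<omega>)"
      by (rule K.cauchy_schwarz) (use Mc[OF \<eta>] Mc[OF \<omega>(1)] in auto)
    also have "\<dots> \<le> hnorm K \<eta> * norm ((\<Sum>k\<in>F. c k) - j)"
      using K.op_norm[OF Mc[OF \<omega>(1)], of "(\<Sum>k\<in>F. c k) - j"] \<omega>(2) by (simp add: mult_left_mono)
    finally have le: "hnorm K \<eta> * hnorm K \<eta> \<le> hnorm K \<eta> * norm ((\<Sum>k\<in>F. c k) - j)" by (simp add: power2_eq_square)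
    have "(hnorm K \<eta>)\<^sup>2 = (hnorm H (\<pi> b z))\<^sup>2"
    proof -
      have "complex_of_real ((hnorm K \<eta>)\<^sup>2) = of_real ((hnorm H (\<pi> b z))\<^sup>2)"
        using K.inner_star_mult[OF Mc[OF \<omega>(1)], of "iA b"] H.inner_star_mult[OF z(1), of b] \<omega>(3)[of "star b * b"]
        by (simp add: \<eta>_def iA_simps)
      then show ?thesis by (simp only: of_real_eq_iff)
    qed
    then have "hnorm K \<eta> = hnorm H (\<pi> b z)" by (simp add: power2_eq_iff_nonneg)
    then have "r < hnorm K \<eta>" using rz by simp
    then show ?thesis using le r by (simp add: mult_le_cancel_left)
  qed
  have "norm b \<le> norm ((\<Sum>k\<in>F. c k) - j)"
  proof (cases "b = 0")
    case False
    show ?thesis by (rule dense_le_bounded[of 0]) (use main False in simp_all)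
  qed simp
  then show ?thesis using star_hom_norm[OF iA, of b] b by simp
qed

text \<open>Multiplication by \<open>star (c l)\<close> moves degree l to degree 0 and preserves J;
  by the C*-identity one factor \<open>norm (c l)\<close> then cancels.\<close>

lemma component_norm:
  assumes free: "topologically_free spectrum_topology dual_dom dual"
    and J: "cstar_ideal J" and I: "iA -` J = {0}"
    and F: "finite F" and c: "\<And>k. k \<in> F \<Longrightarrow> graded k (c k)" "l \<in> F" and j: "j \<in> J"
  shows "norm (c l) \<le> norm ((\<Sum>k\<in>F. c k) - j)"
proof -
  let ?F = "(\<lambda>k. k - l) ` F" and ?d = "\<lambda>k. star (c l) * c (k + l)"
  have "norm (?d 0) \<le> norm ((\<Sum>k\<in>?F. ?d k) - star (c l) * j)"
  proof (rule component_norm_0[OF free J I])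
    show "graded k (?d k)" if "k \<in> ?F" for k
      using that graded_mult[OF graded_star[OF c(1)[OF c(2)]] c(1)[of "k + l"]] by auto
    show "star (c l) * j \<in> J" by (rule cstar_idealD(3)[OF J j])
  qed (use F c(2) in auto)
  also have "(\<Sum>k\<in>?F. ?d k) - star (c l) * j = star (c l) * ((\<Sum>k\<in>F. c k) - j)"
    by (subst sum.reindex) (auto simp: inj_on_def sum_distrib_left right_diff_distrib)
  also have "norm \<dots> \<le> norm (c l) * norm ((\<Sum>k\<in>F. c k) - j)"
    using norm_mult_ineq[of "star (c l)"] by (simp add: norm_star)
  finally have "norm (c l) * norm (c l) \<le> norm (c l) * norm ((\<Sum>k\<in>F. c k) - j)"
    by (simp add: cstar_identity power2_eq_square)
  then show ?thesis by (cases "norm (c l) = 0") (simp_all add: mult_le_cancel_left)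
qed

end

section \<open>Coding by sequences\<close>

text \<open>Cardinality matters because the universal property is assumed on carriers inside
  \<open>nat \<Rightarrow> 'a \<times> 'x\<close>, where the cyclic representations behind the gauge
  action have to be coded.\<close>

lemma lepoll_sequences:
  assumes "T \<lesssim> (UNIV :: (nat \<Rightarrow> 'y) set)"
  shows "{s :: nat \<Rightarrow> 't. range s \<subseteq> T} \<lesssim> (UNIV :: (nat \<Rightarrow> 'y) set)"
proof -
  obtain f :: "'t \<Rightarrow> nat \<Rightarrow> 'y" where f: "inj_on f T" using assms by (auto simp: lepoll_def)
  define g where "g s m = f (s (fst (prod_decode m))) (snd (prod_decode m))" for s :: "nat \<Rightarrow> 't" and m
  have "inj_on g {s. range s \<subseteq> T}"
  proof (rule inj_onI)
    fix s s' assume s: "s \<in> {s. range s \<subseteq> T}" "s' \<in> {s. range s \<subseteq> T}" "g s = g s'"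
    have "f (s n) k = f (s' n) k" for n k using fun_cong[OF s(3), of "prod_encode (n, k)"] by (simp add: g_def)
    then have "f (s n) = f (s' n)" for n by blast
    moreover have "s n \<in> T" "s' n \<in> T" for n using s(1,2) by auto
    ultimately have "s n = s' n" for n using f by (simp add: inj_on_eq_iff)
    then show "s = s'" by blast
  qed
  then show ?thesis unfolding lepoll_def by blast
qed

lemma lepoll_countable_Union:
  fixes T :: "nat \<Rightarrow> 't set"
  assumes "p \<noteq> (q :: 'y)" and "\<And>n. T n \<lesssim> (UNIV :: (nat \<Rightarrow> 'y) set)"
  shows "(\<Union>n. T n) \<lesssim> (UNIV :: (nat \<Rightarrow> 'y) set)"
proof -
  have "\<exists>f :: 't \<Rightarrow> nat \<Rightarrow> 'y. inj_on f (T n)" for n using assms(2)[of n] by (auto simp: lepoll_def)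
  then obtain f :: "nat \<Rightarrow> 't \<Rightarrow> nat \<Rightarrow> 'y" where f: "\<And>n. inj_on (f n) (T n)" by metis
  define i where "i t = (SOME n. t \<in> T n)" for t
  have i: "t \<in> T (i t)" if "t \<in> T n" for t n unfolding i_def using that by (rule someI)
  \<comment> \<open>Row 0 of the grid marks the position \<open>i t\<close> by the letter p among
    letters q; the other rows hold the code of t as an element of \<open>T (i t)\<close>.\<close>
  define g where "g t m = (let (l, k) = prod_decode m in if l = 0 then (if k = i t then p else q) else f (i t) t k)" for t m
  have "inj_on g (\<Union>n. T n)"
  proof (rule inj_onI)
    fix s t assume st: "s \<in> (\<Union>n. T n)" "t \<in> (\<Union>n. T n)" "g s = g t"
    have "g s (prod_encode (0, i s)) = g t (prod_encode (0, i s))" using st(3) by simp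
    then have ist: "i s = i t" using assms(1) by (simp add: g_def split: if_splits)
    have "f (i s) s k = f (i s) t k" for k
      using fun_cong[OF st(3), of "prod_encode (1, k)"] by (simp add: g_def ist)
    then have "f (i s) s = f (i s) t" by blast
    moreover obtain n m where "s \<in> T n" "t \<in> T m" using st(1,2) by blast
    then have "s \<in> T (i s)" "t \<in> T (i s)" using i[of s n] i[of t m] ist by simp_all
    ultimately show "s = t" by (rule inj_onD[OF f])
  qed
  then show ?thesis unfolding lepoll_def by blast
qed

section \<open>Counting the elements of a generated C*-algebra\<close>

lemma dense_if_generates:
  fixes S :: "'b::cstar_algebra set"
  assumes "cstar_generates G" "G \<subseteq> S" and "0 \<in> S" "\<And>x y. x \<in> S \<Longrightarrow> y \<in> S \<Longrightarrow> x + y \<in> S"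
    "\<And>x c. x \<in> S \<Longrightarrow> c *\<^sub>C x \<in> S" "\<And>x y. x \<in> S \<Longrightarrow> y \<in> S \<Longrightarrow> x * y \<in> S" "\<And>x. x \<in> S \<Longrightarrow> star x \<in> S"
  shows "closure S = UNIV"
proof -
  have seq: "x \<in> closure S \<Longrightarrow> \<exists>s. (\<forall>n. s n \<in> S) \<and> s \<longlonglongrightarrow> x" for x
    unfolding closure_sequential by blast
  have lim: "(\<And>n. s n \<in> S) \<Longrightarrow> s \<longlonglongrightarrow> x \<Longrightarrow> x \<in> closure S" for s x
    unfolding closure_sequential by blast
  have "cstar_subalgebra (closure S)"
    unfolding cstar_subalgebra_def
  proof (intro conjI ballI csubspaceI)
    show "0 \<in> closure S" using assms(3) closure_subset by blast
    fix x assume "x \<in> closure S"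
    then obtain s where s: "\<And>n. s n \<in> S" "s \<longlonglongrightarrow> x" using seq by blast
    show "c *\<^sub>C x \<in> closure S" for c
      by (rule lim[of "\<lambda>n. c *\<^sub>C s n"]) (use s assms(5) bounded_linear.tendsto[OF bounded_linear_scaleC] in auto)
    show "star x \<in> closure S"
      by (rule lim[of "\<lambda>n. star (s n)"]) (use s assms(7) tendsto_star in auto)
    fix y assume "y \<in> closure S"
    then obtain t where t: "\<And>n. t n \<in> S" "t \<longlonglongrightarrow> y" using seq by blast
    show "x + y \<in> closure S"
      by (rule lim[of "\<lambda>n. s n + t n"]) (use s t assms(4) tendsto_add in auto)
    show "x * y \<in> closure S"
      by (rule lim[of "\<lambda>n. s n * t n"]) (use s t assms(6) tendsto_mult in auto)
  qed simp
  moreover have "G \<subseteq> closure S" using assms(2) closure_subset by blast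
  ultimately show ?thesis using assms(1) unfolding cstar_generates_def by blast
qed

text \<open>Operations numbered by all natural numbers, so that \<open>star_terms\<close> grows by
  countable unions: sum, product, adjoint and, from 3 on, the first entry itself, which makes
  \<open>star_terms\<close> increasing. Scalars enter through the generators.\<close>

primrec star_ops :: "nat \<Rightarrow> (nat \<Rightarrow> 'b::cstar_algebra) \<Rightarrow> 'b"
  where "star_ops 0 s = s 0 + s 1"
  | "star_ops (Suc n) s = (if n = 0 then s 0 * s 1 else if n = 1 then star (s 0) else s 0)"

primrec star_terms :: "'b::cstar_algebra set \<Rightarrow> nat \<Rightarrow> 'b set"
  where "star_terms G 0 = G"
  | "star_terms G (Suc n) = (\<Union>i. star_ops i ` {s. range s \<subseteq> star_terms G n})"

lemma star_terms_mono: "n \<le> m \<Longrightarrow> star_terms G n \<subseteq> star_terms G m"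
proof (induction m rule: dec_induct)
  case (step m)
  have "x \<in> star_terms G (Suc m)" if "x \<in> star_terms G m" for x
  proof -
    have "star_ops 3 (\<lambda>_. x) = x" by (simp add: numeral_3_eq_3)
    then show ?thesis using that by (force intro!: exI[of _ 3] image_eqI[of _ _ "\<lambda>_. x"])
  qed
  then show ?case using step by blast
qed simp

text \<open>Every element is a limit of terms. Each level of terms is coded by induction, their
  union countably, and a limit by the sequence that converges to it.\<close>

lemma generated_lepoll:
  fixes G :: "'b::cstar_algebra set"
  assumes gen: "cstar_generates G" and G: "0 \<in> G" "\<And>x c. x \<in> G \<Longrightarrow> c *\<^sub>C x \<in> G"
    and pq: "p \<noteq> (q :: 'y)" and code: "G \<lesssim> (UNIV :: (nat \<Rightarrow> 'y) set)"
  shows "(UNIV :: 'b set) \<lesssim> (UNIV :: (nat \<Rightarrow> 'y) set)"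
proof -
  let ?D = "\<Union>n. star_terms G n"
  have up: "star_ops i s \<in> ?D" if s: "range s \<subseteq> {x, y}" and xy: "x \<in> ?D" "y \<in> ?D" for i s x y
  proof -
    obtain n m where nm: "x \<in> star_terms G n" "y \<in> star_terms G m" using xy by blast
    then have "range s \<subseteq> star_terms G (max n m)" using star_terms_mono[of n "max n m" G] star_terms_mono[of m "max n m" G] s by auto
    then have "star_ops i s \<in> star_terms G (Suc (max n m))" by auto
    then show ?thesis by blast
  qed
  have "closure ?D = UNIV"
  proof (rule dense_if_generates[OF gen])
    show "G \<subseteq> ?D" using star_terms.simps(1) by blast
    then show "0 \<in> ?D" using G by blast
    show "x + y \<in> ?D" if "x \<in> ?D" "y \<in> ?D" for x y
      using up[of "\<lambda>n. if n = 0 then x else y" x y 0] that by (simp add: image_subset_iff)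
    show "x * y \<in> ?D" if "x \<in> ?D" "y \<in> ?D" for x y
      using up[of "\<lambda>n. if n = 0 then x else y" x y 1] that by (simp add: image_subset_iff)
    show "star x \<in> ?D" if "x \<in> ?D" for x
      using up[of "\<lambda>n. x" x x 2] that by (simp add: numeral_2_eq_2 image_subset_iff)
    have "c *\<^sub>C x \<in> star_terms G n" if "x \<in> star_terms G n" for x n c
      using that
    proof (induction n arbitrary: x c)
      case (Suc n)
      then obtain i s where s: "range s \<subseteq> star_terms G n" "x = star_ops i s" by auto
      consider "i = 0" | "i = 1" | "i = 2" | "3 \<le> i" by linarith
      then have "\<exists>s'. range s' \<subseteq> star_terms G n \<and> c *\<^sub>C x = star_ops i s'"
      proof cases
        case 1
        then show ?thesis using s Suc.IH by (intro exI[of _ "\<lambda>n. c *\<^sub>C s n"]) (auto simp: scaleC_add_right)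
      next
        case 2
        then show ?thesis
          using s Suc.IH by (intro exI[of _ "\<lambda>n. if n = 0 then c *\<^sub>C s 0 else s n"]) (auto simp: scaleC_mult_left)
      next
        case 3
        then show ?thesis
          using s Suc.IH by (intro exI[of _ "\<lambda>n. cnj c *\<^sub>C s n"]) (auto simp: numeral_2_eq_2 star_scaleC)
      next
        case 4
        then obtain k where "i = Suc k" "2 \<le> k" by (cases i) auto
        then show ?thesis using s Suc.IH by (intro exI[of _ "\<lambda>n. c *\<^sub>C s n"]) auto
      qed
      then show ?case by auto
    qed (simp add: G)
    then show "c *\<^sub>C x \<in> ?D" if "x \<in> ?D" for x c using that by blast
  qed
  have terms: "star_terms G n \<lesssim> (UNIV :: (nat \<Rightarrow> 'y) set)" for n
  proof (induction n)
    case (Suc n)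
    then show ?case
      by (auto intro!: lepoll_countable_Union[OF pq] intro: lepoll_trans[OF image_lepoll lepoll_sequences])
  qed (simp add: code)
  have D: "?D \<lesssim> (UNIV :: (nat \<Rightarrow> 'y) set)" by (rule lepoll_countable_Union[OF pq terms])
  have "b \<in> lim ` {s. range s \<subseteq> ?D}" for b
  proof -
    have "b \<in> closure ?D" using \<open>closure ?D = UNIV\<close> by simp
    then obtain s where "\<And>n. s n \<in> ?D" "s \<longlonglongrightarrow> b" unfolding closure_sequential by blast
    then show ?thesis by (intro image_eqI[of _ _ s]) (auto simp: limI)
  qed
  then have "UNIV = lim ` {s. range s \<subseteq> ?D}" by blast
  then show ?thesis using lepoll_trans[OF image_lepoll lepoll_sequences[OF D]] by metis
qed

lemma (in hilbert_space) dense_lepoll: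
  fixes u :: "'v::complex_vector \<Rightarrow> 'h"
  assumes u: "\<And>v. u v \<in> hcarrier H" "\<And>v v'. u (v + v') = hadd H (u v) (u v')" "\<And>c v. u (c *\<^sub>C v) = hscale H c (u v)"
    and dense: "hperp H (range u) = {hzero H}" and code: "(UNIV :: 'v set) \<lesssim> (UNIV :: (nat \<Rightarrow> 'y) set)"
  shows "hcarrier H \<lesssim> (UNIV :: (nat \<Rightarrow> 'y) set)"
proof -
  define F where "F s = (SOME h. h \<in> hcarrier H \<and> (\<lambda>n. hdist H (u (s n)) h) \<longlonglongrightarrow> 0)" for s
  have "h \<in> F ` {s. range s \<subseteq> UNIV}" if h: "h \<in> hcarrier H" for h
  proof -
    obtain s where s: "(\<lambda>n. hdist H (u (s n)) h) \<longlonglongrightarrow> 0" by (rule dense_seq[OF u dense h])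
    have "F s \<in> hcarrier H \<and> (\<lambda>n. hdist H (u (s n)) (F s)) \<longlonglongrightarrow> 0"
      unfolding F_def by (rule someI[of _ h]) (use h s in simp)
    then have "F s = h" using hdist_unique[of "\<lambda>n. u (s n)" "F s" h] h s u(1) by simp
    then show ?thesis by blast
  qed
  then have "hcarrier H \<subseteq> F ` {s. range s \<subseteq> UNIV}" by blast
  from lepoll_trans[OF subset_imp_lepoll[OF this] lepoll_trans[OF image_lepoll lepoll_sequences[OF code]]]
  show ?thesis .
qed

section \<open>The gauge action\<close>

context covariant_pair
begin

lemma crossed_product_lepoll:
  assumes gen: "cstar_generates (range iA \<union> range iX)" and pq: "p \<noteq> (q :: 'a \<times> 'x)"
  shows "(UNIV :: 'b set) \<lesssim> (UNIV :: (nat \<Rightarrow> 'a \<times> 'x) set)"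
proof (rule generated_lepoll[OF gen _ _ pq])
  show "0 \<in> range iA \<union> range iX" using iA_simps(3) by (metis UnI1 rangeI)
  show "c *\<^sub>C x \<in> range iA \<union> range iX" if "x \<in> range iA \<union> range iX" for c x
    using that by (auto simp flip: iA_simps(2) iX_simps(2))
  have a: "range iA = (\<lambda>s :: nat \<Rightarrow> 'a \<times> 'x. iA (fst (s 0))) ` UNIV"
    by (auto intro!: image_eqI[of _ _ "\<lambda>_. (a, undefined)" for a])
  have x: "range iX = (\<lambda>s :: nat \<Rightarrow> 'a \<times> 'x. iX (snd (s 0))) ` UNIV"
    by (auto intro!: image_eqI[of _ _ "\<lambda>_. (undefined, x)" for x])
  have "(if n = 0 then range iA else range iX) \<lesssim> (UNIV :: (nat \<Rightarrow> 'a \<times> 'x) set)" for n :: nat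
    unfolding a x by (simp add: image_lepoll)
  from lepoll_countable_Union[OF pq this]
  have "(\<Union>n::nat. if n = 0 then range iA else range iX) \<lesssim> (UNIV :: (nat \<Rightarrow> 'a \<times> 'x) set)" .
  moreover have "(\<Union>n::nat. if n = 0 then range iA else range iX) = range iA \<union> range iX" by auto
  ultimately show "range iA \<union> range iX \<lesssim> (UNIV :: (nat \<Rightarrow> 'a \<times> 'x) set)" by simp
qed

text \<open>Scaling X by z on the unit circle preserves covariance, and the universal property
  returns \<sigma> composed with the gauge automorphism, as far as homogeneous elements see it. The
  automorphism itself is not constructed.\<close>

lemma twisted_rep:
  fixes \<sigma> :: "'b \<Rightarrow> (nat \<Rightarrow> 'a \<times> 'x) \<Rightarrow> nat \<Rightarrow> 'a \<times> 'x"
  assumes cp: "crossed_product lact ract ipL ipR iA iX"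
    and \<sigma>: "rep L \<sigma>" and z: "cmod z = 1"
  obtains \<rho> where "rep L \<rho>"
    "\<And>k w h. graded k w \<Longrightarrow> h \<in> hcarrier L \<Longrightarrow> \<rho> w h = \<sigma> ((z powi k) *\<^sub>C w) h"
proof -
  interpret S: rep L \<sigma> by (rule \<sigma>)
  have z0: "z \<noteq> 0" using z by auto
  have zz: "cnj z * z = 1" "z * cnj z = 1" using z by (simp_all add: complex_norm_square[symmetric] mult.commute)
  have star: "\<sigma> (star b) h = hadjoint L (\<sigma> b) h" if "h \<in> hcarrier L" for b h
    using S.rep that by (simp add: representation_def)
  have "covariant_rep lact ract ipL ipR L (\<lambda>a. \<sigma> (iA a)) (\<lambda>x. \<sigma> (z *\<^sub>C iX x))"
    unfolding covariant_rep_def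
  proof (intro conjI allI ballI)
    show "representation L (\<lambda>a. \<sigma> (iA a))" by (rule rep.rep[OF rep_star_hom_comp[OF \<sigma> iA]])
    show "op_linear L (\<lambda>x. \<sigma> (z *\<^sub>C iX x))"
      unfolding op_linear_def
      by (simp add: S.bounded iX_simps scaleC_add_right S.op_add S.op_scale scaleC_scaleC mult.commute flip: S.op_scale)
    fix a x y h assume h: "h \<in> hcarrier L"
    show "\<sigma> (z *\<^sub>C iX (lact a x)) h = \<sigma> (iA a) (\<sigma> (z *\<^sub>C iX x) h)"
      "\<sigma> (z *\<^sub>C iX (ract x a)) h = \<sigma> (z *\<^sub>C iX x) (\<sigma> (iA a) h)"
      using h by (simp_all add: iX_lact iX_ract scaleC_mult_left scaleC_mult_right flip: S.op_mult)
    show "\<sigma> (iA (ipR x y)) h = hadjoint L (\<sigma> (z *\<^sub>C iX x)) (\<sigma> (z *\<^sub>C iX y) h)"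
      using h by (simp add: zz star_scaleC scaleC_mult_left scaleC_mult_right scaleC_scaleC scaleC_one iA_ipR flip: S.op_mult star)
    show "\<sigma> (iA (ipL x y)) h = \<sigma> (z *\<^sub>C iX x) (hadjoint L (\<sigma> (z *\<^sub>C iX y)) h)"
      using h by (simp add: zz star_scaleC scaleC_mult_left scaleC_mult_right scaleC_scaleC scaleC_one iA_ipL flip: S.op_mult star)
  qed
  moreover have "\<forall>(H :: (nat \<Rightarrow> 'a \<times> 'x) hilbert) \<pi>A \<pi>X. covariant_rep lact ract ipL ipR H \<pi>A \<pi>X \<longrightarrow>
      (\<exists>\<rho>. representation H \<rho> \<and> (\<forall>a. \<forall>h\<in>hcarrier H. \<rho> (iA a) h = \<pi>A a h) \<and>
        (\<forall>x. \<forall>h\<in>hcarrier H. \<rho> (iX x) h = \<pi>X x h))"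
    using cp unfolding crossed_product_def by (elim conjE)
  ultimately have "\<exists>\<rho>. representation L \<rho> \<and> (\<forall>a. \<forall>h\<in>hcarrier L. \<rho> (iA a) h = \<sigma> (iA a) h) \<and>
      (\<forall>x. \<forall>h\<in>hcarrier L. \<rho> (iX x) h = \<sigma> (z *\<^sub>C iX x) h)"
    by fast
  then obtain \<rho> where \<rho>: "representation L \<rho>" "\<And>a h. h \<in> hcarrier L \<Longrightarrow> \<rho> (iA a) h = \<sigma> (iA a) h"
    "\<And>x h. h \<in> hcarrier L \<Longrightarrow> \<rho> (iX x) h = \<sigma> (z *\<^sub>C iX x) h"
    by blast
  interpret R: rep L \<rho> by (rule rep.intro[OF \<rho>(1)])
  have "\<rho> w h = \<sigma> ((z powi k) *\<^sub>C w) h" if "graded k w" "h \<in> hcarrier L" for k w h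
    using that
  proof (induction arbitrary: h rule: graded.induct)
    case (graded_star k w)
    have zk: "z powi (- k) = cnj (z powi k)"
      using z0 by (simp add: power_int_minus inverse_eq_divide divide_eq_eq zz flip: power_int_mult_distrib)
    show ?case
    proof (rule S.eqI)
      fix g assume g: "g \<in> hcarrier L"
      have "hinner L g (\<rho> (star w) h) = hinner L (\<rho> w g) h" using g graded_star.prems by (simp add: R.adj)
      also have "\<dots> = hinner L g (\<sigma> (star ((z powi k) *\<^sub>C w)) h)"
        using g graded_star by (simp add: S.adj)
      finally show "hinner L g (\<rho> (star w) h) = hinner L g (\<sigma> ((z powi (- k)) *\<^sub>C star w) h)"
        by (simp add: zk star_scaleC)
    qed (use graded_star.prems in auto)
  next
    case (graded_mult k v l w)
    then show ?case
      by (simp add: R.op_mult power_int_add z0 scaleC_mult_left scaleC_mult_right scaleC_scaleC mult.commute flip: S.op_mult)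
  qed (simp_all add: \<rho> scaleC_one scaleC_add_right scaleC_scaleC mult.commute S.op_add R.op_add S.op_scale R.op_scale S.scale_scale)
  then show thesis using that[OF R.rep_axioms] by blast
qed

lemma gauge_norm:
  assumes cp: "crossed_product lact ract ipL ipR iA iX" and pq: "p \<noteq> (q :: 'a \<times> 'x)"
    and z: "cmod z = 1" and F: "finite F" and c: "\<And>k. k \<in> F \<Longrightarrow> graded k (c k)"
  shows "norm (\<Sum>k\<in>F. (z powi k) *\<^sub>C c k) \<le> norm (\<Sum>k\<in>F. c k)"
proof -
  define b where "b = (\<Sum>k\<in>F. (z powi k) *\<^sub>C c k)"
  \<comment> \<open>The vector norms \<open>star b\<close>, not b: the vector \<eta> = \<pi> (star
    b) \<omega> lies in the cyclic subspace M, where \<omega> itself might not, and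
    \<parallel>\<eta>\<parallel>^2 = \<langle>\<omega>, \<pi> b \<eta>\<rangle> shows that b has
    norm at least \<parallel>\<eta>\<parallel> on M.\<close>
  obtain K :: "('b unitization \<Rightarrow> complex) hilbert" and \<pi> \<omega> where
    K: "rep K \<pi>" "\<omega> \<in> hcarrier K" "hnorm K \<omega> = 1" "norm (star b) \<le> hnorm K (\<pi> (star b) \<omega>)"
    by (rule norming_rep)
  interpret K: rep K \<pi> by (rule K(1))
  define M where "M = hperp K (hperp K (range (\<lambda>u. \<pi> u \<omega>)))"
  note M = K.cyclic_subspace[OF K(2), folded M_def]
  let ?M = "K\<lparr>hcarrier := M\<rparr>"
  interpret M: rep ?M \<pi> by (rule K.subrep[OF M(1,2)])
  have "hcarrier ?M \<lesssim> (UNIV :: (nat \<Rightarrow> 'a \<times> 'x) set)"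
  proof (rule M.dense_lepoll)
    show "(UNIV :: 'b set) \<lesssim> (UNIV :: (nat \<Rightarrow> 'a \<times> 'x) set)"
      using crossed_product_lepoll[OF _ pq] cp by (simp add: crossed_product_def)
    show "hperp ?M (range (\<lambda>u. \<pi> u \<omega>)) = {hzero ?M}" using M(4) by simp
  qed (use M(3) K(2) in \<open>auto simp: K.op_add K.op_scale\<close>)
  then obtain j :: "_ \<Rightarrow> nat \<Rightarrow> 'a \<times> 'x" where j: "inj_on j (hcarrier ?M)" by (auto simp: lepoll_def)
  note t = M.transport_equivalent[OF j]
  define L where "L = transport ?M j"
  define \<sigma> where "\<sigma> a k = j (\<pi> a (inv_into (hcarrier ?M) j k))" for a k
  note t = M.transport_equivalent[OF j, folded L_def \<sigma>_def]
  obtain \<rho> where \<rho>: "rep L \<rho>"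
    "\<And>k w h. graded k w \<Longrightarrow> h \<in> hcarrier L \<Longrightarrow> \<rho> w h = \<sigma> ((z powi k) *\<^sub>C w) h"
    using twisted_rep[OF cp t(1) z] by blast
  interpret L: rep L \<rho> by (rule \<rho>(1))
  interpret S: rep L \<sigma> by (rule t(1))
  define \<eta> where "\<eta> = \<pi> (star b) \<omega>"
  have \<eta>: "\<eta> \<in> M" using M(3) by (auto simp: \<eta>_def)
  have \<eta>K: "\<eta> \<in> hcarrier K" using K(2) by (simp add: \<eta>_def)
  have b\<eta>: "\<pi> b \<eta> \<in> M" using M(2) \<eta> by blast
  have j\<eta>: "j \<eta> \<in> hcarrier L" using unitaryD(1)[OF t(2)] \<eta> by simp
  have "\<rho> (\<Sum>k\<in>F'. c k) h = \<sigma> (\<Sum>k\<in>F'. (z powi k) *\<^sub>C c k) h" if "finite F'" "F' \<subseteq> F" "h \<in> hcarrier L" for F' h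
    using that by (induction F') (simp_all add: L.op_add S.op_add \<rho>(2)[OF c])
  from this[OF F subset_refl j\<eta>] have eq: "\<rho> (\<Sum>k\<in>F. c k) (j \<eta>) = j (\<pi> b \<eta>)"
    using t(3) \<eta> by (simp add: b_def)
  have "hinner K \<omega> (\<pi> b \<eta>) = of_real ((hnorm K \<eta>)\<^sup>2)"
    using K.adj'[OF K(2) \<eta>K, of b] K.inner_self[OF \<eta>K] by (simp flip: \<eta>_def)
  then have "(hnorm K \<eta>)\<^sup>2 = cmod (hinner K \<omega> (\<pi> b \<eta>))" by (simp add: norm_power)
  also have "\<dots> \<le> hnorm K (\<pi> b \<eta>)" using K.cauchy_schwarz[OF K(2), of "\<pi> b \<eta>"] \<eta>K K(3) by simp
  also have "\<dots> = hnorm L (\<rho> (\<Sum>k\<in>F. c k) (j \<eta>))"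
    unfolding eq using unitaryD(7)[OF t(2), of "\<pi> b \<eta>"] b\<eta> by (simp add: hnorm_def)
  also have "\<dots> \<le> norm (\<Sum>k\<in>F. c k) * hnorm L (j \<eta>)" by (rule L.op_norm[OF j\<eta>])
  also have "hnorm L (j \<eta>) = hnorm K \<eta>" using unitaryD(7)[OF t(2), of \<eta>] \<eta> by (simp add: hnorm_def)
  finally have le: "hnorm K \<eta> * hnorm K \<eta> \<le> norm (\<Sum>k\<in>F. c k) * hnorm K \<eta>" by (simp add: power2_eq_square)
  have "norm b \<le> hnorm K \<eta>" using K(4) by (simp add: \<eta>_def)
  also have "hnorm K \<eta> \<le> norm (\<Sum>k\<in>F. c k)"
    using le hnorm_nonneg[of K \<eta>] by (cases "hnorm K \<eta> = 0") (simp_all add: mult_le_cancel_right)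
  finally show ?thesis by (simp add: b_def)
qed

end

section \<open>Fejer means\<close>

lemma sum_roots_of_unity:
  assumes "\<bar>i\<bar> < int L"
  shows "(\<Sum>t<L. cis (2 * pi * real t / real L) powi i) = (if i = 0 then of_nat L else 0)"
proof (cases "i = 0")
  case False
  define w where "w = cis (2 * pi * i / L)"
  have L: "L > 0" using assms by (cases L) auto
  have w: "cis (2 * pi * real t / real L) powi i = w ^ t" for t
    by (simp add: w_def cis_power_int Complex.DeMoivre mult_ac)
  have "w \<noteq> 1"
  proof
    assume "w = 1"
    then obtain n :: int where "2 * pi * i / L = of_int (2 * n) * pi"
      by (auto simp: w_def cis_conv_exp exp_eq_1)
    then have "real_of_int i = real_of_int (n * int L)" using L by (simp add: field_simps)
    then have "i = n * int L" by linarith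
    then show False using assms False by (auto simp: abs_mult dest: zdvd_imp_le)
  qed
  moreover have "w ^ L = 1"
  proof -
    have "w ^ L = cis (2 * pi * of_int i)" using L by (simp add: w_def Complex.DeMoivre)
    then show ?thesis by (simp add: cis_multiple_2pi)
  qed
  ultimately show ?thesis using False by (simp add: w sum_gp_strict)
qed simp

text \<open>A coefficient of the Fejer kernel, the squared modulus of the sum of z^m over m < N,
  divided by N: the double sum counts pairs with n - m = k.\<close>

definition fejer :: "nat \<Rightarrow> int \<Rightarrow> real"
  where "fejer N k = (\<Sum>m<N. \<Sum>n<N. if int m - int n + k = 0 then 1 else 0) / N"

lemma fejer_eq:
  assumes "N > 0"
  shows "fejer N k = max 0 (1 - \<bar>k\<bar> / N)"
proof -
  have "(\<Sum>n<N. if int m - int n + k = 0 then 1 else 0 :: real) = (if 0 \<le> int m + k \<and> int m + k < int N then 1 else 0)" for m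
  proof (cases "0 \<le> int m + k \<and> int m + k < int N")
    case True
    have "(\<Sum>n<N. if int m - int n + k = 0 then 1 else 0 :: real) = (\<Sum>n<N. if n = nat (int m + k) then 1 else 0)"
      by (rule sum.cong) (use True in auto)
    then show ?thesis using True by (simp add: nat_less_iff)
  qed (auto intro!: sum.neutral)
  then have "(\<Sum>m<N. \<Sum>n<N. if int m - int n + k = 0 then 1 else 0 :: real)
      = (\<Sum>m<N. if 0 \<le> int m + k \<and> int m + k < int N then 1 else 0)" by simp
  also have "\<dots> = card {m\<in>{..<N}. 0 \<le> int m + k \<and> int m + k < int N}"
    by (simp add: sum.If_cases Int_def)
  also have "{m\<in>{..<N}. 0 \<le> int m + k \<and> int m + k < int N} = {nat (- k)..<nat (min (int N) (int N - k))}"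
    by auto
  also have "real (card \<dots>) = max 0 (real N - \<bar>real_of_int k\<bar>)"
    by (simp add: min_def max_def abs_if) linarith
  finally show ?thesis using assms by (simp add: fejer_def max_def field_simps)
qed

text \<open>The mean is a weighted average of the rotated sums, with the nonnegative values of the
  kernel as weights; a finite average over roots of unity takes the place of an integral over the
  circle.\<close>

lemma fejer_norm:
  fixes c :: "int \<Rightarrow> 'b::cstar_algebra"
  assumes bound: "\<And>z. cmod z = 1 \<Longrightarrow> norm (\<Sum>k\<in>F. (z powi k) *\<^sub>C c k) \<le> B" and F: "finite F" and N: "N > 0"
  shows "norm (\<Sum>k\<in>F. fejer N k *\<^sub>R c k) \<le> B"
proof -
  obtain b :: nat where b: "\<And>k. k \<in> F \<Longrightarrow> \<bar>k\<bar> \<le> int b"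
    using F Max_ge[of "(\<lambda>k. nat \<bar>k\<bar>) ` F"] by (metis finite_imageI image_eqI nat_le_iff)
  \<comment> \<open>Exponents m - n + k with m, n < N and |k| \<le> b stay below L in absolute
    value, so averaging over the L-th roots of unity kills all but the exponent 0.\<close>
  define L where "L = N + b + 1"
  define z where "z t = cis (2 * pi * real t / real L)" for t :: nat
  define w where "w t = (cmod (\<Sum>m<N. z t powi int m))\<^sup>2" for t
  have z0: "z t \<noteq> 0" "cmod (z t) = 1" for t by (simp_all add: z_def)
  have ww: "complex_of_real (w t) = (\<Sum>m<N. \<Sum>n<N. z t powi (int m - int n))" for t
  proof -
    have cz: "cnj (z t powi int n) = z t powi (- int n)" for n
      by (simp add: z_def power_int_minus cis_power_int Complex.DeMoivre cis_cnj cis_inverse)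
    have "complex_of_real (w t) = (\<Sum>m<N. z t powi int m) * cnj (\<Sum>m<N. z t powi int m)"
      unfolding w_def by (rule complex_norm_square)
    also have "\<dots> = (\<Sum>m<N. \<Sum>n<N. z t powi int m * z t powi (- int n))"
      by (simp only: cnj_sum cz sum_product)
    also have "\<dots> = (\<Sum>m<N. \<Sum>n<N. z t powi (int m - int n))"
      using power_int_add[of "z t" "int m" "- int n" for m n] z0(1)[of t] by (simp only: simp_thms diff_conv_add_uminus)
    finally show ?thesis .
  qed
  have coeff: "(\<Sum>t<L. of_real (w t) * z t powi k) = of_real (real L * real N * fejer N k)" if k: "\<bar>k\<bar> \<le> int b" for k
  proof -
    have "(\<Sum>t<L. of_real (w t) * z t powi k) = (\<Sum>t<L. \<Sum>m<N. \<Sum>n<N. z t powi (int m - int n + k))"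
      by (simp add: ww sum_distrib_right power_int_add z0)
    also have "\<dots> = (\<Sum>m<N. \<Sum>n<N. \<Sum>t<L. z t powi (int m - int n + k))"
      by (subst sum.swap, rule sum.cong[OF refl], rule sum.swap)
    also have "\<dots> = (\<Sum>m<N. \<Sum>n<N. if int m - int n + k = 0 then of_nat L else 0)"
    proof (intro sum.cong refl)
      fix m n assume "m \<in> {..<N}" "n \<in> {..<N}"
      then show "(\<Sum>t<L. z t powi (int m - int n + k)) = (if int m - int n + k = 0 then of_nat L else 0)"
        unfolding z_def by (intro sum_roots_of_unity) (use k in \<open>auto simp: L_def\<close>)
    qed
    also have "\<dots> = of_real (real L * (\<Sum>m<N. \<Sum>n<N. if int m - int n + k = 0 then 1 else 0))"
      by (simp add: sum_distrib_left if_distrib cong: if_cong)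
    also have "real L * (\<Sum>m<N. \<Sum>n<N. if int m - int n + k = 0 then 1 else 0) = real L * real N * fejer N k"
      using N by (simp add: fejer_def)
    finally show ?thesis .
  qed
  have tot: "(\<Sum>t<L. w t) = real L * real N"
  proof -
    have "complex_of_real (\<Sum>t<L. w t) = of_real (real L * real N)" using coeff[of 0] N by (simp add: fejer_eq)
    then show ?thesis by (simp only: of_real_eq_iff)
  qed
  have LN: "real L * real N > 0" using N by (simp add: L_def)
  have "(real L * real N) *\<^sub>R (\<Sum>k\<in>F. fejer N k *\<^sub>R c k) = (\<Sum>k\<in>F. (\<Sum>t<L. of_real (w t) * z t powi k) *\<^sub>C c k)"
    unfolding scaleR_sum_right
    by (rule sum.cong[OF refl]) (simp add: coeff b scaleR_scaleC scaleC_scaleC)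
  also have "\<dots> = (\<Sum>k\<in>F. \<Sum>t<L. w t *\<^sub>R (z t powi k) *\<^sub>C c k)"
    by (simp add: complex_vector.scale_sum_left scaleR_scaleC scaleC_scaleC)
  also have "\<dots> = (\<Sum>t<L. w t *\<^sub>R (\<Sum>k\<in>F. (z t powi k) *\<^sub>C c k))"
    by (subst sum.swap) (simp add: scaleR_sum_right)
  also have "norm \<dots> \<le> (\<Sum>t<L. w t * B)"
    by (rule sum_norm_le) (use bound z0(2) in \<open>simp add: w_def mult_left_mono\<close>)
  also have "\<dots> = real L * real N * B" by (simp add: tot flip: sum_distrib_right)
  finally have "(real L * real N) * norm (\<Sum>k\<in>F. fejer N k *\<^sub>R c k) \<le> (real L * real N) * B" by simp
  then show ?thesis using LN by (simp only: mult_le_cancel_left_pos)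
qed

section \<open>Simplicity\<close>

context covariant_pair
begin

text \<open>Components vanish off F, so that two such sums can be compared over a common index
  set.\<close>

definition graded_sum :: "int set \<Rightarrow> (int \<Rightarrow> 'b) \<Rightarrow> bool"
  where "graded_sum F c \<longleftrightarrow> finite F \<and> (\<forall>k. graded k (c k)) \<and> (\<forall>k. k \<notin> F \<longrightarrow> c k = 0)"

lemma graded_sum_extend: "graded_sum F c \<Longrightarrow> finite G \<Longrightarrow> F \<subseteq> G \<Longrightarrow> (\<Sum>k\<in>G. r k *\<^sub>R c k) = (\<Sum>k\<in>F. r k *\<^sub>R c k)"
  by (rule sum.mono_neutral_right) (auto simp: graded_sum_def)

lemma graded_diff: "graded k v \<Longrightarrow> graded k w \<Longrightarrow> graded k (v - w)"
  using graded_add[of k v "(-1) *\<^sub>C w"] graded_scale[of k w "-1"] by (simp add: scaleC_minus_one)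

lemma span_graded_sum:
  assumes "b \<in> cspan {w. \<exists>k. graded k w}"
  shows "\<exists>F c. graded_sum F c \<and> b = (\<Sum>k\<in>F. c k)"
proof -
  let ?S = "{b. \<exists>F c. graded_sum F c \<and> b = (\<Sum>k\<in>F. c k)}"
  have "csubspace ?S"
  proof (rule csubspaceI)
    have "graded_sum {} (\<lambda>_. 0)" by (simp add: graded_sum_def graded_zero)
    then show "0 \<in> ?S" by force
    fix x assume "x \<in> ?S"
    then obtain F c where c: "graded_sum F c" "x = (\<Sum>k\<in>F. c k)" by blast
    have "graded_sum F (\<lambda>k. a *\<^sub>C c k)" for a using c(1) by (simp add: graded_sum_def graded_scale)
    then show "a *\<^sub>C x \<in> ?S" for a unfolding c(2) complex_vector.scale_sum_right by blast
    fix y assume "y \<in> ?S"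
    then obtain G d where d: "graded_sum G d" "y = (\<Sum>k\<in>G. d k)" by blast
    have fin: "finite (F \<union> G)" using c(1) d(1) by (simp add: graded_sum_def)
    have "x + y = (\<Sum>k\<in>F \<union> G. c k + d k)"
      using graded_sum_extend[OF c(1) fin, of "\<lambda>_. 1"] graded_sum_extend[OF d(1) fin, of "\<lambda>_. 1"] c(2) d(2)
      by (simp add: sum.distrib)
    moreover have "graded_sum (F \<union> G) (\<lambda>k. c k + d k)"
      using c(1) d(1) by (simp add: graded_sum_def graded_add)
    ultimately show "x + y \<in> ?S" by blast
  qed
  moreover have "{w. \<exists>k. graded k w} \<subseteq> ?S"
  proof
    fix w assume "w \<in> {w. \<exists>k. graded k w}"
    then obtain k where "graded k w" by blast
    then have "graded_sum {k} (\<lambda>i. if i = k then w else 0)" by (auto simp: graded_sum_def graded_zero)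
    moreover have "w = (\<Sum>i\<in>{k}. if i = k then w else 0)" by simp
    ultimately show "w \<in> ?S" by blast
  qed
  ultimately have "cspan {w. \<exists>k. graded k w} \<subseteq> ?S" by (intro complex_vector.span_minimal)
  then show ?thesis using assms by blast
qed

lemma graded_sums_dense:
  assumes gen: "cstar_generates (range iA \<union> range iX)" and e: "0 < e"
  obtains F c where "graded_sum F c" "norm ((\<Sum>k\<in>F. c k) - b) < e"
proof -
  let ?X = "{w. \<exists>k. graded k w}"
  note span = complex_vector.span_base complex_vector.span_add complex_vector.span_scale complex_vector.span_zero
  have XX: "u * w \<in> cspan ?X" if u: "u \<in> cspan ?X" and w: "w \<in> ?X" for u w
  proof -
    have "csubspace {u. u * w \<in> cspan ?X}"
      by (rule csubspaceI) (simp_all add: distrib_right scaleC_mult_left span)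
    moreover have "?X \<subseteq> {u. u * w \<in> cspan ?X}" using w graded_mult by (blast intro: span(1))
    ultimately show ?thesis using u complex_vector.span_minimal by blast
  qed
  have mult: "u * w \<in> cspan ?X" if u: "u \<in> cspan ?X" and w: "w \<in> cspan ?X" for u w
  proof -
    have "csubspace {w. u * w \<in> cspan ?X}"
      by (rule csubspaceI) (simp_all add: distrib_left scaleC_mult_right span)
    moreover have "?X \<subseteq> {w. u * w \<in> cspan ?X}" using XX[OF u] by blast
    ultimately show ?thesis using w complex_vector.span_minimal by blast
  qed
  have star: "star u \<in> cspan ?X" if u: "u \<in> cspan ?X" for u
  proof -
    have "csubspace {u. star u \<in> cspan ?X}"
      by (rule csubspaceI) (simp_all add: star_add star_scaleC span star_zero)
    moreover have "?X \<subseteq> {u. star u \<in> cspan ?X}" using graded_star by (blast intro: span(1))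
    ultimately show ?thesis using u complex_vector.span_minimal by blast
  qed
  have "range iA \<union> range iX \<subseteq> cspan ?X" using graded_iA graded_iX by (blast intro: span(1))
  from dense_if_generates[OF gen this span(4) span(2,3) mult star]
  have "b \<in> closure (cspan ?X)" by simp
  then obtain y where "y \<in> cspan ?X" "dist y b < e" using e unfolding closure_approachable by blast
  then show thesis using that span_graded_sum[of y] by (auto simp: dist_norm)
qed

lemma ideal_zero:
  assumes cp: "crossed_product lact ract ipL ipR iA iX" and pq: "p \<noteq> (q :: 'a \<times> 'x)"
    and free: "topologically_free spectrum_topology dual_dom dual"
    and J: "cstar_ideal J" and I: "iA -` J = {0}" and x: "x \<in> J"
  shows "x = 0"
proof -
  have gen: "cstar_generates (range iA \<union> range iX)" using cp by (simp add: crossed_product_def)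
  \<comment> \<open>One e each for the distance from x to the first sum, for the change of this sum
    by its mean and for the mean of the second sum; two for the difference of the two means.\<close>
  have "norm x \<le> 5 * e" if e: "0 < e" for e
  proof -
    obtain F c where c: "graded_sum F c" "norm ((\<Sum>k\<in>F. c k) - x) < e" by (rule graded_sums_dense[OF gen e])
    \<comment> \<open>B / N bounds the change of the first sum under the mean of order N, because 1
      - \<open>fejer N k\<close> is at most |k| / N.\<close>
    define B where "B = (\<Sum>k\<in>F. \<bar>k\<bar> * norm (c k))"
    have B0: "0 \<le> B" by (simp add: B_def sum_nonneg)
    obtain N :: nat where N: "B / e < N" using reals_Archimedean2 by blast
    have "0 \<le> B / e" using B0 e by simp
    then have N0: "N > 0" using N by (cases N) auto
    have "B \<le> e * N" using N e by (simp add: field_simps)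
    then have BN: "B / N \<le> e" using N0 by (simp add: field_simps)
    \<comment> \<open>The mean involves at most 2N + 1 degrees of the second sum, each with a
      component of norm at most \<delta>.\<close>
    define \<delta> where "\<delta> = e / (2 * N + 1)"
    have \<delta>: "0 < \<delta>" "\<delta> \<le> e" using e by (simp_all add: \<delta>_def field_simps)
    obtain G d where d: "graded_sum G d" "norm ((\<Sum>k\<in>G. d k) - x) < \<delta>" by (rule graded_sums_dense[OF gen \<delta>(1)])
    let ?f = "fejer N"
    have f: "0 \<le> ?f k" "?f k \<le> 1" "1 - ?f k \<le> \<bar>k\<bar> / N" "int N \<le> \<bar>k\<bar> \<Longrightarrow> ?f k = 0" for k
      using N0 by (auto simp: fejer_eq max_def field_simps)
    have "norm ((\<Sum>k\<in>F. c k) - (\<Sum>k\<in>F. ?f k *\<^sub>R c k)) \<le> (\<Sum>k\<in>F. \<bar>k\<bar> / N * norm (c k))"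
    proof -
      have "(\<Sum>k\<in>F. c k) - (\<Sum>k\<in>F. ?f k *\<^sub>R c k) = (\<Sum>k\<in>F. (1 - ?f k) *\<^sub>R c k)"
        by (simp add: sum_subtractf scaleR_diff_left)
      also have "norm \<dots> \<le> (\<Sum>k\<in>F. \<bar>k\<bar> / N * norm (c k))"
      proof (rule sum_norm_le)
        fix k
        have "norm ((1 - ?f k) *\<^sub>R c k) = (1 - ?f k) * norm (c k)" using f(2)[of k] by simp
        also have "\<dots> \<le> \<bar>k\<bar> / N * norm (c k)" by (rule mult_right_mono) (use f(3)[of k] in simp_all)
        finally show "norm ((1 - ?f k) *\<^sub>R c k) \<le> \<bar>k\<bar> / N * norm (c k)" .
      qed
      finally show ?thesis .
    qed
    also have "\<dots> = B / N" by (simp add: B_def sum_divide_distrib)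
    finally have 1: "norm ((\<Sum>k\<in>F. c k) - (\<Sum>k\<in>F. ?f k *\<^sub>R c k)) \<le> e" using BN by simp
    have dk: "norm (d k) \<le> \<delta>" for k
    proof (cases "k \<in> G")
      case True
      have "norm (d k) \<le> norm ((\<Sum>k\<in>G. d k) - x)"
        by (rule component_norm[OF free J I _ _ True x]) (use d(1) in \<open>auto simp: graded_sum_def\<close>)
      then show ?thesis using d(2) by simp
    next
      case False
      then show ?thesis using d(1) \<delta>(1) by (simp add: graded_sum_def)
    qed
    have "norm (\<Sum>k\<in>G. ?f k *\<^sub>R d k) = norm (\<Sum>k\<in>G \<inter> {- int N..int N}. ?f k *\<^sub>R d k)"
    proof (intro arg_cong[where f = norm] sum.mono_neutral_right ballI)
      fix k assume "k \<in> G - G \<inter> {- int N..int N}"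
      then have "int N \<le> \<bar>k\<bar>" by auto
      then show "?f k *\<^sub>R d k = 0" by (simp add: f(4))
    qed (use d(1) in \<open>auto simp: graded_sum_def\<close>)
    also have "\<dots> \<le> (\<Sum>k\<in>G \<inter> {- int N..int N}. \<delta>)"
      by (rule sum_norm_le) (use f(1,2) dk \<delta>(1) mult_mono[of "?f k" 1 "norm (d k)" \<delta> for k] in \<open>simp\<close>)
    also have "\<dots> \<le> (\<Sum>k\<in>{- int N..int N}. \<delta>)"
      by (rule sum_mono2) (use \<delta>(1) in auto)
    also have "\<dots> = e" by (simp add: \<delta>_def nat_add_distrib field_simps)
    finally have 2: "norm (\<Sum>k\<in>G. ?f k *\<^sub>R d k) \<le> e" .
    have fin: "finite (F \<union> G)" using c(1) d(1) by (simp add: graded_sum_def)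
    have split: "(\<Sum>k\<in>F \<union> G. r k *\<^sub>R (c k - d k)) = (\<Sum>k\<in>F. r k *\<^sub>R c k) - (\<Sum>k\<in>G. r k *\<^sub>R d k)" for r
      using graded_sum_extend[OF c(1) fin, of r] graded_sum_extend[OF d(1) fin, of r]
      by (simp add: scaleR_diff_right sum_subtractf)
    have "norm (\<Sum>k\<in>F \<union> G. ?f k *\<^sub>R (c k - d k)) \<le> norm (\<Sum>k\<in>F \<union> G. c k - d k)"
      by (rule fejer_norm[OF _ fin N0], rule gauge_norm[OF cp pq _ fin])
        (use c(1) d(1) in \<open>auto simp: graded_sum_def graded_diff\<close>)
    then have "norm ((\<Sum>k\<in>F. ?f k *\<^sub>R c k) - (\<Sum>k\<in>G. ?f k *\<^sub>R d k)) \<le> norm ((\<Sum>k\<in>F. c k) - (\<Sum>k\<in>G. d k))"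
      using split[of ?f] split[of "\<lambda>_. 1"] by simp
    also have "\<dots> \<le> norm ((\<Sum>k\<in>F. c k) - x) + norm ((\<Sum>k\<in>G. d k) - x)"
      using norm_triangle_ineq4[of "(\<Sum>k\<in>F. c k) - x" "(\<Sum>k\<in>G. d k) - x"] by simp
    finally have 3: "norm ((\<Sum>k\<in>F. ?f k *\<^sub>R c k) - (\<Sum>k\<in>G. ?f k *\<^sub>R d k)) \<le> 2 * e"
      using c(2) d(2) \<delta>(2) by linarith
    let ?a = "\<Sum>k\<in>F. c k" and ?b = "\<Sum>k\<in>F. ?f k *\<^sub>R c k" and ?c = "\<Sum>k\<in>G. ?f k *\<^sub>R d k"
    have "norm x \<le> norm (?a - x) + norm ?a" using norm_triangle_sub[of x ?a] by (simp add: norm_minus_commute)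
    also have "norm ?a \<le> norm ?b + norm (?a - ?b)" by (rule norm_triangle_sub)
    also have "norm ?b \<le> norm ?c + norm (?b - ?c)" by (rule norm_triangle_sub)
    finally show ?thesis using 1 2 3 c(2) by linarith
  qed
  from this[of "norm x / 10"] show ?thesis by (cases "x = 0") simp_all
qed

end

theorem corollary2p6:
  fixes lact :: "'a::cstar_algebra \<Rightarrow> 'x::complex_vector \<Rightarrow> 'x"
    and ract :: "'x \<Rightarrow> 'a \<Rightarrow> 'x"
    and ipL ipR :: "'x \<Rightarrow> 'x \<Rightarrow> 'a"
    and iA :: "'a \<Rightarrow> 'b::cstar_algebra"
    and iX :: "'x \<Rightarrow> 'b"
  assumes "hilbert_bimodule lact ract ipL ipR"
    and "topologically_free spectrum_topology
           (ideal_spectrum (ip_ideal ipR)) (dual_map lact ipR)"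
    and "minimal_map spectrum_topology
           (ideal_spectrum (ip_ideal ipR)) (dual_map lact ipR)"
    and "crossed_product lact ract ipL ipR iA iX"
  shows "simple_cstar_algebra TYPE('b)"
proof -
  have "covariant_pair_axioms lact ract ipL ipR iA iX"
    using assms(4) unfolding crossed_product_def by (intro covariant_pair_axioms.intro) (elim conjE, blast)+
  then interpret covariant_pair lact ract ipL ipR iA iX
    by (rule covariant_pair.intro[OF assms(1)])
  have gen: "cstar_generates (range iA \<union> range iX)" using assms(4) by (simp add: crossed_product_def)
  have "J = {0} \<or> J = UNIV" if J: "cstar_ideal J" for J :: "'b set"
  \<comment> \<open>Coding by sequences needs two distinct letters. If \<open>'a \<times> 'x\<close>
    has only one element, the generators are 0 and so is the crossed product.\<close>
  proof (cases "\<exists>p q :: 'a \<times> 'x. p \<noteq> q")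
    case True
    then obtain p q :: "'a \<times> 'x" where pq: "p \<noteq> q" by blast
    have "0 \<in> J" by (rule csubspaceD(1)[OF cstar_idealD(1)[OF J]])
    then show ?thesis
      using vimage_trivial[OF assms(3) J] ideal_UNIV[OF gen J] ideal_zero[OF assms(4) pq assms(2) J] by blast
  next
    case False
    then have 0: "a = 0" "x = 0" for a :: 'a and x :: 'x by blast+
    have "iA a = 0" "iX x = 0" for a x by (simp_all add: 0(1)[of a] 0(2)[of x] iA_simps iX_simps)
    then have "range iA \<union> range iX \<subseteq> {0}" by blast
    moreover have "cstar_subalgebra {0 :: 'b}"
      using cstar_ideal_zero by (auto simp: cstar_subalgebra_def cstar_ideal_def star_zero)
    ultimately have "{0} = (UNIV :: 'b set)" using gen unfolding cstar_generates_def by blast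
    moreover have "0 \<in> J" by (rule csubspaceD(1)[OF cstar_idealD(1)[OF J]])
    ultimately show ?thesis by blast
  qed
  then show ?thesis by (simp add: simple_cstar_algebra_def)
qed

end
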